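(* Let $1<p<\infty$, $q=p/(p-1)$, $a<b$ real, $\gamma\in\mathcal M^+_{\rm loc}(\mathbb R^d)$ and $\phi\in\mathcal A_p(a,b)$. Then: (i) The space $\mathcal M_{\rm loc}(\mathbb R^d)$ endowed with the pseudo-distance $\mathcal W_{\phi,\gamma}$ is complete. (ii) Given a measure $\sigma\in\mathcal M_{\rm loc}(\mathbb R^d)$, the space $\mathcal M[\sigma]:=\{\mu\in\mathcal M_{\rm loc}(\mathbb R^d):\mathcal W_{\phi,\gamma}(\mu,\sigma)<+\infty\}$ (with $\mathcal W_{\phi,\gamma}$) is a complete metric space. (iii) If $\tilde{\mathrm m}_{-q}(\gamma)<+\infty$, then $\mu(\mathbb R^d)=\sigma(\mathbb R^d)$ for every $\mu\in\mathcal M[\sigma]$.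
   Context: Notation. $\mathcal M_{\rm loc}(\mathbb R^d)$, $\mathcal M^+_{\rm loc}(\mathbb R^d)$, $\mathcal M_{\rm loc}(\mathbb R^d;\mathbb R^d)$ are the signed, non-negative, and $\mathbb R^d$-valued Radon measures on $\mathbb R^d$, with the weak* topology (duality with $C_c$). $\mu(\mathbb R^d)$ is the total (signed) mass of $\mu$. A pseudo-distance here is a function satisfying the axioms of a distance except that it can assume the value $+\infty$. Generalized moment: for $\gamma\in\mathcal M^+_{\rm loc}(\mathbb R^d)$ and $r\in\mathbb R$, $\tilde{\mathrm m}_r(\gamma):=\gamma(B(0,1))+\int_{\mathbb R^d\setminus B(0,1)}|x|^r\,d\gamma(x)$. Admissible densities: for $1<p<\infty$, $\mathcal A_p$ is the set of l.s.c. proper convex functions $\phi:\mathbb R\times\mathbb R^d\to[0,+\infty]$ such that (F1) for every $\rho$ with $(\{\rho\}\times\mathbb R^d)\cap\mathrm{dom}(\phi)\neq\emptyset$ one has $\phi(\rho,0)=0$ and $\phi(\rho,\lambda w)=|\lambda|^p\phi(\rho,w)$ for all $\lambda\ne0$, $w\in\mathbb R^d$; (F2) there is $\rho_0\in\mathbb R$ with $\{\rho_0\}\times\mathbb R^d\subseteq\mathrm{dom}(\phi)$ and $\phi(\rho_0,w)>0$ for all $w\neq0$. Here $\mathrm{dom}(\phi)=\{\phi<+\infty\}$. For real $a<b$, $\mathcal A_p(a,b)$ is the set of $\phi\in\mathcal A_p$ with $\mathrm{int}(\mathrm{dom}(\phi))=(a,b)\times\mathbb R^d$. Action functional: the recession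 function of $\phi$ is $\phi^\infty(y):=\sup\{\phi(x+y)-\phi(x):x\in\mathrm{dom}(\phi)\}$, $y\in\mathbb R\times\mathbb R^d$. Given $\gamma\in\mathcal M^+_{\rm loc}(\mathbb R^d)$, $\mu\in\mathcal M_{\rm loc}(\mathbb R^d)$, $\nu\in\mathcal M_{\rm loc}(\mathbb R^d;\mathbb R^d)$ with supports contained in $\mathrm{supp}(\gamma)$, write the Lebesgue decompositions $\mu=\rho\gamma+\mu^\perp$, $\nu=w\gamma+\nu^\perp$, take $\sigma'=|\mu^\perp|+|\nu^\perp|$, write $\mu^\perp=\rho^\perp\sigma'$, $\nu^\perp=w^\perp\sigma'$, and set $\Phi(\mu,\nu|\gamma):=\int\phi(\rho,w)\,d\gamma+\int\phi^\infty(\rho^\perp,w^\perp)\,d\sigma'$. Continuity equation: $\mathcal{CE}(0,T)$ is the set of families $(\mu_t,\nu_t)_{t\in[0,T]}$ with $t\mapsto\mu_t\in\mathcal M_{\rm loc}(\mathbb R^d)$ weakly* continuous on $[0,T]$, $(\nu_t)$ a Borel family in $\mathcal M_{\rm loc}(\mathbb R^d;\mathbb R^d)$, $\int_0^T|\mu_t|(B(0,R))\,dt<\infty$ and $\int_0^T|\nu_t|(B(0,R))\,dt<\infty$ for all $R>0$, and $\partial_t\mu_t+\mathrm{div}\,\nu_t=0$ in the sense of distributions on $\mathbb R^d\times(0,T)$, i.e. $\int_0^T\int\partial_t\zeta\,d\mu_t\,dt+\int_0^T\int\nabla_x\zeta\cdot d\nu_t\,dt=0$ for all $\zeta\in C^1_c(\mathbb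 R^d\times(0,T))$. $\mathcal{CE}_{\phi,\gamma}(0,1;\mu^0\to\mu^1)$ is the set of $(\mu,\nu)\in\mathcal{CE}(0,1)$ with $\mu_{t=0}=\mu^0$, $\mu_{t=1}=\mu^1$ and $\int_0^1\Phi(\mu_t,\nu_t|\gamma)\,dt<+\infty$. Distance: $\mathcal W_{\phi,\gamma}(\mu^0,\mu^1):=\inf\big\{\big(\int_0^1\Phi(\mu_t,\nu_t|\gamma)\,dt\big)^{1/p}:(\mu,\nu)\in\mathcal{CE}_{\phi,\gamma}(0,1;\mu^0\to\mu^1)\big\}$, equal to $+\infty$ if this set is empty.
   Formalization: In (iii) the equality is claimed when μ(R^d) and σ(R^d) are both meaningful (not ∞−∞), since M[σ] can contain measures with no total mass; and W(μ,μ) is claimed to be 0 or +∞, since it is +∞ when no curve of finite action starts at μ. *)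

theory Defs
  imports "HOL-Analysis.Analysis"
begin

section \<open>Radon measures\<close>

text \<open>A signed or vector-valued Radon measure need not be defined on unbounded sets: its positive
  and negative parts may both have infinite mass. It is therefore represented by its values on the
  bounded Borel sets, on which it is countably additive. Outside of these it is put to \<open>0\<close>, so that
  equality of set functions is equality of measures.\<close>

definition bborel :: "'a::euclidean_space set set" where
  "bborel = {A \<in> sets borel. bounded A}"

definition Mloc :: "('a::euclidean_space set \<Rightarrow> 'b::euclidean_space) set" where
  "Mloc = {\<mu>. (\<forall>A. A \<notin> bborel \<longrightarrow> \<mu> A = 0) \<and>
     (\<forall>A :: nat \<Rightarrow> 'a set. range A \<subseteq> sets borel \<longrightarrow> disjoint_family A \<longrightarrow> bounded (\<Union>n. A n) \<longrightarrow>
        (\<lambda>n. \<mu> (A n)) sums \<mu> (\<Union>n. A n))}"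

definition Mloc_pos :: "'a::euclidean_space measure set" where
  "Mloc_pos = {\<gamma>. sets \<gamma> = sets borel \<and> (\<forall>K. compact K \<longrightarrow> emeasure \<gamma> K < \<infinity>)}"

text \<open>Total variation. The set function below is countably additive for \<open>\<mu> \<in> Mloc\<close>, so that it is
  the \<^const>\<open>emeasure\<close> of \<open>variation \<mu>\<close> on Borel sets.\<close>

definition variation :: "('a::euclidean_space set \<Rightarrow> 'b::euclidean_space) \<Rightarrow> 'a measure" where
  "variation \<mu> = measure_of UNIV (sets borel)
     (\<lambda>A. SUP P\<in>{P. finite P \<and> disjoint P \<and> (\<forall>B\<in>P. B \<in> bborel \<and> B \<subseteq> A)}.
            \<Sum>B\<in>P. ennreal (norm (\<mu> B)))"

definition loc_integrable :: "'a::euclidean_space measure \<Rightarrow> ('a \<Rightarrow> 'b::euclidean_space) \<Rightarrow> bool" where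
  "loc_integrable M f \<longleftrightarrow> f \<in> borel_measurable M \<and> (\<forall>A\<in>bborel. set_integrable M A f)"

definition with_density ::
    "'a::euclidean_space measure \<Rightarrow> ('a \<Rightarrow> 'b::euclidean_space) \<Rightarrow> 'a set \<Rightarrow> 'b" where
  "with_density M f = (\<lambda>A. if A \<in> bborel then (LINT x:A|M. f x) else 0)"

definition rn_density ::
    "'a::euclidean_space measure \<Rightarrow> ('a set \<Rightarrow> 'b::euclidean_space) \<Rightarrow> 'a \<Rightarrow> 'b" where
  "rn_density M \<mu> = (SOME f. loc_integrable M f \<and> \<mu> = with_density M f)"

text \<open>Integration of \<open>F\<close> against \<open>\<mu>\<close> through the polar decomposition \<open>\<mu> = \<theta>|\<mu>|\<close>: this is
  \<open>\<integral> F d\<mu>\<close> for scalar \<open>\<mu>\<close>, where the inner product is the product of reals, and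
  \<open>\<integral> F \<cdot> d\<mu>\<close> for vector-valued \<open>\<mu>\<close>.\<close>

definition pairing ::
    "('a::euclidean_space set \<Rightarrow> 'b::euclidean_space) \<Rightarrow> ('a \<Rightarrow> 'b) \<Rightarrow> real" where
  "pairing \<mu> F = (LINT x|variation \<mu>. F x \<bullet> rn_density (variation \<mu>) \<mu> x)"

definition msupp :: "'a::euclidean_space measure \<Rightarrow> 'a set" where
  "msupp M = {x. \<forall>r>0. emeasure M (ball x r) > 0}"

text \<open>Positive and negative part of the Jordan decomposition, evaluated on the whole space
  (\<^const>\<open>ennreal\<close> maps negative numbers to \<open>0\<close>). The total mass is meaningful if they are not
  both infinite.\<close>

definition pos_mass :: "('a::euclidean_space set \<Rightarrow> real) \<Rightarrow> ennreal" where
  "pos_mass \<mu> = (SUP A\<in>bborel. ennreal (\<mu> A))"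

definition neg_mass :: "('a::euclidean_space set \<Rightarrow> real) \<Rightarrow> ennreal" where
  "neg_mass \<mu> = (SUP A\<in>bborel. ennreal (- \<mu> A))"

definition has_total_mass :: "('a::euclidean_space set \<Rightarrow> real) \<Rightarrow> bool" where
  "has_total_mass \<mu> \<longleftrightarrow> pos_mass \<mu> < \<infinity> \<or> neg_mass \<mu> < \<infinity>"

definition total_mass :: "('a::euclidean_space set \<Rightarrow> real) \<Rightarrow> ereal" where
  "total_mass \<mu> = enn2ereal (pos_mass \<mu>) - enn2ereal (neg_mass \<mu>)"

definition gen_moment :: "real \<Rightarrow> 'a::euclidean_space measure \<Rightarrow> ennreal" where
  "gen_moment r \<gamma> = emeasure \<gamma> (ball 0 1) + (\<integral>\<^sup>+x\<in>- ball 0 1. ennreal (norm x powr r) \<partial>\<gamma>)"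

section \<open>Admissible densities and the action functional\<close>

definition edom :: "('v \<Rightarrow> ennreal) \<Rightarrow> 'v set" where
  "edom \<phi> = {y. \<phi> y < \<infinity>}"

definition lsc :: "('v::topological_space \<Rightarrow> ennreal) \<Rightarrow> bool" where
  "lsc \<phi> \<longleftrightarrow> (\<forall>y. \<phi> y \<le> Liminf (at y) \<phi>)"

definition econvex :: "('v::real_vector \<Rightarrow> ennreal) \<Rightarrow> bool" where
  "econvex \<phi> \<longleftrightarrow> (\<forall>x y u v. 0 \<le> u \<longrightarrow> 0 \<le> v \<longrightarrow> u + v = 1 \<longrightarrow>
     \<phi> (u *\<^sub>R x + v *\<^sub>R y) \<le> ennreal u * \<phi> x + ennreal v * \<phi> y)"

definition Adm :: "real \<Rightarrow> (real \<times> 'a::euclidean_space \<Rightarrow> ennreal) set" where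
  "Adm p = {\<phi>. lsc \<phi> \<and> edom \<phi> \<noteq> {} \<and> econvex \<phi> \<and>
     (\<forall>\<rho>. ({\<rho>} \<times> UNIV) \<inter> edom \<phi> \<noteq> {} \<longrightarrow>
        \<phi> (\<rho>, 0) = 0 \<and>
        (\<forall>l w. l \<noteq> 0 \<longrightarrow> \<phi> (\<rho>, l *\<^sub>R w) = ennreal (\<bar>l\<bar> powr p) * \<phi> (\<rho>, w))) \<and>
     (\<exists>\<rho>\<^sub>0. {\<rho>\<^sub>0} \<times> UNIV \<subseteq> edom \<phi> \<and> (\<forall>w. w \<noteq> 0 \<longrightarrow> \<phi> (\<rho>\<^sub>0, w) > 0))}"

definition Adm_int :: "real \<Rightarrow> real \<Rightarrow> real \<Rightarrow> (real \<times> 'a::euclidean_space \<Rightarrow> ennreal) set" where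
  "Adm_int p a b = {\<phi> \<in> Adm p. interior (edom \<phi>) = {a<..<b} \<times> UNIV}"

definition recession :: "('v::real_vector \<Rightarrow> ennreal) \<Rightarrow> 'v \<Rightarrow> ereal" where
  "recession \<phi> y = (SUP x\<in>edom \<phi>. enn2ereal (\<phi> (x + y)) - enn2ereal (\<phi> x))"

text \<open>Lebesgue decomposition \<open>\<mu> = \<rho>\<gamma> + \<mu>\<^sup>\<bottom>\<close>, with \<open>\<rho>\<close> unique up to \<open>\<gamma>\<close>-null sets.\<close>

definition msingular ::
    "('a::euclidean_space set \<Rightarrow> 'b::euclidean_space) \<Rightarrow> 'a measure \<Rightarrow> bool" where
  "msingular \<mu> \<gamma> \<longleftrightarrow>
     (\<exists>N\<in>sets borel. emeasure \<gamma> N = 0 \<and> emeasure (variation \<mu>) (- N) = 0)"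

definition ac_density ::
    "'a::euclidean_space measure \<Rightarrow> ('a set \<Rightarrow> 'b::euclidean_space) \<Rightarrow> 'a \<Rightarrow> 'b" where
  "ac_density \<gamma> \<mu> =
     (SOME \<rho>. loc_integrable \<gamma> \<rho> \<and> msingular (\<lambda>A. \<mu> A - with_density \<gamma> \<rho> A) \<gamma>)"

definition sing_part ::
    "'a::euclidean_space measure \<Rightarrow> ('a set \<Rightarrow> 'b::euclidean_space) \<Rightarrow> 'a set \<Rightarrow> 'b" where
  "sing_part \<gamma> \<mu> = (\<lambda>A. \<mu> A - with_density \<gamma> (ac_density \<gamma> \<mu>) A)"

definition sum_meas ::
    "'a::euclidean_space measure \<Rightarrow> 'a measure \<Rightarrow> 'a measure" where
  "sum_meas M N = measure_of UNIV (sets borel) (\<lambda>A. emeasure M A + emeasure N A)"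

text \<open>The functional is only meant for \<open>\<mu>\<close>, \<open>\<nu>\<close> supported in the support of \<open>\<gamma>\<close>; it is set
  to \<open>\<infinity>\<close> otherwise. The conversion \<^const>\<open>e2ennreal\<close> loses nothing, since the recession function
  of an admissible \<open>\<phi>\<close> is non-negative.\<close>

definition action ::
    "(real \<times> 'a::euclidean_space \<Rightarrow> ennreal) \<Rightarrow> 'a measure \<Rightarrow> ('a set \<Rightarrow> real) \<Rightarrow> ('a set \<Rightarrow> 'a) \<Rightarrow> ennreal"
  where
  "action \<phi> \<gamma> \<mu> \<nu> =
     (if msupp (variation \<mu>) \<subseteq> msupp \<gamma> \<and> msupp (variation \<nu>) \<subseteq> msupp \<gamma> then
        let \<mu>s = sing_part \<gamma> \<mu>; \<nu>s = sing_part \<gamma> \<nu>;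
            \<sigma>' = sum_meas (variation \<mu>s) (variation \<nu>s)
        in (\<integral>\<^sup>+x. \<phi> (ac_density \<gamma> \<mu> x, ac_density \<gamma> \<nu> x) \<partial>\<gamma>)
           + (\<integral>\<^sup>+x. e2ennreal (recession \<phi> (rn_density \<sigma>' \<mu>s x, rn_density \<sigma>' \<nu>s x)) \<partial>\<sigma>')
      else \<infinity>)"

section \<open>Continuity equation and the distance\<close>

definition weak_star_continuous_on ::
    "real set \<Rightarrow> (real \<Rightarrow> 'a::euclidean_space set \<Rightarrow> real) \<Rightarrow> bool" where
  "weak_star_continuous_on I \<mu> \<longleftrightarrow>
     (\<forall>f. continuous_on UNIV f \<longrightarrow> compact (closure {x. f x \<noteq> 0}) \<longrightarrow>
        continuous_on I (\<lambda>t. pairing (\<mu> t) f))"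

definition borel_family_on ::
    "real set \<Rightarrow> (real \<Rightarrow> 'a::euclidean_space set \<Rightarrow> 'b::euclidean_space) \<Rightarrow> bool" where
  "borel_family_on I \<nu> \<longleftrightarrow> (\<forall>A\<in>bborel. (\<lambda>t. \<nu> t A) \<in> borel_measurable (restrict_space borel I))"

text \<open>Test functions \<open>\<zeta>\<close> are defined on all of \<open>'a \<times> real\<close> with compact support in
  \<open>'a \<times> (0,T)\<close>; the gradient is \<open>D = (\<nabla>\<^sub>x\<zeta>, \<partial>\<^sub>t\<zeta>)\<close>.\<close>

definition CE ::
    "real \<Rightarrow> ((real \<Rightarrow> 'a::euclidean_space set \<Rightarrow> real) \<times> (real \<Rightarrow> 'a set \<Rightarrow> 'a)) set" where
  "CE T = {(\<mu>, \<nu>).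
     (\<forall>t\<in>{0..T}. \<mu> t \<in> Mloc \<and> \<nu> t \<in> Mloc) \<and>
     weak_star_continuous_on {0..T} \<mu> \<and>
     borel_family_on {0..T} \<nu> \<and>
     (\<forall>R>0. (\<integral>\<^sup>+t\<in>{0..T}. emeasure (variation (\<mu> t)) (ball 0 R) \<partial>lborel) < \<infinity>) \<and>
     (\<forall>R>0. (\<integral>\<^sup>+t\<in>{0..T}. emeasure (variation (\<nu> t)) (ball 0 R) \<partial>lborel) < \<infinity>) \<and>
     (\<forall>(\<zeta> :: 'a \<times> real \<Rightarrow> real) D.
        (\<forall>z. GDERIV \<zeta> z :> D z) \<longrightarrow> continuous_on UNIV D \<longrightarrow>
        compact (closure {z. \<zeta> z \<noteq> 0}) \<longrightarrow> closure {z. \<zeta> z \<noteq> 0} \<subseteq> UNIV \<times> {0<..<T} \<longrightarrow>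
        (LINT t:{0..T}|lborel. pairing (\<mu> t) (\<lambda>x. snd (D (x, t))))
        + (LINT t:{0..T}|lborel. pairing (\<nu> t) (\<lambda>x. fst (D (x, t)))) = 0)}"

definition total_action ::
    "(real \<times> 'a::euclidean_space \<Rightarrow> ennreal) \<Rightarrow> 'a measure \<Rightarrow>
     (real \<Rightarrow> 'a set \<Rightarrow> real) \<Rightarrow> (real \<Rightarrow> 'a set \<Rightarrow> 'a) \<Rightarrow> ennreal" where
  "total_action \<phi> \<gamma> \<mu> \<nu> = (\<integral>\<^sup>+t\<in>{0..1}. action \<phi> \<gamma> (\<mu> t) (\<nu> t) \<partial>lborel)"

definition CE_action ::
    "(real \<times> 'a::euclidean_space \<Rightarrow> ennreal) \<Rightarrow> 'a measure \<Rightarrow> ('a set \<Rightarrow> real) \<Rightarrow> ('a set \<Rightarrow> real) \<Rightarrow>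
     ((real \<Rightarrow> 'a set \<Rightarrow> real) \<times> (real \<Rightarrow> 'a set \<Rightarrow> 'a)) set" where
  "CE_action \<phi> \<gamma> \<mu>0 \<mu>1 =
     {(\<mu>, \<nu>) \<in> CE 1. \<mu> 0 = \<mu>0 \<and> \<mu> 1 = \<mu>1 \<and> total_action \<phi> \<gamma> \<mu> \<nu> < \<infinity>}"

definition W ::
    "real \<Rightarrow> (real \<times> 'a::euclidean_space \<Rightarrow> ennreal) \<Rightarrow> 'a measure \<Rightarrow>
     ('a set \<Rightarrow> real) \<Rightarrow> ('a set \<Rightarrow> real) \<Rightarrow> ennreal" where
  "W p \<phi> \<gamma> \<mu>0 \<mu>1 =
     (INF (\<mu>, \<nu>) \<in> CE_action \<phi> \<gamma> \<mu>0 \<mu>1. ennreal (enn2real (total_action \<phi> \<gamma> \<mu> \<nu>) powr (1 / p)))"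

definition finite_dist_class ::
    "real \<Rightarrow> (real \<times> 'a::euclidean_space \<Rightarrow> ennreal) \<Rightarrow> 'a measure \<Rightarrow> ('a set \<Rightarrow> real) \<Rightarrow>
     ('a set \<Rightarrow> real) set" where
  "finite_dist_class p \<phi> \<gamma> \<sigma> = {\<mu> \<in> Mloc. W p \<phi> \<gamma> \<mu> \<sigma> < \<infinity>}"

text \<open>A pseudo-distance satisfies the axioms of a distance, except that it may take the value
  \<open>\<infinity>\<close>. This includes the diagonal: for \<open>\<phi> \<in> Adm_int p a b\<close>, if \<open>\<mu>\<close> is not of the
  form \<open>\<rho>\<gamma>\<close> with \<open>(\<rho>, 0)\<close> in the domain of \<open>\<phi>\<close> almost everywhere, no curve of finite action starts from \<open>\<mu>\<close>, hence \<open>W p \<phi> \<gamma> \<mu> \<mu> = \<infinity>\<close> by the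
  convention for the empty set.\<close>

definition pseudo_distance_on :: "'m set \<Rightarrow> ('m \<Rightarrow> 'm \<Rightarrow> ennreal) \<Rightarrow> bool" where
  "pseudo_distance_on X d \<longleftrightarrow>
     (\<forall>x\<in>X. d x x = 0 \<or> d x x = \<infinity>) \<and>
     (\<forall>x\<in>X. \<forall>y\<in>X. d x y = 0 \<longrightarrow> x = y) \<and>
     (\<forall>x\<in>X. \<forall>y\<in>X. d x y = d y x) \<and>
     (\<forall>x\<in>X. \<forall>y\<in>X. \<forall>z\<in>X. d x z \<le> d x y + d y z)"

definition pseudo_complete_on :: "'m set \<Rightarrow> ('m \<Rightarrow> 'm \<Rightarrow> ennreal) \<Rightarrow> bool" where
  "pseudo_complete_on X d \<longleftrightarrow>
     (\<forall>u :: nat \<Rightarrow> 'm. range u \<subseteq> X \<longrightarrow>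
        (\<forall>\<epsilon>>0. \<exists>N. \<forall>n\<ge>N. \<forall>m\<ge>N. d (u n) (u m) < \<epsilon>) \<longrightarrow>
        (\<exists>x\<in>X. (\<lambda>n. d (u n) x) \<longlonglongrightarrow> 0))"

end

theory Submission imports Defs begin

text \<open>By (F1) and \<open>p > 1\<close>, and since \<open>\<phi>\<close> is finite only for \<open>\<rho> \<in> [a, b]\<close>, the recession function is
  \<open>\<infinity>\<close> off the origin. Finite action therefore forces \<open>\<mu> = \<rho>\<gamma>\<close> with \<open>a \<le> \<rho> \<le> b\<close> and \<open>\<nu> = w\<gamma>\<close>, and (F2)
  with convexity gives \<open>\<phi>(\<rho>, w) \<ge> c|w|\<^sup>p\<close>. By Young's inequality the fluxes \<open>\<integral> \<nabla>f \<cdot> d\<nu>\<^sub>t\<close> are then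
  integrable in \<open>t\<close>, and the continuity equation says that \<open>t \<mapsto> \<integral> f d\<mu>\<^sub>t\<close> is their primitive. In this
  form curves can be concatenated and reparametrised affinely, which gives the axioms of a
  pseudo-distance.

  For completeness neither compactness of curves nor lower semicontinuity of the action is needed:
  short curves joining the terms of a fast Cauchy subsequence are concatenated to a single curve on
  \<open>[0, 1)\<close> of finite action. Its values have densities in \<open>[a, b]\<close> and test functions are dense in
  \<open>L\<^sup>1(\<gamma>)\<close>, so it has a limit at \<open>t = 1\<close>, and the tails of the curve show that this is the limit in the
  distance.

  The total mass is the limit of the integrals of the cut-offs \<open>(1 - |x|\<^sup>2/R\<^sup>2)\<^sub>+\<^sup>2\<close>. Their gradients
  are bounded by a multiple of \<open>min (1/R) (1/|x|)\<close>, so that the moment condition makes their norms in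
  \<open>L\<^sup>q(\<gamma>)\<close>, hence the flux, vanish as \<open>R \<rightarrow> \<infinity>\<close>.\<close>

subsection \<open>Lower integrals\<close>

text \<open>Measures with density in \<open>[a, b]\<close> are dominated by one fixed multiple of
  \<open>\<gamma>\<close>. Hence a single approximation in \<open>L\<^sup>1(\<gamma>)\<close>
  controls all of them at once, and weak limits keep the density bound. Two further points shape the
  proof. The continuity equation speaks of test functions on space-time, a curve of pairings at
  fixed times: one direction tests with products and uses the du Bois-Reymond argument, the other
  freezes a general \<open>\<zeta>\<close> on the cells of a time grid and sums by parts. And all
  estimates of the distance rest on one scaling law: bridging a distance \<open>e\<close> in time
  \<open>\<tau>\<close> costs about \<open>\<tau> powr (1 - p) * e powr p\<close>. Dividing time in
  proportion to two distances makes the costs add up to the \<open>p\<close>-th power of their sum,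
  which is the triangle inequality; times \<open>h\<close> and distances \<open>h\<^sup>2\<close>
  with \<open>h\<close> geometric give the chain of a Cauchy sequence summable costs. Near-optimal
  curves suffice throughout; minimisers never occur.\<close>

text \<open>The action \<open>t \<mapsto> \<Phi>(\<mu>\<^sub>t, \<nu>\<^sub>t|\<gamma>)\<close> is not shown to be measurable. The nonnegative integral of a
  non-measurable function is the supremum over the simple functions below it; it is only
  superadditive, and its additivity under splitting of the domain has to be proved.\<close>

lemma nn_integral_le_measurable:
  assumes "\<And>g. g \<in> borel_measurable M \<Longrightarrow> (\<And>x. g x \<le> f x) \<Longrightarrow> integral\<^sup>N M g \<le> c"
  shows "integral\<^sup>N M f \<le> c"
  unfolding nn_integral_def[of M f]
proof (rule SUP_least)
  fix g assume "g \<in> {g. simple_function M g \<and> g \<le> f}"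
  then have g: "simple_function M g" "\<And>x. g x \<le> f x" by (auto simp: le_fun_def)
  then have "integral\<^sup>S M g = integral\<^sup>N M g" by (simp add: nn_integral_eq_simple_integral)
  also have "\<dots> \<le> c" using g by (intro assms) (auto intro: borel_measurable_simple_function)
  finally show "integral\<^sup>S M g \<le> c" .
qed

text \<open>A measurable minorant of \<open>f\<close> can be split along \<open>A\<close> and
  \<open>B\<close>, and each part is a minorant of the restricted \<open>f\<close>. The two sets may
  overlap.\<close>

lemma nn_integral_split_le:
  assumes A: "A \<in> sets M" and B: "B \<in> sets M" and f: "\<And>x. x \<in> space M \<Longrightarrow> x \<notin> A \<Longrightarrow> x \<notin> B \<Longrightarrow> f x = 0"
  shows "integral\<^sup>N M f \<le> (\<integral>\<^sup>+x\<in>A. f x \<partial>M) + (\<integral>\<^sup>+x\<in>B. f x \<partial>M)"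
proof (rule nn_integral_le_measurable)
  fix g assume g[measurable]: "g \<in> borel_measurable M" and le: "\<And>x. g x \<le> f x"
  note A[measurable] B[measurable]
  have "integral\<^sup>N M g \<le> (\<integral>\<^sup>+x. g x * indicator A x + g x * indicator B x \<partial>M)"
  proof (rule nn_integral_mono)
    fix x assume "x \<in> space M"
    then show "g x \<le> g x * indicator A x + g x * indicator B x"
      using le[of x] f[of x] by (auto simp: indicator_def)
  qed
  also have "\<dots> = (\<integral>\<^sup>+x\<in>A. g x \<partial>M) + (\<integral>\<^sup>+x\<in>B. g x \<partial>M)" by (rule nn_integral_add) auto
  also have "\<dots> \<le> (\<integral>\<^sup>+x\<in>A. f x \<partial>M) + (\<integral>\<^sup>+x\<in>B. f x \<partial>M)"
    by (intro add_mono nn_integral_mono) (auto intro: le mult_right_mono)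
  finally show "integral\<^sup>N M g \<le> \<dots>" .
qed

text \<open>Monotone convergence is applied to a measurable minorant \<open>g\<close> instead of
  \<open>f\<close>: its restrictions to \<open>A i\<close> increase to \<open>g\<close>, because
  \<open>g\<close> vanishes off the union.\<close>

lemma nn_integral_UN_le:
  fixes A :: "nat \<Rightarrow> 'x set"
  assumes A: "\<And>i. A i \<in> sets M" "incseq A"
    and c: "\<And>i. (\<integral>\<^sup>+x\<in>A i. f x \<partial>M) \<le> c"
  shows "(\<integral>\<^sup>+x\<in>(\<Union>i. A i). f x \<partial>M) \<le> c"
proof (rule nn_integral_le_measurable)
  fix g assume g[measurable]: "g \<in> borel_measurable M"
    and le: "\<And>x. g x \<le> f x * indicator (\<Union>i. A i) x"
  note A(1)[measurable]
  have "integral\<^sup>N M g \<le> (\<integral>\<^sup>+x. (SUP i. g x * indicator (A i) x) \<partial>M)"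
  proof (rule nn_integral_mono)
    fix x show "g x \<le> (SUP i. g x * indicator (A i) x)"
    proof (cases "x \<in> (\<Union>i. A i)")
      case True
      then obtain i where "x \<in> A i" by auto
      then show ?thesis by (intro SUP_upper2[of i]) auto
    next
      case False then show ?thesis using le[of x] by simp
    qed
  qed
  also have "\<dots> = (SUP i. \<integral>\<^sup>+x. g x * indicator (A i) x \<partial>M)"
    using A(2) by (intro nn_integral_monotone_convergence_SUP)
      (auto simp: incseq_def le_fun_def indicator_def subset_eq)
  also have "\<dots> \<le> c"
  proof (rule SUP_least)
    fix i
    have "(\<integral>\<^sup>+x. g x * indicator (A i) x \<partial>M) \<le> (\<integral>\<^sup>+x\<in>A i. f x \<partial>M)"
    proof (rule nn_integral_mono)
      fix x show "g x * indicator (A i) x \<le> f x * indicator (A i) x"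
      proof (cases "x \<in> A i")
        case True
        then have "indicator (\<Union>i. A i) x = (1::ennreal)" by (auto simp: indicator_def)
        then show ?thesis using le[of x] True by simp
      qed simp
    qed
    also note c[of i]
    finally show "(\<integral>\<^sup>+x. g x * indicator (A i) x \<partial>M) \<le> c" .
  qed
  finally show "integral\<^sup>N M g \<le> c" .
qed

text \<open>If \<open>s\<close> is a measurable minorant of the sum, then \<open>s - g\<close> is a
  measurable minorant of \<open>f\<close>; finiteness of \<open>g\<close> makes the subtraction
  faithful. In the applications \<open>f\<close> is a multiple of the action.\<close>

lemma nn_integral_add_le:
  assumes g[measurable]: "g \<in> borel_measurable M" and fin: "\<And>x. g x < \<infinity>"
  shows "(\<integral>\<^sup>+x. g x + f x \<partial>M) \<le> integral\<^sup>N M g + integral\<^sup>N M f"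
proof (rule nn_integral_le_measurable)
  fix s assume s[measurable]: "s \<in> borel_measurable M" and le: "\<And>x. s x \<le> g x + f x"
  have "integral\<^sup>N M s \<le> (\<integral>\<^sup>+x. g x + (s x - g x) \<partial>M)"
  proof (rule nn_integral_mono)
    fix x show "s x \<le> g x + (s x - g x)"
      by (cases "g x \<le> s x") (use fin[of x] in \<open>auto simp: add_diff_inverse_ennreal less_top intro: add_increasing2\<close>)
  qed
  also have "\<dots> = integral\<^sup>N M g + (\<integral>\<^sup>+x. s x - g x \<partial>M)" by (rule nn_integral_add) auto
  also have "\<dots> \<le> integral\<^sup>N M g + integral\<^sup>N M f"
  proof (intro add_left_mono nn_integral_mono)
    fix x show "s x - g x \<le> f x" using le[of x] fin[of x] by (auto simp: ennreal_minus_le_iff)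
  qed
  finally show "integral\<^sup>N M s \<le> \<dots>" .
qed

text \<open>One inequality, used for \<open>c\<close> and for \<open>1 / c\<close>, gives equality
  without measurability of \<open>f\<close>.\<close>

lemma nn_integral_cmult_real:
  fixes c :: real assumes c: "0 < c"
  shows "(\<integral>\<^sup>+x. ennreal c * f x \<partial>M) = ennreal c * integral\<^sup>N M f"
proof -
  have le: "(\<integral>\<^sup>+x. ennreal c * f x \<partial>M) \<le> ennreal c * integral\<^sup>N M f" if c: "0 < c" for f and c :: real
  proof (rule nn_integral_le_measurable)
    fix g assume g[measurable]: "g \<in> borel_measurable M" and le: "\<And>x. g x \<le> ennreal c * f x"
    have eq: "ennreal c * (ennreal (1/c) * y) = y" for y
      using c by (simp add: mult.assoc[symmetric] ennreal_mult[symmetric])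
    have "integral\<^sup>N M g = ennreal c * (\<integral>\<^sup>+x. ennreal (1/c) * g x \<partial>M)"
      by (subst nn_integral_cmult) (auto simp: eq)
    also have "(\<integral>\<^sup>+x. ennreal (1/c) * g x \<partial>M) \<le> integral\<^sup>N M f"
    proof (rule nn_integral_mono)
      fix x
      have "ennreal (1/c) * g x \<le> ennreal (1/c) * (ennreal c * f x)" by (intro mult_left_mono le) simp
      also have "\<dots> = f x" using c by (simp add: mult.assoc[symmetric] ennreal_mult[symmetric])
      finally show "ennreal (1/c) * g x \<le> f x" .
    qed
    finally show "integral\<^sup>N M g \<le> ennreal c * integral\<^sup>N M f" by (simp add: mult_left_mono)
  qed
  have "ennreal c * integral\<^sup>N M f = ennreal c * (\<integral>\<^sup>+x. ennreal (1/c) * (ennreal c * f x) \<partial>M)"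
    using c by (simp add: mult.assoc[symmetric] ennreal_mult[symmetric])
  also have "\<dots> \<le> ennreal c * (ennreal (1/c) * (\<integral>\<^sup>+x. ennreal c * f x \<partial>M))"
    using c by (intro mult_left_mono le) auto
  also have "\<dots> = (\<integral>\<^sup>+x. ennreal c * f x \<partial>M)"
    using c by (simp add: mult.assoc[symmetric] ennreal_mult[symmetric])
  finally show ?thesis using le[OF c, of f] by (rule antisym[rotated])
qed

lemma nn_integral_affine:
  fixes c :: real assumes c: "c \<noteq> 0"
  shows "(\<integral>\<^sup>+x. f x \<partial>lborel) = ennreal \<bar>c\<bar> * (\<integral>\<^sup>+x. f (t + c * x) \<partial>lborel)"
proof -
  have le: "(\<integral>\<^sup>+x. f x \<partial>lborel) \<le> ennreal \<bar>c\<bar> * (\<integral>\<^sup>+x. f (t + c * x) \<partial>lborel)" if c: "c \<noteq> 0" for f and c t :: real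
  proof (rule nn_integral_le_measurable)
    fix g :: "real \<Rightarrow> ennreal" assume g: "g \<in> borel_measurable lborel" and le: "\<And>x. g x \<le> f x"
    from g have "(\<integral>\<^sup>+x. g x \<partial>lborel) = ennreal \<bar>c\<bar> * (\<integral>\<^sup>+x. g (t + c * x) \<partial>lborel)"
      by (intro nn_integral_real_affine c) simp
    also have "\<dots> \<le> ennreal \<bar>c\<bar> * (\<integral>\<^sup>+x. f (t + c * x) \<partial>lborel)"
      by (intro mult_left_mono nn_integral_mono le) simp
    finally show "(\<integral>\<^sup>+x. g x \<partial>lborel) \<le> \<dots>" .
  qed
  have "ennreal \<bar>c\<bar> * (\<integral>\<^sup>+x. f (t + c * x) \<partial>lborel)
    \<le> ennreal \<bar>c\<bar> * (ennreal \<bar>1/c\<bar> * (\<integral>\<^sup>+x. f (t + c * (- t / c + 1/c * x)) \<partial>lborel))"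
    using le[of "1/c" "\<lambda>x. f (t + c * x)" "- t / c"] c by (intro mult_left_mono) auto
  also have "\<dots> = (\<integral>\<^sup>+x. f x \<partial>lborel)"
    using c by (simp add: mult.assoc[symmetric] ennreal_mult[symmetric] ring_distribs)
  finally show ?thesis using le[OF c, of f t] by (rule antisym[rotated])
qed

text \<open>If \<open>f\<close> were infinite on the whole interval, the constant
  \<open>\<infinity>\<close> there would be a measurable minorant with infinite integral. This
  yields times of finite action near any given time.\<close>

lemma nn_integral_finite_dense:
  fixes f :: "real \<Rightarrow> ennreal"
  assumes fin: "(\<integral>\<^sup>+t\<in>A. f t \<partial>lborel) < \<infinity>" and ab: "a < b" "{a<..<b} \<subseteq> A"
  obtains t where "a < t" "t < b" "f t < \<infinity>"
proof -
  have "\<exists>t. a < t \<and> t < b \<and> f t < \<infinity>"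
  proof (rule ccontr)
    assume no: "\<not> ?thesis"
    have "(\<integral>\<^sup>+t. \<infinity> * indicator {a<..<b} t \<partial>lborel) \<le> (\<integral>\<^sup>+t\<in>A. f t \<partial>lborel)"
      using no ab by (intro nn_integral_mono) (auto simp: indicator_def less_top[symmetric] subset_eq)
    moreover have "(\<integral>\<^sup>+t. \<infinity> * indicator {a<..<b} t \<partial>lborel) = \<infinity>"
      using ab by (subst nn_integral_cmult_indicator) (auto simp: ennreal_top_mult)
    ultimately show False using fin by simp
  qed
  then show thesis using that by auto
qed

text \<open>The bound \<open>k\<close> will contain the action and may fail to be measurable. The
  supremum \<open>B\<close> of the norms is measurable and lies below \<open>k\<close>, so that
  \<open>B\<close> can dominate instead.\<close>

lemma dominated_convergence_lower:
  fixes f :: "nat \<Rightarrow> 'x \<Rightarrow> 'b::{banach, second_countable_topology}"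
  assumes f[measurable]: "\<And>n. f n \<in> borel_measurable M"
    and lim: "\<And>x. (\<lambda>n. f n x) \<longlonglongrightarrow> l x"
    and le: "\<And>n x. ennreal (norm (f n x)) \<le> k x" and k: "integral\<^sup>N M k < \<infinity>"
  shows "integrable M l" "(\<lambda>n. integral\<^sup>L M (f n)) \<longlonglongrightarrow> integral\<^sup>L M l" "\<And>n. integrable M (f n)"
proof -
  define B where "B x = (SUP n. ennreal (norm (f n x)))" for x
  have B[measurable]: "B \<in> borel_measurable M" unfolding B_def by measurable
  have "integral\<^sup>N M B \<le> integral\<^sup>N M k"
    by (intro nn_integral_mono) (auto simp: B_def intro!: SUP_least le)
  then have Bfin: "integral\<^sup>N M B < \<infinity>" using k by (rule order.strict_trans1)
  then have ae: "AE x in M. B x \<noteq> \<infinity>" by (intro nn_integral_PInf_AE) auto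
  have intB: "integrable M (\<lambda>x. enn2real (B x))"
  proof (rule integrableI_nonneg)
    have "(\<integral>\<^sup>+x. ennreal (enn2real (B x)) \<partial>M) = integral\<^sup>N M B"
      using ae by (intro nn_integral_cong_AE) (auto simp: less_top)
    then show "(\<integral>\<^sup>+x. ennreal (enn2real (B x)) \<partial>M) < \<infinity>" using Bfin by simp
  qed auto
  have bnd: "AE x in M. norm (f n x) \<le> enn2real (B x)" for n
    using ae
  proof eventually_elim
    case (elim x)
    have "ennreal (norm (f n x)) \<le> B x" unfolding B_def by (rule SUP_upper) auto
    with elim show ?case by (metis enn2real_ennreal enn2real_mono infinity_ennreal_def less_top norm_ge_zero)
  qed
  have [measurable]: "l \<in> borel_measurable M"
    by (rule borel_measurable_LIMSEQ_metric[where f=f]) (use lim in auto)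
  show "integrable M l"
    by (rule integrable_dominated_convergence[of _ _ f "\<lambda>x. enn2real (B x)"]) (use lim bnd intB in auto)
  show "(\<lambda>n. integral\<^sup>L M (f n)) \<longlonglongrightarrow> integral\<^sup>L M l"
    by (rule integral_dominated_convergence[where w="\<lambda>x. enn2real (B x)"]) (use lim bnd intB in auto)
  show "integrable M (f n)" for n
    by (rule Bochner_Integration.integrable_bound[OF intB]) (use bnd[of n] in auto)
qed

subsection \<open>Radon measures on bounded sets\<close>

lemma bborelD: "A \<in> bborel \<Longrightarrow> A \<in> sets borel" "A \<in> bborel \<Longrightarrow> bounded A"
  by (auto simp: bborel_def)

lemma bborelI: "A \<in> sets borel \<Longrightarrow> bounded A \<Longrightarrow> A \<in> bborel"
  by (auto simp: bborel_def)

lemma bborel_ball [simp, intro]: "ball x r \<in> bborel" by (auto simp: bborel_def)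
lemma bborel_empty [simp, intro]: "{} \<in> bborel" by (auto simp: bborel_def)
lemma bborel_Int: "A \<in> bborel \<Longrightarrow> B \<in> sets borel \<Longrightarrow> A \<inter> B \<in> bborel"
  "A \<in> bborel \<Longrightarrow> B \<in> sets borel \<Longrightarrow> B \<inter> A \<in> bborel"
  by (auto simp: bborel_def intro: bounded_subset)
lemma bborel_Diff: "A \<in> bborel \<Longrightarrow> B \<in> sets borel \<Longrightarrow> A - B \<in> bborel"
  by (auto simp: bborel_def intro: bounded_subset)
lemma bborel_Un: "A \<in> bborel \<Longrightarrow> B \<in> bborel \<Longrightarrow> A \<union> B \<in> bborel"
  by (auto simp: bborel_def)
lemma bborel_subset: "A \<in> bborel \<Longrightarrow> B \<subseteq> A \<Longrightarrow> B \<in> sets borel \<Longrightarrow> B \<in> bborel"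
  by (auto simp: bborel_def intro: bounded_subset)

lemma bborel_in_ball:
  assumes "A \<in> bborel" obtains n :: nat where "A \<subseteq> ball 0 (real n)"
proof -
  obtain B where "\<forall>x\<in>A. norm x < B" using assms bborelD(2) bounded_pos_less by metis
  moreover obtain n :: nat where "B < real n" using reals_Archimedean2 by blast
  ultimately have "A \<subseteq> ball 0 (real n)" by force
  then show thesis by (rule that)
qed

lemma UN_balls: "(\<Union>n::nat. ball (0::'a::real_normed_vector) (real n)) = UNIV"
  using reals_Archimedean2 by auto

lemma Mloc_pos_sets: "\<gamma> \<in> Mloc_pos \<Longrightarrow> sets \<gamma> = sets borel" by (simp add: Mloc_pos_def)
lemma Mloc_pos_space: "\<gamma> \<in> Mloc_pos \<Longrightarrow> space \<gamma> = UNIV"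
  using Mloc_pos_sets[THEN sets_eq_imp_space_eq] by simp

lemma Mloc_pos_finite:
  assumes "\<gamma> \<in> Mloc_pos" "A \<in> bborel" shows "emeasure \<gamma> A < \<infinity>"
proof -
  have "emeasure \<gamma> A \<le> emeasure \<gamma> (closure A)"
    using assms by (intro emeasure_mono closure_subset) (auto simp: Mloc_pos_sets)
  also have "\<dots> < \<infinity>" using assms by (auto simp: Mloc_pos_def bborel_def)
  finally show ?thesis .
qed

lemma Mloc_posI:
  assumes "sets \<gamma> = sets borel" "\<And>A. A \<in> bborel \<Longrightarrow> emeasure \<gamma> A < \<infinity>"
  shows "\<gamma> \<in> Mloc_pos"
  using assms by (auto simp: Mloc_pos_def bborel_def compact_imp_bounded borel_compact)

lemma Mloc_pos_sigma_finite:
  assumes g: "\<gamma> \<in> Mloc_pos" shows "sigma_finite_measure \<gamma>"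
proof
  have fin: "emeasure \<gamma> (ball 0 (real n)) \<noteq> \<infinity>" for n
    using Mloc_pos_finite[OF g bborel_ball[of 0 "real n"]] by simp
  show "\<exists>A. countable A \<and> A \<subseteq> sets \<gamma> \<and> \<Union> A = space \<gamma> \<and> (\<forall>a\<in>A. emeasure \<gamma> a \<noteq> \<infinity>)"
    using g fin UN_balls by (intro exI[of _ "range (\<lambda>n::nat. ball 0 (real n))"])
      (auto simp: Mloc_pos_sets Mloc_pos_space)
qed

lemma MlocD_sums:
  assumes "\<mu> \<in> Mloc" "range A \<subseteq> sets borel" "disjoint_family A" "bounded (\<Union>n. A n)"
  shows "(\<lambda>n. \<mu> (A n)) sums \<mu> (\<Union>n::nat. A n)"
  using assms by (auto simp: Mloc_def)

lemma Mloc_notin: "\<mu> \<in> Mloc \<Longrightarrow> A \<notin> bborel \<Longrightarrow> \<mu> A = 0" by (auto simp: Mloc_def)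

lemma MlocI:
  assumes "\<And>A. A \<notin> bborel \<Longrightarrow> \<mu> A = 0"
    "\<And>A. \<lbrakk>\<And>n::nat. A n \<in> bborel; disjoint_family A; (\<Union>n. A n) \<in> bborel\<rbrakk> \<Longrightarrow> (\<lambda>n. \<mu> (A n)) sums \<mu> (\<Union>n. A n)"
  shows "\<mu> \<in> Mloc"
  unfolding Mloc_def mem_Collect_eq
proof (intro conjI allI impI)
  fix A :: "nat \<Rightarrow> 'a set" assume A: "range A \<subseteq> sets borel" "disjoint_family A" "bounded (\<Union>n. A n)"
  have U: "(\<Union>n. A n) \<in> bborel" using A by (intro bborelI) auto
  moreover have "A n \<in> bborel" for n using A by (intro bborel_subset[OF U]) auto
  ultimately show "(\<lambda>n. \<mu> (A n)) sums \<mu> (\<Union>n. A n)" using assms(2) A by blast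
qed (use assms(1) in auto)

lemma Mloc_empty: assumes "\<mu> \<in> Mloc" shows "\<mu> {} = 0"
proof -
  have "(\<lambda>n. \<mu> {}) sums \<mu> (\<Union>n::nat. {})"
    using assms by (intro MlocD_sums) (auto simp: disjoint_family_on_def)
  then have "summable (\<lambda>n::nat. \<mu> {})" by (rule sums_summable)
  then show ?thesis by (simp add: summable_const_iff)
qed

lemma Mloc_Un:
  assumes mu: "\<mu> \<in> Mloc" and A: "A \<in> bborel" "B \<in> bborel" "A \<inter> B = {}"
  shows "\<mu> (A \<union> B) = \<mu> A + \<mu> B"
proof -
  have "(\<lambda>n. \<mu> (binaryset A B n)) sums \<mu> (\<Union>n. binaryset A B n)"
  proof (rule MlocD_sums[OF mu])
    show "range (binaryset A B) \<subseteq> sets borel" using A by (auto simp: range_binaryset_eq bborelD)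
    show "disjoint_family (binaryset A B)" using A(3)
      by (auto simp: disjoint_family_on_def binaryset_def)
    show "bounded (\<Union>n. binaryset A B n)" using A by (auto simp: UN_binaryset_eq bborelD)
  qed
  moreover have "(\<lambda>n. \<mu> (binaryset A B n)) sums (\<mu> A + \<mu> B)"
    using Mloc_empty[OF mu] binaryset_sums[where f=\<mu>] by metis
  ultimately show ?thesis using sums_unique2 UN_binaryset_eq by metis
qed

lemma Mloc_Diff:
  assumes mu: "\<mu> \<in> Mloc" and A: "A \<in> bborel" "B \<in> bborel" "B \<subseteq> A"
  shows "\<mu> (A - B) = \<mu> A - \<mu> B"
proof -
  have "\<mu> ((A - B) \<union> B) = \<mu> (A - B) + \<mu> B"
    using A bborelD by (intro Mloc_Un mu bborel_Diff) auto
  moreover have "(A - B) \<union> B = A" using A by auto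
  ultimately show ?thesis by simp
qed

lemma Mloc_Union_finite:
  assumes mu: "\<mu> \<in> Mloc" and "finite P" "disjoint P" "\<And>B. B \<in> P \<Longrightarrow> B \<in> bborel"
  shows "\<Union>P \<in> bborel \<and> \<mu> (\<Union>P) = (\<Sum>B\<in>P. \<mu> B)"
  using assms(2-)
proof (induction P rule: finite_induct)
  case empty then show ?case using Mloc_empty[OF mu] by simp
next
  case (insert B P)
  have IH: "\<Union>P \<in> bborel" "\<mu> (\<Union>P) = (\<Sum>B\<in>P. \<mu> B)"
    using insert by (auto simp: pairwise_insert)
  have "B \<inter> \<Union>P = {}" using insert by (auto simp: disjoint_def)
  then show ?case using IH insert Mloc_Un[OF mu, of B "\<Union>P"] by (auto intro: bborel_Un)
qed

lemma Mloc_diff: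
  assumes "\<mu> \<in> Mloc" "\<nu> \<in> Mloc" shows "(\<lambda>A. \<mu> A - \<nu> A) \<in> Mloc"
  by (rule MlocI) (use assms in \<open>auto simp: Mloc_notin intro!: sums_diff MlocD_sums dest: bborelD\<close>)

lemma Mloc_add:
  assumes "\<mu> \<in> Mloc" "\<nu> \<in> Mloc" shows "(\<lambda>A. \<mu> A + \<nu> A) \<in> Mloc"
  by (rule MlocI) (use assms in \<open>auto simp: Mloc_notin intro!: sums_add MlocD_sums dest: bborelD\<close>)

lemma Mloc_bounded_linear:
  fixes \<mu> :: "'a::euclidean_space set \<Rightarrow> 'b::euclidean_space" and T :: "'b \<Rightarrow> 'c::euclidean_space"
  assumes "\<mu> \<in> Mloc" "bounded_linear T" shows "(\<lambda>A. T (\<mu> A)) \<in> Mloc"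
proof (rule MlocI)
  fix A :: "'a set" assume "A \<notin> bborel"
  then show "T (\<mu> A) = 0" using assms by (simp add: Mloc_notin linear_simps(3))
next
  fix A :: "nat \<Rightarrow> 'a set" assume A: "\<And>n. A n \<in> bborel" "disjoint_family A" "(\<Union>n. A n) \<in> bborel"
  have "(\<lambda>n. \<mu> (A n)) sums \<mu> (\<Union>n. A n)" using A assms(1) by (intro MlocD_sums) (auto dest: bborelD)
  then show "(\<lambda>n. T (\<mu> (A n))) sums T (\<mu> (\<Union>n. A n))" by (rule bounded_linear.sums[OF assms(2)])
qed

lemma Mloc_scaleR: "\<mu> \<in> Mloc \<Longrightarrow> (\<lambda>A. c *\<^sub>R \<mu> A) \<in> Mloc"
  by (rule Mloc_bounded_linear) (auto intro: bounded_linear_scaleR_right)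

subsection \<open>Total variation\<close>

definition partitions :: "'a::euclidean_space set \<Rightarrow> 'a set set set" where
  "partitions A = {P. finite P \<and> disjoint P \<and> (\<forall>B\<in>P. B \<in> bborel \<and> B \<subseteq> A)}"

text \<open>The set function inside \<open>variation\<close>, named because it has to be shown
  countably additive before \<open>emeasure\<close> of \<open>variation\<close> can be
  evaluated.\<close>

definition pre_variation :: "('a::euclidean_space set \<Rightarrow> 'b::euclidean_space) \<Rightarrow> 'a set \<Rightarrow> ennreal" where
  "pre_variation \<mu> A = (SUP P\<in>partitions A. \<Sum>B\<in>P. ennreal (norm (\<mu> B)))"

lemma empty_partitions: "{} \<in> partitions A" by (simp add: partitions_def)

lemma pre_variation_mono: "A \<subseteq> B \<Longrightarrow> pre_variation \<mu> A \<le> pre_variation \<mu> B"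
  unfolding pre_variation_def by (rule SUP_subset_mono) (auto simp: partitions_def)

lemma norm_le_pre_variation:
  assumes "A \<in> bborel" shows "ennreal (norm (\<mu> A)) \<le> pre_variation \<mu> A"
proof -
  have "{A} \<in> partitions A" using assms by (auto simp: partitions_def)
  then show ?thesis unfolding pre_variation_def by (intro SUP_upper2[of "{A}"]) auto
qed

text \<open>A family in \<open>A\<close> and one in \<open>B\<close> unite to a family in the union;
  a set belonging to both must be empty and so contributes nothing.\<close>

lemma pre_variation_superadditive:
  assumes mu: "\<mu> \<in> Mloc" and AB: "A \<inter> B = {}"
  shows "pre_variation \<mu> A + pre_variation \<mu> B \<le> pre_variation \<mu> (A \<union> B)"
proof -
  have *: "(\<Sum>B\<in>P. ennreal (norm (\<mu> B))) + (\<Sum>B\<in>Q. ennreal (norm (\<mu> B))) \<le> pre_variation \<mu> (A \<union> B)"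
    if P: "P \<in> partitions A" and Q: "Q \<in> partitions B" for P Q
  proof -
    have empty: "X = {}" if "X \<in> P \<inter> Q" for X
    proof -
      have "X \<subseteq> A" "X \<subseteq> B" using that P Q by (auto simp: partitions_def)
      then show ?thesis using AB by blast
    qed
    have "(\<Sum>B\<in>P. ennreal (norm (\<mu> B))) + (\<Sum>B\<in>Q. ennreal (norm (\<mu> B))) = (\<Sum>B\<in>P \<union> Q. ennreal (norm (\<mu> B)))"
      using P Q empty Mloc_empty[OF mu] by (intro sum.union_inter_neutral[symmetric]) (auto simp: partitions_def)
    also have "P \<union> Q \<in> partitions (A \<union> B)"
    proof -
      have "X \<inter> Y = {}" if "X \<in> P" "Y \<in> Q" for X Y
      proof -
        have "X \<subseteq> A" "Y \<subseteq> B" using that P Q by (auto simp: partitions_def)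
        then show ?thesis using AB by blast
      qed
      then have "disjoint (P \<union> Q)" using P Q by (intro disjoint_union) (auto simp: partitions_def)
      then show ?thesis using P Q by (auto simp: partitions_def)
    qed
    then have "(\<Sum>B\<in>P \<union> Q. ennreal (norm (\<mu> B))) \<le> pre_variation \<mu> (A \<union> B)"
      unfolding pre_variation_def by (rule SUP_upper)
    finally show ?thesis .
  qed
  have ne: "partitions A \<noteq> {}" "partitions B \<noteq> {}" using empty_partitions by force+
  show ?thesis
    unfolding pre_variation_def[of \<mu> A] pre_variation_def[of \<mu> B]
      ennreal_SUP_add_left[OF ne(1), symmetric] ennreal_SUP_add_right[OF ne(2)]
    by (intro SUP_least *)
qed

text \<open>Each member of a family is cut by all \<open>A n\<close>. Countable additivity of
  \<open>\<mu>\<close> and the triangle inequality bound it by its pieces, and for fixed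
  \<open>n\<close> the pieces are an admissible family in \<open>A n\<close>.\<close>

lemma pre_variation_subadditive:
  assumes mu: "\<mu> \<in> Mloc" and A: "\<And>n::nat. A n \<in> sets borel" "disjoint_family A"
  shows "pre_variation \<mu> (\<Union>n. A n) \<le> (\<Sum>n. pre_variation \<mu> (A n))"
  unfolding pre_variation_def[of \<mu> "\<Union>n. A n"]
proof (rule SUP_least)
  fix P assume P: "P \<in> partitions (\<Union>n. A n)"
  have "(\<Sum>B\<in>P. ennreal (norm (\<mu> B))) \<le> (\<Sum>B\<in>P. \<Sum>n. ennreal (norm (\<mu> (B \<inter> A n))))"
  proof (rule sum_mono)
    fix B assume B: "B \<in> P"
    then have Bb: "B \<in> bborel" and sub: "B \<subseteq> (\<Union>n. A n)" using P by (auto simp: partitions_def)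
    have "(\<lambda>n. \<mu> (B \<inter> A n)) sums \<mu> (\<Union>n. B \<inter> A n)"
    proof (rule MlocD_sums[OF mu])
      show "bounded (\<Union>n. B \<inter> A n)" using Bb by (auto simp: bborel_def intro: bounded_subset)
      show "disjoint_family (\<lambda>n. B \<inter> A n)" using A(2) by (auto simp: disjoint_family_on_def)
    qed (use Bb A in \<open>auto simp: bborel_def\<close>)
    moreover have "(\<Union>n. B \<inter> A n) = B" using sub by auto
    ultimately have s: "(\<lambda>n. \<mu> (B \<inter> A n)) sums \<mu> B" by simp
    show "ennreal (norm (\<mu> B)) \<le> (\<Sum>n. ennreal (norm (\<mu> (B \<inter> A n))))"
    proof (rule LIMSEQ_le_const2)
      show "(\<lambda>N. ennreal (norm (\<Sum>n<N. \<mu> (B \<inter> A n)))) \<longlonglongrightarrow> ennreal (norm (\<mu> B))"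
        using s unfolding sums_def by (intro tendsto_intros) auto
      have "ennreal (norm (\<Sum>n<N. \<mu> (B \<inter> A n))) \<le> (\<Sum>n. ennreal (norm (\<mu> (B \<inter> A n))))" for N
      proof -
        have "ennreal (norm (\<Sum>n<N. \<mu> (B \<inter> A n))) \<le> (\<Sum>n<N. ennreal (norm (\<mu> (B \<inter> A n))))"
          by (simp add: sum_ennreal norm_sum ennreal_leI)
        also have "\<dots> \<le> (\<Sum>n. ennreal (norm (\<mu> (B \<inter> A n))))" by (rule sum_le_suminf) auto
        finally show ?thesis .
      qed
      then show "\<exists>N. \<forall>n\<ge>N. ennreal (norm (\<Sum>n<n. \<mu> (B \<inter> A n))) \<le> (\<Sum>n. ennreal (norm (\<mu> (B \<inter> A n))))"
        by blast
    qed
  qed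
  also have "\<dots> = (\<Sum>n. \<Sum>B\<in>P. ennreal (norm (\<mu> (B \<inter> A n))))"
    by (rule suminf_sum[symmetric]) auto
  also have "\<dots> \<le> (\<Sum>n. pre_variation \<mu> (A n))"
  proof (rule suminf_le)
    fix n
    let ?Q = "(\<lambda>B. B \<inter> A n) ` P"
    have fin: "finite P" and dis: "disjoint P" using P by (auto simp: partitions_def)
    have "(\<Sum>B\<in>P. ennreal (norm (\<mu> (B \<inter> A n)))) = (\<Sum>B\<in>?Q. ennreal (norm (\<mu> B)))"
    \<comment> \<open>Cutting can identify different members of \<open>P\<close>, but then the
      common piece is empty and weighs 0.\<close>
    proof (rule sum.reindex_nontrivial[symmetric, unfolded o_def, OF fin])
      fix X Y assume "X \<in> P" "Y \<in> P" "X \<noteq> Y" "X \<inter> A n = Y \<inter> A n"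
      then have "X \<inter> A n = {}" using dis by (auto simp: disjoint_def)
      then show "ennreal (norm (\<mu> (X \<inter> A n))) = 0" using Mloc_empty[OF mu] by simp
    qed
    also have "?Q \<in> partitions (A n)"
    proof -
      have "disjoint ?Q" using dis by (auto simp: disjoint_def)
      then show ?thesis using P A(1)[of n] by (auto simp: partitions_def intro: bborel_Int)
    qed
    then have "(\<Sum>B\<in>?Q. ennreal (norm (\<mu> B))) \<le> pre_variation \<mu> (A n)"
      unfolding pre_variation_def by (rule SUP_upper)
    finally show "(\<Sum>B\<in>P. ennreal (norm (\<mu> (B \<inter> A n)))) \<le> pre_variation \<mu> (A n)" .
  qed auto
  finally show "(\<Sum>B\<in>P. ennreal (norm (\<mu> B))) \<le> (\<Sum>n. pre_variation \<mu> (A n))" .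
qed

text \<open>Superadditivity on finite unions together with monotonicity gives one half of countable
  additivity, \<open>pre_variation_subadditive\<close> the other.\<close>

lemma emeasure_variation:
  assumes mu: "\<mu> \<in> Mloc" and A: "A \<in> sets borel"
  shows "emeasure (variation \<mu>) A = pre_variation \<mu> A"
proof -
  have v: "variation \<mu> = measure_of UNIV (sets borel) (pre_variation \<mu>)"
    unfolding variation_def pre_variation_def[abs_def] partitions_def ..
  show ?thesis unfolding v
  proof (rule emeasure_measure_of_sigma)
    show "sigma_algebra UNIV (sets borel)" using sets.sigma_algebra_axioms[of borel] by simp
    show "positive (sets borel) (pre_variation \<mu>)"
    proof -
      have "pre_variation \<mu> {} = 0"
        unfolding pre_variation_def using Mloc_empty[OF mu]
        by (intro antisym SUP_least sum_nonpos) (auto simp: partitions_def)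
      then show ?thesis by (simp add: positive_def)
    qed
    show "countably_additive (sets borel) (pre_variation \<mu>)"
    proof (rule countably_additiveI)
      fix A :: "nat \<Rightarrow> 'a set" assume A: "range A \<subseteq> sets borel" "disjoint_family A"
      have fin: "(\<Sum>n<N. pre_variation \<mu> (A n)) \<le> pre_variation \<mu> (\<Union>n<N. A n)" for N
      proof (induction N)
        case (Suc N)
        have "A N \<inter> A n = {}" if "n < N" for n
          using A(2) that by (intro disjoint_family_onD[of A UNIV]) auto
        then have "A N \<inter> (\<Union>n<N. A n) = {}" by blast
        note disj = this
        have "(\<Sum>n<Suc N. pre_variation \<mu> (A n)) = pre_variation \<mu> (A N) + (\<Sum>n<N. pre_variation \<mu> (A n))"
          by (simp add: add.commute)
        also have "\<dots> \<le> pre_variation \<mu> (A N) + pre_variation \<mu> (\<Union>n<N. A n)"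
          by (rule add_left_mono[OF Suc])
        also have "\<dots> \<le> pre_variation \<mu> (A N \<union> (\<Union>n<N. A n))" by (rule pre_variation_superadditive[OF mu disj])
        also have "\<dots> = pre_variation \<mu> (\<Union>n<Suc N. A n)" by (simp add: lessThan_Suc)
        finally show ?case .
      qed simp
      have "(\<Sum>n. pre_variation \<mu> (A n)) \<le> pre_variation \<mu> (\<Union>n. A n)"
      proof (rule suminf_le_const)
        fix N
        have "pre_variation \<mu> (\<Union>n<N. A n) \<le> pre_variation \<mu> (\<Union>n. A n)" by (rule pre_variation_mono) auto
        then show "(\<Sum>n<N. pre_variation \<mu> (A n)) \<le> pre_variation \<mu> (\<Union>n. A n)" using fin[of N] by (rule order_trans[rotated])
      qed auto
      then show "(\<Sum>n. pre_variation \<mu> (A n)) = pre_variation \<mu> (\<Union>n. A n)"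
        using A by (intro antisym pre_variation_subadditive mu) auto
    qed
  qed (use A in auto)
qed

lemma sets_variation [simp]: "sets (variation \<mu>) = sets borel"
  unfolding variation_def using sets.sigma_sets_eq[of borel] by simp

lemma space_variation [simp]: "space (variation \<mu>) = UNIV"
  by (simp add: variation_def)

lemma norm_le_variation:
  "\<mu> \<in> Mloc \<Longrightarrow> A \<in> bborel \<Longrightarrow> ennreal (norm (\<mu> A)) \<le> emeasure (variation \<mu>) A"
  by (simp add: emeasure_variation bborelD norm_le_pre_variation)

text \<open>A set of infinite variation splits off a piece of measure at least 1 whose complement still has
  infinite variation; iterating this contradicts countable additivity.\<close>

lemma real_variation_split:
  fixes \<mu> :: "'a::euclidean_space set \<Rightarrow> real"
  assumes mu: "\<mu> \<in> Mloc" and E: "E \<in> bborel" "emeasure (variation \<mu>) E = \<infinity>"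
  shows "\<exists>A\<in>bborel. A \<subseteq> E \<and> 1 \<le> \<bar>\<mu> A\<bar> \<and> emeasure (variation \<mu>) (E - A) = \<infinity>"
proof -
  \<comment> \<open>A set of measure at least \<open>1 + \<bar>\<mu> E\<bar>\<close> in absolute
    value has a complement in \<open>E\<close> of measure at least 1 in absolute value. The factor 2
    pays for passing to the positive or to the negative members of the family, one of which carries
    half of the sum.\<close>
  define t where "t = 2 * (1 + \<bar>\<mu> E\<bar>)"
  have "ennreal t < pre_variation \<mu> E" using E by (simp add: emeasure_variation[OF mu] bborelD)
  then obtain P where P: "P \<in> partitions E" and Pt: "ennreal t < (\<Sum>B\<in>P. ennreal (norm (\<mu> B)))"
    unfolding pre_variation_def less_SUP_iff by auto
  have fin: "finite P" and dis: "disjoint P" and Pb: "\<And>B. B \<in> P \<Longrightarrow> B \<in> bborel \<and> B \<subseteq> E"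
    using P by (auto simp: partitions_def)
  have "t < (\<Sum>B\<in>P. \<bar>\<mu> B\<bar>)"
  proof -
    have "ennreal t < ennreal (\<Sum>B\<in>P. \<bar>\<mu> B\<bar>)" using Pt by (simp add: sum_ennreal)
    moreover have "0 \<le> t" by (simp add: t_def)
    ultimately show ?thesis using ennreal_less_iff by blast
  qed
  define S1 where "S1 = {B\<in>P. \<mu> B \<ge> 0}" define S2 where "S2 = {B\<in>P. \<not> \<mu> B \<ge> 0}"
  have "(\<Sum>B\<in>P. \<bar>\<mu> B\<bar>) = (\<Sum>B\<in>S1. \<bar>\<mu> B\<bar>) + (\<Sum>B\<in>S2. \<bar>\<mu> B\<bar>)"
    unfolding S1_def S2_def by (subst sum.union_disjoint[symmetric]) (use fin in \<open>auto intro: sum.cong\<close>)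
  moreover have "(\<Sum>B\<in>S1. \<bar>\<mu> B\<bar>) = (\<Sum>B\<in>S1. \<mu> B)" by (rule sum.cong) (auto simp: S1_def)
  moreover have "(\<Sum>B\<in>S2. \<bar>\<mu> B\<bar>) = - (\<Sum>B\<in>S2. \<mu> B)"
    unfolding sum_negf[symmetric] by (rule sum.cong) (auto simp: S2_def)
  moreover have dS: "disjoint S1" "disjoint S2" using dis by (auto simp: S1_def S2_def disjoint_def)
  have U: "\<Union>S \<in> bborel \<and> \<mu> (\<Union>S) = (\<Sum>B\<in>S. \<mu> B)" if "S \<in> {S1, S2}" for S
    by (rule Mloc_Union_finite[OF mu]) (use that fin dS Pb in \<open>auto simp: S1_def S2_def\<close>)
  ultimately have "t < \<mu> (\<Union>S1) - \<mu> (\<Union>S2)"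
    using \<open>t < (\<Sum>B\<in>P. \<bar>\<mu> B\<bar>)\<close> by simp
  then have "t / 2 \<le> \<bar>\<mu> (\<Union>S1)\<bar> \<or> t / 2 \<le> \<bar>\<mu> (\<Union>S2)\<bar>" by linarith
  then obtain S where S: "S \<in> {S1, S2}" "t / 2 \<le> \<bar>\<mu> (\<Union>S)\<bar>" by auto
  define A where "A = \<Union>S"
  have A: "A \<in> bborel" "A \<subseteq> E" "1 + \<bar>\<mu> E\<bar> \<le> \<bar>\<mu> A\<bar>"
    using U[OF S(1)] S Pb by (auto simp: A_def t_def S1_def S2_def)
  have EA: "E - A \<in> bborel" using E A by (auto intro: bborel_Diff bborelD)
  have "\<mu> (E - A) = \<mu> E - \<mu> A" using Mloc_Diff mu E A by blast
  then have "1 \<le> \<bar>\<mu> (E - A)\<bar>" "1 \<le> \<bar>\<mu> A\<bar>" using A(3) by linarith+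
  have "E = A \<union> (E - A)" using A by auto
  then have "emeasure (variation \<mu>) E = emeasure (variation \<mu>) A + emeasure (variation \<mu>) (E - A)"
    using A EA by (subst \<open>E = A \<union> (E - A)\<close>, intro plus_emeasure[symmetric]) (auto dest: bborelD)
  with E(2) have "emeasure (variation \<mu>) A = \<infinity> \<or> emeasure (variation \<mu>) (E - A) = \<infinity>" by (simp add: ennreal_add_eq_top)
  then show ?thesis
  proof
    assume "emeasure (variation \<mu>) A = \<infinity>"
    moreover have "E - (E - A) = A" using A by auto
    ultimately show ?thesis using EA \<open>1 \<le> \<bar>\<mu> (E - A)\<bar>\<close> by (intro bexI[of _ "E - A"]) auto
  qed (use A \<open>1 \<le> \<bar>\<mu> A\<bar>\<close> in blast)
qed

lemma real_variation_finite:
  fixes \<mu> :: "'a::euclidean_space set \<Rightarrow> real"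
  assumes mu: "\<mu> \<in> Mloc" and E: "E \<in> bborel" shows "emeasure (variation \<mu>) E < \<infinity>"
proof (rule ccontr)
  assume "\<not> ?thesis"
  then have inf: "emeasure (variation \<mu>) E = \<infinity>" by (simp add: not_less top_unique)
  let ?P = "\<lambda>X. X \<in> bborel \<and> X \<subseteq> E \<and> emeasure (variation \<mu>) X = \<infinity>"
  have "\<exists>F. \<forall>n::nat. ?P (F n) \<and> (F (Suc n) \<subseteq> F n \<and> 1 \<le> \<bar>\<mu> (F n - F (Suc n))\<bar>)"
  proof (rule dependent_nat_choice)
    show "\<exists>x. ?P x" using E inf by blast
    fix x n assume x: "?P x"
    then obtain A where A: "A \<in> bborel" "A \<subseteq> x" "1 \<le> \<bar>\<mu> A\<bar>" "emeasure (variation \<mu>) (x - A) = \<infinity>"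
      using real_variation_split[OF mu, of x] by auto
    moreover have "x - (x - A) = A" using A by auto
    ultimately show "\<exists>y. ?P y \<and> y \<subseteq> x \<and> 1 \<le> \<bar>\<mu> (x - y)\<bar>"
      using x by (intro exI[of _ "x - A"]) (auto intro: bborel_Diff dest: bborelD)
  qed
  then obtain F :: "nat \<Rightarrow> 'a set" where F: "\<And>n. F n \<in> bborel" "\<And>n. F n \<subseteq> E" "\<And>n. F (Suc n) \<subseteq> F n"
    "\<And>n. 1 \<le> \<bar>\<mu> (F n - F (Suc n))\<bar>" by auto
  have dec: "decseq F" using F(3) by (rule decseq_SucI)
  define A where "A n = F n - F (Suc n)" for n
  have "disjoint_family A"
  unfolding disjoint_family_on_def
  proof (intro ballI impI)
    have *: "A m \<inter> A n = {}" if "m < n" for m n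
      using decseqD[OF dec, of "Suc m" n] that by (auto simp: A_def)
    fix m n :: nat assume "m \<noteq> n"
    then show "A m \<inter> A n = {}" using *[of m n] *[of n m] by (cases "m < n") auto
  qed
  moreover have "bounded (\<Union>n. A n)" using F(2) bborelD(2)[OF E] by (auto simp: A_def intro: bounded_subset)
  moreover have "range A \<subseteq> sets borel" using F(1) by (auto simp: A_def bborel_def)
  ultimately have "(\<lambda>n. \<mu> (A n)) sums \<mu> (\<Union>n. A n)" by (intro MlocD_sums mu)
  then have "(\<lambda>n. \<mu> (A n)) \<longlonglongrightarrow> 0" by (intro summable_LIMSEQ_zero) (rule sums_summable)
  then obtain n where "\<bar>\<mu> (A n)\<bar> < 1" by (auto simp: LIMSEQ_iff dest!: spec[of _ "1::real"])
  then show False using F(4)[of n] by (simp add: A_def)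
qed

text \<open>The norm is at most the sum of the absolute values of the coordinates, which reduces
  local finiteness to the real case.\<close>

lemma variation_Mloc_pos:
  assumes mu: "\<mu> \<in> Mloc" shows "variation \<mu> \<in> Mloc_pos"
proof (rule Mloc_posI)
  fix A :: "'a set" assume A: "A \<in> bborel"
  let ?c = "\<lambda>b A. \<mu> A \<bullet> b"
  have c: "?c b \<in> Mloc" for b by (rule Mloc_bounded_linear[OF mu]) (rule bounded_linear_inner_left)
  have "pre_variation \<mu> A \<le> (\<Sum>b\<in>Basis. pre_variation (?c b) A)"
    unfolding pre_variation_def[of \<mu>]
  proof (rule SUP_least)
    fix P assume P: "P \<in> partitions A"
    have "(\<Sum>B\<in>P. ennreal (norm (\<mu> B))) \<le> (\<Sum>B\<in>P. \<Sum>b\<in>Basis. ennreal (norm (?c b B)))"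
      by (rule sum_mono) (simp add: sum_ennreal norm_le_l1)
    also have "\<dots> = (\<Sum>b\<in>Basis. \<Sum>B\<in>P. ennreal (norm (?c b B)))" by (rule sum.swap)
    also have "\<dots> \<le> (\<Sum>b\<in>Basis. pre_variation (?c b) A)"
      unfolding pre_variation_def using P by (intro sum_mono SUP_upper)
    finally show "(\<Sum>B\<in>P. ennreal (norm (\<mu> B))) \<le> (\<Sum>b\<in>Basis. pre_variation (?c b) A)" .
  qed
  also have "\<dots> < \<infinity>"
    using real_variation_finite[OF c A] by (simp add: emeasure_variation[OF c] bborelD[OF A] less_top)
  finally show "emeasure (variation \<mu>) A < \<infinity>" by (simp add: emeasure_variation mu bborelD[OF A])
qed simp

subsection \<open>Densities\<close>

lemma loc_integrableD: "loc_integrable M f \<Longrightarrow> A \<in> bborel \<Longrightarrow> set_integrable M A f"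
  by (simp add: loc_integrable_def)

lemma loc_integrableI:
  assumes M: "M \<in> Mloc_pos" and f: "f \<in> borel_measurable borel"
    and fin: "\<And>A. A \<in> bborel \<Longrightarrow> (\<integral>\<^sup>+x\<in>A. ennreal (norm (f x)) \<partial>M) < \<infinity>"
  shows "loc_integrable M f"
  unfolding loc_integrable_def set_integrable_def
proof (intro conjI ballI)
  show [measurable]: "f \<in> borel_measurable M"
    using f by (simp add: measurable_cong_sets[OF Mloc_pos_sets[OF M] refl])
  fix A :: "'a set" assume A: "A \<in> bborel"
  then have [measurable]: "A \<in> sets M" using M by (auto simp: Mloc_pos_sets bborelD)
  have "(\<integral>\<^sup>+x. ennreal (norm (indicator A x *\<^sub>R f x)) \<partial>M) = (\<integral>\<^sup>+x\<in>A. ennreal (norm (f x)) \<partial>M)"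
    by (rule nn_integral_cong) (auto simp: indicator_def)
  then show "integrable M (\<lambda>x. indicator A x *\<^sub>R f x)" using fin[OF A]
    by (intro integrableI_bounded) auto
qed

lemma loc_integrable_bounded:
  assumes M: "M \<in> Mloc_pos" and f: "f \<in> borel_measurable borel" and le: "\<And>x. norm (f x) \<le> C"
  shows "loc_integrable M f"
proof (rule loc_integrableI[OF M f])
  fix A :: "'a set" assume A: "A \<in> bborel"
  have "(\<integral>\<^sup>+x\<in>A. ennreal (norm (f x)) \<partial>M) \<le> (\<integral>\<^sup>+x. ennreal C * indicator A x \<partial>M)"
    by (intro nn_integral_mono mult_right_mono ennreal_leI le) auto
  also have "\<dots> = ennreal C * emeasure M A"
    using A M by (intro nn_integral_cmult_indicator) (auto simp: Mloc_pos_sets bborelD)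
  also have "\<dots> < \<infinity>" using Mloc_pos_finite[OF M A] by (simp add: ennreal_mult_less_top less_top)
  finally show "(\<integral>\<^sup>+x\<in>A. ennreal (norm (f x)) \<partial>M) < \<infinity>" .
qed

lemma loc_integrable_diff:
  "loc_integrable M f \<Longrightarrow> loc_integrable M g \<Longrightarrow> loc_integrable M (\<lambda>x. f x - g x)"
  by (auto simp: loc_integrable_def set_integral_diff)

lemma loc_integrable_scaleR:
  "loc_integrable M f \<Longrightarrow> loc_integrable M (\<lambda>x. c *\<^sub>R f x)"
  by (auto simp: loc_integrable_def)

lemma with_density_add:
  "loc_integrable M f \<Longrightarrow> loc_integrable M g \<Longrightarrow> with_density M (\<lambda>x. f x + g x) A = with_density M f A + with_density M g A"
  by (auto simp: loc_integrable_def set_integral_add with_density_def)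

lemma with_density_diff:
  "loc_integrable M f \<Longrightarrow> loc_integrable M g \<Longrightarrow> with_density M (\<lambda>x. f x - g x) A = with_density M f A - with_density M g A"
  by (auto simp: loc_integrable_def set_integral_diff with_density_def)

lemma with_density_scaleR:
  "with_density M (\<lambda>x. c *\<^sub>R f x) A = c *\<^sub>R with_density M f A"
  by (auto simp: with_density_def set_lebesgue_integral_def scaleR_left_commute
      simp del: scaleR_scaleR)

lemma with_density_Mloc:
  assumes M: "M \<in> Mloc_pos" and f: "loc_integrable M f"
  shows "with_density M f \<in> Mloc"
proof (rule MlocI)
  fix A :: "nat \<Rightarrow> 'a set"
  assume A: "\<And>n. A n \<in> bborel" "disjoint_family A" "(\<Union>n. A n) \<in> bborel"
  have int: "set_integrable M (\<Union>n. A n) f" using f A(3) by (rule loc_integrableD)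
  have sets[measurable]: "A n \<in> sets M" for n using A M by (auto simp: Mloc_pos_sets bborelD)
  have "(\<lambda>n. LINT x:(\<Union>i<n. A i)|M. f x) \<longlonglongrightarrow> (LINT x:(\<Union>n. \<Union>i<n. A i)|M. f x)"
  proof (rule set_integral_cont_up)
    show "incseq (\<lambda>n. \<Union>i<n. A i)" by (rule monoI) (intro UN_mono, auto)
    have "(\<Union>n. \<Union>i<n. A i) = (\<Union>n. A n)" by (auto intro: exI[of _ "Suc _"])
    then show "set_integrable M (\<Union>n. \<Union>i<n. A i) f" using int by simp
  qed auto
  moreover have "(\<Union>n. \<Union>i<n. A i) = (\<Union>n. A n)" by (auto intro: exI[of _ "Suc _"])
  moreover have "(LINT x:(\<Union>i<n. A i)|M. f x) = (\<Sum>i<n. LINT x:A i|M. f x)" for n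
    by (rule set_integral_finite_Union)
      (use A in \<open>auto simp: disjoint_family_on_def intro!: loc_integrableD[OF f]\<close>)
  ultimately show "(\<lambda>n. with_density M f (A n)) sums with_density M f (\<Union>n. A n)"
    using A by (simp add: sums_def with_density_def)
qed (simp add: with_density_def)

text \<open>Local integrability becomes integrability after cutting off with balls; the countably
  many exceptional sets are then united.\<close>

lemma with_density_eq_AE:
  assumes M: "M \<in> Mloc_pos" and f: "loc_integrable M f" "loc_integrable M g"
    and eq: "with_density M f = with_density M g"
  shows "AE x in M. f x = g x"
proof -
  have "AE x in M. indicator (ball 0 (real n)) x *\<^sub>R f x = indicator (ball 0 (real n)) x *\<^sub>R g x" for n
  proof (rule sigma_finite_measure.density_unique_banach[OF Mloc_pos_sigma_finite[OF M]])
    show "integrable M (\<lambda>x. indicator (ball 0 (real n)) x *\<^sub>R f x)"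
      "integrable M (\<lambda>x. indicator (ball 0 (real n)) x *\<^sub>R g x)"
      using f[THEN loc_integrableD[OF _ bborel_ball]] by (auto simp: set_integrable_def)
    fix A assume "A \<in> sets M"
    then have A: "ball 0 (real n) \<inter> A \<in> bborel" using M by (auto simp: Mloc_pos_sets intro: bborel_Int)
    have *: "(LINT x:A|M. indicator (ball 0 (real n)) x *\<^sub>R h x) = with_density M h (ball 0 (real n) \<inter> A)" for h :: "'a \<Rightarrow> 'b"
      using A by (auto simp: with_density_def set_lebesgue_integral_def indicator_inter_arith mult.commute)
    show "(LINT x:A|M. indicator (ball 0 (real n)) x *\<^sub>R f x) = (LINT x:A|M. indicator (ball 0 (real n)) x *\<^sub>R g x)"
      unfolding * eq ..
  qed
  then have "AE x in M. \<forall>n::nat. indicator (ball 0 (real n)) x *\<^sub>R f x = indicator (ball 0 (real n)) x *\<^sub>R g x"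
    unfolding AE_all_countable by blast
  then show ?thesis
  proof eventually_elim
    case (elim x)
    obtain n :: nat where "x \<in> ball 0 (real n)" using UN_balls by blast
    then show ?case using elim[rule_format, of n] by simp
  qed
qed

lemma with_density_cong_AE:
  assumes "f \<in> borel_measurable M" "g \<in> borel_measurable M" "M \<in> Mloc_pos" "AE x in M. f x = g x"
  shows "with_density M f = with_density M g"
proof
  fix A
  have [measurable]: "A \<in> sets M" if "A \<in> bborel"
    using that assms(3) by (simp add: Mloc_pos_sets bborelD)
  show "with_density M f A = with_density M g A"
    using assms unfolding with_density_def set_lebesgue_integral_def
    by (auto intro!: integral_cong_AE borel_measurable_scaleR)
qed

lemma variation_with_density_le:
  assumes M: "M \<in> Mloc_pos" and f: "loc_integrable M f" and A: "A \<in> sets borel"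
  shows "emeasure (variation (with_density M f)) A \<le> (\<integral>\<^sup>+x\<in>A. ennreal (norm (f x)) \<partial>M)"
  unfolding emeasure_variation[OF with_density_Mloc[OF M f] A] pre_variation_def
proof (rule SUP_least)
  fix P assume P: "P \<in> partitions A"
  then have fin: "finite P" and dis: "disjoint P" and Pb: "\<And>B. B \<in> P \<Longrightarrow> B \<in> bborel \<and> B \<subseteq> A"
    by (auto simp: partitions_def)
  have [measurable]: "f \<in> borel_measurable M" using f by (simp add: loc_integrable_def)
  have Ps: "B \<in> sets M" if "B \<in> P" for B using Pb[OF that] M by (auto simp: Mloc_pos_sets bborelD)
  have "(\<Sum>B\<in>P. ennreal (norm (with_density M f B))) \<le> (\<Sum>B\<in>P. \<integral>\<^sup>+x\<in>B. ennreal (norm (f x)) \<partial>M)"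
  proof (rule sum_mono)
    fix B assume B: "B \<in> P"
    have "ennreal (norm (with_density M f B)) \<le> ennreal (LINT x|M. norm (indicator B x *\<^sub>R f x))"
      using Pb[OF B] by (simp add: with_density_def set_lebesgue_integral_def integral_norm_bound ennreal_leI del: norm_scaleR)
    also have "\<dots> = (\<integral>\<^sup>+x. norm (indicator B x *\<^sub>R f x) \<partial>M)"
      using loc_integrableD[OF f] Pb[OF B]
      by (intro nn_integral_eq_integral[symmetric]) (auto simp: set_integrable_def simp del: norm_scaleR)
    also have "\<dots> = (\<integral>\<^sup>+x\<in>B. ennreal (norm (f x)) \<partial>M)"
      by (rule nn_integral_cong) (auto simp: indicator_def)
    finally show "ennreal (norm (with_density M f B)) \<le> (\<integral>\<^sup>+x\<in>B. ennreal (norm (f x)) \<partial>M)" .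
  qed
  also have "\<dots> = (\<integral>\<^sup>+x. (\<Sum>B\<in>P. ennreal (norm (f x)) * indicator B x) \<partial>M)"
    using Ps by (intro nn_integral_sum[symmetric]) auto
  also have "\<dots> \<le> (\<integral>\<^sup>+x\<in>A. ennreal (norm (f x)) \<partial>M)"
  proof (rule nn_integral_mono)
    fix x
    show "(\<Sum>B\<in>P. ennreal (norm (f x)) * indicator B x) \<le> ennreal (norm (f x)) * indicator A x"
    proof (cases "\<exists>B\<in>P. x \<in> B")
      case True
      then obtain B where B: "B \<in> P" "x \<in> B" by auto
      have "(\<Sum>C\<in>P. ennreal (norm (f x)) * indicator C x) = (\<Sum>C\<in>{B}. ennreal (norm (f x)) * indicator C x)"
        using B dis fin by (intro sum.mono_neutral_right) (auto simp: disjoint_def indicator_def)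
      moreover have "x \<in> A" using B Pb by blast
      ultimately show ?thesis using B by simp
    next
      case False then show ?thesis by (simp add: indicator_def)
    qed
  qed
  finally show "(\<Sum>B\<in>P. ennreal (norm (with_density M f B))) \<le> (\<integral>\<^sup>+x\<in>A. ennreal (norm (f x)) \<partial>M)" .
qed

text \<open>Radon-Nikodym for a set function known on bounded sets only. As \<open>\<kappa>\<close>
  is monotone, the supremum over balls extends it to a measure. The upper bound gives absolute
  continuity and, tested on the set where the density exceeds \<open>K\<close>, the bound on the
  density.\<close>

lemma bounded_density:
  fixes \<kappa> :: "'a::euclidean_space set \<Rightarrow> real"
  assumes k: "\<kappa> \<in> Mloc" and l: "L \<in> Mloc_pos"
    and bnd: "\<And>A. A \<in> bborel \<Longrightarrow> 0 \<le> \<kappa> A \<and> \<kappa> A \<le> K * measure L A" and K: "0 \<le> K"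
  shows "\<exists>f\<in>borel_measurable borel. (\<forall>x. 0 \<le> f x \<and> f x \<le> K) \<and> \<kappa> = with_density L f"
proof -
  define N where "N A = (SUP n::nat. ennreal (\<kappa> (A \<inter> ball 0 (real n))))" for A
  have mono: "\<kappa> A \<le> \<kappa> B" if "A \<subseteq> B" "A \<in> bborel" "B \<in> bborel" for A B
    using Mloc_Diff[OF k that(3,2,1)] bnd[of "B - A"] that by (auto intro!: bborel_Diff bborelD)
  have Ab: "A \<inter> ball 0 (real n) \<in> bborel" if "A \<in> sets borel" for A :: "'a set" and n :: nat
    using that by (auto intro: bborel_Int)
  have inc: "incseq (\<lambda>n. ennreal (\<kappa> (A \<inter> ball 0 (real n))))" if "A \<in> sets borel" for A
    unfolding incseq_def using that by (auto intro!: ennreal_leI mono Ab)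
  define M where "M = measure_of UNIV (sets borel) N"
  have sM: "sets M = sets borel" unfolding M_def using sets.sigma_sets_eq[of borel] by simp
  have eM: "emeasure M A = N A" if "A \<in> sets borel" for A
    unfolding M_def
  proof (rule emeasure_measure_of_sigma)
    show "sigma_algebra UNIV (sets borel)" using sets.sigma_algebra_axioms[of borel] by simp
    show "positive (sets borel) N" by (simp add: positive_def N_def Mloc_empty[OF k])
    show "countably_additive (sets borel) N"
    proof (rule countably_additiveI)
      fix A :: "nat \<Rightarrow> 'a set" assume A: "range A \<subseteq> sets borel" "disjoint_family A"
      have "(\<Sum>i. N (A i)) = (SUP n. \<Sum>i. ennreal (\<kappa> (A i \<inter> ball 0 (real n))))"
        unfolding N_def using A inc by (intro ennreal_suminf_SUP_eq) auto
      also have "\<dots> = N (\<Union>i. A i)"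
        unfolding N_def
      proof (rule SUP_cong)
        fix n :: nat
        have "(\<lambda>i. \<kappa> (A i \<inter> ball 0 (real n))) sums \<kappa> (\<Union>i. A i \<inter> ball 0 (real n))"
        proof (rule MlocD_sums[OF k])
          show "disjoint_family (\<lambda>i. A i \<inter> ball 0 (real n))" using A(2) by (auto simp: disjoint_family_on_def)
          show "bounded (\<Union>i. A i \<inter> ball 0 (real n))" by (rule bounded_subset[OF bounded_ball]) auto
        qed (use A in auto)
        moreover have "(\<Union>i. A i \<inter> ball 0 (real n)) = (\<Union>i. A i) \<inter> ball 0 (real n)" by auto
        ultimately have "(\<lambda>i. \<kappa> (A i \<inter> ball 0 (real n))) sums \<kappa> ((\<Union>i. A i) \<inter> ball 0 (real n))" by simp
        moreover have "0 \<le> \<kappa> (A i \<inter> ball 0 (real n))" for i using A bnd[OF Ab] by auto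
        ultimately show "(\<Sum>i. ennreal (\<kappa> (A i \<inter> ball 0 (real n)))) = ennreal (\<kappa> ((\<Union>i. A i) \<inter> ball 0 (real n)))"
          by (metis suminf_ennreal_eq)
      qed simp
      finally show "(\<Sum>i. N (A i)) = N (\<Union>i. A i)" .
    qed
  qed (fact that)
  have Nb: "N A = ennreal (\<kappa> A)" if Abb: "A \<in> bborel" for A
  proof (rule antisym)
    show "N A \<le> ennreal (\<kappa> A)" unfolding N_def
      using Abb by (intro SUP_least ennreal_leI mono Ab) (auto dest: bborelD)
    obtain n :: nat where "A \<subseteq> ball 0 (real n)" using bborel_in_ball[OF Abb] .
    then have "A \<inter> ball 0 (real n) = A" by auto
    then show "ennreal (\<kappa> A) \<le> N A" unfolding N_def by (intro SUP_upper2[of n]) auto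
  qed
  have le: "emeasure M A \<le> ennreal K * emeasure L A" if "A \<in> bborel" for A
  proof -
    have "emeasure L A = ennreal (measure L A)"
      using Mloc_pos_finite[OF l that] by (intro emeasure_eq_ennreal_measure) auto
    then show ?thesis using that bnd[OF that] K by (simp add: eM Nb bborelD ennreal_mult[symmetric] ennreal_leI)
  qed
  interpret sigma_finite_measure L by (rule Mloc_pos_sigma_finite[OF l])
  have "absolutely_continuous L M"
    unfolding absolutely_continuous_def
  proof
    fix A assume "A \<in> null_sets L"
    then have A: "A \<in> sets borel" "emeasure L A = 0" using l by (auto simp: null_sets_def Mloc_pos_sets)
    have "emeasure M (A \<inter> ball 0 (real n)) = 0" for n
    proof -
      have "emeasure L (A \<inter> ball 0 (real n)) \<le> emeasure L A" using A l by (intro emeasure_mono) (auto simp: Mloc_pos_sets)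
      then show ?thesis using le[OF Ab[OF A(1)], of n] A(2) by simp
    qed
    then have "N A = 0" unfolding N_def using A Ab[OF A(1)] by (simp add: eM Nb bborelD)
    then show "A \<in> null_sets M" using A by (simp add: null_sets_def sM eM)
  qed
  from Radon_Nikodym[OF this] obtain f where f: "f \<in> borel_measurable L" and dens: "density L f = M"
    using sM l by (auto simp: Mloc_pos_sets)
  note f[measurable]
  have bs[measurable]: "A \<in> sets L" if "A \<in> bborel" for A using that l by (simp add: Mloc_pos_sets bborelD)
  have eq: "(\<integral>\<^sup>+x\<in>A. f x \<partial>L) = ennreal (\<kappa> A)" if "A \<in> bborel" for A
    using that emeasure_density[OF f bs[OF that]] dens by (simp add: eM Nb bborelD)
  have "AE x in L. x \<in> ball 0 (real n) \<longrightarrow> f x \<le> ennreal K" for n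
  proof -
    define B where "B = {x\<in>space L. f x > ennreal K} \<inter> ball 0 (real n)"
    have Bs[measurable]: "B \<in> sets L" unfolding B_def by (intro sets.Int bs[OF bborel_ball]) measurable
    have Bb: "B \<in> bborel" using Bs l by (intro bborel_subset[OF bborel_ball[of 0 "real n"]]) (auto simp: B_def Mloc_pos_sets)
    have "(\<integral>\<^sup>+x. (f x - ennreal K) * indicator B x \<partial>L) + (\<integral>\<^sup>+x. ennreal K * indicator B x \<partial>L)
        = (\<integral>\<^sup>+x. f x * indicator B x \<partial>L)"
    proof (subst nn_integral_add[symmetric])
      show "(\<lambda>x. (f x - ennreal K) * indicator B x) \<in> borel_measurable L" by measurable
      show "(\<lambda>x. ennreal K * indicator B x) \<in> borel_measurable L" by measurable
      show "(\<integral>\<^sup>+x. (f x - ennreal K) * indicator B x + ennreal K * indicator B x \<partial>L) = (\<integral>\<^sup>+x. f x * indicator B x \<partial>L)"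
      proof (rule nn_integral_cong)
        fix x show "(f x - ennreal K) * indicator B x + ennreal K * indicator B x = f x * indicator B x"
          by (cases "x \<in> B") (auto simp: B_def diff_add_cancel_ennreal)
      qed
    qed
    also have "\<dots> \<le> 0 + (\<integral>\<^sup>+x. ennreal K * indicator B x \<partial>L)"
      using le[OF Bb] Bb by (simp add: eq nn_integral_cmult_indicator eM Nb bborelD)
    finally have "(\<integral>\<^sup>+x. ennreal K * indicator B x \<partial>L) + (\<integral>\<^sup>+x. (f x - ennreal K) * indicator B x \<partial>L)
        \<le> (\<integral>\<^sup>+x. ennreal K * indicator B x \<partial>L) + 0" by (simp add: add.commute)
    moreover have "(\<integral>\<^sup>+x. ennreal K * indicator B x \<partial>L) \<noteq> \<infinity>"
      using Mloc_pos_finite[OF l Bb] Bs by (simp add: nn_integral_cmult_indicator ennreal_mult_eq_top_iff)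
    ultimately have "(\<integral>\<^sup>+x. (f x - ennreal K) * indicator B x \<partial>L) \<le> 0"
      using ennreal_add_left_cancel_le by (metis infinity_ennreal_def)
    then have "AE x in L. (f x - ennreal K) * indicator B x = 0"
      by (subst (asm) le_zero_eq, subst (asm) nn_integral_0_iff_AE) auto
    then show ?thesis
    proof eventually_elim
      case (elim x)
      then show ?case using l
        by (auto simp: indicator_def B_def Mloc_pos_space not_less split: if_splits) (metis diff_gt_0_iff_gt_ennreal ennreal_less_top leI less_irrefl not_less)
    qed
  qed
  then have "AE x in L. \<forall>n::nat. x \<in> ball 0 (real n) \<longrightarrow> f x \<le> ennreal K" unfolding AE_all_countable by blast
  then have ae: "AE x in L. f x \<le> ennreal K"
  proof eventually_elim
    case (elim x)
    obtain n :: nat where "x \<in> ball 0 (real n)" using UN_balls by blast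
    then show ?case using elim by blast
  qed
  \<comment> \<open>Truncation turns the bound that holds almost everywhere into one that holds
    everywhere, with real values.\<close>
  define g where "g x = min K (enn2real (f x))" for x
  have gb: "0 \<le> g x \<and> g x \<le> K" for x using K by (simp add: g_def)
  have "f \<in> borel_measurable borel" using f by (simp add: measurable_cong_sets[OF Mloc_pos_sets[OF l] refl])
  then have gm: "g \<in> borel_measurable borel" unfolding g_def by measurable
  have [measurable]: "g \<in> borel_measurable L" using gm by (simp add: measurable_cong_sets[OF Mloc_pos_sets[OF l] refl])
  have gl: "loc_integrable L g" by (rule loc_integrable_bounded[OF l gm, of K]) (use gb in auto)
  have "\<kappa> A = with_density L g A" for A
  proof (cases "A \<in> bborel")
    case True
    then have [measurable]: "A \<in> sets L" by (rule bs)
    have "ennreal (LINT x|L. indicator A x *\<^sub>R g x) = (\<integral>\<^sup>+x. ennreal (indicator A x *\<^sub>R g x) \<partial>L)"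
      using loc_integrableD[OF gl True] gb
      by (intro nn_integral_eq_integral[symmetric]) (auto simp: set_integrable_def)
    also have "\<dots> = (\<integral>\<^sup>+x\<in>A. f x \<partial>L)"
      using ae
    proof (intro nn_integral_cong_AE, eventually_elim)
      case (elim x)
      then have "f x = ennreal (g x)"
        using K by (cases "f x") (auto simp: g_def min_def top_unique ennreal_le_iff)
      then show ?case by (auto simp: indicator_def)
    qed
    also have "\<dots> = ennreal (\<kappa> A)" by (rule eq[OF True])
    finally show ?thesis using True bnd[OF True] gb
      by (subst (asm) ennreal_inj) (auto simp: with_density_def set_lebesgue_integral_def intro!: integral_nonneg_AE)
  qed (simp add: Mloc_notin[OF k] with_density_def)
  then show ?thesis using gm gb by blast
qed

text \<open>Adding the variation to a coordinate of \<open>\<mu>\<close> gives a set function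
  between 0 and twice the variation, to which \<open>bounded_density\<close> applies. Subtracting 1,
  the density of the added term, recovers the coordinate.\<close>

lemma polar_decomposition:
  fixes \<mu> :: "'a::euclidean_space set \<Rightarrow> 'b::euclidean_space"
  assumes mu: "\<mu> \<in> Mloc"
  shows "\<exists>\<theta>. loc_integrable (variation \<mu>) \<theta> \<and> \<mu> = with_density (variation \<mu>) \<theta>"
proof -
  let ?V = "variation \<mu>"
  note V = variation_Mloc_pos[OF mu]
  have one: "loc_integrable ?V (\<lambda>x. 1::real)" by (rule loc_integrable_bounded[OF V, of _ 1]) auto
  have w1: "with_density ?V (\<lambda>x. 1::real) A = measure ?V A" if "A \<in> bborel" for A
    using that Mloc_pos_finite[OF V that] by (simp add: with_density_def set_lebesgue_integral_def)
  have ex: "\<exists>f. loc_integrable ?V f \<and> (\<forall>A. \<mu> A \<bullet> b = with_density ?V f A)" if b: "b \<in> Basis" for b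
  proof -
    define \<kappa> where "\<kappa> A = \<mu> A \<bullet> b + with_density ?V (\<lambda>x. 1) A" for A
    have k: "\<kappa> \<in> Mloc"
      unfolding \<kappa>_def by (intro Mloc_add Mloc_bounded_linear[OF mu] with_density_Mloc V one bounded_linear_inner_left)
    have bnd: "0 \<le> \<kappa> A \<and> \<kappa> A \<le> 2 * measure ?V A" if A: "A \<in> bborel" for A
    proof -
      have "ennreal (norm (\<mu> A)) \<le> ennreal (measure ?V A)"
        using norm_le_variation[OF mu A] Mloc_pos_finite[OF V A] by (simp add: emeasure_eq_ennreal_measure)
      then have "norm (\<mu> A) \<le> measure ?V A" by simp
      moreover have "\<bar>\<mu> A \<bullet> b\<bar> \<le> norm (\<mu> A)" using Basis_le_norm[OF b] .
      ultimately show ?thesis unfolding \<kappa>_def w1[OF A] by linarith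
    qed
    obtain f where f: "f \<in> borel_measurable borel" "\<And>x. 0 \<le> f x \<and> f x \<le> 2" "\<kappa> = with_density ?V f"
      using bounded_density[OF k V bnd] by auto
    have "loc_integrable ?V f" by (rule loc_integrable_bounded[OF V f(1), of 2]) (use f(2) in auto)
    then have "loc_integrable ?V (\<lambda>x. f x - 1)" "with_density ?V (\<lambda>x. f x - 1) A = \<mu> A \<bullet> b" for A
      using one f(3)[THEN fun_cong, of A] by (auto simp: loc_integrable_diff with_density_diff \<kappa>_def)
    then show ?thesis by metis
  qed
  then obtain f where f: "\<And>b. b \<in> Basis \<Longrightarrow> loc_integrable ?V (f b) \<and> (\<forall>A. \<mu> A \<bullet> b = with_density ?V (f b) A)"
    by metis
  define \<theta> where "\<theta> x = (\<Sum>b\<in>Basis. f b x *\<^sub>R b)" for x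
  have sint: "set_integrable ?V A (f b)" if "b \<in> Basis" "A \<in> bborel" for b A
    using f[OF that(1)] that(2) by (auto simp: loc_integrable_def)
  have th: "loc_integrable ?V \<theta>"
    unfolding loc_integrable_def \<theta>_def
  proof (intro conjI ballI)
    show "(\<lambda>x. \<Sum>b\<in>Basis. f b x *\<^sub>R b) \<in> borel_measurable ?V"
      using f by (intro borel_measurable_sum borel_measurable_scaleR) (auto simp: loc_integrable_def)
    fix A :: "'a set" assume A: "A \<in> bborel"
    show "set_integrable ?V A (\<lambda>x. \<Sum>b\<in>Basis. f b x *\<^sub>R b)"
      unfolding set_integrable_def scaleR_sum_right
      using sint[OF _ A] by (intro Bochner_Integration.integrable_sum) (auto simp: set_integrable_def)
  qed
  have "\<mu> A = with_density ?V \<theta> A" for A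
  proof (cases "A \<in> bborel")
    case True
    have "with_density ?V \<theta> A = (LINT x|?V. (\<Sum>b\<in>Basis. (indicator A x *\<^sub>R f b x) *\<^sub>R b))"
      using True by (simp only: \<theta>_def with_density_def set_lebesgue_integral_def scaleR_sum_right scaleR_scaleR
          real_scaleR_def if_True)
    also have "\<dots> = (\<Sum>b\<in>Basis. (LINT x:A|?V. f b x) *\<^sub>R b)"
      using sint[OF _ True] unfolding set_lebesgue_integral_def set_integrable_def
      by (subst Bochner_Integration.integral_sum) (auto simp: integral_scaleR_left)
    also have "\<dots> = (\<Sum>b\<in>Basis. (\<mu> A \<bullet> b) *\<^sub>R b)"
      using f True by (intro sum.cong) (auto simp: with_density_def)
    finally show ?thesis by (simp add: euclidean_representation)
  qed (simp add: Mloc_notin[OF mu] with_density_def)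
  then show ?thesis using th by blast
qed


section \<open>Densities with respect to a dominating measure\<close>

lemma rn_density:
  assumes "loc_integrable M f" "\<mu> = with_density M f"
  shows "loc_integrable M (rn_density M \<mu>)" "with_density M (rn_density M \<mu>) = \<mu>"
proof -
  have "loc_integrable M (rn_density M \<mu>) \<and> \<mu> = with_density M (rn_density M \<mu>)"
    unfolding rn_density_def using assms by (rule someI[of _ f, OF conjI])
  then show "loc_integrable M (rn_density M \<mu>)" "with_density M (rn_density M \<mu>) = \<mu>" by auto
qed

text \<open>The density is finite almost everywhere because \<open>N\<close> is finite on balls, so
  it may be taken real.\<close>

lemma Radon_Nikodym_real:
  assumes M: "M \<in> Mloc_pos" and N: "N \<in> Mloc_pos" and ac: "absolutely_continuous M N"
  shows "\<exists>g\<in>borel_measurable borel. (\<forall>x. 0 \<le> g x) \<and> density M (\<lambda>x. ennreal (g x)) = N"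
proof -
  interpret sigma_finite_measure M by (rule Mloc_pos_sigma_finite[OF M])
  obtain h where h: "h \<in> borel_measurable M" and dens: "density M h = N"
    using Radon_Nikodym[OF ac] M N by (auto simp: Mloc_pos_sets)
  note h[measurable]
  have "AE x in M. h x * indicator (ball 0 (real n)) x \<noteq> \<infinity>" for n
  proof (rule nn_integral_PInf_AE)
    have [measurable]: "ball 0 (real n) \<in> sets M" using M by (simp add: Mloc_pos_sets)
    show "(\<lambda>x. h x * indicator (ball 0 (real n)) x) \<in> borel_measurable M" by measurable
    have "(\<integral>\<^sup>+x. h x * indicator (ball 0 (real n)) x \<partial>M) = emeasure N (ball 0 (real n))"
      unfolding dens[symmetric] by (rule emeasure_density[symmetric]) auto
    then show "(\<integral>\<^sup>+x. h x * indicator (ball 0 (real n)) x \<partial>M) \<noteq> \<infinity>"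
      using Mloc_pos_finite[OF N bborel_ball[of 0 "real n"]] by simp
  qed
  then have "AE x in M. \<forall>n::nat. h x * indicator (ball 0 (real n)) x \<noteq> \<infinity>"
    unfolding AE_all_countable by blast
  then have ae: "AE x in M. h x = ennreal (enn2real (h x))"
  proof eventually_elim
    case (elim x)
    obtain n :: nat where "x \<in> ball 0 (real n)" using UN_balls by blast
    then show ?case using elim[rule_format, of n] by (simp add: less_top)
  qed
  have "h \<in> borel_measurable borel" using h by (simp add: measurable_cong_sets[OF Mloc_pos_sets[OF M] refl])
  moreover have "density M (\<lambda>x. ennreal (enn2real (h x))) = N"
    unfolding dens[symmetric] using ae by (intro density_cong) auto
  ultimately show ?thesis by (intro bexI[of _ "\<lambda>x. enn2real (h x)"]) auto
qed

lemma with_density_density: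
  assumes M: "M \<in> Mloc_pos" and g: "g \<in> borel_measurable borel" "\<And>x. 0 \<le> g x"
    and f: "loc_integrable (density M (\<lambda>x. ennreal (g x))) f"
  shows "loc_integrable M (\<lambda>x. g x *\<^sub>R f x)"
    "with_density (density M (\<lambda>x. ennreal (g x))) f = with_density M (\<lambda>x. g x *\<^sub>R f x)"
proof -
  have fm[measurable]: "f \<in> borel_measurable M" using f by (simp add: loc_integrable_def)
  have [measurable]: "g \<in> borel_measurable M" using g by (simp add: measurable_cong_sets[OF Mloc_pos_sets[OF M] refl])
  have sets[measurable]: "A \<in> bborel \<Longrightarrow> A \<in> sets M" for A using M by (simp add: Mloc_pos_sets bborelD)
  have eq: "(\<lambda>x. g x *\<^sub>R indicator A x *\<^sub>R f x) = (\<lambda>x. indicator A x *\<^sub>R g x *\<^sub>R f x)" for A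
    by (simp add: mult.commute)
  show "loc_integrable M (\<lambda>x. g x *\<^sub>R f x)"
    unfolding loc_integrable_def
  proof (intro conjI ballI)
    fix A :: "'a set" assume A: "A \<in> bborel"
    note sets[OF A, measurable]
    have "integrable (density M (\<lambda>x. ennreal (g x))) (\<lambda>x. indicator A x *\<^sub>R f x)"
      using f A by (simp add: loc_integrable_def set_integrable_def)
    then show "set_integrable M A (\<lambda>x. g x *\<^sub>R f x)"
      unfolding set_integrable_def eq[symmetric]
      by (rule integrable_density[THEN iffD1, rotated 3]) (use g(2) in auto)
  qed measurable
  show "with_density (density M (\<lambda>x. ennreal (g x))) f = with_density M (\<lambda>x. g x *\<^sub>R f x)"
  proof
    fix A :: "'a set"
    have "(LINT x|density M (\<lambda>x. ennreal (g x)). indicator A x *\<^sub>R f x) = (LINT x|M. indicator A x *\<^sub>R g x *\<^sub>R f x)"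
      if A: "A \<in> bborel"
    proof -
      note sets[OF A, measurable]
      show ?thesis unfolding eq[symmetric] using g(2) by (intro integral_density) auto
    qed
    then show "with_density (density M (\<lambda>x. ennreal (g x))) f A = with_density M (\<lambda>x. g x *\<^sub>R f x) A"
      by (auto simp: with_density_def set_lebesgue_integral_def)
  qed
qed

text \<open>Chain rule: the polar density times the density of the variation is a density of
  \<open>\<mu>\<close>, so the choice in \<open>rn_density\<close> succeeds.\<close>

lemma absolutely_continuous_density:
  assumes mu: "\<mu> \<in> Mloc" and M: "M \<in> Mloc_pos" and ac: "absolutely_continuous M (variation \<mu>)"
  shows "loc_integrable M (rn_density M \<mu>)" "with_density M (rn_density M \<mu>) = \<mu>"
proof -
  obtain \<theta> where th: "loc_integrable (variation \<mu>) \<theta>" "\<mu> = with_density (variation \<mu>) \<theta>"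
    using polar_decomposition[OF mu] by auto
  obtain g where g: "g \<in> borel_measurable borel" "\<And>x. 0 \<le> g x" "density M (\<lambda>x. ennreal (g x)) = variation \<mu>"
    using Radon_Nikodym_real[OF M variation_Mloc_pos[OF mu] ac] by auto
  have "loc_integrable M (\<lambda>x. g x *\<^sub>R \<theta> x)" "\<mu> = with_density M (\<lambda>x. g x *\<^sub>R \<theta> x)"
    using with_density_density[OF M g(1,2), of \<theta>] th unfolding g(3) by auto
  from rn_density[OF this]
  show "loc_integrable M (rn_density M \<mu>)" "with_density M (rn_density M \<mu>) = \<mu>" by auto
qed

section \<open>Sums of measures and the Lebesgue decomposition\<close>

lemma sum_meas:
  assumes M: "M \<in> Mloc_pos" and N: "N \<in> Mloc_pos"
  shows "sets (sum_meas M N) = sets borel" "sum_meas M N \<in> Mloc_pos"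
    "A \<in> sets borel \<Longrightarrow> emeasure (sum_meas M N) A = emeasure M A + emeasure N A"
proof -
  show s: "sets (sum_meas M N) = sets borel"
    unfolding sum_meas_def using sets.sigma_sets_eq[of borel] by simp
  have e: "emeasure (sum_meas M N) A = emeasure M A + emeasure N A" if A: "A \<in> sets borel" for A
    unfolding sum_meas_def
  proof (rule emeasure_measure_of_sigma)
    show "sigma_algebra UNIV (sets borel)" using sets.sigma_algebra_axioms[of borel] by simp
    show "countably_additive (sets borel) (\<lambda>A. emeasure M A + emeasure N A)"
    proof (rule countably_additiveI)
      fix A :: "nat \<Rightarrow> 'a set" assume A: "range A \<subseteq> sets borel" "disjoint_family A"
      have "(\<Sum>i. emeasure M (A i) + emeasure N (A i)) = (\<Sum>i. emeasure M (A i)) + (\<Sum>i. emeasure N (A i))"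
        by (rule suminf_add[symmetric]) auto
      also have "\<dots> = emeasure M (\<Union>i. A i) + emeasure N (\<Union>i. A i)"
        using A M N by (simp add: suminf_emeasure Mloc_pos_sets)
      finally show "(\<Sum>i. emeasure M (A i) + emeasure N (A i)) = emeasure M (\<Union>i. A i) + emeasure N (\<Union>i. A i)" .
    qed
  qed (use A in \<open>auto simp: positive_def\<close>)
  show "A \<in> sets borel \<Longrightarrow> emeasure (sum_meas M N) A = emeasure M A + emeasure N A" by (rule e)
  show "sum_meas M N \<in> Mloc_pos"
    using Mloc_pos_finite[OF M] Mloc_pos_finite[OF N] by (intro Mloc_posI s) (auto simp: e bborelD)
qed

lemma sum_meas_absolutely_continuous:
  assumes M: "M \<in> Mloc_pos" and N: "N \<in> Mloc_pos"
  shows "absolutely_continuous (sum_meas M N) M" "absolutely_continuous (sum_meas M N) N"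
  using sum_meas[OF M N] M N by (auto simp: absolutely_continuous_def null_sets_def Mloc_pos_sets)

text \<open>The decomposition is read off from \<open>\<gamma> = g L\<close> and
  \<open>\<mu> = \<theta> L\<close>, where \<open>L\<close> is the sum of \<open>\<gamma>\<close>
  and the variation of \<open>\<mu>\<close>: off \<open>N = {g = 0}\<close> the quotient
  \<open>\<theta> / g\<close> is a density, and \<open>N\<close> is a null set of
  \<open>\<gamma>\<close>.\<close>

lemma ac_density:
  fixes \<mu> :: "'a::euclidean_space set \<Rightarrow> 'b::euclidean_space"
  assumes mu: "\<mu> \<in> Mloc" and G: "\<gamma> \<in> Mloc_pos"
  shows "loc_integrable \<gamma> (ac_density \<gamma> \<mu>)" "msingular (sing_part \<gamma> \<mu>) \<gamma>" "sing_part \<gamma> \<mu> \<in> Mloc"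
proof -
  let ?L = "sum_meas (variation \<mu>) \<gamma>"
  note V = variation_Mloc_pos[OF mu]
  note L = sum_meas(2)[OF V G]
  obtain \<theta> where th: "loc_integrable ?L \<theta>" "with_density ?L \<theta> = \<mu>"
    using absolutely_continuous_density[OF mu L sum_meas_absolutely_continuous(1)[OF V G]] by blast
  obtain g where g: "g \<in> borel_measurable borel" "\<And>x. 0 \<le> g x" "density ?L (\<lambda>x. ennreal (g x)) = \<gamma>"
    using Radon_Nikodym_real[OF L G sum_meas_absolutely_continuous(2)[OF V G]] by auto
  define N where "N = {x. g x = 0}"
  have N: "N \<in> sets borel" using g(1) unfolding N_def by measurable
  have gL[measurable]: "g \<in> borel_measurable ?L" using g(1) by (simp add: measurable_cong_sets[OF sum_meas(1)[OF V G] refl])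
  have thL[measurable]: "\<theta> \<in> borel_measurable ?L" using th by (simp add: loc_integrable_def)
  have "emeasure \<gamma> N = emeasure (density ?L (\<lambda>x. ennreal (g x))) N" unfolding g(3) ..
  also have "\<dots> = (\<integral>\<^sup>+x. ennreal (g x) * indicator N x \<partial>?L)"
    using N by (intro emeasure_density) (auto simp: sum_meas(1)[OF V G])
  also have "\<dots> = (\<integral>\<^sup>+x. 0 \<partial>?L)" by (rule nn_integral_cong) (auto simp: N_def indicator_def)
  finally have N0: "emeasure \<gamma> N = 0" by simp
  \<comment> \<open>Division by 0 gives 0 on \<open>N\<close>, so this is the density of the
    restriction of \<open>\<mu>\<close> to the complement of \<open>N\<close>.\<close>
  define \<rho> where "\<rho> x = (1 / g x) *\<^sub>R \<theta> x" for x
  have rm: "\<rho> \<in> borel_measurable ?L" unfolding \<rho>_def by measurable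
  have gr: "g x *\<^sub>R \<rho> x = indicator (- N) x *\<^sub>R \<theta> x" for x by (auto simp: \<rho>_def N_def indicator_def)
  have eq: "(\<lambda>x. g x *\<^sub>R indicator A x *\<^sub>R \<rho> x) = (\<lambda>x. indicator (A - N) x *\<^sub>R \<theta> x)" for A
  proof
    fix x show "g x *\<^sub>R indicator A x *\<^sub>R \<rho> x = indicator (A - N) x *\<^sub>R \<theta> x"
      using gr[of x] by (cases "x \<in> A") (auto simp: indicator_def)
  qed
  have AN: "A - N \<in> bborel" if "A \<in> bborel" for A using that N by (rule bborel_Diff)
  have sets[measurable]: "A \<in> bborel \<Longrightarrow> A \<in> sets ?L" for A by (simp add: sum_meas(1)[OF V G] bborelD)
  have r: "loc_integrable \<gamma> \<rho>"
    unfolding loc_integrable_def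
  proof (intro conjI ballI)
    show "\<rho> \<in> borel_measurable \<gamma>" using rm by (simp add: measurable_cong_sets[OF sum_meas(1)[OF V G] refl] measurable_cong_sets[OF Mloc_pos_sets[OF G] refl])
    fix A :: "'a set" assume A: "A \<in> bborel"
    note sets[OF A, measurable]
    have "integrable ?L (\<lambda>x. g x *\<^sub>R indicator A x *\<^sub>R \<rho> x)"
      unfolding eq using loc_integrableD[OF th(1) AN[OF A]] by (simp add: set_integrable_def)
    then have "integrable (density ?L (\<lambda>x. ennreal (g x))) (\<lambda>x. indicator A x *\<^sub>R \<rho> x)"
      by (rule integrable_density[THEN iffD2, rotated 3]) (use g(2) rm in auto)
    then show "set_integrable \<gamma> A \<rho>" by (simp add: set_integrable_def g(3))
  qed
  have wd: "with_density \<gamma> \<rho> A = \<mu> (A - N)" if A: "A \<in> bborel" for A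
  proof -
    note sets[OF A, measurable]
    have "(LINT x|\<gamma>. indicator A x *\<^sub>R \<rho> x) = (LINT x|density ?L (\<lambda>x. ennreal (g x)). indicator A x *\<^sub>R \<rho> x)"
      unfolding g(3) ..
    also have "\<dots> = (LINT x|?L. indicator (A - N) x *\<^sub>R \<theta> x)"
      unfolding eq[symmetric] using g(2) rm by (intro integral_density) auto
    also have "\<dots> = with_density ?L \<theta> (A - N)" using AN[OF A] by (simp add: with_density_def set_lebesgue_integral_def)
    also have "\<dots> = \<mu> (A - N)" unfolding th(2) ..
    finally show ?thesis using A by (simp add: with_density_def set_lebesgue_integral_def)
  qed
  have "msingular (\<lambda>A. \<mu> A - with_density \<gamma> \<rho> A) \<gamma>"
    unfolding msingular_def
  proof (intro bexI[of _ N] conjI N0 N)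
    let ?s = "\<lambda>A. \<mu> A - with_density \<gamma> \<rho> A"
    have s: "?s \<in> Mloc" by (intro Mloc_diff mu with_density_Mloc G r)
    have "?s B = 0" if "B \<in> bborel" "B \<subseteq> - N" for B
    proof -
      have "B - N = B" using that by auto
      then show ?thesis using wd[OF that(1)] by simp
    qed
    then have "pre_variation ?s (- N) \<le> 0"
      unfolding pre_variation_def by (intro SUP_least) (auto simp: partitions_def intro!: sum_nonpos)
    then show "emeasure (variation ?s) (- N) = 0" using N by (simp add: emeasure_variation[OF s])
  qed
  with r have "loc_integrable \<gamma> (ac_density \<gamma> \<mu>) \<and> msingular (\<lambda>A. \<mu> A - with_density \<gamma> (ac_density \<gamma> \<mu>) A) \<gamma>"
    unfolding ac_density_def by (intro someI[of "\<lambda>\<rho>. loc_integrable \<gamma> \<rho> \<and> msingular (\<lambda>A. \<mu> A - with_density \<gamma> \<rho> A) \<gamma>" \<rho>] conjI)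
  then show "loc_integrable \<gamma> (ac_density \<gamma> \<mu>)" "msingular (sing_part \<gamma> \<mu>) \<gamma>" by (auto simp: sing_part_def)
  then show "sing_part \<gamma> \<mu> \<in> Mloc" unfolding sing_part_def by (intro Mloc_diff mu with_density_Mloc G)
qed

text \<open>Uniqueness of the decomposition: the singular part vanishes off a null set of
  \<open>\<gamma>\<close> and, having itself a density with respect to \<open>\<gamma>\<close>,
  vanishes on that set as well.\<close>

lemma ac_density_with_density:
  fixes f :: "'a::euclidean_space \<Rightarrow> 'b::euclidean_space"
  assumes G: "\<gamma> \<in> Mloc_pos" and f: "loc_integrable \<gamma> f"
  shows "AE x in \<gamma>. ac_density \<gamma> (with_density \<gamma> f) x = f x" "sing_part \<gamma> (with_density \<gamma> f) = (\<lambda>A. 0)"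
proof -
  let ?\<mu> = "with_density \<gamma> f" let ?\<rho> = "ac_density \<gamma> ?\<mu>" let ?s = "sing_part \<gamma> ?\<mu>"
  note ac = ac_density[OF with_density_Mloc[OF G f] G]
  have "?s = with_density \<gamma> (\<lambda>x. f x - ?\<rho> x)"
    by (auto simp: sing_part_def with_density_diff[OF f ac(1)])
  obtain N where N: "N \<in> sets borel" "emeasure \<gamma> N = 0" "emeasure (variation ?s) (- N) = 0"
    using ac(2) unfolding msingular_def by auto
  have "?s A = 0" for A
  proof (cases "A \<in> bborel")
    case True
    have AN: "A - N \<in> bborel" "A \<inter> N \<in> bborel" using True N by (auto intro: bborel_Diff bborel_Int)
    have "emeasure (variation ?s) (A - N) \<le> emeasure (variation ?s) (- N)" using N by (intro emeasure_mono) auto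
    then have 1: "?s (A - N) = 0" using norm_le_variation[OF ac(3) AN(1)] N(3) by simp
    have "emeasure \<gamma> (A \<inter> N) \<le> emeasure \<gamma> N" using N True G by (intro emeasure_mono) (auto simp: Mloc_pos_sets)
    then have "A \<inter> N \<in> null_sets \<gamma>" using N AN G by (simp add: null_sets_def Mloc_pos_sets bborelD)
    then have "(LINT x:A \<inter> N|\<gamma>. f x - ?\<rho> x) = 0"
      unfolding set_lebesgue_integral_def using AE_not_in by (intro integral_eq_zero_AE) fastforce
    then have 2: "?s (A \<inter> N) = 0" unfolding \<open>?s = _\<close> by (simp add: with_density_def)
    have "?s ((A - N) \<union> (A \<inter> N)) = ?s (A - N) + ?s (A \<inter> N)" by (rule Mloc_Un[OF ac(3) AN]) auto
    moreover have "(A - N) \<union> (A \<inter> N) = A" by auto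
    ultimately show ?thesis using 1 2 by simp
  qed (use Mloc_notin[OF ac(3)] in auto)
  then show s0: "?s = (\<lambda>A. 0)" by auto
  show "AE x in \<gamma>. ?\<rho> x = f x"
  proof (rule with_density_eq_AE[OF G ac(1) f])
    show "with_density \<gamma> ?\<rho> = ?\<mu>" using fun_cong[OF s0] by (auto simp: sing_part_def)
  qed
qed

subsection \<open>Pairings\<close>

text \<open>Bounded Borel functions of bounded support. They pair with every element of
  \<open>Mloc\<close> and, unlike continuous functions, include the indicators of bounded Borel
  sets.\<close>

definition bfun :: "('a::euclidean_space \<Rightarrow> 'b::euclidean_space) \<Rightarrow> bool" where
  "bfun F \<longleftrightarrow> F \<in> borel_measurable borel \<and> (\<exists>C R. \<forall>x. norm (F x) \<le> C * indicator (ball 0 R) x)"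

lemma bfunI: "F \<in> borel_measurable borel \<Longrightarrow> (\<And>x. norm (F x) \<le> C * indicator (ball 0 R) x) \<Longrightarrow> bfun F"
  by (auto simp: bfun_def)

lemma bfunE:
  assumes "bfun F" obtains C R where "0 \<le> C" "\<And>x. norm (F x) \<le> C * indicator (ball 0 R) x"
proof -
  obtain C R where CR: "\<And>x. norm (F x) \<le> C * indicator (ball 0 R) x" using assms by (auto simp: bfun_def)
  have "norm (F x) \<le> \<bar>C\<bar> * indicator (ball 0 R) x" for x
    by (rule order_trans[OF CR]) (auto simp: indicator_def)
  then show thesis by (intro that[of "\<bar>C\<bar>" R]) auto
qed

lemma bfun_measurable: "bfun F \<Longrightarrow> F \<in> borel_measurable borel" by (simp add: bfun_def)

lemma bfun_inner_integrable:
  assumes M: "M \<in> Mloc_pos" and f: "loc_integrable M f" and F: "bfun F"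
  shows "integrable M (\<lambda>x. F x \<bullet> f x)"
proof -
  obtain C R where CR: "0 \<le> C" "\<And>x. norm (F x) \<le> C * indicator (ball 0 R) x" using F by (rule bfunE) blast
  have [measurable]: "F \<in> borel_measurable M" using bfun_measurable[OF F] by (simp add: measurable_cong_sets[OF Mloc_pos_sets[OF M] refl])
  have [measurable]: "f \<in> borel_measurable M" using f by (simp add: loc_integrable_def)
  have "integrable M (\<lambda>x. C *\<^sub>R (indicator (ball 0 R) x *\<^sub>R f x))"
    using loc_integrableD[OF f bborel_ball[of 0 R]] by (intro integrable_scaleR_right) (simp add: set_integrable_def)
  then show ?thesis
  proof (rule Bochner_Integration.integrable_bound)
    show "AE x in M. norm (F x \<bullet> f x) \<le> norm (C *\<^sub>R (indicator (ball 0 R) x *\<^sub>R f x))"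
    proof (rule AE_I2)
      fix x
      have "norm (F x \<bullet> f x) \<le> norm (F x) * norm (f x)" by (simp add: Cauchy_Schwarz_ineq2)
      also have "\<dots> \<le> (C * indicator (ball 0 R) x) * norm (f x)" by (intro mult_right_mono CR) auto
      finally show "norm (F x \<bullet> f x) \<le> norm (C *\<^sub>R (indicator (ball 0 R) x *\<^sub>R f x))" using CR(1) by simp
    qed
  qed measurable
qed

lemma bfun_simple_approx:
  assumes F: "bfun F"
  obtains S C R where "0 \<le> C" "\<And>n::nat. S n \<in> borel_measurable borel" "\<And>n. finite (range (S n))"
    "\<And>n x. norm (S n x) \<le> C * indicator (ball 0 R) x" "\<And>x. (\<lambda>n. S n x) \<longlonglongrightarrow> F x"
    "\<And>x. norm (F x) \<le> C * indicator (ball 0 R) x"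
proof -
  obtain C R where CR: "0 \<le> C" "\<And>x. norm (F x) \<le> C * indicator (ball 0 R) x" using F by (rule bfunE) blast
  obtain S where S: "\<And>n. simple_function borel (S n)" "\<And>x. (\<lambda>n. S n x) \<longlonglongrightarrow> F x"
    "\<And>n x. norm (S n x) \<le> 2 * norm (F x)"
    using borel_measurable_implies_sequence_metric[OF bfun_measurable[OF F], of 0] by auto
  have "norm (S n x) \<le> (2 * C) * indicator (ball 0 R) x" for n x
    using S(3)[of n x] CR(2)[of x] by linarith
  moreover have "norm (F x) \<le> (2 * C) * indicator (ball 0 R) x" for x
    using CR by (intro order_trans[OF CR(2)] mult_right_mono) auto
  moreover have "finite (range (S n))" for n using simple_functionD(1)[OF S(1), of n] by simp
  moreover have "S n \<in> borel_measurable borel" for n by (rule borel_measurable_simple_function[OF S(1)])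
  ultimately show thesis using that[of "2 * C" S R] S(2) CR(1) by auto
qed

text \<open>For simple functions the integral depends on the measure through its values on bounded
  sets alone. The value 0 is left out, as its level set is unbounded.\<close>

lemma integral_inner_simple:
  fixes S :: "'a::euclidean_space \<Rightarrow> 'b::euclidean_space"
  assumes M: "M \<in> Mloc_pos" and f: "loc_integrable M f"
    and S: "S \<in> borel_measurable borel" "finite (range S)" "\<And>x. norm (S x) \<le> C * indicator (ball 0 R) x"
  shows "(LINT x|M. S x \<bullet> f x) = (\<Sum>v\<in>range S - {0}. v \<bullet> with_density M f {x. S x = v})"
proof -
  have b: "{x. S x = v} \<in> bborel" if "v \<noteq> 0" for v
  proof (rule bborel_subset[OF bborel_ball[of 0 R]])
    show "{x. S x = v} \<subseteq> ball 0 R"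
    proof
      fix x assume "x \<in> {x. S x = v}"
      then show "x \<in> ball 0 R" using S(3)[of x] that by (cases "x \<in> ball 0 R") auto
    qed
    show "{x. S x = v} \<in> sets borel" using S(1) by measurable
  qed
  have eq: "S x \<bullet> f x = (\<Sum>v\<in>range S - {0}. v \<bullet> (indicator {x. S x = v} x *\<^sub>R f x))" for x
  proof (cases "S x = 0")
    case True
    then show ?thesis by (auto simp: indicator_def intro!: sum.neutral[symmetric])
  next
    case False
    have "(\<Sum>v\<in>range S - {0}. v \<bullet> (indicator {x. S x = v} x *\<^sub>R f x)) = (\<Sum>v\<in>{S x}. v \<bullet> (indicator {x. S x = v} x *\<^sub>R f x))"
      using S(2) False by (intro sum.mono_neutral_right) (auto simp: indicator_def)
    then show ?thesis by simp
  qed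
  have int: "integrable M (\<lambda>x. indicator {x. S x = v} x *\<^sub>R f x)" if "v \<noteq> 0" for v
    using loc_integrableD[OF f b[OF that]] by (simp add: set_integrable_def)
  show ?thesis
    unfolding eq
  proof (subst Bochner_Integration.integral_sum)
    show "integrable M (\<lambda>x. v \<bullet> (indicator {x. S x = v} x *\<^sub>R f x))" if "v \<in> range S - {0}" for v
      using int[of v] that by (intro integrable_inner_right) auto
    show "(\<Sum>v\<in>range S - {0}. LINT x|M. v \<bullet> (indicator {x. S x = v} x *\<^sub>R f x))
      = (\<Sum>v\<in>range S - {0}. v \<bullet> with_density M f {x. S x = v})"
    proof (rule sum.cong)
      fix v assume "v \<in> range S - {0}"
      then have "v \<noteq> 0" by auto
      then show "(LINT x|M. v \<bullet> (indicator {x. S x = v} x *\<^sub>R f x)) = v \<bullet> with_density M f {x. S x = v}"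
        using int[of v] b[of v] unfolding with_density_def set_lebesgue_integral_def
          by (subst integral_inner_right) auto
    qed simp
  qed
qed

lemma bfun_limit:
  assumes M: "M \<in> Mloc_pos" and f: "loc_integrable M f"
    and F: "\<And>n. F n \<in> borel_measurable borel" "\<And>n x. norm (F n x) \<le> C * indicator (ball 0 R) x"
      "\<And>x. (\<lambda>n. F n x) \<longlonglongrightarrow> l x"
  shows "(\<lambda>n. LINT x|M. F n x \<bullet> f x) \<longlonglongrightarrow> (LINT x|M. l x \<bullet> f x)"
proof (rule integral_dominated_convergence[where w="\<lambda>x. norm (C *\<^sub>R (indicator (ball 0 R) x *\<^sub>R f x))"])
  have [measurable]: "F n \<in> borel_measurable M" for n using F(1)[of n] by (simp add: measurable_cong_sets[OF Mloc_pos_sets[OF M] refl])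
  have [measurable]: "f \<in> borel_measurable M" using f by (simp add: loc_integrable_def)
  have [measurable]: "l \<in> borel_measurable M" by (rule borel_measurable_LIMSEQ_metric[where f=F]) (use F in auto)
  show "(\<lambda>x. l x \<bullet> f x) \<in> borel_measurable M" "(\<lambda>x. F n x \<bullet> f x) \<in> borel_measurable M" for n by measurable
  show "integrable M (\<lambda>x. norm (C *\<^sub>R (indicator (ball 0 R) x *\<^sub>R f x)))"
    using loc_integrableD[OF f bborel_ball[of 0 R]] by (intro integrable_norm integrable_scaleR_right) (simp add: set_integrable_def)
  show "AE x in M. (\<lambda>n. F n x \<bullet> f x) \<longlonglongrightarrow> l x \<bullet> f x"
    by (intro AE_I2 tendsto_intros F)
  show "AE x in M. norm (F n x \<bullet> f x) \<le> norm (C *\<^sub>R (indicator (ball 0 R) x *\<^sub>R f x))" for n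
  proof (rule AE_I2)
    fix x
    have "norm (F n x \<bullet> f x) \<le> norm (F n x) * norm (f x)" by (simp add: Cauchy_Schwarz_ineq2)
    also have "\<dots> \<le> (C * indicator (ball 0 R) x) * norm (f x)" by (intro mult_right_mono F) auto
    also have "\<dots> \<le> \<bar>C\<bar> * indicator (ball 0 R) x * norm (f x)" by (intro mult_right_mono) auto
    finally show "norm (F n x \<bullet> f x) \<le> norm (C *\<^sub>R (indicator (ball 0 R) x *\<^sub>R f x))" by (simp add: abs_mult)
  qed
qed

text \<open>Two representations of the same measure agree on simple functions and hence on their
  limits. So pairings depend neither on the reference measure nor on the choice made in
  \<open>rn_density\<close>.\<close>

lemma integral_inner_eq:
  assumes M1: "M1 \<in> Mloc_pos" "loc_integrable M1 f1" and M2: "M2 \<in> Mloc_pos" "loc_integrable M2 f2"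
    and eq: "with_density M1 f1 = with_density M2 f2" and F: "bfun F"
  shows "(LINT x|M1. F x \<bullet> f1 x) = (LINT x|M2. F x \<bullet> f2 x)"
proof -
  obtain S C R where S: "0 \<le> C" "\<And>n::nat. S n \<in> borel_measurable borel" "\<And>n. finite (range (S n))"
    "\<And>n x. norm (S n x) \<le> C * indicator (ball 0 R) x" "\<And>x. (\<lambda>n. S n x) \<longlonglongrightarrow> F x"
    using bfun_simple_approx[OF F] by metis
  have "(LINT x|M1. S n x \<bullet> f1 x) = (LINT x|M2. S n x \<bullet> f2 x)" for n
    unfolding integral_inner_simple[OF M1 S(2,3,4)] integral_inner_simple[OF M2 S(2,3,4)] eq ..
  then show ?thesis
    using bfun_limit[OF M1 S(2,4,5)] bfun_limit[OF M2 S(2,4,5)] LIMSEQ_unique by auto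
qed

lemma pairing_with_density:
  assumes "M \<in> Mloc_pos" "loc_integrable M f" "bfun F"
  shows "pairing (with_density M f) F = (LINT x|M. F x \<bullet> f x)"
proof -
  let ?\<mu> = "with_density M f"
  have mu: "?\<mu> \<in> Mloc" using assms by (intro with_density_Mloc)
  obtain \<theta> where th: "loc_integrable (variation ?\<mu>) \<theta>" "?\<mu> = with_density (variation ?\<mu>) \<theta>"
    using polar_decomposition[OF mu] by auto
  show ?thesis unfolding pairing_def
    by (rule integral_inner_eq[OF variation_Mloc_pos[OF mu] rn_density(1)[OF th] assms(1,2) rn_density(2)[OF th] assms(3)])
qed

lemma pairing_eq_integral:
  assumes mu: "\<mu> \<in> Mloc"
  obtains f where "loc_integrable (variation \<mu>) f" "with_density (variation \<mu>) f = \<mu>"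
    "\<And>F. pairing \<mu> F = (LINT x|variation \<mu>. F x \<bullet> f x)"
proof -
  obtain \<theta> where th: "loc_integrable (variation \<mu>) \<theta>" "\<mu> = with_density (variation \<mu>) \<theta>"
    using polar_decomposition[OF mu] by auto
  show thesis by (rule that[OF rn_density[OF th]]) (simp add: pairing_def)
qed

lemma pairing_limit:
  assumes mu: "\<mu> \<in> Mloc"
    and F: "\<And>n. F n \<in> borel_measurable borel" "\<And>n x. norm (F n x) \<le> C * indicator (ball 0 R) x"
      "\<And>x. (\<lambda>n. F n x) \<longlonglongrightarrow> l x"
  shows "(\<lambda>n. pairing \<mu> (F n)) \<longlonglongrightarrow> pairing \<mu> l"
proof -
  obtain f where f: "loc_integrable (variation \<mu>) f" "\<And>F. pairing \<mu> F = (LINT x|variation \<mu>. F x \<bullet> f x)"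
    using pairing_eq_integral[OF mu] by blast
  show ?thesis unfolding f(2) by (rule bfun_limit[OF variation_Mloc_pos[OF mu] f(1) F])
qed

lemma pairing_simple:
  assumes mu: "\<mu> \<in> Mloc"
    and S: "S \<in> borel_measurable borel" "finite (range S)" "\<And>x. norm (S x) \<le> C * indicator (ball 0 R) x"
  shows "pairing \<mu> S = (\<Sum>v\<in>range S - {0}. v \<bullet> \<mu> {x. S x = v})"
proof -
  obtain f where f: "loc_integrable (variation \<mu>) f" "with_density (variation \<mu>) f = \<mu>"
    "\<And>F. pairing \<mu> F = (LINT x|variation \<mu>. F x \<bullet> f x)"
    using pairing_eq_integral[OF mu] by blast
  show ?thesis unfolding f(3) integral_inner_simple[OF variation_Mloc_pos[OF mu] f(1) S] f(2) ..
qed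

lemma pairing_add:
  assumes mu: "\<mu> \<in> Mloc" and F: "bfun F" "bfun G"
  shows "pairing \<mu> (\<lambda>x. F x + G x) = pairing \<mu> F + pairing \<mu> G"
    "pairing \<mu> (\<lambda>x. F x - G x) = pairing \<mu> F - pairing \<mu> G"
proof -
  obtain f where f: "loc_integrable (variation \<mu>) f" "\<And>F. pairing \<mu> F = (LINT x|variation \<mu>. F x \<bullet> f x)"
    using pairing_eq_integral[OF mu] by blast
  note int = F[THEN bfun_inner_integrable[OF variation_Mloc_pos[OF mu] f(1)]]
  show "pairing \<mu> (\<lambda>x. F x + G x) = pairing \<mu> F + pairing \<mu> G"
    "pairing \<mu> (\<lambda>x. F x - G x) = pairing \<mu> F - pairing \<mu> G"
    using int by (auto simp: f(2) inner_add_left inner_diff_left)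
qed

lemma pairing_scaleR: "pairing \<mu> (\<lambda>x. c *\<^sub>R F x) = c * pairing \<mu> F"
  by (simp add: pairing_def)

lemma pairing_scale_measure:
  assumes mu: "\<mu> \<in> Mloc" and F: "bfun F"
  shows "pairing (\<lambda>A. c *\<^sub>R \<mu> A) F = c * pairing \<mu> F"
proof -
  obtain f where f: "loc_integrable (variation \<mu>) f" "with_density (variation \<mu>) f = \<mu>"
    "\<And>F. pairing \<mu> F = (LINT x|variation \<mu>. F x \<bullet> f x)"
    using pairing_eq_integral[OF mu] by blast
  have "(\<lambda>A. c *\<^sub>R \<mu> A) = with_density (variation \<mu>) (\<lambda>x. c *\<^sub>R f x)"
    by (auto simp: with_density_scaleR f(2))
  then have "pairing (\<lambda>A. c *\<^sub>R \<mu> A) F = (LINT x|variation \<mu>. F x \<bullet> (c *\<^sub>R f x))"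
    using pairing_with_density[OF variation_Mloc_pos[OF mu] loc_integrable_scaleR[OF f(1)] F] by simp
  then show ?thesis by (simp add: f(3))
qed

text \<open>For simple functions the pairing is a finite combination of values
  \<open>\<nu> t A\<close>, measurable in \<open>t\<close> by hypothesis; the general case is a
  pointwise limit.\<close>

lemma pairing_measurable:
  assumes mu: "\<And>t. t \<in> T \<Longrightarrow> \<nu> t \<in> Mloc" and T: "T \<in> sets borel" and b: "borel_family_on T \<nu>" and F: "bfun F"
  shows "(\<lambda>t. indicator T t * pairing (\<nu> t) F) \<in> borel_measurable borel"
proof -
  obtain S C R where S: "0 \<le> C" "\<And>n::nat. S n \<in> borel_measurable borel" "\<And>n. finite (range (S n))"
    "\<And>n x. norm (S n x) \<le> C * indicator (ball 0 R) x" "\<And>x. (\<lambda>n. S n x) \<longlonglongrightarrow> F x"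
    using bfun_simple_approx[OF F] by metis
  have bm: "(\<lambda>t. indicator T t *\<^sub>R \<nu> t A) \<in> borel_measurable borel" for A
  proof (cases "A \<in> bborel")
    case True
    then show ?thesis using b T by (simp add: borel_family_on_def borel_measurable_restrict_space_iff)
  next
    case False
    then have "(\<lambda>t. indicator T t *\<^sub>R \<nu> t A) = (\<lambda>t. 0)" using mu by (auto simp: Mloc_notin indicator_def)
    then show ?thesis by simp
  qed
  show ?thesis
  proof (rule borel_measurable_LIMSEQ_metric)
    fix n
    have "(\<lambda>t. indicator T t * pairing (\<nu> t) (S n)) = (\<lambda>t. \<Sum>v\<in>range (S n) - {0}. v \<bullet> (indicator T t *\<^sub>R \<nu> t {x. S n x = v}))"
    proof
      fix t show "indicator T t * pairing (\<nu> t) (S n) = (\<Sum>v\<in>range (S n) - {0}. v \<bullet> (indicator T t *\<^sub>R \<nu> t {x. S n x = v}))"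
        using pairing_simple[OF mu S(2,3,4)] by (cases "t \<in> T") auto
    qed
    also have "\<dots> \<in> borel_measurable borel" using bm by measurable
    finally show "(\<lambda>t. indicator T t * pairing (\<nu> t) (S n)) \<in> borel_measurable borel" .
  next
    fix t
    show "(\<lambda>n. indicator T t * pairing (\<nu> t) (S n)) \<longlonglongrightarrow> indicator T t * pairing (\<nu> t) F"
      using pairing_limit[OF mu S(2,4,5)] by (cases "t \<in> T") (auto intro!: tendsto_mult_left)
  qed
qed

subsection \<open>Admissible densities\<close>

text \<open>\<open>lsc\<close> compares with the limit inferior over punctured neighbourhoods, which
  a segment of zeros ending at \<open>y\<close> forces to be 0.\<close>

lemma lsc_zero:
  fixes \<phi> :: "'v::real_normed_vector \<Rightarrow> ennreal"
  assumes lsc: "lsc \<phi>" and zy: "z \<noteq> y" and zero: "\<And>s. 0 < s \<Longrightarrow> s < 1 \<Longrightarrow> \<phi> (y + s *\<^sub>R (z - y)) = 0"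
  shows "\<phi> y = 0"
proof -
  have "Liminf (at y) \<phi> \<le> 0"
    unfolding Liminf_def
  proof (rule SUP_least)
    fix P assume "P \<in> {P. eventually P (at y)}"
    then obtain d where d: "d > 0" "\<And>x. x \<noteq> y \<Longrightarrow> dist x y < d \<Longrightarrow> P x" by (auto simp: eventually_at)
    define s where "s = min (1/2) (d / (2 * norm (z - y)))"
    have s: "0 < s" "s < 1" using d zy by (auto simp: s_def)
    have "s * norm (z - y) \<le> d / (2 * norm (z - y)) * norm (z - y)" by (rule mult_right_mono) (auto simp: s_def)
    also have "\<dots> < d" using zy d by simp
    finally have "P (y + s *\<^sub>R (z - y))" using s zy by (intro d) (auto simp: dist_norm)
    then show "Inf (\<phi> ` Collect P) \<le> 0" using zero[OF s] by (intro INF_lower2) auto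
  qed
  then show ?thesis using lsc unfolding lsc_def by (metis le_zero_eq order_trans)
qed

text \<open>Young's inequality without the optimal constants, which are irrelevant here.\<close>

lemma Young_crude:
  fixes x y p q :: real
  assumes p: "1 < p" and q: "q = p / (p - 1)" and xy: "0 \<le> x" "0 \<le> y"
  shows "x * y \<le> x powr q + y powr p"
proof (cases "x powr q \<le> y powr p")
  case True
  have "x = (x powr q) powr (1 / q)" using p q xy by (simp add: powr_powr)
  also have "\<dots> \<le> (y powr p) powr (1 / q)" using True p q by (intro powr_mono2) auto
  also have "\<dots> = y powr (p - 1)" using p q by (simp add: powr_powr)
  finally have "x * y \<le> y powr (p - 1) * y" using xy by (intro mult_right_mono)
  also have "\<dots> = y powr p" using xy by (cases "y = 0") (auto simp: powr_diff p)
  finally show ?thesis by (simp add: add_increasing)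
next
  case False
  have q1: "1 < q" using p q by (simp add: less_divide_eq)
  have "y = (y powr p) powr (1 / p)" using p xy by (simp add: powr_powr)
  also have "\<dots> \<le> (x powr q) powr (1 / p)" using False p by (intro powr_mono2) auto
  also have "\<dots> = x powr (q / p)" by (simp add: powr_powr)
  also have "q / p = q - 1" using p q by (simp add: field_simps)
  finally have "x * y \<le> x * x powr (q - 1)" using xy by (intro mult_left_mono)
  also have "\<dots> = x powr q" using xy q1 by (cases "x = 0") (auto simp: powr_diff)
  finally show ?thesis by (simp add: add_increasing2)
qed

locale action_setup =
  fixes p q a b :: real and \<gamma> :: "'a::euclidean_space measure" and \<phi> :: "real \<times> 'a \<Rightarrow> ennreal"
  assumes p: "1 < p" and q_def: "q = p / (p - 1)" and ab: "a < b"
    and G: "\<gamma> \<in> Mloc_pos" and phi: "\<phi> \<in> Adm_int p a b"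
begin

section \<open>Domain, zeros and homogeneity of \<open>\<phi>\<close>\<close>

lemma phi_lsc: "lsc \<phi>" and phi_econvex: "econvex \<phi>"
  and interior_edom: "interior (edom \<phi>) = {a<..<b} \<times> UNIV"
  using phi by (auto simp: Adm_int_def Adm_def)

lemma phi_convex:
  "0 \<le> u \<Longrightarrow> 0 \<le> v \<Longrightarrow> u + v = 1 \<Longrightarrow>
     \<phi> (u * x + v * x', u *\<^sub>R w + v *\<^sub>R w') \<le> ennreal u * \<phi> (x, w) + ennreal v * \<phi> (x', w')"
  using phi_econvex[unfolded econvex_def, rule_format, of u v "(x, w)" "(x', w')"] by simp

lemma phi_F1:
  assumes "\<phi> (\<rho>, w) < \<infinity>"
  shows "\<phi> (\<rho>, 0) = 0" "l \<noteq> 0 \<Longrightarrow> \<phi> (\<rho>, l *\<^sub>R w') = ennreal (\<bar>l\<bar> powr p) * \<phi> (\<rho>, w')"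
proof -
  have "({\<rho>} \<times> UNIV) \<inter> edom \<phi> \<noteq> {}" using assms by (auto simp: edom_def)
  then show "\<phi> (\<rho>, 0) = 0" "l \<noteq> 0 \<Longrightarrow> \<phi> (\<rho>, l *\<^sub>R w') = ennreal (\<bar>l\<bar> powr p) * \<phi> (\<rho>, w')"
    using phi unfolding Adm_int_def Adm_def by blast+
qed

lemma phi_finite: "a < \<rho> \<Longrightarrow> \<rho> < b \<Longrightarrow> \<phi> (\<rho>, w) < \<infinity>"
proof -
  assume "a < \<rho>" "\<rho> < b"
  then have "(\<rho>, w) \<in> interior (edom \<phi>)" by (simp add: interior_edom)
  then show ?thesis using interior_subset by (auto simp: edom_def)
qed

text \<open>Convexity between \<open>m\<close> and \<open>x\<close>: all of \<open>w\<close> is put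
  on the point over \<open>m\<close>, where \<open>\<phi>\<close> is finite for every vector, and 0
  on the point over \<open>x\<close>.\<close>

lemma phi_finite_segment:
  assumes x: "\<phi> (x, w0) < \<infinity>" and m: "a < m" "m < b" and s: "0 \<le> s" "s < 1"
  shows "\<phi> (m + s * (x - m), w) < \<infinity>"
proof -
  have i: "(1 - s) * inverse (1 - s) = 1" using s by simp
  have "(1 - s) * m + s * x = m + s * (x - m)" by (simp add: algebra_simps)
  moreover have "(1 - s) *\<^sub>R (w /\<^sub>R (1 - s)) + s *\<^sub>R 0 = w"
    by (simp only: scaleR_scaleR i scaleR_one scaleR_zero_right add_0_right)
  ultimately have "\<phi> (m + s * (x - m), w) \<le> ennreal (1 - s) * \<phi> (m, w /\<^sub>R (1 - s)) + ennreal s * \<phi> (x, 0)"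
    using phi_convex[of "1 - s" s m x "w /\<^sub>R (1 - s)" 0] s by simp
  also have "\<dots> < \<infinity>" using phi_F1(1)[OF x] phi_finite[OF m, of "w /\<^sub>R (1 - s)"] by (simp add: ennreal_mult_less_top)
  finally show ?thesis .
qed

text \<open>If \<open>x\<close> lay outside \<open>[a, b]\<close>, the open strip between the
  midpoint and \<open>x\<close> would lie in the domain and contain an end point of the interval,
  against the description of the interior.\<close>

lemma phi_dom:
  assumes "\<phi> (x, w) < \<infinity>" shows "a \<le> x" "x \<le> b"
proof -
  define m where "m = (a + b) / 2"
  have m: "a < m" "m < b" using ab by (auto simp: m_def)
  define U where "U = {min m x<..<max m x} \<times> (UNIV :: 'a set)"
  have "U \<subseteq> edom \<phi>"
  proof
    fix z assume z: "z \<in> U"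
    obtain y v where zy: "z = (y, v)" by force
    define s where "s = (y - m) / (x - m)"
    have yx: "min m x < y" "y < max m x" using z by (auto simp: U_def zy)
    have "x \<noteq> m" using yx by auto
    have "0 \<le> s" "s < 1" using yx by (auto simp: s_def min_def max_def divide_simps split: if_splits)
    moreover have "m + s * (x - m) = y" using \<open>x \<noteq> m\<close> by (simp add: s_def)
    ultimately show "z \<in> edom \<phi>" using phi_finite_segment[OF assms m, of s v] by (simp add: edom_def zy)
  qed
  moreover have "open U" unfolding U_def by (intro open_Times) auto
  ultimately have sub: "U \<subseteq> {a<..<b} \<times> UNIV" using interior_maximal[of U "edom \<phi>"] interior_edom by simp
  show "x \<le> b"
  proof (rule ccontr)
    assume "\<not> x \<le> b"
    then have "(b, 0) \<in> U" using m by (auto simp: U_def)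
    then show False using sub by auto
  qed
  show "a \<le> x"
  proof (rule ccontr)
    assume "\<not> a \<le> x"
    then have "(a, 0) \<in> U" using m by (auto simp: U_def)
    then show False using sub by auto
  qed
qed

lemma phi_infinite: "\<not> (a \<le> x \<and> x \<le> b) \<Longrightarrow> \<phi> (x, w) = \<infinity>"
  using phi_dom[of x w] by (cases "\<phi> (x, w) < \<infinity>") (auto simp: not_less top_unique)

text \<open>(F1) covers the interior. At the end points lower semicontinuity along a segment from
  the interior gives the value 0, which puts \<open>(a, 0)\<close> and \<open>(b, 0)\<close> in the
  domain.\<close>

lemma phi_zero:
  assumes x: "a \<le> x" "x \<le> b" shows "\<phi> (x, 0) = 0"
proof (cases "a < x \<and> x < b")
  case True then show ?thesis using phi_F1(1)[OF phi_finite] by blast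
next
  case False
  define m where "m = (a + b) / 2"
  show ?thesis
  proof (rule lsc_zero[OF phi_lsc, of "(m, 0)"])
    show "(m, 0) \<noteq> (x, 0)" using False x ab by (auto simp: m_def)
    fix s :: real assume s: "0 < s" "s < 1"
    have "0 < s * (b - a)" "s * (b - a) < 1 * (b - a)" using s ab by (intro mult_pos_pos mult_strict_right_mono; simp)+
    moreover have "x = a \<or> x = b" using False x by auto
    ultimately have "a < x + s * (m - x)" "x + s * (m - x) < b" by (auto simp: m_def field_simps)
    then show "\<phi> ((x, 0) + s *\<^sub>R ((m, 0) - (x, 0))) = 0" using phi_F1(1)[OF phi_finite] by simp
  qed
qed

text \<open>Off \<open>[a, b]\<close> both sides are infinite; on it, \<open>phi_zero\<close>
  provides the point of the domain that (F1) asks for.\<close>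

lemma phi_hom: assumes l: "l \<noteq> 0" shows "\<phi> (x, l *\<^sub>R w) = ennreal (\<bar>l\<bar> powr p) * \<phi> (x, w)"
proof (cases "a \<le> x \<and> x \<le> b")
  case True
  then show ?thesis using phi_F1(2)[of x 0] phi_zero l by simp
next
  case False
  then have "\<phi> (x, v) = \<infinity>" for v by (rule phi_infinite)
  then show ?thesis using l by (simp add: ennreal_mult_top)
qed

section \<open>Coercivity and the recession function\<close>

definition mid :: real where "mid = (a + b) / 2"

lemma mid: "a < mid" "mid < b" using ab by (auto simp: mid_def)

text \<open>(F2) gives positivity over a single \<open>r\<close>. A zero at \<open>(mid, w)\<close>
  is by homogeneity a zero at all multiples of \<open>w\<close>, by convexity with
  \<open>(r, 0)\<close> a zero on the open segment towards \<open>(r, w)\<close>, and by lower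
  semicontinuity a zero at \<open>(r, w)\<close>.\<close>

lemma phi_mid_pos: assumes w: "w \<noteq> 0" shows "\<phi> (mid, w) > 0"
proof (rule ccontr)
  assume "\<not> ?thesis"
  then have z: "\<phi> (mid, w) = 0" by simp
  obtain r where r: "{r} \<times> UNIV \<subseteq> edom \<phi>" and pos: "\<And>w. w \<noteq> 0 \<Longrightarrow> \<phi> (r, w) > 0"
    using phi unfolding Adm_int_def Adm_def by blast
  have "(r, 0) \<in> edom \<phi>" using r by auto
  then have fin: "\<phi> (r, 0) < \<infinity>" by (simp add: edom_def)
  have "r \<noteq> mid" using z pos[OF w] by auto
  have "\<phi> (r, w) = 0"
  proof (rule lsc_zero[OF phi_lsc, of "(mid, w)"])
    show "(mid, w) \<noteq> (r, w)" using \<open>r \<noteq> mid\<close> by simp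
    fix s :: real assume s: "0 < s" "s < 1"
    have eq: "s * mid + (1 - s) * r = r + s * (mid - r)" "s *\<^sub>R (w /\<^sub>R s) + (1 - s) *\<^sub>R 0 = w"
      using s by (auto simp: ring_distribs)
    have "\<phi> (mid, w /\<^sub>R s) = 0" using phi_hom[of "inverse s" mid w] s z by simp
    then have "\<phi> (r + s * (mid - r), w) \<le> 0"
      using phi_convex[of s "1 - s" mid r "w /\<^sub>R s" 0] s phi_F1(1)[OF fin] unfolding eq by simp
    then show "\<phi> ((r, w) + s *\<^sub>R ((mid, w) - (r, w))) = 0" by simp
  qed
  then show False using pos[OF w] by simp
qed

lemma phi_mid_coercive: "\<exists>c>0. \<forall>w. ennreal (c * norm w powr p) \<le> \<phi> (mid, w)"
proof -
  define S where "S = sphere (0::'a) 1"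
  have nb: "\<exists>U c. open U \<and> w \<in> U \<and> 0 < c \<and> (\<forall>v\<in>U. ennreal c \<le> \<phi> (mid, v))" if "w \<in> S" for w
  proof -
    have "w \<noteq> 0" using that by (auto simp: S_def)
    from phi_mid_pos[OF this] obtain c' where c': "0 < c'" "c' < \<phi> (mid, w)" using dense by blast
    then obtain c where cc: "ennreal c = c'" "0 < c" by (cases c') auto
    have "ennreal c < Liminf (at (mid, w)) \<phi>" using phi_lsc c' cc unfolding lsc_def by (metis order.strict_trans2)
    then have "eventually (\<lambda>x. ennreal c < \<phi> x) (at (mid, w))" by (rule less_LiminfD)
    then obtain V where V: "open V" "(mid, w) \<in> V" "\<And>x. x \<in> V \<Longrightarrow> x \<noteq> (mid, w) \<Longrightarrow> ennreal c < \<phi> x"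
      by (auto simp: eventually_at_topological)
    define U where "U = (\<lambda>v. (mid, v)) -` V"
    have "open U" unfolding U_def using V(1) by (intro open_vimage continuous_intros)
    moreover have "w \<in> U" using V by (simp add: U_def)
    \<comment> \<open>The limit inferior says nothing about the point itself, hence the separate
      case \<open>v = w\<close>.\<close>
    moreover have "ennreal c \<le> \<phi> (mid, v)" if "v \<in> U" for v
      using V(3)[of "(mid, v)"] that c' cc by (cases "v = w") (auto simp: U_def)
    ultimately show ?thesis using cc by blast
  qed
  then obtain U c where Uc: "\<And>w. w \<in> S \<Longrightarrow> open (U w) \<and> w \<in> U w \<and> 0 < c w \<and> (\<forall>v\<in>U w. ennreal (c w) \<le> \<phi> (mid, v))"
    by metis
  obtain T where T: "T \<subseteq> S" "finite T" "S \<subseteq> (\<Union>w\<in>T. U w)"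
    using compactE_image[of S S U] Uc by (force simp: S_def)
  define c0 where "c0 = Min (insert 1 (c ` T))"
  have c0: "0 < c0" using T Uc by (auto simp: c0_def)
  have S: "ennreal c0 \<le> \<phi> (mid, v)" if vS: "v \<in> S" for v
  proof -
    obtain w where w: "w \<in> T" "v \<in> U w" using T vS by blast
    have "c0 \<le> c w" using w T by (auto simp: c0_def)
    then have "ennreal c0 \<le> ennreal (c w)" by (rule ennreal_leI)
    also have "\<dots> \<le> \<phi> (mid, v)" using Uc w T by blast
    finally show ?thesis .
  qed
  have "ennreal (c0 * norm w powr p) \<le> \<phi> (mid, w)" for w
  proof (cases "w = 0")
    case False
    have "\<phi> (mid, w) = \<phi> (mid, norm w *\<^sub>R sgn w)" using False by (simp add: sgn_div_norm)
    also have "\<dots> = ennreal (norm w powr p) * \<phi> (mid, sgn w)" using phi_hom[of "norm w"] False by simp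
    also have "\<dots> \<ge> ennreal (norm w powr p) * ennreal c0"
      using False by (intro mult_left_mono S) (auto simp: S_def norm_sgn)
    finally show ?thesis by (simp add: ennreal_mult'' mult.commute)
  qed simp
  then show ?thesis using c0 by blast
qed

lemma phi_coercive_ex: "\<exists>c>0. \<forall>x w. ennreal (c * norm w powr p) \<le> \<phi> (x, w)"
proof -
  obtain c where c: "0 < c" "\<And>w. ennreal (c * norm w powr p) \<le> \<phi> (mid, w)" using phi_mid_coercive by blast
  have "ennreal (c * 2 powr (-p) * norm w powr p) \<le> \<phi> (x, w)" for x w
  proof (cases "\<phi> (x, w) = \<infinity>")
    case False
    then have x: "a \<le> x" "x \<le> b" using phi_dom[of x w] by (auto simp: less_top)
    \<comment> \<open>\<open>z\<close> is the end point across \<open>mid\<close> from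
      \<open>x\<close>, so that \<open>mid\<close> divides the segment from \<open>z\<close> to
      \<open>x\<close>. As \<open>mid\<close> halves the interval, the weight \<open>l\<close> of
      \<open>x\<close> is at least 1/2, whence the factor \<open>2 powr (-p)\<close>.\<close>
    define z where "z = (if mid \<le> x then a else b)"
    have z: "\<phi> (z, 0) = 0" using ab by (intro phi_zero) (auto simp: z_def)
    define l where "l = (mid - z) / (x - z)"
    have xz: "x \<noteq> z" using x mid by (auto simp: z_def)
    have l: "1 / 2 \<le> l" "l \<le> 1"
      using x mid ab by (auto simp: l_def z_def divide_simps mid_def split: if_splits)
    have "l * (x - z) = mid - z" using xz by (simp add: l_def)
    then have eq: "l * x + (1 - l) * z = mid" by (simp add: algebra_simps)
    have "\<phi> (mid, l *\<^sub>R w) \<le> ennreal l * \<phi> (x, w)"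
      using phi_convex[of l "1 - l" x z w 0] l z unfolding eq by simp
    also have "\<dots> \<le> 1 * \<phi> (x, w)" using l by (intro mult_right_mono) auto
    finally have "\<phi> (mid, l *\<^sub>R w) \<le> \<phi> (x, w)" by simp
    moreover have "c * 2 powr (-p) * norm w powr p \<le> c * norm (l *\<^sub>R w) powr p"
    proof -
      have "2 powr (-p) * norm w powr p = ((1/2) * norm w) powr p" using p by (simp add: powr_mult powr_minus powr_divide divide_simps)
      also have "\<dots> \<le> (l * norm w) powr p" using l p by (intro powr_mono2 mult_right_mono) auto
      finally show ?thesis using c(1) l by (simp add: mult.assoc)
    qed
    then have "ennreal (c * 2 powr (-p) * norm w powr p) \<le> \<phi> (mid, l *\<^sub>R w)"
      by (intro order_trans[OF ennreal_leI c(2)])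
    ultimately show ?thesis by (rule order_trans[rotated])
  qed simp
  moreover have "0 < c * 2 powr (-p)" using c by simp
  ultimately show ?thesis by blast
qed

text \<open>The coercivity constant of \<open>\<phi>\<close>. It comes from compactness of the unit sphere at \<open>\<rho> = mid\<close>,
  and is transported to other \<open>\<rho>\<close> by convexity.\<close>

definition coer :: real where "coer = (SOME c. c > 0 \<and> (\<forall>x w. ennreal (c * norm w powr p) \<le> \<phi> (x, w)))"

lemma coer_pos: "0 < coer" and phi_coercive: "ennreal (coer * norm w powr p) \<le> \<phi> (x, w)"
proof -
  have "coer > 0 \<and> (\<forall>x w. ennreal (coer * norm w powr p) \<le> \<phi> (x, w))"
    unfolding coer_def by (rule someI_ex[OF phi_coercive_ex])
  then show "0 < coer" "ennreal (coer * norm w powr p) \<le> \<phi> (x, w)" by auto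
qed

text \<open>An increment that changes \<open>\<rho>\<close> leaves \<open>[a, b]\<close> from a
  suitable starting point. An increment in \<open>w\<close> alone is viewed from \<open>t w\<close>
  with \<open>t\<close> large, because the increments of \<open>t powr p\<close> are unbounded for
  \<open>p > 1\<close>.\<close>

lemma recession_infinite:
  assumes y: "y \<noteq> 0" shows "recession \<phi> y = \<infinity>"
proof -
  obtain r w where rw: "y = (r, w)" by force
  show ?thesis
  proof (cases "r = 0")
    case False
    \<comment> \<open>Within \<open>\<bar>r\<bar> / 2\<close> of the end point towards which
      \<open>r\<close> points, so that adding \<open>r\<close> leaves the interval.\<close>
    define x where "x = (if r > 0 then max mid (b - r / 2) else min mid (a - r / 2))"
    have x: "a < x" "x < b" "\<not> (a \<le> x + r \<and> x + r \<le> b)" using mid False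
      by (auto simp: x_def max_def min_def)
    then have "\<phi> (x + r, w) = \<infinity>" by (intro phi_infinite)
    moreover have "\<phi> (x, 0) = 0" using x by (intro phi_zero) auto
    ultimately have "enn2ereal (\<phi> ((x, 0) + y)) - enn2ereal (\<phi> (x, 0)) = \<infinity>" by (simp add: rw zero_ereal_def[symmetric])
    moreover have "(x, 0) \<in> edom \<phi>" using \<open>\<phi> (x, 0) = 0\<close> by (simp add: edom_def)
    ultimately have "\<infinity> \<le> recession \<phi> y"
      using SUP_upper[of "(x, 0)" "edom \<phi>" "\<lambda>x. enn2ereal (\<phi> (x + y)) - enn2ereal (\<phi> x)"]
      unfolding recession_def by simp
    then show ?thesis by simp
  next
    case True
    then have w: "w \<noteq> 0" using y by (auto simp: rw zero_prod_def)
    obtain k where k: "\<phi> (mid, w) = ennreal k" "0 < k"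
      using phi_mid_pos[OF w] phi_finite[OF mid, of w] by (cases "\<phi> (mid, w)") auto
    show ?thesis unfolding recession_def
    proof (rule SUP_PInfty)
      fix N :: nat
      \<comment> \<open>Chosen so that \<open>(t + 1) powr (p - 1) * k\<close> is at least
        \<open>N\<close>; this quantity bounds the increment from \<open>t w\<close> to
        \<open>(t + 1) w\<close> from below.\<close>
      define t where "t = max 1 ((real N / k) powr (1 / (p - 1)))"
      have t: "1 \<le> t" by (simp add: t_def)
      have e1: "\<phi> (mid, s *\<^sub>R w) = ennreal (s powr p * k)" if "s > 0" for s
        using phi_hom[of s mid w] that k by (simp add: ennreal_mult)
      have "real N / k = ((real N / k) powr (1 / (p - 1))) powr (p - 1)" using p k by (simp add: powr_powr)
      also have "\<dots> \<le> (t + 1) powr (p - 1)" using p by (intro powr_mono2) (auto simp: t_def)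
      finally have N: "real N \<le> (t + 1) powr (p - 1) * k" using k by (simp add: field_simps)
      have "t powr p = t * t powr (p - 1)" using t by (simp add: powr_diff)
      also have "\<dots> \<le> t * (t + 1) powr (p - 1)" using t p by (intro mult_left_mono powr_mono2) auto
      also have "\<dots> = (t + 1) * (t + 1) powr (p - 1) - (t + 1) powr (p - 1)" by (simp add: algebra_simps)
      also have "(t + 1) * (t + 1) powr (p - 1) = (t + 1) powr p" using t by (simp add: powr_diff)
      finally have "(t + 1) powr (p - 1) * k \<le> ((t + 1) powr p - t powr p) * k" using k by (intro mult_right_mono) auto
      then have "real N \<le> (t + 1) powr p * k - t powr p * k" using N by (simp add: left_diff_distrib)
      moreover have "(mid, t *\<^sub>R w) + y = (mid, (t + 1) *\<^sub>R w)" using True by (simp add: rw algebra_simps)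
      ultimately have "ereal (real N) \<le> enn2ereal (\<phi> ((mid, t *\<^sub>R w) + y)) - enn2ereal (\<phi> (mid, t *\<^sub>R w))"
        using e1[of t] e1[of "t + 1"] t k by (simp add: enn2ereal_ennreal)
      moreover have "(mid, t *\<^sub>R w) \<in> edom \<phi>" using phi_finite[OF mid] by (simp add: edom_def)
      ultimately show "\<exists>i\<in>edom \<phi>. ereal (real N) \<le> enn2ereal (\<phi> (i + y)) - enn2ereal (\<phi> i)" by blast
    qed
  qed
qed

end

subsection \<open>The action of absolutely continuous measures\<close>

lemma zero_Mloc: "(\<lambda>A. 0) \<in> Mloc" by (rule MlocI) auto

lemma variation_zero: "emeasure (variation (\<lambda>A. 0 :: 'b::euclidean_space)) A = 0"
proof (cases "A \<in> sets borel")
  case True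
  have "pre_variation (\<lambda>A. 0 :: 'b) A \<le> 0"
    unfolding pre_variation_def by (intro SUP_least) simp
  then show ?thesis using True by (simp add: emeasure_variation[OF zero_Mloc])
qed (simp add: emeasure_notin_sets)

lemma msupp_variation_with_density:
  assumes M: "M \<in> Mloc_pos" and f: "loc_integrable M f"
  shows "msupp (variation (with_density M f)) \<subseteq> msupp M"
proof
  fix x assume x: "x \<in> msupp (variation (with_density M f))"
  show "x \<in> msupp M" unfolding msupp_def
  proof (intro CollectI allI impI)
    fix r :: real assume "r > 0"
    then have pos: "0 < emeasure (variation (with_density M f)) (ball x r)" using x by (auto simp: msupp_def)
    show "0 < emeasure M (ball x r)"
    proof (rule ccontr)
      assume "\<not> ?thesis"
      then have "ball x r \<in> null_sets M" using M by (simp add: null_sets_def Mloc_pos_sets)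
      then have "(\<integral>\<^sup>+y\<in>ball x r. ennreal (norm (f y)) \<partial>M) = 0" by (rule nn_integral_null_set)
      then show False using pos variation_with_density_le[OF M f, of "ball x r"] by simp
    qed
  qed
qed

text \<open>The chosen densities agree with the given ones almost everywhere and the singular parts
  vanish, so that the second integral is over the zero measure.\<close>

lemma action_with_density:
  assumes G: "\<gamma> \<in> Mloc_pos" and r: "loc_integrable \<gamma> \<rho>" and w: "loc_integrable \<gamma> w"
  shows "action \<phi> \<gamma> (with_density \<gamma> \<rho>) (with_density \<gamma> w) = (\<integral>\<^sup>+x. \<phi> (\<rho> x, w x) \<partial>\<gamma>)"
proof -
  let ?z = "sum_meas (variation (\<lambda>A::'a set. 0::real)) (variation (\<lambda>A::'a set. 0::'a))"
  have "(\<integral>\<^sup>+x. F x \<partial>?z) = 0" for F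
  proof -
    note V = variation_Mloc_pos[OF zero_Mloc]
    have "emeasure ?z UNIV = 0" by (simp add: sum_meas(3)[OF V V] variation_zero)
    moreover have "UNIV \<in> sets ?z" by (simp add: sum_meas(1)[OF V V])
    ultimately have "AE x in ?z. F x = 0" by (intro AE_I[of _ _ UNIV]) auto
    then have "(\<integral>\<^sup>+x. F x \<partial>?z) = (\<integral>\<^sup>+x. 0 \<partial>?z)" by (rule nn_integral_cong_AE)
    then show ?thesis by simp
  qed
  moreover have "(\<integral>\<^sup>+x. \<phi> (ac_density \<gamma> (with_density \<gamma> \<rho>) x, ac_density \<gamma> (with_density \<gamma> w) x) \<partial>\<gamma>) = (\<integral>\<^sup>+x. \<phi> (\<rho> x, w x) \<partial>\<gamma>)"
    using ac_density_with_density(1)[OF G r] ac_density_with_density(1)[OF G w]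
    by (intro nn_integral_cong_AE, eventually_elim) simp
  ultimately show ?thesis
    unfolding action_def using msupp_variation_with_density[OF G r] msupp_variation_with_density[OF G w]
    by (simp add: ac_density_with_density(2)[OF G r] ac_density_with_density(2)[OF G w] Let_def)
qed

context action_setup
begin

lemma borel_iff: "f \<in> borel_measurable \<gamma> \<longleftrightarrow> f \<in> borel_measurable borel"
  by (simp add: measurable_cong_sets[OF Mloc_pos_sets[OF G] refl])

text \<open>These are the measures for which some flux has finite action. The bounds on the density
  are imposed everywhere, which a change on a null set achieves.\<close>

definition bdens :: "('a set \<Rightarrow> real) \<Rightarrow> bool" where
  "bdens \<mu> \<longleftrightarrow> (\<exists>\<rho>\<in>borel_measurable borel. (\<forall>x. \<rho> x \<in> {a..b}) \<and> \<mu> = with_density \<gamma> \<rho>)"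

lemma bounded_density_loc_integrable:
  assumes "\<rho> \<in> borel_measurable borel" "\<And>x. \<rho> x \<in> {a..b}"
  shows "loc_integrable \<gamma> \<rho>"
proof (rule loc_integrable_bounded[OF G assms(1)])
  show "norm (\<rho> x) \<le> max \<bar>a\<bar> \<bar>b\<bar>" for x using assms(2)[of x] by (auto simp: max_def)
qed

text \<open>Where one of the singular densities is nonzero the recession function is infinite, so
  this set is null for the singular measure \<open>?s\<close>.\<close>

lemma action_finite_ac:
  assumes mu: "\<mu> \<in> Mloc" and nu: "\<nu> \<in> Mloc" and fin: "action \<phi> \<gamma> \<mu> \<nu> < \<infinity>"
  shows "with_density \<gamma> (ac_density \<gamma> \<mu>) = \<mu>" "with_density \<gamma> (ac_density \<gamma> \<nu>) = \<nu>"
proof -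
  let ?m = "sing_part \<gamma> \<mu>" let ?n = "sing_part \<gamma> \<nu>"
  let ?s = "sum_meas (variation ?m) (variation ?n)"
  note m = ac_density[OF mu G] note n = ac_density[OF nu G]
  note V = variation_Mloc_pos[OF m(3)] variation_Mloc_pos[OF n(3)]
  note s = sum_meas(2)[OF V]
  note dm = absolutely_continuous_density[OF m(3) s sum_meas_absolutely_continuous(1)[OF V]]
  note dn = absolutely_continuous_density[OF n(3) s sum_meas_absolutely_continuous(2)[OF V]]
  let ?r = "\<lambda>x. (rn_density ?s ?m x, rn_density ?s ?n x)"
  have [measurable]: "rn_density ?s ?m \<in> borel_measurable ?s" "rn_density ?s ?n \<in> borel_measurable ?s"
    using dm dn by (auto simp: loc_integrable_def)
  have "(\<integral>\<^sup>+x. e2ennreal (recession \<phi> (?r x)) \<partial>?s) < \<infinity>"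
    using fin by (auto simp: action_def Let_def split: if_splits)
  moreover define E where "E = {x\<in>space ?s. rn_density ?s ?m x \<noteq> 0 \<or> rn_density ?s ?n x \<noteq> 0}"
  have E[measurable]: "E \<in> sets ?s" unfolding E_def by measurable
  have "(\<integral>\<^sup>+x. \<infinity> * indicator E x \<partial>?s) \<le> (\<integral>\<^sup>+x. e2ennreal (recession \<phi> (?r x)) \<partial>?s)"
  proof (rule nn_integral_mono)
    fix x show "\<infinity> * indicator E x \<le> e2ennreal (recession \<phi> (?r x))"
    proof (cases "x \<in> E")
      case True
      then have "?r x \<noteq> 0" by (auto simp: E_def zero_prod_def)
      then show ?thesis by (simp add: recession_infinite)
    qed simp
  qed
  ultimately have "(\<integral>\<^sup>+x. \<infinity> * indicator E x \<partial>?s) < \<infinity>" by (rule order.strict_trans1[rotated])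
  then have "emeasure ?s E = 0"
    by (subst (asm) nn_integral_cmult_indicator) (auto simp: ennreal_top_mult split: if_splits)
  then have ae: "AE x in ?s. rn_density ?s ?m x = 0 \<and> rn_density ?s ?n x = 0"
    by (intro AE_I[of _ _ E]) (auto simp: E_def)
  have "with_density ?s (rn_density ?s ?m) = with_density ?s (\<lambda>x. 0)"
    using ae by (intro with_density_cong_AE s) auto
  then have "?m = with_density ?s (\<lambda>x. 0)" using dm(2) by simp
  then have "?m A = 0" for A
    by (rule fun_cong[THEN trans]) (simp add: with_density_def set_lebesgue_integral_def)
  then show "with_density \<gamma> (ac_density \<gamma> \<mu>) = \<mu>" by (simp add: sing_part_def fun_eq_iff)
  have "with_density ?s (rn_density ?s ?n) = with_density ?s (\<lambda>x. 0)"
    using ae by (intro with_density_cong_AE s) auto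
  then have "?n = with_density ?s (\<lambda>x. 0)" using dn(2) by simp
  then have "?n A = 0" for A
    by (rule fun_cong[THEN trans]) (simp add: with_density_def set_lebesgue_integral_def)
  then show "with_density \<gamma> (ac_density \<gamma> \<nu>) = \<nu>" by (simp add: sing_part_def fun_eq_iff)
qed

lemma action_finite_ex:
  assumes mu: "\<mu> \<in> Mloc" and nu: "\<nu> \<in> Mloc" and fin: "action \<phi> \<gamma> \<mu> \<nu> < \<infinity>"
  shows "\<exists>\<rho> w. \<rho> \<in> borel_measurable borel \<and> (\<forall>x. \<rho> x \<in> {a..b}) \<and> loc_integrable \<gamma> w \<and>
    \<mu> = with_density \<gamma> \<rho> \<and> \<nu> = with_density \<gamma> w \<and> action \<phi> \<gamma> \<mu> \<nu> = (\<integral>\<^sup>+x. \<phi> (\<rho> x, w x) \<partial>\<gamma>)"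
proof -
  let ?r = "ac_density \<gamma> \<mu>" let ?w = "ac_density \<gamma> \<nu>"
  note ac = action_finite_ac[OF assms]
  note r = ac_density(1)[OF mu G] note w = ac_density(1)[OF nu G]
  have act: "action \<phi> \<gamma> \<mu> \<nu> = (\<integral>\<^sup>+x. \<phi> (?r x, ?w x) \<partial>\<gamma>)"
    using action_with_density[OF G r w, of \<phi>] unfolding ac .
  have [measurable]: "?r \<in> borel_measurable \<gamma>" using r by (simp add: loc_integrable_def)
  define E where "E = {x\<in>space \<gamma>. \<not> (a \<le> ?r x \<and> ?r x \<le> b)}"
  have E[measurable]: "E \<in> sets \<gamma>" unfolding E_def by measurable
  have "(\<integral>\<^sup>+x. \<infinity> * indicator E x \<partial>\<gamma>) \<le> (\<integral>\<^sup>+x. \<phi> (?r x, ?w x) \<partial>\<gamma>)"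
  proof (rule nn_integral_mono)
    fix x show "\<infinity> * indicator E x \<le> \<phi> (?r x, ?w x)"
    proof (cases "x \<in> E")
      case True
      then have "\<phi> (?r x, ?w x) = \<infinity>" by (intro phi_infinite) (simp add: E_def)
      then show ?thesis by simp
    qed simp
  qed
  then have "(\<integral>\<^sup>+x. \<infinity> * indicator E x \<partial>\<gamma>) < \<infinity>" using fin unfolding act by (rule order.strict_trans1)
  then have "emeasure \<gamma> E = 0"
    by (subst (asm) nn_integral_cmult_indicator) (auto simp: ennreal_top_mult split: if_splits)
  then have ae: "AE x in \<gamma>. a \<le> ?r x \<and> ?r x \<le> b"
    by (intro AE_I[of _ _ E]) (auto simp: E_def)
  \<comment> \<open>The density lies in \<open>[a, b]\<close> almost everywhere; truncation makes
    this hold at every point.\<close>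
  define \<rho> where "\<rho> x = max a (min b (?r x))" for x
  have eq: "AE x in \<gamma>. ?r x = \<rho> x" using ae by eventually_elim (auto simp: \<rho>_def)
  have rm: "\<rho> \<in> borel_measurable \<gamma>" unfolding \<rho>_def by measurable
  show ?thesis
  proof (intro exI[of _ \<rho>] exI[of _ ?w] conjI allI)
    show "\<rho> \<in> borel_measurable borel" using rm by (simp add: borel_iff)
    show "\<rho> x \<in> {a..b}" for x using ab by (auto simp: \<rho>_def)
    show "loc_integrable \<gamma> ?w" by (rule w)
    show "\<mu> = with_density \<gamma> \<rho>" using with_density_cong_AE[OF _ rm G eq] ac(1) by auto
    show "\<nu> = with_density \<gamma> ?w" using ac(2) by simp
    show "action \<phi> \<gamma> \<mu> \<nu> = (\<integral>\<^sup>+x. \<phi> (\<rho> x, ?w x) \<partial>\<gamma>)"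
      unfolding act using eq by (intro nn_integral_cong_AE, eventually_elim) simp
  qed
qed

lemma action_finite_bdens:
  assumes "\<mu> \<in> Mloc" "\<nu> \<in> Mloc" "action \<phi> \<gamma> \<mu> \<nu> < \<infinity>" shows "bdens \<mu>"
  using action_finite_ex[OF assms] unfolding bdens_def by auto

text \<open>Young's inequality with a free weight: \<open>\<theta>\<close> is taken large when the
  action can be made small, and small when the moment of \<open>g\<close> can be.\<close>

lemma pairing_bound:
  fixes g :: "'a \<Rightarrow> 'a"
  assumes mu: "\<mu> \<in> Mloc" and nu: "\<nu> \<in> Mloc" and g: "bfun g" and th: "0 < \<theta>"
  shows "ennreal \<bar>pairing \<nu> g\<bar> \<le> ennreal (\<theta> powr (- q)) * (\<integral>\<^sup>+x. ennreal (norm (g x) powr q) \<partial>\<gamma>)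
     + ennreal (\<theta> powr p / coer) * action \<phi> \<gamma> \<mu> \<nu>"
proof (cases "action \<phi> \<gamma> \<mu> \<nu> = \<infinity>")
  case True
  then show ?thesis using th coer_pos by (simp add: ennreal_mult_top)
next
  case False
  obtain \<rho> w where \<rho>: "\<rho> \<in> borel_measurable borel" "\<And>x. \<rho> x \<in> {a..b}" and w: "loc_integrable \<gamma> w"
    and eq: "\<mu> = with_density \<gamma> \<rho>" "\<nu> = with_density \<gamma> w" "action \<phi> \<gamma> \<mu> \<nu> = (\<integral>\<^sup>+x. \<phi> (\<rho> x, w x) \<partial>\<gamma>)"
    using action_finite_ex[OF mu nu] False by (auto simp: less_top)
  have [measurable]: "w \<in> borel_measurable \<gamma>" using w by (simp add: loc_integrable_def)
  have [measurable]: "g \<in> borel_measurable \<gamma>" using bfun_measurable[OF g] by (simp add: borel_iff)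
  have "ennreal \<bar>pairing \<nu> g\<bar> = ennreal (norm (LINT x|\<gamma>. g x \<bullet> w x))"
    unfolding eq(2) pairing_with_density[OF G w g] by simp
  also have "\<dots> \<le> ennreal (LINT x|\<gamma>. norm (g x \<bullet> w x))" by (intro ennreal_leI integral_norm_bound)
  also have "\<dots> = (\<integral>\<^sup>+x. ennreal (norm (g x \<bullet> w x)) \<partial>\<gamma>)"
    by (intro nn_integral_eq_integral[symmetric] integrable_norm bfun_inner_integrable G w g) auto
  also have "\<dots> \<le> (\<integral>\<^sup>+x. ennreal (\<theta> powr (- q)) * ennreal (norm (g x) powr q) + ennreal (\<theta> powr p / coer) * ennreal (coer * norm (w x) powr p) \<partial>\<gamma>)"
  proof (rule nn_integral_mono)
    fix x
    have "norm (g x \<bullet> w x) \<le> (norm (g x) / \<theta>) * (\<theta> * norm (w x))"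
      using th by (simp add: Cauchy_Schwarz_ineq2)
    also have "\<dots> \<le> (norm (g x) / \<theta>) powr q + (\<theta> * norm (w x)) powr p"
      using th by (intro Young_crude p q_def) auto
    also have "\<dots> = \<theta> powr (- q) * norm (g x) powr q + (\<theta> powr p / coer) * (coer * norm (w x) powr p)"
      using th coer_pos by (simp add: powr_divide powr_mult powr_minus field_simps)
    finally have "ennreal (norm (g x \<bullet> w x)) \<le> ennreal (\<theta> powr (- q) * norm (g x) powr q + (\<theta> powr p / coer) * (coer * norm (w x) powr p))"
      by (rule ennreal_leI)
    then show "ennreal (norm (g x \<bullet> w x)) \<le> ennreal (\<theta> powr (- q)) * ennreal (norm (g x) powr q) + ennreal (\<theta> powr p / coer) * ennreal (coer * norm (w x) powr p)"
      using th coer_pos by (simp add: ennreal_mult[symmetric] ennreal_plus[symmetric] del: ennreal_plus)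
  qed
  also have "\<dots> = ennreal (\<theta> powr (- q)) * (\<integral>\<^sup>+x. ennreal (norm (g x) powr q) \<partial>\<gamma>)
      + ennreal (\<theta> powr p / coer) * (\<integral>\<^sup>+x. ennreal (coer * norm (w x) powr p) \<partial>\<gamma>)"
    by (subst nn_integral_add) (auto simp: nn_integral_cmult)
  also have "\<dots> \<le> ennreal (\<theta> powr (- q)) * (\<integral>\<^sup>+x. ennreal (norm (g x) powr q) \<partial>\<gamma>)
      + ennreal (\<theta> powr p / coer) * (\<integral>\<^sup>+x. \<phi> (\<rho> x, w x) \<partial>\<gamma>)"
    by (intro add_left_mono mult_left_mono nn_integral_mono phi_coercive) auto
  finally show ?thesis unfolding eq(3) .
qed

text \<open>From \<open>norm w \<le> 1 + norm w powr p\<close>. It provides the local integrability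
  in time of the variation of \<open>\<nu>\<close> that \<open>CE\<close> demands.\<close>

lemma variation_bound:
  assumes mu: "\<mu> \<in> Mloc" and nu: "\<nu> \<in> Mloc" and A: "A \<in> sets borel"
  shows "emeasure (variation \<nu>) A \<le> emeasure \<gamma> A + ennreal (1 / coer) * action \<phi> \<gamma> \<mu> \<nu>"
proof (cases "action \<phi> \<gamma> \<mu> \<nu> = \<infinity>")
  case True
  then show ?thesis using coer_pos by (simp add: ennreal_mult_top)
next
  case False
  obtain \<rho> w where \<rho>: "\<rho> \<in> borel_measurable borel" "\<And>x. \<rho> x \<in> {a..b}" and w: "loc_integrable \<gamma> w"
    and eq: "\<mu> = with_density \<gamma> \<rho>" "\<nu> = with_density \<gamma> w" "action \<phi> \<gamma> \<mu> \<nu> = (\<integral>\<^sup>+x. \<phi> (\<rho> x, w x) \<partial>\<gamma>)"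
    using action_finite_ex[OF mu nu] False by (auto simp: less_top)
  have [measurable]: "w \<in> borel_measurable \<gamma>" using w by (simp add: loc_integrable_def)
  have [measurable]: "A \<in> sets \<gamma>" using A by (simp add: Mloc_pos_sets[OF G])
  have "emeasure (variation \<nu>) A \<le> (\<integral>\<^sup>+x\<in>A. ennreal (norm (w x)) \<partial>\<gamma>)"
    unfolding eq(2) by (rule variation_with_density_le[OF G w A])
  also have "\<dots> \<le> (\<integral>\<^sup>+x. indicator A x + ennreal (1 / coer) * ennreal (coer * norm (w x) powr p) \<partial>\<gamma>)"
  proof (rule nn_integral_mono)
    fix x
    have "ennreal (norm (w x)) \<le> ennreal (1 + norm (w x) powr p)"
      using Young_crude[OF p q_def, of 1 "norm (w x)"] by (intro ennreal_leI) simp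
    moreover have "ennreal (1 / coer) * ennreal (coer * norm (w x) powr p) = ennreal (norm (w x) powr p)"
      using coer_pos by (simp add: ennreal_mult[symmetric])
    ultimately show "ennreal (norm (w x)) * indicator A x \<le> indicator A x + ennreal (1 / coer) * ennreal (coer * norm (w x) powr p)"
      by (cases "x \<in> A") auto
  qed
  also have "\<dots> = emeasure \<gamma> A + ennreal (1 / coer) * (\<integral>\<^sup>+x. ennreal (coer * norm (w x) powr p) \<partial>\<gamma>)"
    by (subst nn_integral_add) (auto simp: nn_integral_cmult)
  also have "\<dots> \<le> emeasure \<gamma> A + ennreal (1 / coer) * (\<integral>\<^sup>+x. \<phi> (\<rho> x, w x) \<partial>\<gamma>)"
    by (intro add_left_mono mult_left_mono nn_integral_mono phi_coercive) auto
  finally show ?thesis unfolding eq(3) .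
qed

text \<open>Homogeneity of \<open>\<phi>\<close>, including the infinite case: if scaling produced a
  finite action, scaling back by \<open>1 / c\<close> would make the original one finite.\<close>

lemma action_scale:
  assumes mu: "\<mu> \<in> Mloc" and nu: "\<nu> \<in> Mloc" and c: "c \<noteq> 0"
  shows "action \<phi> \<gamma> \<mu> (\<lambda>A. c *\<^sub>R \<nu> A) = ennreal (\<bar>c\<bar> powr p) * action \<phi> \<gamma> \<mu> \<nu>"
proof -
  have fin: "action \<phi> \<gamma> \<mu> (\<lambda>A. c *\<^sub>R \<nu> A) = ennreal (\<bar>c\<bar> powr p) * action \<phi> \<gamma> \<mu> \<nu>"
    if h: "action \<phi> \<gamma> \<mu> \<nu> < \<infinity>" "\<nu> \<in> Mloc" "c \<noteq> 0" for \<nu> :: "'a set \<Rightarrow> 'a" and c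
  proof -
    obtain \<rho> w where \<rho>: "\<rho> \<in> borel_measurable borel" "\<And>x. \<rho> x \<in> {a..b}" and w: "loc_integrable \<gamma> w"
      and eq: "\<mu> = with_density \<gamma> \<rho>" "\<nu> = with_density \<gamma> w" "action \<phi> \<gamma> \<mu> \<nu> = (\<integral>\<^sup>+x. \<phi> (\<rho> x, w x) \<partial>\<gamma>)"
      using action_finite_ex[OF mu h(2,1)] by auto
    have "(\<lambda>A. c *\<^sub>R \<nu> A) = with_density \<gamma> (\<lambda>x. c *\<^sub>R w x)" by (auto simp: with_density_scaleR eq(2))
    then have "action \<phi> \<gamma> \<mu> (\<lambda>A. c *\<^sub>R \<nu> A) = (\<integral>\<^sup>+x. \<phi> (\<rho> x, c *\<^sub>R w x) \<partial>\<gamma>)"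
      unfolding eq(1) using action_with_density[OF G bounded_density_loc_integrable[OF \<rho>] loc_integrable_scaleR[OF w]] by simp
    also have "\<dots> = ennreal (\<bar>c\<bar> powr p) * (\<integral>\<^sup>+x. \<phi> (\<rho> x, w x) \<partial>\<gamma>)"
      unfolding phi_hom[OF h(3)] using h(3) by (intro nn_integral_cmult_real) auto
    finally show ?thesis by (simp add: eq(3))
  qed
  show ?thesis
  proof (cases "action \<phi> \<gamma> \<mu> \<nu> < \<infinity>")
    case False
    have "action \<phi> \<gamma> \<mu> (\<lambda>A. c *\<^sub>R \<nu> A) = \<infinity>"
    proof (rule ccontr)
      assume "\<not> ?thesis"
      then have lt: "action \<phi> \<gamma> \<mu> (\<lambda>A. c *\<^sub>R \<nu> A) < \<infinity>" by (simp add: less_top)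
      from fin[OF this Mloc_scaleR[OF nu], of "1 / c"] c
      have "action \<phi> \<gamma> \<mu> \<nu> = ennreal (\<bar>1 / c\<bar> powr p) * action \<phi> \<gamma> \<mu> (\<lambda>A. c *\<^sub>R \<nu> A)" by simp
      also have "\<dots> < \<infinity>" using lt by (simp add: ennreal_mult_less_top)
      finally show False using False by simp
    qed
    then show ?thesis using False c by (simp add: not_less top_unique ennreal_mult_top)
  qed (use fin nu c in auto)
qed

lemma action_zero: assumes "bdens \<mu>" shows "action \<phi> \<gamma> \<mu> (\<lambda>A. 0) = 0"
proof -
  obtain \<rho> where r: "\<rho> \<in> borel_measurable borel" "\<And>x. \<rho> x \<in> {a..b}" "\<mu> = with_density \<gamma> \<rho>"
    using assms by (auto simp: bdens_def)
  have z: "loc_integrable \<gamma> (\<lambda>x. 0 :: 'a)" by (rule loc_integrable_bounded[OF G, of _ 0]) auto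
  have "(\<lambda>A. 0) = with_density \<gamma> (\<lambda>x. 0 :: 'a)" by (auto simp: with_density_def set_lebesgue_integral_def)
  then have "action \<phi> \<gamma> \<mu> (\<lambda>A. 0) = (\<integral>\<^sup>+x. \<phi> (\<rho> x, 0) \<partial>\<gamma>)"
    using action_with_density[OF G bounded_density_loc_integrable[OF r(1,2)] z, of \<phi>] r(3) by simp
  also have "\<dots> = (\<integral>\<^sup>+x. 0 \<partial>\<gamma>)" using r(2) by (intro nn_integral_cong phi_zero) auto
  finally show ?thesis by simp
qed

end

subsection \<open>Test functions\<close>

text \<open>Continuously differentiable functions of compact support. The gradient is a separate
  argument because it is what the fluxes are paired with.\<close>

definition test :: "('a::euclidean_space \<Rightarrow> real) \<Rightarrow> ('a \<Rightarrow> 'a) \<Rightarrow> bool" where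
  "test f g \<longleftrightarrow> (\<forall>x. GDERIV f x :> g x) \<and> continuous_on UNIV g \<and> bounded {x. f x \<noteq> 0}"

lemma GDERIV_continuous_on: "(\<And>x. GDERIV f x :> g x) \<Longrightarrow> continuous_on UNIV f"
  unfolding gderiv_def by (intro has_derivative_continuous_on) (auto intro: has_derivative_at_withinI)

lemma test_continuous: "test f g \<Longrightarrow> continuous_on UNIV f" "test f g \<Longrightarrow> continuous_on UNIV g"
  by (auto simp: test_def intro: GDERIV_continuous_on)

lemma GDERIV_support:
  assumes d: "\<And>x. GDERIV f x :> g x"
  shows "{x. g x \<noteq> 0} \<subseteq> closure {x. f x \<noteq> 0}"
proof (rule ccontr)
  assume "\<not> ?thesis"
  then obtain x where x: "g x \<noteq> 0" "x \<notin> closure {x. f x \<noteq> 0}" by blast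
  have "(f has_derivative (\<lambda>h. h \<bullet> g x)) (at x)" using d[of x] by (simp add: gderiv_def)
  moreover have "(f has_derivative (\<lambda>h. 0)) (at x)"
  proof (rule has_derivative_transform_within_open[of "\<lambda>_. 0" _ x UNIV "- closure {x. f x \<noteq> 0}"])
    show "0 = f y" if "y \<in> - closure {x. f x \<noteq> 0}" for y
      using that closure_subset[of "{x. f x \<noteq> 0}"] by auto
  qed (use x in auto)
  ultimately have "(\<lambda>h. h \<bullet> g x) = (\<lambda>h. 0)" by (rule has_derivative_unique)
  from fun_cong[OF this, of "g x"] show False using x by simp
qed

lemma bfun_continuous:
  fixes F :: "'a::euclidean_space \<Rightarrow> 'b::euclidean_space"
  assumes c: "continuous_on UNIV F" and b: "bounded {x. F x \<noteq> 0}"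
  shows "bfun F"
proof -
  obtain R where R: "\<And>x. F x \<noteq> 0 \<Longrightarrow> norm x \<le> R" using b by (auto simp: bounded_iff)
  have "compact (F ` cball 0 R)" by (intro compact_continuous_image continuous_on_subset[OF c]) auto
  then obtain C where "\<forall>y\<in>F ` cball 0 R. norm y \<le> C"
    using compact_imp_bounded bounded_iff by blast
  then have C: "\<And>x. norm x \<le> R \<Longrightarrow> norm (F x) \<le> C" by auto
  show ?thesis
  proof (rule bfunI[of F "\<bar>C\<bar>" "R + 1"])
    show "F \<in> borel_measurable borel" using c by (rule borel_measurable_continuous_onI)
    fix x show "norm (F x) \<le> \<bar>C\<bar> * indicator (ball 0 (R + 1)) x"
    proof (cases "F x = 0")
      case False
      then have "norm x \<le> R" by (rule R)
      then show ?thesis using C[of x] by simp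
    qed simp
  qed
qed

lemma test_bfun: assumes "test f g" shows "bfun f" "bfun g"
proof -
  have b: "bounded {x. f x \<noteq> 0}" using assms by (simp add: test_def)
  then show "bfun f" using assms by (intro bfun_continuous test_continuous)
  have "bounded {x. g x \<noteq> 0}"
    using assms by (intro bounded_subset[OF bounded_closure[OF b]] GDERIV_support) (auto simp: test_def)
  then show "bfun g" using assms by (intro bfun_continuous test_continuous)
qed

lemma test_add:
  assumes f: "test f g" and f': "test f' g'" shows "test (\<lambda>x. f x + f' x) (\<lambda>x. g x + g' x)"
  unfolding test_def
proof (intro conjI allI)
  show "GDERIV (\<lambda>x. f x + f' x) x :> g x + g' x" for x
    using f f' by (intro GDERIV_add) (auto simp: test_def)
  show "continuous_on UNIV (\<lambda>x. g x + g' x)"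
    by (rule continuous_on_add[OF test_continuous(2)[OF f] test_continuous(2)[OF f']])
  have "bounded ({x. f x \<noteq> 0} \<union> {x. f' x \<noteq> 0})" using f f' by (simp add: test_def)
  then show "bounded {x. f x + f' x \<noteq> 0}" by (rule bounded_subset) auto
qed

lemma test_mult:
  assumes f: "test f g" and f': "test f' g'" shows "test (\<lambda>x. f x * f' x) (\<lambda>x. f x *\<^sub>R g' x + f' x *\<^sub>R g x)"
  unfolding test_def
proof (intro conjI allI)
  show "GDERIV (\<lambda>x. f x * f' x) x :> f x *\<^sub>R g' x + f' x *\<^sub>R g x" for x
    using f f' by (intro GDERIV_mult) (auto simp: test_def)
  show "continuous_on UNIV (\<lambda>x. f x *\<^sub>R g' x + f' x *\<^sub>R g x)"
    by (intro continuous_on_add continuous_on_scaleR test_continuous[OF f] test_continuous[OF f'])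
  have "bounded {x. f x \<noteq> 0}" using f by (simp add: test_def)
  then show "bounded {x. f x * f' x \<noteq> 0}" by (rule bounded_subset) auto
qed

lemma test_scale: "test f g \<Longrightarrow> test (\<lambda>x. c * f x) (\<lambda>x. c *\<^sub>R g x)"
  unfolding test_def
proof (intro conjI allI)
  assume t: "(\<forall>x. GDERIV f x :> g x) \<and> continuous_on UNIV g \<and> bounded {x. f x \<noteq> 0}"
  fix x show "GDERIV (\<lambda>x. c * f x) x :> c *\<^sub>R g x"
    using GDERIV_mult[OF GDERIV_const[of c], of f x "g x"] t by simp
qed (auto intro!: continuous_intros intro: bounded_subset)

lemma test_diff: "test f g \<Longrightarrow> test f' g' \<Longrightarrow> test (\<lambda>x. f x - f' x) (\<lambda>x. g x - g' x)"
  using test_add[of f g "\<lambda>x. -1 * f' x" "\<lambda>x. -1 *\<^sub>R g' x"] test_scale[of f' g' "-1"] by simp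

lemma test_zero: "test (\<lambda>x. 0) (\<lambda>x. 0)" by (simp add: test_def GDERIV_const)

text \<open>A product of factors \<open>1 - f k\<close> equals 1 far away and so is no test
  function, but its complement to 1 is. Two such complements \<open>e\<close> and \<open>f\<close>
  combine to \<open>e + f - e * f\<close>.\<close>

lemma test_prod:
  assumes "finite K" "\<And>k. k \<in> K \<Longrightarrow> \<exists>g. test (f k) g"
  shows "\<exists>g. test (\<lambda>x. 1 - (\<Prod>k\<in>K. 1 - f k x)) g"
  using assms
proof (induction K rule: finite_induct)
  case empty then show ?case using test_zero by auto
next
  case (insert k K)
  then obtain g where "test (\<lambda>x. 1 - (\<Prod>k\<in>K. 1 - f k x)) g" by blast
  moreover obtain h where "test (f k) h" using insert by blast
  ultimately show ?case
  proof -
    assume a: "test (\<lambda>x. 1 - (\<Prod>k\<in>K. 1 - f k x)) g" "test (f k) h"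
    have "(\<lambda>x. 1 - (\<Prod>k\<in>insert k K. 1 - f k x)) = (\<lambda>x. (1 - (\<Prod>k\<in>K. 1 - f k x)) + f k x - (1 - (\<Prod>k\<in>K. 1 - f k x)) * f k x)"
      using insert(1,2) by (simp add: algebra_simps fun_eq_iff)
    then show ?thesis using test_diff[OF test_add[OF a] test_mult[OF a]] by auto
  qed
qed

section \<open>Continuously differentiable bumps\<close>

lemma DERIV_max_square: "((\<lambda>u::real. (max 0 u)\<^sup>2) has_field_derivative 2 * max 0 u) (at u)"
proof -
  consider "u > 0" | "u < 0" | "u = 0" by linarith
  then show ?thesis
  proof cases
    case 1
    have "((\<lambda>u::real. (max 0 u)\<^sup>2) has_field_derivative 2 * u) (at u)"
    proof (rule has_field_derivative_transform_within_open[of "\<lambda>u. u\<^sup>2" _ u "{0<..}"])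
      show "((\<lambda>u::real. u\<^sup>2) has_field_derivative 2 * u) (at u)" by (auto intro!: derivative_eq_intros)
    qed (use 1 in auto)
    then show ?thesis using 1 by simp
  next
    case 2
    have "((\<lambda>u::real. (max 0 u)\<^sup>2) has_field_derivative 0) (at u)"
      by (rule has_field_derivative_transform_within_open[of "\<lambda>u. 0" _ u "{..<0}"]) (use 2 in auto)
    then show ?thesis using 2 by simp
  next
    case 3
    have "((\<lambda>h. (max 0 h)\<^sup>2 / h) \<longlongrightarrow> 0) (at (0::real))"
    proof (rule Lim_null_comparison)
      show "\<forall>\<^sub>F h in at 0. norm ((max 0 h)\<^sup>2 / h) \<le> \<bar>h\<bar>"
        by (rule always_eventually) (auto simp: max_def power2_eq_square)
      show "((\<lambda>h. \<bar>h\<bar>) \<longlongrightarrow> 0) (at (0::real))" by (intro tendsto_eq_intros) auto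
    qed
    then show ?thesis using 3 by (simp only: DERIV_def) simp
  qed
qed

text \<open>The outer square makes the truncation continuously differentiable; the function is
  positive exactly on the open ball. Small radii serve to approximate open sets, large ones as
  cut-offs for the total mass.\<close>

definition bump :: "'a::euclidean_space \<Rightarrow> real \<Rightarrow> 'a \<Rightarrow> real" where
  "bump c r x = (max 0 (1 - (norm (x - c))\<^sup>2 / r\<^sup>2))\<^sup>2"

definition bump_grad :: "'a::euclidean_space \<Rightarrow> real \<Rightarrow> 'a \<Rightarrow> 'a" where
  "bump_grad c r x = (2 * max 0 (1 - (norm (x - c))\<^sup>2 / r\<^sup>2)) *\<^sub>R (- 2 / r\<^sup>2) *\<^sub>R (x - c)"

lemma bump_range: "0 \<le> bump c r x" "bump c r x \<le> 1"
  unfolding bump_def by (auto intro: power_le_one)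

lemma bump_pos_iff: assumes "r > 0" shows "bump c r x \<noteq> 0 \<longleftrightarrow> x \<in> ball c r"
proof -
  have "bump c r x \<noteq> 0 \<longleftrightarrow> 0 < 1 - (norm (x - c))\<^sup>2 / r\<^sup>2" unfolding bump_def power_eq_0_iff by linarith
  also have "\<dots> \<longleftrightarrow> (norm (x - c))\<^sup>2 / r\<^sup>2 < 1" by simp
  also have "\<dots> \<longleftrightarrow> (norm (x - c))\<^sup>2 < r\<^sup>2" using assms by (simp add: divide_less_eq)
  also have "\<dots> \<longleftrightarrow> norm (x - c) < r" using assms by (meson less_imp_le norm_ge_zero power2_less_imp_less power_strict_mono pos2)
  finally show ?thesis by (simp add: dist_norm norm_minus_commute)
qed

lemma test_bump: assumes "r > 0" shows "test (bump c r) (bump_grad c r)"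
  unfolding test_def
proof (intro conjI allI)
  fix x
  have "GDERIV (\<lambda>x. 1 - (norm (x - c))\<^sup>2 / r\<^sup>2) x :> (- 2 / r\<^sup>2) *\<^sub>R (x - c)"
  proof -
    have "((\<lambda>x. 1 - inverse (r\<^sup>2) * ((x - c) \<bullet> (x - c))) has_derivative (\<lambda>h. 0 - inverse (r\<^sup>2) * ((x - c) \<bullet> (h - 0) + (h - 0) \<bullet> (x - c)))) (at x)"
      by (intro derivative_intros)
    also have "(\<lambda>h. 0 - inverse (r\<^sup>2) * ((x - c) \<bullet> (h - 0) + (h - 0) \<bullet> (x - c))) = (\<lambda>h. h \<bullet> ((- 2 / r\<^sup>2) *\<^sub>R (x - c)))"
      by (simp add: inner_commute[of _ "x - c"] divide_inverse fun_eq_iff)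
    finally show ?thesis unfolding gderiv_def power2_norm_eq_inner by (simp add: divide_inverse mult.commute)
  qed
  from GDERIV_DERIV_compose[OF this DERIV_max_square]
  show "GDERIV (bump c r) x :> bump_grad c r x" by (simp add: bump_def[abs_def] bump_grad_def)
  show "continuous_on UNIV (bump_grad c r)" unfolding bump_grad_def[abs_def]
    by (intro continuous_intros) (use assms in auto)
  show "bounded {x. bump c r x \<noteq> 0}" by (simp add: bump_pos_iff[OF assms] ball_def[symmetric])
qed

section \<open>Density of test functions in \<open>L\<^sup>1\<close>\<close>

definition approximable :: "'a::euclidean_space measure \<Rightarrow> ('a \<Rightarrow> real) \<Rightarrow> bool" where
  "approximable M F \<longleftrightarrow> integrable M F \<and> (\<forall>\<epsilon>>0. \<exists>f g. test f g \<and> (LINT x|M. \<bar>F x - f x\<bar>) < \<epsilon>)"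

lemma bfun_integrable:
  assumes M: "M \<in> Mloc_pos" and f: "bfun (f :: 'a::euclidean_space \<Rightarrow> real)" shows "integrable M f"
proof -
  have "loc_integrable M (\<lambda>x. 1::real)" by (rule loc_integrable_bounded[OF M, of _ 1]) auto
  from bfun_inner_integrable[OF M this f] show ?thesis by simp
qed

lemma approximable_test: "M \<in> Mloc_pos \<Longrightarrow> test f g \<Longrightarrow> approximable M f"
  unfolding approximable_def using test_bfun(1) bfun_integrable by (auto intro!: exI[of _ f] exI[of _ g])

lemma approximable_add:
  assumes M: "M \<in> Mloc_pos" and F: "approximable M F" "approximable M F'"
  shows "approximable M (\<lambda>x. F x + F' x)"
  unfolding approximable_def
proof (intro conjI allI impI)
  have i: "integrable M F" "integrable M F'" using F by (auto simp: approximable_def)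
  then show "integrable M (\<lambda>x. F x + F' x)" by simp
  fix \<epsilon> :: real assume "\<epsilon> > 0"
  then have "\<epsilon> / 2 > 0" by simp
  then obtain f g f' g' where t: "test f g" "(LINT x|M. \<bar>F x - f x\<bar>) < \<epsilon> / 2" "test f' g'" "(LINT x|M. \<bar>F' x - f' x\<bar>) < \<epsilon> / 2"
    using F unfolding approximable_def by blast
  note j = t(1)[THEN test_bfun(1), THEN bfun_integrable[OF M]] t(3)[THEN test_bfun(1), THEN bfun_integrable[OF M]]
  have "(LINT x|M. \<bar>F x + F' x - (f x + f' x)\<bar>) \<le> (LINT x|M. \<bar>F x - f x\<bar> + \<bar>F' x - f' x\<bar>)"
    using i j by (intro integral_mono) auto
  also have "\<dots> = (LINT x|M. \<bar>F x - f x\<bar>) + (LINT x|M. \<bar>F' x - f' x\<bar>)" using i j by (intro Bochner_Integration.integral_add) auto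
  also have "\<dots> < \<epsilon>" using t by simp
  finally show "\<exists>f g. test f g \<and> (LINT x|M. \<bar>F x + F' x - f x\<bar>) < \<epsilon>" using test_add[OF t(1,3)] by blast
qed

lemma approximable_scale:
  assumes M: "M \<in> Mloc_pos" and F: "approximable M F"
  shows "approximable M (\<lambda>x. c * F x)"
proof (cases "c = 0")
  case True then show ?thesis using approximable_test[OF M test_zero] by simp
next
  case False
  show ?thesis unfolding approximable_def
  proof (intro conjI allI impI)
    show "integrable M (\<lambda>x. c * F x)" using F by (auto simp: approximable_def)
    fix \<epsilon> :: real assume "\<epsilon> > 0"
    then have "\<epsilon> / \<bar>c\<bar> > 0" using False by simp
    then obtain f g where t: "test f g" "(LINT x|M. \<bar>F x - f x\<bar>) < \<epsilon> / \<bar>c\<bar>"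
      using F unfolding approximable_def by blast
    have "(LINT x|M. \<bar>c * F x - c * f x\<bar>) = \<bar>c\<bar> * (LINT x|M. \<bar>F x - f x\<bar>)"
      by (simp add: right_diff_distrib[symmetric] abs_mult)
    also have "\<dots> < \<epsilon>" using t(2) False by (simp add: field_simps)
    finally show "\<exists>f g. test f g \<and> (LINT x|M. \<bar>c * F x - f x\<bar>) < \<epsilon>" using test_scale[OF t(1)] by blast
  qed
qed

lemma approximable_dominated:
  fixes F :: "nat \<Rightarrow> 'a::euclidean_space \<Rightarrow> real"
  assumes M: "M \<in> Mloc_pos" and F: "\<And>n. approximable M (F n)" and F0: "F0 \<in> borel_measurable M"
    and lim: "\<And>x. (\<lambda>n. F n x) \<longlonglongrightarrow> F0 x" and w: "integrable M w" and le: "\<And>n x. \<bar>F n x\<bar> \<le> w x"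
  shows "approximable M F0"
  unfolding approximable_def
proof (intro conjI allI impI)
  have i: "integrable M (F n)" for n using F by (auto simp: approximable_def)
  have [measurable]: "F n \<in> borel_measurable M" for n using i[of n] by (rule borel_measurable_integrable)
  note F0[measurable]
  have le0: "\<bar>F0 x\<bar> \<le> w x" for x
    by (rule LIMSEQ_le_const2[OF tendsto_rabs[OF lim]]) (use le in auto)
  show i0: "integrable M F0"
    by (rule Bochner_Integration.integrable_bound[OF w F0]) (use le0 order_trans[OF abs_ge_zero le0] in auto)
  have "(\<lambda>n. LINT x|M. \<bar>F n x - F0 x\<bar>) \<longlonglongrightarrow> (LINT x|M. 0)"
  proof (rule integral_dominated_convergence[where w="\<lambda>x. 2 * w x"])
    show "AE x in M. (\<lambda>n. \<bar>F n x - F0 x\<bar>) \<longlonglongrightarrow> 0"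
      by (rule AE_I2) (use lim LIM_zero tendsto_rabs_zero in blast)
    show "AE x in M. norm \<bar>F n x - F0 x\<bar> \<le> 2 * w x" for n
    proof (rule AE_I2)
      fix x show "norm \<bar>F n x - F0 x\<bar> \<le> 2 * w x" using le[of n x] le0[of x] by simp
    qed
  qed (use w in auto)
  then have z: "(\<lambda>n. LINT x|M. \<bar>F n x - F0 x\<bar>) \<longlonglongrightarrow> 0" by simp
  fix \<epsilon> :: real assume "\<epsilon> > 0"
  then have "\<epsilon> / 2 > 0" by simp
  then obtain n where n: "(LINT x|M. \<bar>F n x - F0 x\<bar>) < \<epsilon> / 2"
    using order_tendstoD(2)[OF z \<open>\<epsilon> / 2 > 0\<close>] by (auto simp: eventually_sequentially simp del: less_divide_eq_numeral1)
  obtain f g where t: "test f g" "(LINT x|M. \<bar>F n x - f x\<bar>) < \<epsilon> / 2"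
    using F[of n] \<open>\<epsilon> / 2 > 0\<close> unfolding approximable_def by blast
  note j = t(1)[THEN test_bfun(1), THEN bfun_integrable[OF M]]
  have "(LINT x|M. \<bar>F0 x - f x\<bar>) \<le> (LINT x|M. \<bar>F n x - F0 x\<bar> + \<bar>F n x - f x\<bar>)"
    using i i0 j by (intro integral_mono) auto
  also have "\<dots> = (LINT x|M. \<bar>F n x - F0 x\<bar>) + (LINT x|M. \<bar>F n x - f x\<bar>)" using i i0 j by (intro Bochner_Integration.integral_add) auto
  also have "\<dots> < \<epsilon>" using t n by simp
  finally show "\<exists>f g. test f g \<and> (LINT x|M. \<bar>F0 x - f x\<bar>) < \<epsilon>" using t(1) by blast
qed

lemma bborel_integrable: "M \<in> Mloc_pos \<Longrightarrow> A \<in> bborel \<Longrightarrow> integrable M (indicator A :: _ \<Rightarrow> real)"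
  using Mloc_pos_finite by (intro integrable_real_indicator) (auto simp: Mloc_pos_sets bborelD)

text \<open>\<open>U\<close> is a countable union of balls, and \<open>e n\<close> joins the bumps
  of the first \<open>n\<close> of them. It is merely positive on these balls; \<open>F n\<close>
  sharpens it, since \<open>(1 - e n) ^ n\<close> tends to 0 at every point of
  \<open>U\<close>.\<close>

lemma approximable_open:
  assumes M: "M \<in> Mloc_pos" and U: "open U" "bounded U"
  shows "approximable M (indicator U)"
proof -
  define \<C> where "\<C> = {ball x r |x r. r > 0 \<and> ball x r \<subseteq> U}"
  obtain \<D> where D: "\<D> \<subseteq> \<C>" "countable \<D>" "\<Union>\<D> = \<Union>\<C>"
    using Lindelof[of \<C>] by (auto simp: \<C>_def)
  have "\<Union>\<C> = U"
  proof
    show "\<Union>\<C> \<subseteq> U" by (auto simp: \<C>_def)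
    show "U \<subseteq> \<Union>\<C>"
    proof
      fix x assume "x \<in> U"
      then obtain r where "r > 0" "ball x r \<subseteq> U" using U(1) open_contains_ball by blast
      then have "ball x r \<in> \<C>" "x \<in> ball x r" by (auto simp: \<C>_def)
      then show "x \<in> \<Union>\<C>" by blast
    qed
  qed
  show ?thesis
  proof (cases "U = {}")
    case True
    have "(indicator {} :: 'a \<Rightarrow> real) = (\<lambda>x. 0)" by (simp add: fun_eq_iff)
    then show ?thesis using True approximable_test[OF M test_zero] by simp
  next
    case False
    then have "\<D> \<noteq> {}" using D \<open>\<Union>\<C> = U\<close> by auto
    then have B: "range (from_nat_into \<D>) = \<D>" using D(2) by (rule range_from_nat_into)
    define B where "B = from_nat_into \<D>"
    note B = B[folded B_def]
    have "\<exists>x r. r > 0 \<and> B k = ball x r \<and> ball x r \<subseteq> U" for k :: nat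
    proof -
      have "B k \<in> \<D>" using B by blast
      then have "B k \<in> \<C>" using D(1) by blast
      then show ?thesis by (auto simp: \<C>_def)
    qed
    then obtain c r where cr: "\<And>k. r k > 0" "\<And>k. B k = ball (c k) (r k)" "\<And>k. ball (c k) (r k) \<subseteq> U" by metis
    define e where "e n x = 1 - (\<Prod>k<n. 1 - bump (c k) (r k) x)" for n :: nat and x
    define F where "F n x = 1 - (1 - e n x) ^ n" for n :: nat and x
    have te: "\<exists>g. test (e n) g" for n
      unfolding e_def[abs_def] using test_bump[OF cr(1)] by (intro test_prod) auto
    have tF: "\<exists>g. test (F n) g" for n
      using test_prod[of "{..<n}" "\<lambda>_. e n"] te[of n] unfolding F_def[abs_def] by auto
    have pr: "0 \<le> (\<Prod>k<n. 1 - bump (c k) (r k) x)" "(\<Prod>k<n. 1 - bump (c k) (r k) x) \<le> 1" for n x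
      using bump_range by (auto intro!: prod_nonneg prod_le_1)
    have out: "F n x = 0" if "x \<notin> U" for n x
    proof -
      have "bump (c k) (r k) x = 0" for k using bump_pos_iff[OF cr(1)] cr(3)[of k] that by blast
      then show ?thesis by (simp add: F_def e_def)
    qed
    have F01: "0 \<le> F n x" "F n x \<le> 1" for n x
      using pr[where n=n and x=x] by (auto simp: F_def e_def intro: power_le_one)
    have lim: "(\<lambda>n. F n x) \<longlonglongrightarrow> indicator U x" for x
    proof (cases "x \<in> U")
      case True
      then obtain k where k: "x \<in> ball (c k) (r k)" using \<open>\<Union>\<C> = U\<close> D(3) B cr(2) by (metis UnionE imageE)
      then have "bump (c k) (r k) x > 0" using bump_pos_iff[OF cr(1)[of k], of "c k" x] bump_range(1)[of "c k" "r k" x] by linarith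
      define y where "y = 1 - bump (c k) (r k) x"
      have y: "0 \<le> y" "y < 1" using \<open>bump (c k) (r k) x > 0\<close> bump_range by (auto simp: y_def)
      have "(\<lambda>n. (\<Prod>k<n. 1 - bump (c k) (r k) x) ^ n) \<longlonglongrightarrow> 0"
      proof (rule tendsto_sandwich[OF _ _ tendsto_const LIMSEQ_power_zero[of y]])
        show "\<forall>\<^sub>F n in sequentially. 0 \<le> (\<Prod>k<n. 1 - bump (c k) (r k) x) ^ n" using pr by simp
        show "\<forall>\<^sub>F n in sequentially. (\<Prod>k<n. 1 - bump (c k) (r k) x) ^ n \<le> y ^ n"
        \<comment> \<open>For \<open>n > k\<close> the product contains the factor
          \<open>y < 1\<close>, so its \<open>n\<close>-th power is at most
          \<open>y ^ n\<close>.\<close>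
        proof (rule eventually_sequentiallyI[of "Suc k"])
          fix n assume "Suc k \<le> n"
          then have "(\<Prod>j<n. 1 - bump (c j) (r j) x) = y * (\<Prod>j\<in>{..<n} - {k}. 1 - bump (c j) (r j) x)"
            by (subst prod.remove[of _ k]) (auto simp: y_def)
          also have "\<dots> \<le> y * 1" using y bump_range by (intro mult_left_mono prod_le_1) auto
          finally show "(\<Prod>k<n. 1 - bump (c k) (r k) x) ^ n \<le> y ^ n" using pr by (intro power_mono) auto
        qed
      qed (use y in auto)
      then have "(\<lambda>n. 1 - (\<Prod>k<n. 1 - bump (c k) (r k) x) ^ n) \<longlonglongrightarrow> 1 - 0" by (intro tendsto_intros)
      then show ?thesis using True by (simp add: F_def e_def)
    qed (simp add: out)
    show ?thesis
    proof (rule approximable_dominated[OF M, where F=F and w="indicator U"])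
      show "approximable M (F n)" for n using tF approximable_test[OF M] by blast
      show "(indicator U :: 'a \<Rightarrow> real) \<in> borel_measurable M" using U M by (intro borel_measurable_indicator) (simp add: Mloc_pos_sets)
      show "integrable M (indicator U :: 'a \<Rightarrow> real)" using U by (intro bborel_integrable M bborelI) auto
      show "\<bar>F n x\<bar> \<le> indicator U x" for n x using F01[where n=n and x=x] out[where n=n and x=x] by (cases "x \<in> U") auto
    qed (rule lim)
  qed
qed

text \<open>Induction over the intersection-stable generator of open sets. The ball keeps all
  measures finite, so that complements are differences of integrable functions.\<close>

lemma approximable_bounded_set:
  fixes A :: "'a::euclidean_space set"
  assumes M: "M \<in> Mloc_pos" and A: "A \<in> sets borel"
  shows "approximable M (indicator (A \<inter> ball 0 r))"
proof -
  have "Int_stable {S :: 'a set. open S}" by (auto simp: Int_stable_def)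
  moreover have "{S :: 'a set. open S} \<subseteq> Pow UNIV" by simp
  moreover have "A \<in> sigma_sets UNIV {S. open S}" using A by (simp add: borel_def)
  ultimately show ?thesis
  proof (induction rule: sigma_sets_induct_disjoint)
    case (basic A)
    then show ?case by (intro approximable_open M) (auto intro: bounded_subset[OF bounded_ball])
  next
    case empty then show ?case using approximable_test[OF M test_zero] by (simp add: indicator_def)
  next
    case (compl A)
    have "approximable M (\<lambda>x. indicator (ball 0 r) x + (-1) * indicator (A \<inter> ball 0 r) x)"
      by (intro approximable_add approximable_scale approximable_open M compl) auto
    also have "(\<lambda>x. indicator (ball 0 r) x + (-1) * indicator (A \<inter> ball 0 r) x) = (indicator ((UNIV - A) \<inter> ball 0 r) :: 'a \<Rightarrow> real)"
      by (auto simp: indicator_def)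
    finally show ?case .
  next
    case (union A)
    have A: "A i \<in> sets borel" for i using union by (auto simp: borel_def)
    have fin: "approximable M (indicator ((\<Union>i<n. A i) \<inter> ball 0 r))" for n
    proof (induction n)
      case 0 then show ?case using approximable_test[OF M test_zero] by (simp add: indicator_def)
    next
      case (Suc n)
      have d: "A n \<inter> A i = {}" if "i < n" for i using union(1) that by (intro disjoint_family_onD[of A UNIV]) auto
      have "approximable M (\<lambda>x. indicator ((\<Union>i<n. A i) \<inter> ball 0 r) x + indicator (A n \<inter> ball 0 r) x)"
        by (intro approximable_add M Suc union)
      also have "(\<lambda>x. indicator ((\<Union>i<n. A i) \<inter> ball 0 r) x + indicator (A n \<inter> ball 0 r) x) = (indicator ((\<Union>i<Suc n. A i) \<inter> ball 0 r) :: 'a \<Rightarrow> real)"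
        using d by (auto simp: indicator_def lessThan_Suc fun_eq_iff)
      finally show ?case .
    qed
    show ?case
    proof (rule approximable_dominated[OF M fin, where w="indicator (ball 0 r)"])
      show "(indicator ((\<Union>i. A i) \<inter> ball 0 r) :: 'a \<Rightarrow> real) \<in> borel_measurable M"
        using A M by (intro borel_measurable_indicator) (auto simp: Mloc_pos_sets)
      show "integrable M (indicator (ball 0 r) :: 'a \<Rightarrow> real)" by (rule bborel_integrable[OF M bborel_ball])
      show "\<bar>indicator ((\<Union>i<n. A i) \<inter> ball 0 r) x\<bar> \<le> (indicator (ball 0 r) x :: real)" for n x
        by (auto simp: indicator_def)
      fix x
      show "(\<lambda>n. indicator ((\<Union>i<n. A i) \<inter> ball 0 r) x) \<longlonglongrightarrow> (indicator ((\<Union>i. A i) \<inter> ball 0 r) x :: real)"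
      proof (cases "x \<in> (\<Union>i. A i)")
        case True
        then obtain i where "x \<in> A i" by auto
        then have "\<forall>n\<ge>Suc i. indicator ((\<Union>i<n. A i) \<inter> ball 0 r) x = (indicator ((\<Union>i. A i) \<inter> ball 0 r) x :: real)"
          by (auto simp: indicator_def)
        then show ?thesis by (intro tendsto_eventually) (auto simp: eventually_sequentially)
      next
        case False
        then have "indicator ((\<Union>i<n. A i) \<inter> ball 0 r) x = (0::real)" "indicator ((\<Union>i. A i) \<inter> ball 0 r) x = (0::real)" for n
          by (auto simp: indicator_def)
        then show ?thesis by simp
      qed
    qed
  qed
qed

lemma approximable_integrable:
  assumes M: "M \<in> Mloc_pos" and F: "integrable M F" shows "approximable M F"
  using F
proof (induction rule: integrable_induct)
  case (base A c)
  have A: "A \<in> sets borel" using base M by (simp add: Mloc_pos_sets)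
  have "approximable M (indicator A)"
  proof (rule approximable_dominated[OF M, where F="\<lambda>n. indicator (A \<inter> ball 0 (real n))" and w="indicator A"])
    show "approximable M (indicator (A \<inter> ball 0 (real n)))" for n by (rule approximable_bounded_set[OF M A])
    show "(indicator A :: _ \<Rightarrow> real) \<in> borel_measurable M" using base by simp
    show "integrable M (indicator A :: _ \<Rightarrow> real)" using base by (intro integrable_real_indicator) auto
    fix x :: 'a
    obtain m :: nat where m: "norm x < real m" using reals_Archimedean2 by blast
    then have "\<forall>n\<ge>m. indicator (A \<inter> ball 0 (real n)) x = (indicator A x :: real)"
      by (auto simp: indicator_def)
    then show "(\<lambda>n. indicator (A \<inter> ball 0 (real n)) x) \<longlonglongrightarrow> (indicator A x :: real)"
      by (intro tendsto_eventually) (auto simp: eventually_sequentially)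
  qed (auto simp: indicator_def)
  from approximable_scale[OF M this, of c] show ?case by (simp add: mult.commute)
next
  case (add f g) then show ?case by (intro approximable_add M)
next
  case (lim f s)
  have sp: "space M = UNIV" by (rule Mloc_pos_space[OF M])
  show ?case
  proof (rule approximable_dominated[OF M])
    show "approximable M (s i)" for i by (rule lim)
    show "f \<in> borel_measurable M" using lim by auto
    show "integrable M (\<lambda>x. 2 * norm (f x))" using lim by auto
    show "(\<lambda>i. s i x) \<longlonglongrightarrow> f x" for x using lim sp by auto
    show "\<bar>s i x\<bar> \<le> 2 * norm (f x)" for i x using lim sp by auto
  qed
qed

lemma test_dense:
  assumes "M \<in> Mloc_pos" "integrable M F" "0 < \<epsilon>"
  obtains f g where "test f g" "(LINT x|M. \<bar>F x - f x\<bar>) < \<epsilon>"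
  using approximable_integrable[OF assms(1,2)] assms(3) unfolding approximable_def by blast

subsection \<open>Measures are determined by test functions\<close>

lemma bfun_indicator: "A \<in> bborel \<Longrightarrow> bfun (indicator A :: _ \<Rightarrow> real)"
proof -
  assume A: "A \<in> bborel"
  obtain n :: nat where "A \<subseteq> ball 0 (real n)" using bborel_in_ball[OF A] by blast
  moreover have "A \<in> sets borel" using A by (rule bborelD)
  ultimately show ?thesis by (intro bfunI[of _ 1 "real n"] borel_measurable_indicator) (auto simp: indicator_def)
qed

lemma pairing_indicator:
  assumes mu: "\<mu> \<in> Mloc" and A: "A \<in> bborel" shows "pairing \<mu> (indicator A) = (\<mu> A :: real)"
proof -
  obtain f where f: "loc_integrable (variation \<mu>) f" "with_density (variation \<mu>) f = \<mu>"
    "\<And>F. pairing \<mu> F = (LINT x|variation \<mu>. F x \<bullet> f x)"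
    using pairing_eq_integral[OF mu] by blast
  have "pairing \<mu> (indicator A) = with_density (variation \<mu>) f A"
    using A by (simp add: f(3) with_density_def set_lebesgue_integral_def)
  then show ?thesis by (simp add: f(2))
qed

lemma pairing_diff_measure:
  assumes mu: "\<mu> \<in> Mloc" and nu: "\<nu> \<in> Mloc" and F: "bfun F"
  shows "pairing (\<lambda>A. \<mu> A - \<nu> A) F = pairing \<mu> F - pairing \<nu> F"
proof -
  note V = variation_Mloc_pos[OF mu] variation_Mloc_pos[OF nu]
  let ?S = "sum_meas (variation \<mu>) (variation \<nu>)"
  note S = sum_meas(2)[OF V]
  note d1 = absolutely_continuous_density[OF mu S sum_meas_absolutely_continuous(1)[OF V]]
  note d2 = absolutely_continuous_density[OF nu S sum_meas_absolutely_continuous(2)[OF V]]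
  have eq: "(\<lambda>A. \<mu> A - \<nu> A) = with_density ?S (\<lambda>x. rn_density ?S \<mu> x - rn_density ?S \<nu> x)"
    using d1 d2 by (simp add: fun_eq_iff with_density_diff)
  have "pairing (\<lambda>A. \<mu> A - \<nu> A) F = (LINT x|?S. F x \<bullet> (rn_density ?S \<mu> x - rn_density ?S \<nu> x))"
    unfolding eq by (intro pairing_with_density S F loc_integrable_diff d1 d2)
  also have "\<dots> = (LINT x|?S. F x \<bullet> rn_density ?S \<mu> x) - (LINT x|?S. F x \<bullet> rn_density ?S \<nu> x)"
    unfolding inner_diff_right by (intro Bochner_Integration.integral_diff bfun_inner_integrable S F d1 d2)
  finally show ?thesis
    using pairing_with_density[OF S d1(1) F] pairing_with_density[OF S d2(1) F] by (simp add: d1(2) d2(2))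
qed

text \<open>\<open>\<xi>\<close> is the difference and \<open>\<theta>\<close> its polar density.
  The weight \<open>\<bar>\<theta>\<bar>\<close> in \<open>M\<close> turns the error of a pairing
  into an \<open>L\<^sup>1(M)\<close> distance, so approximating the indicator of \<open>A\<close>
  by test functions gives \<open>\<xi> A = 0\<close>.\<close>

lemma Mloc_eqI:
  fixes \<mu> \<nu> :: "'a::euclidean_space set \<Rightarrow> real"
  assumes mu: "\<mu> \<in> Mloc" and nu: "\<nu> \<in> Mloc" and eq: "\<And>f g. test f g \<Longrightarrow> pairing \<mu> f = pairing \<nu> f"
  shows "\<mu> = \<nu>"
proof -
  define \<xi> where "\<xi> A = \<mu> A - \<nu> A" for A
  have xi: "\<xi> \<in> Mloc" unfolding \<xi>_def by (intro Mloc_diff mu nu)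
  obtain \<theta> where th: "loc_integrable (variation \<xi>) \<theta>" "with_density (variation \<xi>) \<theta> = \<xi>"
    "\<And>F. pairing \<xi> F = (LINT x|variation \<xi>. F x \<bullet> \<theta> x)"
    using pairing_eq_integral[OF xi] by blast
  note V = variation_Mloc_pos[OF xi]
  define M where "M = density (variation \<xi>) (\<lambda>x. ennreal \<bar>\<theta> x\<bar>)"
  have [measurable]: "\<theta> \<in> borel_measurable (variation \<xi>)" using th by (simp add: loc_integrable_def)
  have M: "M \<in> Mloc_pos"
  proof (rule Mloc_posI)
    fix A :: "'a set" assume A: "A \<in> bborel"
    then have [measurable]: "A \<in> sets (variation \<xi>)" by (simp add: bborelD)
    have "emeasure M A = (\<integral>\<^sup>+x. ennreal (norm (indicator A x *\<^sub>R \<theta> x)) \<partial>variation \<xi>)"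
      unfolding M_def by (subst emeasure_density) (auto intro!: nn_integral_cong simp: indicator_def bborelD[OF A])
    also have "\<dots> < \<infinity>" using loc_integrableD[OF th(1) A] by (simp add: set_integrable_def integrable_iff_bounded)
    finally show "emeasure M A < \<infinity>" .
  qed (simp add: M_def)
  have "\<xi> A = 0" for A
  proof (cases "A \<in> bborel")
    case A: True
    have "\<bar>\<xi> A\<bar> < \<epsilon>" if e: "\<epsilon> > 0" for \<epsilon>
    proof -
      obtain f g where f: "test f g" "(LINT x|M. \<bar>indicator A x - f x\<bar>) < \<epsilon>"
        using test_dense[OF M bborel_integrable[OF M A] e] by blast
      have fm[measurable]: "f \<in> borel_measurable borel" using test_bfun(1)[OF f(1)] by (rule bfun_measurable)
      have [measurable]: "f \<in> borel_measurable (variation \<xi>)" "A \<in> sets (variation \<xi>)"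
        using bborelD(1)[OF A] fm by (auto simp: measurable_cong_sets[OF sets_variation refl])
      have "pairing \<xi> f = 0"
        unfolding \<xi>_def using eq[OF f(1)] by (simp add: pairing_diff_measure[OF mu nu test_bfun(1)[OF f(1)]])
      then have "\<xi> A = pairing \<xi> (\<lambda>x. indicator A x - f x)"
        using pairing_add(2)[OF xi bfun_indicator[OF A] test_bfun(1)[OF f(1)]] pairing_indicator[OF xi A] by simp
      also have "\<bar>\<dots>\<bar> \<le> (LINT x|variation \<xi>. \<bar>(indicator A x - f x) \<bullet> \<theta> x\<bar>)"
        unfolding th(3) using integral_norm_bound[of "variation \<xi>" "\<lambda>x. (indicator A x - f x) \<bullet> \<theta> x"] by simp
      also have "\<dots> = (LINT x|M. \<bar>indicator A x - f x\<bar>)"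
        unfolding M_def by (subst integral_density) (auto simp: abs_mult mult.commute)
      finally show ?thesis using f(2) by simp
    qed
    then show ?thesis by (metis abs_le_zero_iff dense_ge order_less_imp_le not_less)
  qed (rule Mloc_notin[OF xi])
  then show ?thesis by (auto simp: \<xi>_def fun_eq_iff)
qed

subsection \<open>Measures with density in the interval\<close>

context action_setup
begin

definition dbound :: real where "dbound = max \<bar>a\<bar> \<bar>b\<bar>"

lemma dbound: "0 \<le> dbound" "x \<in> {a..b} \<Longrightarrow> \<bar>x\<bar> \<le> dbound"
  by (auto simp: dbound_def)

lemma bdensD:
  assumes "bdens \<mu>"
  obtains \<rho> where "\<rho> \<in> borel_measurable borel" "\<And>x. \<rho> x \<in> {a..b}" "loc_integrable \<gamma> \<rho>" "\<mu> = with_density \<gamma> \<rho>"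
  using assms bounded_density_loc_integrable unfolding bdens_def by blast

lemma bdens_Mloc: "bdens \<mu> \<Longrightarrow> \<mu> \<in> Mloc"
  by (elim bdensD) (auto intro: with_density_Mloc G)

lemma bdens_pairing_le:
  assumes mu: "bdens \<mu>" and F: "bfun F"
  shows "\<bar>pairing \<mu> F\<bar> \<le> dbound * (LINT x|\<gamma>. \<bar>F x\<bar>)"
proof -
  obtain \<rho> where r: "\<rho> \<in> borel_measurable borel" "\<And>x. \<rho> x \<in> {a..b}" "loc_integrable \<gamma> \<rho>" "\<mu> = with_density \<gamma> \<rho>"
    using mu by (rule bdensD) blast
  have "pairing \<mu> F = (LINT x|\<gamma>. F x \<bullet> \<rho> x)" unfolding r(4) by (rule pairing_with_density[OF G r(3) F])
  also have "\<bar>\<dots>\<bar> \<le> (LINT x|\<gamma>. \<bar>F x \<bullet> \<rho> x\<bar>)"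
    using integral_norm_bound[of \<gamma> "\<lambda>x. F x \<bullet> \<rho> x"] by simp
  also have "\<dots> \<le> (LINT x|\<gamma>. dbound * \<bar>F x\<bar>)"
  proof (rule integral_mono)
    show "integrable \<gamma> (\<lambda>x. \<bar>F x \<bullet> \<rho> x\<bar>)" by (intro integrable_abs bfun_inner_integrable G r F)
    show "integrable \<gamma> (\<lambda>x. dbound * \<bar>F x\<bar>)" using bfun_integrable[OF G F] by simp
    show "\<bar>F x \<bullet> \<rho> x\<bar> \<le> dbound * \<bar>F x\<bar>" for x
      using mult_right_mono[OF dbound(2)[OF r(2)], of "\<bar>F x\<bar>" x] by (simp add: abs_mult mult.commute)
  qed
  finally show ?thesis by simp
qed

lemma bdens_pairing_diff_le:
  assumes mu: "bdens \<mu>" and F: "bfun F" "bfun F'"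
  shows "\<bar>pairing \<mu> F - pairing \<mu> F'\<bar> \<le> dbound * (LINT x|\<gamma>. \<bar>F x - F' x\<bar>)"
proof -
  have "bfun (\<lambda>x. F x - F' x)"
  proof -
    obtain C R where CR: "0 \<le> C" "\<And>x. norm (F x) \<le> C * indicator (ball 0 R) x" using F(1) by (rule bfunE) blast
    obtain C' R' where CR': "0 \<le> C'" "\<And>x. norm (F' x) \<le> C' * indicator (ball 0 R') x" using F(2) by (rule bfunE) blast
    show ?thesis
    proof (rule bfunI[of _ "C + C'" "max R R'"])
      show "(\<lambda>x. F x - F' x) \<in> borel_measurable borel" using F[THEN bfun_measurable] by measurable
      fix x
      have "norm (F x - F' x) \<le> C * indicator (ball 0 R) x + C' * indicator (ball 0 R') x"
        by (rule order_trans[OF norm_triangle_ineq4 add_mono[OF CR(2) CR'(2)]])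
      also have "\<dots> \<le> C * indicator (ball 0 (max R R')) x + C' * indicator (ball 0 (max R R')) x"
        using CR(1) CR'(1) by (intro add_mono mult_left_mono) (auto simp: indicator_def)
      finally show "norm (F x - F' x) \<le> (C + C') * indicator (ball 0 (max R R')) x" by (simp add: distrib_right)
    qed
  qed
  from bdens_pairing_le[OF mu this] show ?thesis by (simp add: pairing_add(2)[OF bdens_Mloc[OF mu] F])
qed

lemma bdens_sets:
  assumes mu: "bdens \<mu>" and A: "A \<in> bborel"
  shows "a * measure \<gamma> A \<le> \<mu> A" "\<mu> A \<le> b * measure \<gamma> A" "\<bar>\<mu> A\<bar> \<le> dbound * measure \<gamma> A"
proof -
  obtain \<rho> where r: "\<rho> \<in> borel_measurable borel" "\<And>x. \<rho> x \<in> {a..b}" "loc_integrable \<gamma> \<rho>" "\<mu> = with_density \<gamma> \<rho>"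
    using mu by (rule bdensD) blast
  have i: "integrable \<gamma> (\<lambda>x. indicator A x *\<^sub>R \<rho> x)" using loc_integrableD[OF r(3) A] by (simp add: set_integrable_def)
  note j = bborel_integrable[OF G A]
  have eq: "\<mu> A = (LINT x|\<gamma>. indicator A x *\<^sub>R \<rho> x)" using A by (simp add: r(4) with_density_def set_lebesgue_integral_def)
  have m: "(LINT x|\<gamma>. c * indicator A x) = c * measure \<gamma> A" for c
    using A by (simp add: Mloc_pos_sets[OF G] Mloc_pos_space[OF G] bborelD)
  have le: "a * indicator A x \<le> indicator A x *\<^sub>R \<rho> x" "indicator A x *\<^sub>R \<rho> x \<le> b * indicator A x" for x
    using r(2)[of x] by (cases "x \<in> A"; simp)+
  have "(LINT x|\<gamma>. a * indicator A x) \<le> \<mu> A" unfolding eq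
    by (intro integral_mono integrable_mult_right i j le)
  then show "a * measure \<gamma> A \<le> \<mu> A" by (simp only: m)
  have "\<mu> A \<le> (LINT x|\<gamma>. b * indicator A x)" unfolding eq
    by (intro integral_mono integrable_mult_right i j le)
  then show "\<mu> A \<le> b * measure \<gamma> A" by (simp only: m)
  moreover have "- dbound * measure \<gamma> A \<le> a * measure \<gamma> A" "b * measure \<gamma> A \<le> dbound * measure \<gamma> A"
    by (intro mult_right_mono; auto simp: dbound_def)+
  ultimately show "\<bar>\<mu> A\<bar> \<le> dbound * measure \<gamma> A" using \<open>a * measure \<gamma> A \<le> \<mu> A\<close> by linarith
qed

text \<open>The setwise inequalities between \<open>a \<gamma>\<close>, \<open>\<mu>\<close> and
  \<open>b \<gamma>\<close> pass to limits, and this lemma recovers a density from them. Subtracting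
  \<open>a \<gamma>\<close> leads to the situation of \<open>bounded_density\<close>.\<close>

lemma bdensI:
  assumes mu: "\<mu> \<in> Mloc" and le: "\<And>A. A \<in> bborel \<Longrightarrow> a * measure \<gamma> A \<le> \<mu> A \<and> \<mu> A \<le> b * measure \<gamma> A"
  shows "bdens \<mu>"
proof -
  have ca: "loc_integrable \<gamma> (\<lambda>x. a)" by (rule loc_integrable_bounded[OF G, of _ "\<bar>a\<bar>"]) auto
  have wa: "with_density \<gamma> (\<lambda>x. a) A = a * measure \<gamma> A" if "A \<in> bborel" for A
    using that Mloc_pos_finite[OF G that] by (simp add: with_density_def set_lebesgue_integral_def Mloc_pos_sets[OF G] Mloc_pos_space[OF G] bborelD)
  define \<kappa> where "\<kappa> A = \<mu> A - with_density \<gamma> (\<lambda>x. a) A" for A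
  have k: "\<kappa> \<in> Mloc" unfolding \<kappa>_def by (intro Mloc_diff mu with_density_Mloc G ca)
  have "0 \<le> \<kappa> A \<and> \<kappa> A \<le> (b - a) * measure \<gamma> A" if "A \<in> bborel" for A
    using le[OF that] unfolding \<kappa>_def wa[OF that] by (simp add: left_diff_distrib)
  from bounded_density[OF k G this] ab obtain f where f: "f \<in> borel_measurable borel" "\<And>x. 0 \<le> f x \<and> f x \<le> b - a"
    "\<kappa> = with_density \<gamma> f" by auto
  have lf: "loc_integrable \<gamma> f" by (rule loc_integrable_bounded[OF G f(1), of "b - a"]) (use f(2) in auto)
  have "\<mu> = with_density \<gamma> (\<lambda>x. f x + a)"
  proof
    fix A show "\<mu> A = with_density \<gamma> (\<lambda>x. f x + a) A"
      using fun_cong[OF f(3), of A] by (simp add: with_density_add[OF lf ca] \<kappa>_def)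
  qed
  moreover have "f x + a \<in> {a..b}" for x using f(2)[of x] by auto
  ultimately show ?thesis using f(1) unfolding bdens_def by (intro bexI[of _ "\<lambda>x. f x + a"]) auto
qed

text \<open>The test function depends on \<open>F\<close> and \<open>\<epsilon>\<close> alone: one
  approximation in \<open>L\<^sup>1(\<gamma>)\<close> serves all measures with density in
  \<open>[a, b]\<close>.\<close>

lemma bfun_test_close:
  assumes F: "bfun F" and e: "0 < \<epsilon>"
  obtains f g where "test f g" "\<And>\<mu>. bdens \<mu> \<Longrightarrow> \<bar>pairing \<mu> F - pairing \<mu> f\<bar> < \<epsilon>"
proof -
  have "0 < \<epsilon> / (dbound + 1)" using e dbound(1) by simp
  then obtain f g where f: "test f g" "(LINT x|\<gamma>. \<bar>F x - f x\<bar>) < \<epsilon> / (dbound + 1)"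
    using test_dense[OF G bfun_integrable[OF G F]] by blast
  have "\<bar>pairing \<mu> F - pairing \<mu> f\<bar> < \<epsilon>" if "bdens \<mu>" for \<mu>
  proof -
    have "\<bar>pairing \<mu> F - pairing \<mu> f\<bar> \<le> dbound * (LINT x|\<gamma>. \<bar>F x - f x\<bar>)"
      by (rule bdens_pairing_diff_le[OF that F test_bfun(1)[OF f(1)]])
    also have "\<dots> \<le> dbound * (\<epsilon> / (dbound + 1))" using f(2) dbound(1) by (intro mult_left_mono) auto
    also have "\<dots> < \<epsilon>" using e dbound(1) by (simp add: field_simps)
    finally show ?thesis .
  qed
  then show thesis using that f(1) by blast
qed

lemma bdens_tendsto:
  assumes mu: "\<forall>\<^sub>F t in L. bdens (\<mu> t)" and mu0: "bdens \<mu>0"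
    and lim: "\<And>f g. test f g \<Longrightarrow> ((\<lambda>t. pairing (\<mu> t) f) \<longlongrightarrow> pairing \<mu>0 f) L" and F: "bfun F"
  shows "((\<lambda>t. pairing (\<mu> t) F) \<longlongrightarrow> pairing \<mu>0 F) L"
proof (rule tendstoI)
  fix \<epsilon> :: real assume "0 < \<epsilon>"
  then have e: "0 < \<epsilon> / 3" by simp
  obtain f g where f: "test f g" "\<And>\<mu>. bdens \<mu> \<Longrightarrow> \<bar>pairing \<mu> F - pairing \<mu> f\<bar> < \<epsilon> / 3"
    using bfun_test_close[OF F e] by blast
  show "\<forall>\<^sub>F t in L. dist (pairing (\<mu> t) F) (pairing \<mu>0 F) < \<epsilon>"
    using mu tendstoD[OF lim[OF f(1)] e]
  proof eventually_elim
    case (elim t)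
    then show ?case using f(2)[of "\<mu> t"] f(2)[OF mu0] unfolding dist_real_def by linarith
  qed
qed

text \<open>By uniform approximation the pairings converge for all bounded functions of bounded
  support, in particular the values on bounded sets. Countable additivity of the limit holds because
  the remainders are bounded, uniformly in \<open>n\<close>, by \<open>dbound\<close> times those of
  \<open>\<gamma>\<close>.\<close>

lemma bdens_limit:
  fixes \<mu> :: "nat \<Rightarrow> 'a set \<Rightarrow> real"
  assumes mu: "\<And>n. bdens (\<mu> n)" and conv: "\<And>f g. test f g \<Longrightarrow> convergent (\<lambda>n. pairing (\<mu> n) f)"
  obtains \<mu>0 where "bdens \<mu>0" "\<And>F. bfun F \<Longrightarrow> (\<lambda>n. pairing (\<mu> n) F) \<longlonglongrightarrow> pairing \<mu>0 F"
proof -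
  have convF: "convergent (\<lambda>n. pairing (\<mu> n) F)" if F: "bfun F" for F
    unfolding Cauchy_convergent_iff[symmetric]
  proof (rule metric_CauchyI)
    fix \<epsilon> :: real assume "0 < \<epsilon>"
    then have e: "0 < \<epsilon> / 3" by simp
    obtain f g where f: "test f g" "\<And>\<mu>. bdens \<mu> \<Longrightarrow> \<bar>pairing \<mu> F - pairing \<mu> f\<bar> < \<epsilon> / 3"
      using bfun_test_close[OF F e] by blast
    obtain N where N: "\<forall>m\<ge>N. \<forall>n\<ge>N. dist (pairing (\<mu> m) f) (pairing (\<mu> n) f) < \<epsilon> / 3"
      using metric_CauchyD[OF convergent_Cauchy[OF conv[OF f(1)]] e] by blast
    show "\<exists>N. \<forall>m\<ge>N. \<forall>n\<ge>N. dist (pairing (\<mu> m) F) (pairing (\<mu> n) F) < \<epsilon>"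
    proof (intro exI[of _ N] allI impI)
      fix m n assume "N \<le> m" "N \<le> n"
      then have "dist (pairing (\<mu> m) f) (pairing (\<mu> n) f) < \<epsilon> / 3" using N by blast
      then show "dist (pairing (\<mu> m) F) (pairing (\<mu> n) F) < \<epsilon>"
        using f(2)[OF mu, of m] f(2)[OF mu, of n] unfolding dist_real_def by linarith
    qed
  qed
  define \<mu>0 where "\<mu>0 A = (if A \<in> bborel then lim (\<lambda>n. \<mu> n A) else 0)" for A
  have lim: "(\<lambda>n. \<mu> n A) \<longlonglongrightarrow> \<mu>0 A" if A: "A \<in> bborel" for A
    using convF[OF bfun_indicator[OF A]] A
    by (simp add: pairing_indicator[OF bdens_Mloc[OF mu] A] \<mu>0_def convergent_LIMSEQ_iff)
  have M0: "\<mu>0 \<in> Mloc"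
  proof (rule MlocI)
    fix A :: "nat \<Rightarrow> 'a set" assume A: "\<And>n. A n \<in> bborel" "disjoint_family A" and U: "(\<Union>n. A n) \<in> bborel"
    let ?U = "\<Union>n. A n"
    have fin: "(\<Union>i<k. A i) \<in> bborel" for k using A by (intro bborel_subset[OF U]) (auto dest: bborelD)
    have sumk: "(\<Sum>i<k. \<nu> (A i)) = \<nu> (\<Union>i<k. A i)" if nu: "\<nu> \<in> Mloc" for \<nu> :: "'a set \<Rightarrow> real" and k
    proof (induction k)
      case 0 then show ?case using Mloc_empty[OF nu] by simp
    next
      case (Suc k)
      have d: "A k \<inter> A i = {}" if "i < k" for i using A(2) that by (intro disjoint_family_onD[of A UNIV]) auto
      have "\<nu> (A k \<union> (\<Union>i<k. A i)) = \<nu> (A k) + \<nu> (\<Union>i<k. A i)"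
        using d by (intro Mloc_Un[OF nu A(1) fin]) auto
      then show ?case using Suc by (simp add: lessThan_Suc add.commute)
    qed
    have one: "loc_integrable \<gamma> (\<lambda>x. 1::real)" by (rule loc_integrable_bounded[OF G, of _ 1]) auto
    have w1: "with_density \<gamma> (\<lambda>x. 1::real) B = measure \<gamma> B" if "B \<in> bborel" for B
      using that Mloc_pos_finite[OF G that] by (simp add: with_density_def set_lebesgue_integral_def Mloc_pos_sets[OF G] Mloc_pos_space[OF G] bborelD)
    note W = with_density_Mloc[OF G one]
    have gs: "(\<lambda>k. measure \<gamma> (\<Union>i<k. A i)) \<longlonglongrightarrow> measure \<gamma> ?U"
    proof -
      have "(\<lambda>n. with_density \<gamma> (\<lambda>x. 1::real) (A n)) sums with_density \<gamma> (\<lambda>x. 1::real) ?U"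
        using A U by (intro MlocD_sums[OF W]) (auto dest: bborelD)
      then show ?thesis unfolding sums_def sumk[OF W] w1[OF fin] w1[OF U] .
    qed
    have bnd: "\<bar>\<mu>0 ?U - (\<Sum>i<k. \<mu>0 (A i))\<bar> \<le> dbound * (measure \<gamma> ?U - measure \<gamma> (\<Union>i<k. A i))" for k
    proof (rule LIMSEQ_le_const2)
      show "(\<lambda>n. \<bar>\<mu> n ?U - (\<Sum>i<k. \<mu> n (A i))\<bar>) \<longlonglongrightarrow> \<bar>\<mu>0 ?U - (\<Sum>i<k. \<mu>0 (A i))\<bar>"
        by (intro tendsto_intros lim A U)
      have "\<bar>\<mu> n ?U - (\<Sum>i<k. \<mu> n (A i))\<bar> \<le> dbound * (measure \<gamma> ?U - measure \<gamma> (\<Union>i<k. A i))" for n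
      proof -
        have D: "?U - (\<Union>i<k. A i) \<in> bborel" using U fin by (intro bborel_Diff) (auto dest: bborelD)
        have s: "(\<Union>i<k. A i) \<subseteq> ?U" by auto
        have "\<mu> n ?U - (\<Sum>i<k. \<mu> n (A i)) = \<mu> n (?U - (\<Union>i<k. A i))"
          unfolding sumk[OF bdens_Mloc[OF mu]] using Mloc_Diff[OF bdens_Mloc[OF mu] U fin s] by simp
        moreover have "measure \<gamma> ?U - measure \<gamma> (\<Union>i<k. A i) = measure \<gamma> (?U - (\<Union>i<k. A i))"
          using Mloc_Diff[OF W U fin s] unfolding w1[OF U] w1[OF fin] w1[OF D] by simp
        ultimately show ?thesis using bdens_sets(3)[OF mu D] by simp
      qed
      then show "\<exists>N. \<forall>n\<ge>N. \<bar>\<mu> n ?U - (\<Sum>i<k. \<mu> n (A i))\<bar> \<le> dbound * (measure \<gamma> ?U - measure \<gamma> (\<Union>i<k. A i))" by blast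
    qed
    have "(\<lambda>k. \<mu>0 ?U - (\<Sum>i<k. \<mu>0 (A i))) \<longlonglongrightarrow> 0"
    proof (rule Lim_null_comparison)
      show "\<forall>\<^sub>F k in sequentially. norm (\<mu>0 ?U - (\<Sum>i<k. \<mu>0 (A i))) \<le> dbound * (measure \<gamma> ?U - measure \<gamma> (\<Union>i<k. A i))"
        using bnd by simp
      have "(\<lambda>k. dbound * (measure \<gamma> ?U - measure \<gamma> (\<Union>i<k. A i))) \<longlonglongrightarrow> dbound * (measure \<gamma> ?U - measure \<gamma> ?U)"
        by (intro tendsto_intros gs)
      then show "(\<lambda>k. dbound * (measure \<gamma> ?U - measure \<gamma> (\<Union>i<k. A i))) \<longlonglongrightarrow> 0" by simp
    qed
    from tendsto_diff[OF tendsto_const[of "\<mu>0 ?U"] this]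
    show "(\<lambda>n. \<mu>0 (A n)) sums \<mu>0 ?U" by (simp add: sums_def)
  qed (simp add: \<mu>0_def)
  have bd: "bdens \<mu>0"
  proof (rule bdensI[OF M0])
    fix A :: "'a set" assume A: "A \<in> bborel"
    have "a * measure \<gamma> A \<le> \<mu>0 A" by (rule LIMSEQ_le_const[OF lim[OF A]]) (use bdens_sets(1)[OF mu A] in auto)
    moreover have "\<mu>0 A \<le> b * measure \<gamma> A" by (rule LIMSEQ_le_const2[OF lim[OF A]]) (use bdens_sets(2)[OF mu A] in auto)
    ultimately show "a * measure \<gamma> A \<le> \<mu>0 A \<and> \<mu>0 A \<le> b * measure \<gamma> A" by simp
  qed
  have "(\<lambda>n. pairing (\<mu> n) F) \<longlonglongrightarrow> pairing \<mu>0 F" if F: "bfun F" for F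
  proof (rule LIMSEQ_I)
    fix \<epsilon> :: real assume "0 < \<epsilon>"
    then have e: "0 < \<epsilon> / 3" by simp
    obtain S C R where S: "0 \<le> C" "\<And>n::nat. S n \<in> borel_measurable borel" "\<And>n. finite (range (S n))"
      "\<And>n x. norm (S n x) \<le> C * indicator (ball 0 R) x" "\<And>x. (\<lambda>n. S n x) \<longlonglongrightarrow> F x"
      "\<And>x. norm (F x) \<le> C * indicator (ball 0 R) x"
      using bfun_simple_approx[OF F] by metis
    have Sb: "bfun (S k)" for k by (rule bfunI[OF S(2,4)])
    have [measurable]: "S k \<in> borel_measurable \<gamma>" "F \<in> borel_measurable \<gamma>" for k
      using S(2)[of k] bfun_measurable[OF F] by (auto simp: borel_iff)
    have "(\<lambda>k. LINT x|\<gamma>. \<bar>F x - S k x\<bar>) \<longlonglongrightarrow> (LINT x|\<gamma>. 0)"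
    proof (rule integral_dominated_convergence[where w="\<lambda>x. 2 * (C * indicator (ball 0 R) x)"])
      show "integrable \<gamma> (\<lambda>x. 2 * (C * indicator (ball 0 R) x))"
        using bborel_integrable[OF G bborel_ball[of 0 R]] by (intro integrable_mult_right) auto
      show "AE x in \<gamma>. (\<lambda>k. \<bar>F x - S k x\<bar>) \<longlonglongrightarrow> 0"
      proof (rule AE_I2)
        fix x
        have "(\<lambda>k. \<bar>F x - S k x\<bar>) \<longlonglongrightarrow> \<bar>F x - F x\<bar>" by (intro tendsto_intros S)
        then show "(\<lambda>k. \<bar>F x - S k x\<bar>) \<longlonglongrightarrow> 0" by simp
      qed
      show "AE x in \<gamma>. norm \<bar>F x - S k x\<bar> \<le> 2 * (C * indicator (ball 0 R) x)" for k
      proof (rule AE_I2)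
        fix x show "norm \<bar>F x - S k x\<bar> \<le> 2 * (C * indicator (ball 0 R) x)" using S(4)[of k x] S(6)[of x] unfolding real_norm_def by linarith
      qed
    qed measurable
    then have z: "(\<lambda>k. dbound * (LINT x|\<gamma>. \<bar>F x - S k x\<bar>)) \<longlonglongrightarrow> dbound * (LINT x|\<gamma>. 0)" by (intro tendsto_intros)
    obtain k where k: "dbound * (LINT x|\<gamma>. \<bar>F x - S k x\<bar>) < \<epsilon> / 3"
      using order_tendstoD(2)[OF z, of "\<epsilon> / 3"] e by (auto simp: eventually_sequentially simp del: less_divide_eq_numeral1)
    \<comment> \<open>The pairing with a simple function is a finite sum of values on bounded sets.
      \<open>k\<close> was chosen so that replacing \<open>F\<close> by \<open>S k\<close> costs
      less than \<open>\<epsilon> / 3\<close> for every measure involved.\<close>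
    have sl: "(\<lambda>n. pairing (\<mu> n) (S k)) \<longlonglongrightarrow> pairing \<mu>0 (S k)"
      unfolding pairing_simple[OF bdens_Mloc[OF mu] S(2,3,4)] pairing_simple[OF M0 S(2,3,4)]
    proof (intro tendsto_sum tendsto_inner tendsto_const)
      fix v assume "v \<in> range (S k) - {0}"
      then have v: "v \<noteq> 0" by auto
      have "{x. S k x = v} \<in> bborel"
      proof (rule bborel_subset[OF bborel_ball[of 0 R]])
        show "{x. S k x = v} \<subseteq> ball 0 R"
        proof
          fix x assume "x \<in> {x. S k x = v}"
          then show "x \<in> ball 0 R" using S(4)[of k x] v by (cases "x \<in> ball 0 R") auto
        qed
        show "{x. S k x = v} \<in> sets borel" using S(2)[of k] by measurable
      qed
      then show "(\<lambda>n. \<mu> n {x. S k x = v}) \<longlonglongrightarrow> \<mu>0 {x. S k x = v}" by (rule lim)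
    qed
    from LIMSEQ_D[OF sl e] obtain N where N: "\<And>n. n \<ge> N \<Longrightarrow> norm (pairing (\<mu> n) (S k) - pairing \<mu>0 (S k)) < \<epsilon> / 3" by blast
    have "norm (pairing (\<mu> n) F - pairing \<mu>0 F) < \<epsilon>" if "n \<ge> N" for n
      using N[OF that] bdens_pairing_diff_le[OF mu F Sb, of n k] bdens_pairing_diff_le[OF bd F Sb, of k] k
      unfolding real_norm_def by linarith
    then show "\<exists>N. \<forall>n\<ge>N. norm (pairing (\<mu> n) F - pairing \<mu>0 F) < \<epsilon>" by blast
  qed
  then show thesis using that bd by blast
qed

text \<open>\<open>bdens_limit\<close> produces some limit with density in \<open>[a, b]\<close>,
  and test functions identify it with \<open>\<mu>0\<close>.\<close>

lemma bdens_closed: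
  assumes mu: "\<And>n. bdens (\<mu> n)" and mu0: "\<mu>0 \<in> Mloc"
    and lim: "\<And>f g. test f g \<Longrightarrow> (\<lambda>n::nat. pairing (\<mu> n) f) \<longlonglongrightarrow> pairing \<mu>0 f"
  shows "bdens \<mu>0"
proof -
  have "convergent (\<lambda>n. pairing (\<mu> n) f)" if "test f g" for f g using lim[OF that] by (auto simp: convergent_def)
  then obtain \<mu>1 where m1: "bdens \<mu>1" "\<And>F. bfun F \<Longrightarrow> (\<lambda>n. pairing (\<mu> n) F) \<longlonglongrightarrow> pairing \<mu>1 F"
    using bdens_limit[of \<mu>, OF mu] by blast
  have "\<mu>0 = \<mu>1"
  proof (rule Mloc_eqI[OF mu0 bdens_Mloc[OF m1(1)]])
    fix f g assume t: "test (f :: 'a \<Rightarrow> real) g"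
    show "pairing \<mu>0 f = pairing \<mu>1 f" by (rule LIMSEQ_unique[OF lim[OF t] m1(2)[OF test_bfun(1)[OF t]]])
  qed
  then show ?thesis using m1(1) by simp
qed

end

subsection \<open>Curves of finite action\<close>

lemma set_integrable_Ioc_split:
  fixes f :: "real \<Rightarrow> 'b::{banach, second_countable_topology}"
  assumes "s \<le> m" "m \<le> t" "set_integrable lborel {s<..m} f" "set_integrable lborel {m<..t} f"
  shows "(LINT r:{s<..t}|lborel. f r) = (LINT r:{s<..m}|lborel. f r) + (LINT r:{m<..t}|lborel. f r)"
proof -
  have "{s<..t} = {s<..m} \<union> {m<..t}" using assms(1,2) by auto
  then show ?thesis using set_integral_Un[OF _ assms(3,4)] by auto
qed

lemma borel_family_on_subset:
  assumes "borel_family_on T \<nu>" "S \<subseteq> T" "S \<in> sets borel" "T \<in> sets borel" shows "borel_family_on S \<nu>"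
  unfolding borel_family_on_def
proof
  fix A :: "'a set" assume "A \<in> bborel"
  then have "(\<lambda>t. \<nu> t A) \<in> borel_measurable (restrict_space borel T)" using assms by (simp add: borel_family_on_def)
  then have "(\<lambda>t. \<nu> t A) \<in> borel_measurable (restrict_space (restrict_space borel T) S)" by (rule measurable_restrict_space1)
  then show "(\<lambda>t. \<nu> t A) \<in> borel_measurable (restrict_space borel S)"
    using assms(2-4) by (simp add: restrict_restrict_space Int_absorb1)
qed

lemma borel_family_on_iff:
  assumes "T \<in> sets borel"
  shows "borel_family_on T \<nu> \<longleftrightarrow> (\<forall>A\<in>bborel. (\<lambda>t. indicator T t *\<^sub>R \<nu> t A) \<in> borel_measurable borel)"
  using assms by (simp add: borel_family_on_def borel_measurable_restrict_space_iff)

context action_setup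
begin

definition cost :: "real set \<Rightarrow> (real \<Rightarrow> 'a set \<Rightarrow> real) \<Rightarrow> (real \<Rightarrow> 'a set \<Rightarrow> 'a) \<Rightarrow> ennreal" where
  "cost T \<mu> \<nu> = (\<integral>\<^sup>+t\<in>T. action \<phi> \<gamma> (\<mu> t) (\<nu> t) \<partial>lborel)"

text \<open>What \<open>curve\<close> demands apart from the density bounds and the equation. It
  makes sense for any set of times, so that it restricts to half-open intervals.\<close>

definition admissible :: "real set \<Rightarrow> (real \<Rightarrow> 'a set \<Rightarrow> real) \<Rightarrow> (real \<Rightarrow> 'a set \<Rightarrow> 'a) \<Rightarrow> bool" where
  "admissible T \<mu> \<nu> \<longleftrightarrow> (\<forall>t\<in>T. \<mu> t \<in> Mloc \<and> \<nu> t \<in> Mloc) \<and> borel_family_on T \<nu> \<and> cost T \<mu> \<nu> < \<infinity>"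

text \<open>The continuity equation integrated in time: the pairings with test functions are primitives of
  the fluxes. The measures \<open>\<mu>\<^sub>t\<close> are required to have densities in \<open>[a, b]\<close> for all \<open>t\<close>, not only for almost all.\<close>

definition curve :: "real \<Rightarrow> real \<Rightarrow> (real \<Rightarrow> 'a set \<Rightarrow> real) \<Rightarrow> (real \<Rightarrow> 'a set \<Rightarrow> 'a) \<Rightarrow> bool" where
  "curve l u \<mu> \<nu> \<longleftrightarrow> admissible {l..u} \<mu> \<nu> \<and> (\<forall>t\<in>{l..u}. bdens (\<mu> t)) \<and>
    (\<forall>f g s t. test f g \<longrightarrow> l \<le> s \<longrightarrow> s \<le> t \<longrightarrow> t \<le> u \<longrightarrow>
      pairing (\<mu> t) f - pairing (\<mu> s) f = (LINT r:{s<..t}|lborel. pairing (\<nu> r) g))"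

lemma curveD:
  assumes "curve l u \<mu> \<nu>"
  shows "admissible {l..u} \<mu> \<nu>" "\<And>t. t \<in> {l..u} \<Longrightarrow> bdens (\<mu> t)"
    "\<And>f g s t. test f g \<Longrightarrow> l \<le> s \<Longrightarrow> s \<le> t \<Longrightarrow> t \<le> u \<Longrightarrow>
      pairing (\<mu> t) f - pairing (\<mu> s) f = (LINT r:{s<..t}|lborel. pairing (\<nu> r) g)"
  using assms by (auto simp: curve_def)

section \<open>Costs and fluxes\<close>

lemma cost_mono: "S \<subseteq> T \<Longrightarrow> cost S \<mu> \<nu> \<le> cost T \<mu> \<nu>"
  unfolding cost_def by (intro nn_integral_mono mult_left_mono) (auto simp: indicator_def)

lemma cost_cong:
  assumes "\<And>t. t \<in> T \<Longrightarrow> \<mu> t = \<mu>' t \<and> \<nu> t = \<nu>' t" shows "cost T \<mu> \<nu> = cost T \<mu>' \<nu>'"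
  unfolding cost_def using assms by (intro nn_integral_cong) (auto simp: indicator_def)

lemma admissible_subset:
  "admissible T \<mu> \<nu> \<Longrightarrow> S \<subseteq> T \<Longrightarrow> S \<in> sets borel \<Longrightarrow> T \<in> sets borel \<Longrightarrow> admissible S \<mu> \<nu>"
  using cost_mono[of S T \<mu> \<nu>] borel_family_on_subset[of T \<nu> S] unfolding admissible_def
  by (auto intro: order.strict_trans1)

lemma moment_finite:
  fixes g :: "'a \<Rightarrow> 'a"
  assumes g: "bfun g" shows "(\<integral>\<^sup>+x. ennreal (norm (g x) powr q) \<partial>\<gamma>) < \<infinity>"
proof -
  obtain C R where CR: "0 \<le> C" "\<And>x. norm (g x) \<le> C * indicator (ball 0 R) x" using g by (rule bfunE) blast
  have q0: "0 < q" using p q_def by simp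
  have "(\<integral>\<^sup>+x. ennreal (norm (g x) powr q) \<partial>\<gamma>) \<le> (\<integral>\<^sup>+x. ennreal (C powr q) * indicator (ball 0 R) x \<partial>\<gamma>)"
  proof (rule nn_integral_mono)
    fix x
    have "norm (g x) powr q \<le> (C * indicator (ball 0 R) x) powr q" using CR q0 by (intro powr_mono2) auto
    then have "ennreal (norm (g x) powr q) \<le> ennreal ((C * indicator (ball 0 R) x) powr q)" by (rule ennreal_leI)
    then show "ennreal (norm (g x) powr q) \<le> ennreal (C powr q) * indicator (ball 0 R) x"
      by (cases "x \<in> ball 0 R") auto
  qed
  also have "\<dots> = ennreal (C powr q) * emeasure \<gamma> (ball 0 R)"
    by (intro nn_integral_cmult_indicator) (simp add: Mloc_pos_sets[OF G])
  also have "\<dots> < \<infinity>" using Mloc_pos_finite[OF G bborel_ball[of 0 R]] by (simp add: ennreal_mult_less_top)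
  finally show ?thesis .
qed

text \<open>\<open>pairing_bound\<close> integrated in time, with the weight \<open>\<theta>\<close>
  still free.\<close>

lemma flux_bound:
  fixes g :: "'a \<Rightarrow> 'a"
  assumes adm: "admissible T \<mu> \<nu>" and g: "bfun g" and T: "T \<in> sets borel" and th: "0 < \<theta>"
  shows "(\<integral>\<^sup>+r\<in>T. ennreal \<bar>pairing (\<nu> r) g\<bar> \<partial>lborel)
    \<le> ennreal (\<theta> powr (- q)) * (\<integral>\<^sup>+x. ennreal (norm (g x) powr q) \<partial>\<gamma>) * emeasure lborel T
      + ennreal (\<theta> powr p / coer) * cost T \<mu> \<nu>"
proof -
  let ?K = "ennreal (\<theta> powr (- q)) * (\<integral>\<^sup>+x. ennreal (norm (g x) powr q) \<partial>\<gamma>)"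
  have K: "?K < \<infinity>" using moment_finite[OF g] by (simp add: ennreal_mult_less_top)
  have "(\<integral>\<^sup>+r\<in>T. ennreal \<bar>pairing (\<nu> r) g\<bar> \<partial>lborel)
    \<le> (\<integral>\<^sup>+r. ?K * indicator T r + ennreal (\<theta> powr p / coer) * (action \<phi> \<gamma> (\<mu> r) (\<nu> r) * indicator T r) \<partial>lborel)"
  proof (rule nn_integral_mono)
    fix r
    show "ennreal \<bar>pairing (\<nu> r) g\<bar> * indicator T r
      \<le> ?K * indicator T r + ennreal (\<theta> powr p / coer) * (action \<phi> \<gamma> (\<mu> r) (\<nu> r) * indicator T r)"
      using pairing_bound[OF _ _ g th, of "\<mu> r" "\<nu> r"] adm by (cases "r \<in> T") (auto simp: admissible_def)
  qed
  also have "\<dots> \<le> (\<integral>\<^sup>+r. ?K * indicator T r \<partial>lborel) + (\<integral>\<^sup>+r. ennreal (\<theta> powr p / coer) * (action \<phi> \<gamma> (\<mu> r) (\<nu> r) * indicator T r) \<partial>lborel)"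
  proof (rule nn_integral_add_le)
    show "(\<lambda>r. ?K * indicator T r) \<in> borel_measurable lborel" using T by measurable
    show "?K * indicator T r < \<infinity>" for r using K by (cases "r \<in> T") auto
  qed
  also have "(\<integral>\<^sup>+r. ?K * indicator T r \<partial>lborel) = ?K * emeasure lborel T"
    using T by (intro nn_integral_cmult_indicator) simp
  also have "(\<integral>\<^sup>+r. ennreal (\<theta> powr p / coer) * (action \<phi> \<gamma> (\<mu> r) (\<nu> r) * indicator T r) \<partial>lborel)
      = ennreal (\<theta> powr p / coer) * cost T \<mu> \<nu>"
    unfolding cost_def using th coer_pos by (intro nn_integral_cmult_real) auto
  finally show ?thesis .
qed

lemma flux_measurable:
  fixes g :: "'a \<Rightarrow> 'a"
  assumes adm: "admissible T \<mu> \<nu>" and g: "bfun g" and T: "T \<in> sets borel"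
  shows "(\<lambda>r. indicator T r * pairing (\<nu> r) g) \<in> borel_measurable borel"
  using adm by (intro pairing_measurable T g) (auto simp: admissible_def)

lemma flux_integrable:
  fixes g :: "'a \<Rightarrow> 'a"
  assumes adm: "admissible T \<mu> \<nu>" and g: "bfun g" and T: "T \<in> sets borel" "emeasure lborel T < \<infinity>"
  shows "set_integrable lborel T (\<lambda>r. pairing (\<nu> r) g)"
  unfolding set_integrable_def
proof (rule integrableI_bounded)
  show "(\<lambda>r. indicator T r *\<^sub>R pairing (\<nu> r) g) \<in> borel_measurable lborel"
    using flux_measurable[OF adm g T(1)] by simp
  have "(\<integral>\<^sup>+r. ennreal (norm (indicator T r *\<^sub>R pairing (\<nu> r) g)) \<partial>lborel) = (\<integral>\<^sup>+r\<in>T. ennreal \<bar>pairing (\<nu> r) g\<bar> \<partial>lborel)"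
    by (rule nn_integral_cong) (auto simp: indicator_def)
  also have "\<dots> \<le> ennreal (1 powr (- q)) * (\<integral>\<^sup>+x. ennreal (norm (g x) powr q) \<partial>\<gamma>) * emeasure lborel T
      + ennreal (1 powr p / coer) * cost T \<mu> \<nu>"
    by (rule flux_bound[OF adm g T(1)]) simp
  also have "\<dots> < \<infinity>" using adm moment_finite[OF g] T by (simp add: admissible_def ennreal_mult_less_top)
  finally show "(\<integral>\<^sup>+r. ennreal (norm (indicator T r *\<^sub>R pairing (\<nu> r) g)) \<partial>lborel) < \<infinity>" .
qed

lemma flux_integrable_Ioc:
  fixes g :: "'a \<Rightarrow> 'a"
  assumes "admissible {l..u} \<mu> \<nu>" "bfun g" "l \<le> s" "t \<le> u"
  shows "set_integrable lborel {s<..t} (\<lambda>r. pairing (\<nu> r) g)"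
proof (rule flux_integrable)
  show "admissible {s<..t} \<mu> \<nu>" using assms by (intro admissible_subset[OF assms(1)]) auto
  show "emeasure lborel {s<..t} < \<infinity>" by (cases "s \<le> t") auto
qed (use assms in auto)

section \<open>Restriction, gluing and reparametrisation of curves\<close>

lemma curve_subset:
  assumes "curve l u \<mu> \<nu>" "l \<le> l'" "u' \<le> u" shows "curve l' u' \<mu> \<nu>"
proof -
  have "admissible {l'..u'} \<mu> \<nu>" using assms by (intro admissible_subset[OF curveD(1)[OF assms(1)]]) auto
  then show ?thesis using curveD(2,3)[OF assms(1)] assms(2,3) by (auto simp: curve_def)
qed

lemma curve_cong:
  assumes c: "curve l u \<mu> \<nu>" and eq: "\<And>t. t \<in> {l..u} \<Longrightarrow> \<mu> t = \<mu>' t \<and> \<nu> t = \<nu>' t"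
  shows "curve l u \<mu>' \<nu>'"
proof -
  have "cost {l..u} \<mu> \<nu> = cost {l..u} \<mu>' \<nu>'" using eq by (rule cost_cong)
  moreover have "borel_family_on {l..u} \<nu>'"
  proof -
    have "(\<lambda>t. indicator {l..u} t *\<^sub>R \<nu>' t A) = (\<lambda>t. indicator {l..u} t *\<^sub>R \<nu> t A)" for A
      using eq by (auto simp: indicator_def fun_eq_iff)
    then show ?thesis using curveD(1)[OF c] by (auto simp: admissible_def borel_family_on_iff)
  qed
  moreover have "(LINT r:{s<..t}|lborel. pairing (\<nu>' r) g) = (LINT r:{s<..t}|lborel. pairing (\<nu> r) g)"
    if "l \<le> s" "t \<le> u" for s t and g :: "'a \<Rightarrow> 'a"
    using eq that by (intro set_lebesgue_integral_cong) auto
  ultimately show ?thesis using c eq unfolding curve_def admissible_def by auto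
qed

text \<open>At the junction the flux is taken from the left piece; a single time affects no
  integral. Across \<open>m\<close> the equation is the sum of those on either side, as half-open
  intervals concatenate.\<close>

lemma curve_glue:
  assumes c1: "curve l m \<mu>1 \<nu>1" and c2: "curve m u \<mu>2 \<nu>2" and lm: "l \<le> m" "m \<le> u" and eq: "\<mu>1 m = \<mu>2 m"
  defines "\<mu> \<equiv> \<lambda>t. if t \<le> m then \<mu>1 t else \<mu>2 t" and "\<nu> \<equiv> \<lambda>t. if t \<le> m then \<nu>1 t else \<nu>2 t"
  shows "curve l u \<mu> \<nu>" "cost {l..u} \<mu> \<nu> \<le> cost {l..m} \<mu>1 \<nu>1 + cost {m..u} \<mu>2 \<nu>2"
proof -
  have "cost {l..u} \<mu> \<nu> \<le> cost {l..m} \<mu> \<nu> + cost {m<..u} \<mu> \<nu>"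
  proof -
    have *: "(\<integral>\<^sup>+t\<in>S. (action \<phi> \<gamma> (\<mu> t) (\<nu> t) * indicator {l..u} t) \<partial>lborel) = cost S \<mu> \<nu>" if "S \<subseteq> {l..u}" for S
      unfolding cost_def using that by (intro nn_integral_cong) (auto simp: indicator_def)
    have "cost {l..u} \<mu> \<nu> \<le> (\<integral>\<^sup>+t\<in>{l..m}. (action \<phi> \<gamma> (\<mu> t) (\<nu> t) * indicator {l..u} t) \<partial>lborel)
      + (\<integral>\<^sup>+t\<in>{m<..u}. (action \<phi> \<gamma> (\<mu> t) (\<nu> t) * indicator {l..u} t) \<partial>lborel)"
      unfolding cost_def by (rule nn_integral_split_le) (auto simp: indicator_def)
    then show ?thesis using lm by (subst (asm) (1 2) *) auto
  qed
  also have "cost {l..m} \<mu> \<nu> = cost {l..m} \<mu>1 \<nu>1" by (rule cost_cong) (auto simp: \<mu>_def \<nu>_def)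
  also have "cost {m<..u} \<mu> \<nu> = cost {m<..u} \<mu>2 \<nu>2" by (rule cost_cong) (auto simp: \<mu>_def \<nu>_def)
  also have "cost {m<..u} \<mu>2 \<nu>2 \<le> cost {m..u} \<mu>2 \<nu>2" by (rule cost_mono) auto
  finally show le: "cost {l..u} \<mu> \<nu> \<le> cost {l..m} \<mu>1 \<nu>1 + cost {m..u} \<mu>2 \<nu>2" by (simp add: add_left_mono)
  have cfin: "cost {l..u} \<mu> \<nu> < \<infinity>"
    using curveD(1)[OF c1] curveD(1)[OF c2] by (intro order.strict_trans1[OF le]) (auto simp: admissible_def)
  have bf: "borel_family_on {l..u} \<nu>"
    unfolding borel_family_on_iff[OF atLeastAtMost_borel]
  proof
    fix A :: "'a set" assume A: "A \<in> bborel"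
    have m1: "(\<lambda>t. indicator {l..m} t *\<^sub>R \<nu>1 t A) \<in> borel_measurable borel"
      using curveD(1)[OF c1] A by (auto simp: admissible_def borel_family_on_iff)
    have "borel_family_on {m<..u} \<nu>2"
      by (rule borel_family_on_subset[of "{m..u}"]) (use curveD(1)[OF c2] in \<open>auto simp: admissible_def\<close>)
    then have m2: "(\<lambda>t. indicator {m<..u} t *\<^sub>R \<nu>2 t A) \<in> borel_measurable borel"
      using A by (auto simp: borel_family_on_iff)
    have "(\<lambda>t. indicator {l..u} t *\<^sub>R \<nu> t A) = (\<lambda>t. indicator {l..m} t *\<^sub>R \<nu>1 t A + indicator {m<..u} t *\<^sub>R \<nu>2 t A)"
      using lm by (auto simp: \<nu>_def indicator_def fun_eq_iff)
    then show "(\<lambda>t. indicator {l..u} t *\<^sub>R \<nu> t A) \<in> borel_measurable borel" using m1 m2 by simp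
  qed
  have adm: "admissible {l..u} \<mu> \<nu>"
    using curveD(1)[OF c1] curveD(1)[OF c2] bf cfin by (auto simp: admissible_def \<mu>_def \<nu>_def)
  have w1: "pairing (\<mu> t) f - pairing (\<mu> s) f = (LINT r:{s<..t}|lborel. pairing (\<nu> r) g)"
    if "test f g" "l \<le> s" "s \<le> t" "t \<le> m" for f g s t
  proof -
    have "(LINT r:{s<..t}|lborel. pairing (\<nu> r) g) = (LINT r:{s<..t}|lborel. pairing (\<nu>1 r) g)"
      using that by (intro set_lebesgue_integral_cong) (auto simp: \<nu>_def)
    then show ?thesis using curveD(3)[OF c1 that] that by (simp add: \<mu>_def)
  qed
  have mum: "\<mu> t = \<mu>2 t" if "m \<le> t" for t using that eq by (auto simp: \<mu>_def)
  have w2: "pairing (\<mu> t) f - pairing (\<mu> s) f = (LINT r:{s<..t}|lborel. pairing (\<nu> r) g)"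
    if "test f g" "m \<le> s" "s \<le> t" "t \<le> u" for f g s t
  proof -
    have "(LINT r:{s<..t}|lborel. pairing (\<nu> r) g) = (LINT r:{s<..t}|lborel. pairing (\<nu>2 r) g)"
      using that by (intro set_lebesgue_integral_cong) (auto simp: \<nu>_def)
    then show ?thesis using curveD(3)[OF c2 that] that by (simp add: mum)
  qed
  have "pairing (\<mu> t) f - pairing (\<mu> s) f = (LINT r:{s<..t}|lborel. pairing (\<nu> r) g)"
    if t: "test f g" "l \<le> s" "s \<le> t" "t \<le> u" for f g s t
  proof -
    consider "t \<le> m" | "m \<le> s" | "s \<le> m" "m \<le> t" by linarith
    then show ?thesis
    proof cases
      case 3
      have "(LINT r:{s<..t}|lborel. pairing (\<nu> r) g) = (LINT r:{s<..m}|lborel. pairing (\<nu> r) g) + (LINT r:{m<..t}|lborel. pairing (\<nu> r) g)"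
        using 3 t lm by (intro set_integrable_Ioc_split flux_integrable_Ioc[OF adm test_bfun(2)[OF t(1)]]) auto
      then show ?thesis using w1[OF t(1), of s m] w2[OF t(1), of m t] 3 t by simp
    qed (use w1 w2 t in auto)
  qed
  moreover have "bdens (\<mu> t)" if "t \<in> {l..u}" for t
    using that curveD(2)[OF c1, of t] curveD(2)[OF c2, of t] by (auto simp: \<mu>_def)
  ultimately show "curve l u \<mu> \<nu>" using adm by (simp add: curve_def)
qed

text \<open>The flux is multiplied by \<open>c\<close>: homogeneity contributes
  \<open>\<bar>c\<bar> powr p\<close> to the cost and the change of variables
  \<open>1 / \<bar>c\<bar>\<close>. Negative \<open>c\<close> is included because time reversal
  gives the symmetry of the distance.\<close>

lemma curve_affine:
  fixes c k :: real
  assumes cv: "curve l u \<mu> \<nu>" and c: "c \<noteq> 0" and int: "\<And>t. t \<in> {l'..u'} \<longleftrightarrow> k + c * t \<in> {l..u}"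
  defines "\<mu>' \<equiv> \<lambda>t. \<mu> (k + c * t)" and "\<nu>' \<equiv> \<lambda>t A. c *\<^sub>R \<nu> (k + c * t) A"
  shows "curve l' u' \<mu>' \<nu>'" "cost {l'..u'} \<mu>' \<nu>' = ennreal (\<bar>c\<bar> powr (p - 1)) * cost {l..u} \<mu> \<nu>"
proof -
  note adm = curveD(1)[OF cv]
  have M: "\<mu> t \<in> Mloc" "\<nu> t \<in> Mloc" if "t \<in> {l..u}" for t using adm that by (auto simp: admissible_def)
  have ind: "indicator {l'..u'} t = (indicator {l..u} (k + c * t) :: 'z :: zero_neq_one)" for t
    using int[of t] by (auto simp: indicator_def)
  have "cost {l'..u'} \<mu>' \<nu>' = (\<integral>\<^sup>+t. ennreal (\<bar>c\<bar> powr p) * (action \<phi> \<gamma> (\<mu> (k + c * t)) (\<nu> (k + c * t)) * indicator {l..u} (k + c * t)) \<partial>lborel)"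
    unfolding cost_def
  proof (rule nn_integral_cong)
    fix t
    show "action \<phi> \<gamma> (\<mu>' t) (\<nu>' t) * indicator {l'..u'} t = ennreal (\<bar>c\<bar> powr p) * (action \<phi> \<gamma> (\<mu> (k + c * t)) (\<nu> (k + c * t)) * indicator {l..u} (k + c * t))"
      using action_scale[OF M c, of "k + c * t" "k + c * t"] unfolding ind \<mu>'_def \<nu>'_def
      by (cases "k + c * t \<in> {l..u}") (auto simp: mult.assoc)
  qed
  also have "\<dots> = ennreal (\<bar>c\<bar> powr p) * (\<integral>\<^sup>+t. action \<phi> \<gamma> (\<mu> (k + c * t)) (\<nu> (k + c * t)) * indicator {l..u} (k + c * t) \<partial>lborel)"
    using c by (intro nn_integral_cmult_real) auto
  also have "\<bar>c\<bar> powr p = \<bar>c\<bar> powr (p - 1) * \<bar>c\<bar>" using c by (simp add: powr_diff)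
  also have "ennreal (\<bar>c\<bar> powr (p - 1) * \<bar>c\<bar>) * (\<integral>\<^sup>+t. action \<phi> \<gamma> (\<mu> (k + c * t)) (\<nu> (k + c * t)) * indicator {l..u} (k + c * t) \<partial>lborel)
    = ennreal (\<bar>c\<bar> powr (p - 1)) * cost {l..u} \<mu> \<nu>"
    unfolding cost_def using nn_integral_affine[OF c, of "\<lambda>t. action \<phi> \<gamma> (\<mu> t) (\<nu> t) * indicator {l..u} t" k]
    by (simp add: ennreal_mult mult.assoc)
  finally show eq: "cost {l'..u'} \<mu>' \<nu>' = ennreal (\<bar>c\<bar> powr (p - 1)) * cost {l..u} \<mu> \<nu>" .
  have "borel_family_on {l'..u'} \<nu>'"
    unfolding borel_family_on_iff[OF atLeastAtMost_borel]
  proof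
    fix A :: "'a set" assume A: "A \<in> bborel"
    have [measurable]: "(\<lambda>t. indicator {l..u} t *\<^sub>R \<nu> t A) \<in> borel_measurable borel"
      using adm A by (auto simp: admissible_def borel_family_on_iff)
    have "(\<lambda>t. c *\<^sub>R (\<lambda>t. indicator {l..u} t *\<^sub>R \<nu> t A) (k + c * t)) \<in> borel_measurable borel" by measurable
    then show "(\<lambda>t. indicator {l'..u'} t *\<^sub>R \<nu>' t A) \<in> borel_measurable borel"
      by (simp add: ind \<nu>'_def mult.commute)
  qed
  moreover have "cost {l'..u'} \<mu>' \<nu>' < \<infinity>" using adm by (simp add: eq admissible_def ennreal_mult_less_top)
  moreover have "\<mu>' t \<in> Mloc \<and> \<nu>' t \<in> Mloc" if "t \<in> {l'..u'}" for t
    using that M[of "k + c * t"] int[of t] by (auto simp: \<mu>'_def \<nu>'_def intro: Mloc_scaleR)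
  ultimately have adm': "admissible {l'..u'} \<mu>' \<nu>'" by (simp add: admissible_def)
  have weak: "pairing (\<mu>' t) f - pairing (\<mu>' s) f = (LINT r:{s<..t}|lborel. pairing (\<nu>' r) g)"
    if t: "test f g" "l' \<le> s" "s \<le> t" "t \<le> u'" for f g s t
  proof -
    note gb = test_bfun(2)[OF t(1)]
    have st: "k + c * s \<in> {l..u}" "k + c * t \<in> {l..u}" using int[of s] int[of t] t by auto
    have in_lu: "k + c * r \<in> {l..u}" if "r \<in> {s<..t}" for r using int[of r] that t by auto
    have i1: "(LINT r:{s<..t}|lborel. pairing (\<nu>' r) g) = (LINT r|lborel. indicator {s<..t} r * (c * pairing (\<nu> (k + c * r)) g))"
      unfolding set_lebesgue_integral_def
    proof (rule Bochner_Integration.integral_cong[OF refl])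
      fix r
      show "indicator {s<..t} r *\<^sub>R pairing (\<nu>' r) g = indicator {s<..t} r * (c * pairing (\<nu> (k + c * r)) g)"
        using pairing_scale_measure[OF M(2)[OF in_lu] gb, of r c] by (cases "r \<in> {s<..t}") (auto simp: \<nu>'_def)
    qed
    have aff: "(LINT r|lborel. F r) = \<bar>c\<bar> * (LINT r|lborel. F (k + c * r))" for F :: "real \<Rightarrow> real"
      using lborel_integral_real_affine[OF c, of F k] by simp
    show ?thesis
    proof (cases "c > 0")
      case True
      have "(LINT r:{k + c * s<..k + c * t}|lborel. pairing (\<nu> r) g)
        = c * (LINT r|lborel. indicator {k + c * s<..k + c * t} (k + c * r) * pairing (\<nu> (k + c * r)) g)"
        unfolding set_lebesgue_integral_def by (subst aff) (use True in simp)
      also have "\<dots> = (LINT r|lborel. indicator {s<..t} r * (c * pairing (\<nu> (k + c * r)) g))"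
        using True by (subst integral_mult_right_zero[symmetric], intro Bochner_Integration.integral_cong) (auto simp: indicator_def)
      finally show ?thesis
        using curveD(3)[OF cv t(1), of "k + c * s" "k + c * t"] st True t unfolding i1 by (simp add: \<mu>'_def)
    next
      case False
      then have cn: "c < 0" using c by simp
      have "- (LINT r:{k + c * t<..k + c * s}|lborel. pairing (\<nu> r) g)
        = c * (LINT r|lborel. indicator {k + c * t<..k + c * s} (k + c * r) * pairing (\<nu> (k + c * r)) g)"
        unfolding set_lebesgue_integral_def by (subst aff) (use cn in simp)
      also have "\<dots> = (LINT r|lborel. indicator {k + c * t<..k + c * s} (k + c * r) * (c * pairing (\<nu> (k + c * r)) g))"
        by (subst integral_mult_right_zero[symmetric], intro Bochner_Integration.integral_cong) auto
      also have "\<dots> = (LINT r|lborel. indicator {s..<t} r * (c * pairing (\<nu> (k + c * r)) g))"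
        using cn by (intro Bochner_Integration.integral_cong) (auto simp: indicator_def)
      \<comment> \<open>Reversing time exchanges the open and the closed end of the interval; the
        two versions differ only at the end points.\<close>
      also have "\<dots> = (LINT r|lborel. indicator {s<..t} r * (c * pairing (\<nu> (k + c * r)) g))"
      proof (rule integral_cong_AE)
        have m: "(\<lambda>r. indicator {l..u} r * pairing (\<nu> r) g) \<in> borel_measurable borel"
          by (rule flux_measurable[OF adm gb]) simp
        \<comment> \<open>Measurability of the flux is known after cutting off with
          \<open>{l..u}\<close>, and on \<open>S\<close> this cut-off changes nothing.\<close>
        have e: "(\<lambda>r. indicator S r * (c * pairing (\<nu> (k + c * r)) g)) = (\<lambda>r. indicator S r * (c * (\<lambda>r. indicator {l..u} r * pairing (\<nu> r) g) (k + c * r)))"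
          if "S \<subseteq> {s..t}" for S :: "real set"
        proof
          fix r
          show "indicator S r * (c * pairing (\<nu> (k + c * r)) g) = indicator S r * (c * (\<lambda>r. indicator {l..u} r * pairing (\<nu> r) g) (k + c * r))"
          proof (cases "r \<in> S")
            case True
            then have "k + c * r \<in> {l..u}" using that int[of r] t by force
            then show ?thesis by simp
          qed simp
        qed
        note m[measurable]
        show "(\<lambda>r. indicator {s..<t} r * (c * pairing (\<nu> (k + c * r)) g)) \<in> borel_measurable lborel"
          by (subst e) (auto intro!: borel_measurable_times measurable_compose[OF _ m])
        show "(\<lambda>r. indicator {s<..t} r * (c * pairing (\<nu> (k + c * r)) g)) \<in> borel_measurable lborel"
          by (subst e) (auto intro!: borel_measurable_times measurable_compose[OF _ m])
        show "AE r in lborel. indicator {s..<t} r * (c * pairing (\<nu> (k + c * r)) g) = indicator {s<..t} r * (c * pairing (\<nu> (k + c * r)) g)"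
          using AE_lborel_singleton[of s] AE_lborel_singleton[of t]
          by eventually_elim (auto simp: indicator_def)
      qed
      finally show ?thesis
        using curveD(3)[OF cv t(1), of "k + c * t" "k + c * s"] st cn t unfolding i1 by (simp add: \<mu>'_def)
    qed
  qed
  have "bdens (\<mu>' t)" if "t \<in> {l'..u'}" for t using int[of t] that curveD(2)[OF cv] by (simp add: \<mu>'_def)
  then show "curve l' u' \<mu>' \<nu>'" using adm' weak by (simp add: curve_def)
qed

section \<open>Continuity in time\<close>

lemma curve_tendsto_test:
  assumes cv: "curve l u \<mu> \<nu>" and t: "test f g"
  shows "continuous_on {l..u} (\<lambda>t. pairing (\<mu> t) f)"
proof (cases "l \<le> u")
  case True
  have G: "pairing (\<mu> t) f = pairing (\<mu> l) f + (LINT r:{l<..t}|lborel. pairing (\<nu> r) g)" if "t \<in> {l..u}" for t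
    using curveD(3)[OF cv t, of l t] that by simp
  have int: "integrable lborel (\<lambda>r. indicator {l<..u} r *\<^sub>R pairing (\<nu> r) g)"
    using flux_integrable_Ioc[OF curveD(1)[OF cv] test_bfun(2)[OF t], of l u] by (simp add: set_integrable_def)
  have "continuous_on {l..u} (\<lambda>t. LINT r:{l<..t}|lborel. pairing (\<nu> r) g)"
    unfolding continuous_on_sequentially o_def
  proof (intro allI ballI impI, elim conjE)
    fix x and t0 assume t0: "t0 \<in> {l..u}" and x: "\<forall>n. x n \<in> {l..u}" "x \<longlonglongrightarrow> t0"
    have eq: "(LINT r:{l<..s}|lborel. pairing (\<nu> r) g) = (LINT r|lborel. indicator {..s} r *\<^sub>R (indicator {l<..u} r *\<^sub>R pairing (\<nu> r) g))"
      if "s \<le> u" for s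
      unfolding set_lebesgue_integral_def using that by (intro Bochner_Integration.integral_cong) (auto simp: indicator_def)
    have "(\<lambda>n. LINT r|lborel. indicator {..x n} r *\<^sub>R (indicator {l<..u} r *\<^sub>R pairing (\<nu> r) g))
      \<longlonglongrightarrow> (LINT r|lborel. indicator {..t0} r *\<^sub>R (indicator {l<..u} r *\<^sub>R pairing (\<nu> r) g))"
    proof (rule integral_dominated_convergence[where w="\<lambda>r. norm (indicator {l<..u} r *\<^sub>R pairing (\<nu> r) g)"])
      have m: "(\<lambda>r. indicator {l<..u} r *\<^sub>R pairing (\<nu> r) g) \<in> borel_measurable lborel" using int by (rule borel_measurable_integrable)
      then show "(\<lambda>r. indicator {..t0} r *\<^sub>R (indicator {l<..u} r *\<^sub>R pairing (\<nu> r) g)) \<in> borel_measurable lborel"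
        "(\<lambda>r. indicator {..x n} r *\<^sub>R (indicator {l<..u} r *\<^sub>R pairing (\<nu> r) g)) \<in> borel_measurable lborel" for n
        by (intro borel_measurable_scaleR borel_measurable_indicator m; simp)+
      show "integrable lborel (\<lambda>r. norm (indicator {l<..u} r *\<^sub>R pairing (\<nu> r) g))" using int by (rule integrable_norm)
      show "AE r in lborel. (\<lambda>n. indicator {..x n} r *\<^sub>R (indicator {l<..u} r *\<^sub>R pairing (\<nu> r) g)) \<longlonglongrightarrow> indicator {..t0} r *\<^sub>R (indicator {l<..u} r *\<^sub>R pairing (\<nu> r) g)"
        using AE_lborel_singleton[of t0]
      proof eventually_elim
        case (elim r)
        have "\<forall>\<^sub>F n in sequentially. indicator {..x n} r = (indicator {..t0} r :: real)"
        proof (cases "r < t0")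
          case True
          show ?thesis using order_tendstoD(1)[OF x(2) True] by eventually_elim (use True in \<open>auto simp: indicator_def\<close>)
        next
          case False
          then have "t0 < r" using elim by simp
          show ?thesis using order_tendstoD(2)[OF x(2) \<open>t0 < r\<close>] by eventually_elim (use \<open>t0 < r\<close> in \<open>auto simp: indicator_def\<close>)
        qed
        then have "(\<lambda>n. indicator {..x n} r :: real) \<longlonglongrightarrow> indicator {..t0} r" by (rule tendsto_eventually)
        then show ?case by (intro tendsto_scaleR tendsto_const)
      qed
      show "AE r in lborel. norm (indicator {..x n} r *\<^sub>R (indicator {l<..u} r *\<^sub>R pairing (\<nu> r) g)) \<le> norm (indicator {l<..u} r *\<^sub>R pairing (\<nu> r) g)" for n
        by (rule AE_I2) (auto simp: indicator_def)
    qed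
    then show "(\<lambda>n. LINT r:{l<..x n}|lborel. pairing (\<nu> r) g) \<longlonglongrightarrow> (LINT r:{l<..t0}|lborel. pairing (\<nu> r) g)"
      using eq x(1) t0 by simp
  qed
  then have "continuous_on {l..u} (\<lambda>t. pairing (\<mu> l) f + (LINT r:{l<..t}|lborel. pairing (\<nu> r) g))"
    by (intro continuous_on_add continuous_on_const)
  then show ?thesis by (rule continuous_on_eq) (rule G[symmetric])
qed simp

text \<open>\<open>bdens_tendsto\<close> carries continuity from test functions to all bounded
  functions of bounded support, in particular to the merely continuous ones of the weak*
  topology.\<close>

lemma curve_continuous:
  assumes cv: "curve l u \<mu> \<nu>" and F: "bfun F"
  shows "continuous_on {l..u} (\<lambda>t. pairing (\<mu> t) F)"
  unfolding continuous_on_def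
proof
  fix t assume t: "t \<in> {l..u}"
  show "((\<lambda>t. pairing (\<mu> t) F) \<longlongrightarrow> pairing (\<mu> t) F) (at t within {l..u})"
  proof (rule bdens_tendsto[OF _ curveD(2)[OF cv t] _ F])
    show "\<forall>\<^sub>F t in at t within {l..u}. bdens (\<mu> t)"
      unfolding eventually_at_filter using curveD(2)[OF cv] by (auto intro: always_eventually)
    show "((\<lambda>t. pairing (\<mu> t) f) \<longlongrightarrow> pairing (\<mu> t) f) (at t within {l..u})" if "test f g" for f g
      using curve_tendsto_test[OF cv that] t by (simp add: continuous_on_def)
  qed
qed

end

subsection \<open>The continuity equation in weak form\<close>

text \<open>A continuously differentiable step from 0 to 1 on \<open>[0, 1]\<close>; its derivative is a tent.\<close>

definition ramp :: "real \<Rightarrow> real" where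
  "ramp u = 4 * max 0 u - 8 * max 0 (u - 1/2) + 4 * max 0 (u - 1)"

definition step :: "real \<Rightarrow> real" where
  "step u = 2 * (max 0 u)\<^sup>2 - 4 * (max 0 (u - 1/2))\<^sup>2 + 2 * (max 0 (u - 1))\<^sup>2"

lemma DERIV_step: "(step has_field_derivative ramp u) (at u)"
proof -
  have d: "((\<lambda>u::real. (max 0 (u - c))\<^sup>2) has_field_derivative 2 * max 0 (u - c)) (at u)" for c
  proof -
    have "((\<lambda>u::real. u - c) has_field_derivative 1) (at u)" by (auto intro!: derivative_eq_intros)
    from DERIV_chain2[where f="\<lambda>u. (max 0 u)\<^sup>2" and g="\<lambda>u. u - c" and x=u and s=UNIV, OF DERIV_max_square this]
    show ?thesis by simp
  qed
  have "((\<lambda>u. 2 * (max 0 (u - 0))\<^sup>2 - 4 * (max 0 (u - 1/2))\<^sup>2 + 2 * (max 0 (u - 1))\<^sup>2) has_field_derivative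
    2 * (2 * max 0 (u - 0)) - 4 * (2 * max 0 (u - 1/2)) + 2 * (2 * max 0 (u - 1))) (at u)"
    by (intro DERIV_add DERIV_diff DERIV_cmult d)
  then show ?thesis by (simp add: step_def[abs_def] ramp_def)
qed

lemma ramp_nonneg: "0 \<le> ramp u" and ramp_le: "ramp u \<le> 2" and ramp_eq_0: "u \<notin> {0..1} \<Longrightarrow> ramp u = 0"
  by (auto simp: ramp_def max_def)

lemma ramp_continuous: "continuous_on S ramp"
  unfolding ramp_def[abs_def] by (intro continuous_intros)

lemma step_0: "u \<le> 0 \<Longrightarrow> step u = 0" by (simp add: step_def)

lemma step_1: assumes "1 \<le> u" shows "step u = 1"
proof -
  have "max 0 u = u" "max 0 (u - 1/2) = u - 1/2" "max 0 (u - 1) = u - 1" using assms by auto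
  then show ?thesis by (simp add: step_def power2_eq_square algebra_simps)
qed

lemma step_mono: "u \<le> v \<Longrightarrow> step u \<le> step v"
  by (rule DERIV_nonneg_imp_nondecreasing) (use DERIV_step ramp_nonneg in auto)

lemma step_range: "0 \<le> step u" "step u \<le> 1"
  using step_mono[of 0 u] step_mono[of u 0] step_mono[of u 1] step_mono[of 1 u] step_0[of u] step_0[of 0] step_1[of u] step_1[of 1]
  by linarith+

lemma step_measurable [measurable]: "step \<in> borel_measurable borel"
  unfolding step_def[abs_def] by measurable

lemma ramp_measurable [measurable]: "ramp \<in> borel_measurable borel"
  unfolding ramp_def[abs_def] by measurable

lemma integral_ramp: "(LINT v:{0..1}|lborel. ramp v) = 1"
proof -
  have "(LINT v:{0..1}|lborel. ramp v) = step 1 - step 0"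
    unfolding set_lebesgue_integral_def real_scaleR_def mult.commute[of "indicator _ _"]
    by (rule integral_FTC_Icc_real)
      (auto intro: DERIV_step[THEN has_field_derivative_at_within] continuous_on_interior
        simp: continuous_on_eq_continuous_at[symmetric] ramp_continuous continuous_on_eq_continuous_within
        intro: ramp_continuous[of UNIV, unfolded continuous_on_eq_continuous_at[OF open_UNIV], rule_format])
  then show ?thesis by (simp add: step_0 step_1)
qed

text \<open>The test functions \<open>\<eta> n\<close> tend to the indicator of
  \<open>{s<..t}\<close>, and their derivatives are differences of approximate identities placed
  just to the right of \<open>s\<close> and of \<open>t\<close>. The tested equation thus tends to
  \<open>G s - G t\<close> plus the integral of \<open>h\<close>.\<close>

lemma dubois_reymond_interior:
  fixes G h :: "real \<Rightarrow> real"
  assumes G: "continuous_on {0..1} G" and h: "set_integrable lborel {0..1} h"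
    and weak: "\<And>\<eta> \<eta>' c d. \<lbrakk>\<And>\<tau>. (\<eta> has_field_derivative \<eta>' \<tau>) (at \<tau>); continuous_on UNIV \<eta>'; 0 < c; d < 1;
       \<And>\<tau>. \<tau> \<notin> {c..d} \<Longrightarrow> \<eta> \<tau> = 0\<rbrakk>
       \<Longrightarrow> (LINT \<tau>:{0..1}|lborel. \<eta>' \<tau> * G \<tau>) + (LINT \<tau>:{0..1}|lborel. \<eta> \<tau> * h \<tau>) = 0"
    and st: "0 < s" "s \<le> t" "t < 1"
  shows "G t - G s = (LINT r:{s<..t}|lborel. h r)"
proof -
  define \<eta> where "\<eta> n \<tau> = step (real (Suc n) * (\<tau> - s)) - step (real (Suc n) * (\<tau> - t))" for n \<tau>
  define k where "k n c \<tau> = real (Suc n) * ramp (real (Suc n) * (\<tau> - c))" for n c \<tau>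
  define H where "H \<tau> = indicator {0..1} \<tau> * G \<tau>" for \<tau> :: real
  have Hm[measurable]: "H \<in> borel_measurable borel"
    unfolding H_def using borel_measurable_continuous_on_indicator[OF _ G] by simp
  have "compact (G ` {0..1})" by (intro compact_continuous_image G) simp
  then obtain C where "\<forall>y\<in>G ` {0..1}. norm y \<le> C"
    using compact_imp_bounded bounded_iff by blast
  then have C: "\<And>\<tau>. \<tau> \<in> {0..1} \<Longrightarrow> \<bar>G \<tau>\<bar> \<le> C" by auto
  have HC: "\<bar>H \<tau>\<bar> \<le> \<bar>C\<bar>" for \<tau> using C[of \<tau>] by (cases "\<tau> \<in> {0..1}") (auto simp: H_def)
  \<comment> \<open>Substituting \<open>\<tau> = c + v / Suc n\<close> removes \<open>n\<close> from
    the kernel, so that dominated convergence applies.\<close>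
  have int: "(LINT \<tau>:{0..1}|lborel. k n c \<tau> * G \<tau>) = (LINT v|lborel. ramp v * H (c + 1 / real (Suc n) * v))" for n c
  proof -
    have "(LINT \<tau>:{0..1}|lborel. k n c \<tau> * G \<tau>) = (LINT \<tau>|lborel. k n c \<tau> * H \<tau>)"
      unfolding set_lebesgue_integral_def H_def by (intro Bochner_Integration.integral_cong) auto
    also have "\<dots> = \<bar>1 / real (Suc n)\<bar> *\<^sub>R (LINT v|lborel. k n c (c + 1 / real (Suc n) * v) * H (c + 1 / real (Suc n) * v))"
      by (rule lborel_integral_real_affine) simp
    also have "\<dots> = (LINT v|lborel. ramp v * H (c + 1 / real (Suc n) * v))"
      unfolding k_def real_scaleR_def
      by (subst integral_mult_right_zero[symmetric]) (intro Bochner_Integration.integral_cong, auto simp: field_simps simp del: of_nat_Suc)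
    finally show ?thesis .
  qed
  have lim1: "(\<lambda>n. LINT \<tau>:{0..1}|lborel. k n c \<tau> * G \<tau>) \<longlonglongrightarrow> G c" if c: "0 < c" "c < 1" for c
  proof -
    have cont: "(\<lambda>n. H (c + 1 / real (Suc n) * v)) \<longlonglongrightarrow> H c" for v
    proof -
      have "continuous_on {0<..<1} H"
        by (rule continuous_on_eq[OF continuous_on_subset[OF G]]) (auto simp: H_def)
      then have "isCont H c" using c by (simp add: continuous_on_eq_continuous_at)
      moreover have "(\<lambda>n. c + 1 / real (Suc n) * v) \<longlonglongrightarrow> c + 0 * v"
        by (intro tendsto_intros LIMSEQ_Suc[OF lim_1_over_n])
      ultimately show ?thesis by (intro isCont_tendsto_compose[of c H]) auto
    qed
    have "(\<lambda>n. LINT v|lborel. ramp v * H (c + 1 / real (Suc n) * v)) \<longlonglongrightarrow> (LINT v|lborel. ramp v * H c)"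
    proof (rule integral_dominated_convergence[where w="\<lambda>v. (2 * \<bar>C\<bar>) * indicator {0..1} v"])
      show "integrable lborel (\<lambda>v. (2 * \<bar>C\<bar>) * indicator {0..1::real} v)" by (intro integrable_mult_right integrable_real_indicator) auto
      show "AE v in lborel. (\<lambda>n. ramp v * H (c + 1 / real (Suc n) * v)) \<longlonglongrightarrow> ramp v * H c"
        by (intro AE_I2 tendsto_mult_left cont)
      show "AE v in lborel. norm (ramp v * H (c + 1 / real (Suc n) * v)) \<le> (2 * \<bar>C\<bar>) * indicator {0..1} v" for n
      proof (rule AE_I2)
        fix v
        show "norm (ramp v * H (c + 1 / real (Suc n) * v)) \<le> (2 * \<bar>C\<bar>) * indicator {0..1} v"
        proof (cases "v \<in> {0..1}")
          case True
          have "\<bar>ramp v\<bar> * \<bar>H (c + 1 / real (Suc n) * v)\<bar> \<le> 2 * \<bar>C\<bar>"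
            using ramp_nonneg ramp_le by (intro mult_mono HC) auto
          then show ?thesis using True by (simp add: abs_mult)
        qed (simp add: ramp_eq_0)
      qed
    qed (simp_all, measurable)
    moreover have "(LINT v|lborel. ramp v * H c) = G c"
    proof -
      have "(LINT v|lborel. ramp v * H c) = (LINT v|lborel. ramp v) * H c" by simp
      also have "(LINT v|lborel. ramp v) = (LINT v:{0..1}|lborel. ramp v)"
        unfolding set_lebesgue_integral_def using ramp_eq_0
        by (intro Bochner_Integration.integral_cong) (auto simp: indicator_def simp del: atLeastAtMost_iff)
      finally show ?thesis using c by (simp add: integral_ramp H_def)
    qed
    ultimately show ?thesis unfolding int by simp
  qed
  have ki: "set_integrable lborel {0..1} (\<lambda>\<tau>. k n c \<tau> * G \<tau>)" for n c
  proof -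
    have "continuous_on {0..1} (\<lambda>\<tau>. k n c \<tau> * G \<tau>)"
      unfolding k_def by (intro continuous_intros continuous_on_compose2[OF ramp_continuous[of UNIV]] G) auto
    then show ?thesis by (rule borel_integrable_atLeastAtMost')
  qed
  have eta_lim: "(\<lambda>n. \<eta> n \<tau>) \<longlonglongrightarrow> indicator {s<..t} \<tau>" for \<tau>
  proof -
    have st': "(\<lambda>n. step (real (Suc n) * (\<tau> - c))) \<longlonglongrightarrow> indicator {c<..} \<tau>" for c
    proof (cases "c < \<tau>")
      case True
      obtain N :: nat where N: "1 / (\<tau> - c) < real N" using reals_Archimedean2 by blast
      have "step (real (Suc n) * (\<tau> - c)) = indicator {c<..} \<tau>" if "n \<ge> N" for n
      proof -
        have "1 = 1 / (\<tau> - c) * (\<tau> - c)" using True by simp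
        also have "\<dots> \<le> real (Suc n) * (\<tau> - c)" using N that True by (intro mult_right_mono) auto
        finally show ?thesis using step_1 True by simp
      qed
      then show ?thesis by (intro tendsto_eventually) (auto simp: eventually_sequentially)
    next
      case False
      then have "step (real (Suc n) * (\<tau> - c)) = 0" for n by (intro step_0) (simp add: mult_nonneg_nonpos)
      then show ?thesis using False by simp
    qed
    have "indicator {s<..} \<tau> - indicator {t<..} \<tau> = (indicator {s<..t} \<tau> :: real)" using st by (auto simp: indicator_def)
    then show ?thesis using tendsto_diff[OF st'[of s] st'[of t]] by (simp add: \<eta>_def)
  qed
  have hm: "(\<lambda>\<tau>. indicator {0..1} \<tau> * h \<tau>) \<in> borel_measurable lborel"
    using borel_measurable_integrable[OF h[unfolded set_integrable_def]] by simp
  have lim2: "(\<lambda>n. LINT \<tau>:{0..1}|lborel. \<eta> n \<tau> * h \<tau>) \<longlonglongrightarrow> (LINT \<tau>:{s<..t}|lborel. h \<tau>)"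
  proof -
    have "(\<lambda>n. LINT \<tau>|lborel. \<eta> n \<tau> * (indicator {0..1} \<tau> * h \<tau>)) \<longlonglongrightarrow> (LINT \<tau>|lborel. indicator {s<..t} \<tau> * (indicator {0..1} \<tau> * h \<tau>))"
    proof (rule integral_dominated_convergence[where w="\<lambda>\<tau>. \<bar>indicator {0..1} \<tau> * h \<tau>\<bar>"])
      show "integrable lborel (\<lambda>\<tau>. \<bar>indicator {0..1} \<tau> * h \<tau>\<bar>)" using h by (simp add: set_integrable_def)
      show "AE \<tau> in lborel. (\<lambda>n. \<eta> n \<tau> * (indicator {0..1} \<tau> * h \<tau>)) \<longlonglongrightarrow> indicator {s<..t} \<tau> * (indicator {0..1} \<tau> * h \<tau>)"
        by (intro AE_I2 tendsto_mult_right eta_lim)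
      show "AE \<tau> in lborel. norm (\<eta> n \<tau> * (indicator {0..1} \<tau> * h \<tau>)) \<le> \<bar>indicator {0..1} \<tau> * h \<tau>\<bar>" for n
      proof (rule AE_I2)
        fix \<tau>
        have "\<bar>\<eta> n \<tau>\<bar> \<le> 1"
          using step_range[of "real (Suc n) * (\<tau> - s)"] step_range[of "real (Suc n) * (\<tau> - t)"] unfolding \<eta>_def by linarith
        then show "norm (\<eta> n \<tau> * (indicator {0..1} \<tau> * h \<tau>)) \<le> \<bar>indicator {0..1} \<tau> * h \<tau>\<bar>"
          unfolding real_norm_def abs_mult[of "\<eta> n \<tau>"] by (intro mult_left_le_one_le) auto
      qed
      show "(\<lambda>\<tau>. indicator {s<..t} \<tau> * (indicator {0..1} \<tau> * h \<tau>)) \<in> borel_measurable lborel"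
        by (rule borel_measurable_times[OF _ hm]) simp
      show "(\<lambda>\<tau>. \<eta> n \<tau> * (indicator {0..1} \<tau> * h \<tau>)) \<in> borel_measurable lborel" for n
      proof (rule borel_measurable_times[OF _ hm])
        show "\<eta> n \<in> borel_measurable lborel" unfolding \<eta>_def[abs_def] by measurable
      qed
    qed
    moreover have "(LINT \<tau>|lborel. \<eta> n \<tau> * (indicator {0..1} \<tau> * h \<tau>)) = (LINT \<tau>:{0..1}|lborel. \<eta> n \<tau> * h \<tau>)" for n
      unfolding set_lebesgue_integral_def by (intro Bochner_Integration.integral_cong) auto
    moreover have "(LINT \<tau>|lborel. indicator {s<..t} \<tau> * (indicator {0..1} \<tau> * h \<tau>)) = (LINT \<tau>:{s<..t}|lborel. h \<tau>)"
      unfolding set_lebesgue_integral_def using st by (intro Bochner_Integration.integral_cong) (auto simp: indicator_def)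
    ultimately show ?thesis by simp
  qed
  \<comment> \<open>From \<open>N\<close> on, the support of \<open>\<eta> n\<close>, which ends at
    \<open>t + 1 / Suc n\<close>, lies inside the open unit interval.\<close>
  obtain N :: nat where N: "1 / (1 - t) < real N" using reals_Archimedean2 by blast
  have eq: "(LINT \<tau>:{0..1}|lborel. k n s \<tau> * G \<tau>) - (LINT \<tau>:{0..1}|lborel. k n t \<tau> * G \<tau>) + (LINT \<tau>:{0..1}|lborel. \<eta> n \<tau> * h \<tau>) = 0"
    if "n \<ge> N" for n
  proof -
    define d where "d = t + 1 / real (Suc n)"
    have "1 < real (Suc n) * (1 - t)"
    proof -
      have "1 = 1 / (1 - t) * (1 - t)" using st by simp
      also have "\<dots> < real (Suc n) * (1 - t)" using N that st by (intro mult_strict_right_mono) auto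
      finally show ?thesis .
    qed
    then have d1: "d < 1" by (simp add: d_def field_simps del: of_nat_Suc)
    have "(LINT \<tau>:{0..1}|lborel. (k n s \<tau> - k n t \<tau>) * G \<tau>) + (LINT \<tau>:{0..1}|lborel. \<eta> n \<tau> * h \<tau>) = 0"
    proof (rule weak)
      fix \<tau>
      have "((\<lambda>\<tau>. step (real (Suc n) * (\<tau> - c))) has_field_derivative k n c \<tau>) (at \<tau>)" for c
        unfolding k_def mult.commute[of "real (Suc n)" "ramp _"]
        by (rule DERIV_chain2[OF DERIV_step]) (auto intro!: derivative_eq_intros)
      then show "(\<eta> n has_field_derivative k n s \<tau> - k n t \<tau>) (at \<tau>)"
        unfolding \<eta>_def[abs_def] by (intro DERIV_diff)
      show "0 < s" by fact
      show "d < 1" by fact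
    next
      show "continuous_on UNIV (\<lambda>\<tau>. k n s \<tau> - k n t \<tau>)"
        unfolding k_def by (intro continuous_intros continuous_on_compose2[OF ramp_continuous[of UNIV]]) auto
    next
      fix \<tau> assume "\<tau> \<notin> {s..d}"
      then consider "\<tau> < s" | "d < \<tau>" by force
      then show "\<eta> n \<tau> = 0"
      proof cases
        case 1
        then show ?thesis using st by (simp add: \<eta>_def step_0 mult_nonneg_nonpos)
      next
        case 2
        have "1 \<le> real (Suc n) * (\<tau> - t)" using 2 by (simp add: d_def field_simps del: of_nat_Suc)
        moreover have "real (Suc n) * (\<tau> - t) \<le> real (Suc n) * (\<tau> - s)" using st by (intro mult_left_mono) auto
        ultimately have "step (real (Suc n) * (\<tau> - t)) = 1" "step (real (Suc n) * (\<tau> - s)) = 1"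
          by (intro step_1; linarith)+
        then show ?thesis by (simp only: \<eta>_def)
      qed
    qed
    moreover have "(LINT \<tau>:{0..1}|lborel. (k n s \<tau> - k n t \<tau>) * G \<tau>) = (LINT \<tau>:{0..1}|lborel. k n s \<tau> * G \<tau>) - (LINT \<tau>:{0..1}|lborel. k n t \<tau> * G \<tau>)"
      unfolding left_diff_distrib by (rule set_integral_diff(2)[OF ki ki])
    ultimately show ?thesis by simp
  qed
  have "(\<lambda>n. (LINT \<tau>:{0..1}|lborel. k n s \<tau> * G \<tau>) - (LINT \<tau>:{0..1}|lborel. k n t \<tau> * G \<tau>) + (LINT \<tau>:{0..1}|lborel. \<eta> n \<tau> * h \<tau>))
    \<longlonglongrightarrow> G s - G t + (LINT \<tau>:{s<..t}|lborel. h \<tau>)"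
    using st by (intro tendsto_intros lim1 lim2) auto
  moreover have "(\<lambda>n. (LINT \<tau>:{0..1}|lborel. k n s \<tau> * G \<tau>) - (LINT \<tau>:{0..1}|lborel. k n t \<tau> * G \<tau>) + (LINT \<tau>:{0..1}|lborel. \<eta> n \<tau> * h \<tau>)) \<longlonglongrightarrow> 0"
    using eq by (intro tendsto_eventually) (auto simp: eventually_sequentially)
  ultimately have "G s - G t + (LINT \<tau>:{s<..t}|lborel. h \<tau>) = 0" by (rule LIMSEQ_unique)
  then show ?thesis by simp
qed

text \<open>Test functions in time vanish near 0 and 1, so the interior case is applied to a
  slightly smaller interval; continuity of \<open>G\<close> and integrability of \<open>h\<close> do
  the rest.\<close>

lemma dubois_reymond:
  fixes G h :: "real \<Rightarrow> real"
  assumes G: "continuous_on {0..1} G" and h: "set_integrable lborel {0..1} h"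
    and weak: "\<And>\<eta> \<eta>' c d. \<lbrakk>\<And>\<tau>. (\<eta> has_field_derivative \<eta>' \<tau>) (at \<tau>); continuous_on UNIV \<eta>'; 0 < c; d < 1;
       \<And>\<tau>. \<tau> \<notin> {c..d} \<Longrightarrow> \<eta> \<tau> = 0\<rbrakk>
       \<Longrightarrow> (LINT \<tau>:{0..1}|lborel. \<eta>' \<tau> * G \<tau>) + (LINT \<tau>:{0..1}|lborel. \<eta> \<tau> * h \<tau>) = 0"
    and st: "0 \<le> s" "s \<le> t" "t \<le> 1"
  shows "G t - G s = (LINT r:{s<..t}|lborel. h r)"
proof (cases "s = t")
  case True then show ?thesis by (simp add: set_lebesgue_integral_def)
next
  case False
  then have lt: "s < t" using st by simp
  \<comment> \<open>At most a third of the length, so that the interval shrunk at both ends keeps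
    its orientation.\<close>
  define d where "d n = (t - s) / real (n + 3)" for n
  have d: "0 < d n" "d n \<le> (t - s) / 3" for n
    using lt unfolding d_def by (simp, intro divide_left_mono) auto
  have d0: "d \<longlonglongrightarrow> 0"
  proof -
    have "(\<lambda>n. 1 / real (n + 3)) \<longlonglongrightarrow> 0" using LIMSEQ_ignore_initial_segment[OF lim_1_over_n, of 3] .
    from tendsto_mult_left[OF this, of "t - s"] show ?thesis by (simp add: d_def[abs_def])
  qed
  have eq: "G (t - d n) - G (s + d n) = (LINT r:{s + d n<..t - d n}|lborel. h r)" for n
  proof (rule dubois_reymond_interior[OF G h])
    fix \<eta> \<eta>' :: "real \<Rightarrow> real" and c d :: real
    assume "\<And>\<tau>. (\<eta> has_field_derivative \<eta>' \<tau>) (at \<tau>)" "continuous_on UNIV \<eta>'" "0 < c" "d < 1" "\<And>\<tau>. \<tau> \<notin> {c..d} \<Longrightarrow> \<eta> \<tau> = 0"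
    then show "(LINT \<tau>:{0..1}|lborel. \<eta>' \<tau> * G \<tau>) + (LINT \<tau>:{0..1}|lborel. \<eta> \<tau> * h \<tau>) = 0" by (rule weak)
  next
    show "0 < s + d n" "t - d n < 1" "s + d n \<le> t - d n" using d[of n] st lt by auto
  qed
  have tt: "(\<lambda>n. t - d n) \<longlonglongrightarrow> t" "(\<lambda>n. s + d n) \<longlonglongrightarrow> s" using tendsto_diff[OF tendsto_const d0] tendsto_add[OF tendsto_const d0] by auto
  have in01: "t - d n \<in> {0..1}" "s + d n \<in> {0..1}" for n using d[of n] st lt by auto
  have "(\<lambda>n. G (t - d n) - G (s + d n)) \<longlonglongrightarrow> G t - G s"
    by (intro tendsto_diff continuous_on_tendsto_compose[OF G] tt always_eventually allI in01) (use st in auto)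
  moreover have "(\<lambda>n. LINT r:{s + d n<..t - d n}|lborel. h r) \<longlonglongrightarrow> (LINT r:{s<..t}|lborel. h r)"
  proof -
    have hm: "(\<lambda>\<tau>. indicator {0..1} \<tau> * h \<tau>) \<in> borel_measurable lborel"
      using borel_measurable_integrable[OF h[unfolded set_integrable_def]] by simp
    have e: "(LINT r:{c<..c'}|lborel. h r) = (LINT r|lborel. indicator {c<..c'} r * (indicator {0..1} r * h r))" if "0 \<le> c" "c' \<le> 1" for c c'
      unfolding set_lebesgue_integral_def using that by (intro Bochner_Integration.integral_cong) (auto simp: indicator_def)
    have "(\<lambda>n. LINT r|lborel. indicator {s + d n<..t - d n} r * (indicator {0..1} r * h r)) \<longlonglongrightarrow> (LINT r|lborel. indicator {s<..t} r * (indicator {0..1} r * h r))"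
    proof (rule integral_dominated_convergence[where w="\<lambda>\<tau>. \<bar>indicator {0..1} \<tau> * h \<tau>\<bar>"])
      show "integrable lborel (\<lambda>\<tau>. \<bar>indicator {0..1} \<tau> * h \<tau>\<bar>)" using h by (simp add: set_integrable_def)
      show "AE r in lborel. (\<lambda>n. indicator {s + d n<..t - d n} r * (indicator {0..1} r * h r)) \<longlonglongrightarrow> indicator {s<..t} r * (indicator {0..1} r * h r)"
        using AE_lborel_singleton[of t]
      proof eventually_elim
        case (elim r)
        have "\<forall>\<^sub>F n in sequentially. indicator {s + d n<..t - d n} r = (indicator {s<..t} r :: real)"
        proof (cases "s < r \<and> r < t")
          case True
          then have "\<forall>\<^sub>F n in sequentially. r < t - d n" "\<forall>\<^sub>F n in sequentially. s + d n < r"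
            using order_tendstoD tt by blast+
          then show ?thesis by eventually_elim (use True in \<open>auto simp: indicator_def\<close>)
        next
          case False
          have "indicator {s + d n<..t - d n} r = (indicator {s<..t} r :: real)" for n
            using False elim d[of n] by (auto simp: indicator_def)
          then show ?thesis by simp
        qed
        then show ?case by (intro tendsto_mult_right tendsto_eventually)
      qed
      show "(\<lambda>r. indicator {s<..t} r * (indicator {0..1} r * h r)) \<in> borel_measurable lborel"
        "(\<lambda>r. indicator {s + d n<..t - d n} r * (indicator {0..1} r * h r)) \<in> borel_measurable lborel" for n
        by (rule borel_measurable_times[OF _ hm]; simp)+
    qed (auto simp: indicator_def)
    then show ?thesis using e st in01 by simp
  qed
  ultimately show ?thesis unfolding eq by (rule LIMSEQ_unique)
qed

section \<open>From the continuity equation to curves\<close>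

lemma GDERIV_mult_time:
  assumes f: "GDERIV f x :> g" and e: "(\<eta> has_field_derivative e') (at t)"
  shows "GDERIV (\<lambda>z. \<eta> (snd z) * f (fst z)) (x, t) :> (\<eta> t *\<^sub>R g, e' * f x)"
proof -
  have "((\<lambda>z. f (fst z)) has_derivative (\<lambda>h. fst h \<bullet> g)) (at (x, t))"
    using f unfolding gderiv_def
    by (intro has_derivative_compose[of fst fst "(x, t)" UNIV f "\<lambda>h. h \<bullet> g", simplified]) (auto intro: derivative_intros)
  moreover have "((\<lambda>z. \<eta> (snd z)) has_derivative (\<lambda>h. e' * snd h)) (at (x, t))"
    using e unfolding has_field_derivative_def
    by (intro has_derivative_compose[of snd snd "(x, t)" UNIV \<eta> "\<lambda>h. e' * h", simplified]) (auto intro: derivative_intros)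
  ultimately have "((\<lambda>z. \<eta> (snd z) * f (fst z)) has_derivative (\<lambda>h. \<eta> (snd (x, t)) * (fst h \<bullet> g) + e' * snd h * f (fst (x, t)))) (at (x, t))"
    by (intro has_derivative_mult)
  then show ?thesis unfolding gderiv_def
    by (rule has_derivative_eq_rhs) (auto simp: fun_eq_iff inner_prod_def mult.commute mult.left_commute)
qed

context action_setup
begin

text \<open>Finite total action bounds the densities at a dense set of times; weak* continuity and
  \<open>bdens_closed\<close> extend this to every time. The integrated equation comes from the test
  functions \<open>\<eta>(t) f(x)\<close> and \<open>dubois_reymond\<close>.\<close>

lemma CE_action_curve:
  assumes "(\<mu>, \<nu>) \<in> CE_action \<phi> \<gamma> \<mu>0 \<mu>1"
  shows "curve 0 1 \<mu> \<nu>" "\<mu> 0 = \<mu>0" "\<mu> 1 = \<mu>1" "total_action \<phi> \<gamma> \<mu> \<nu> = cost {0..1} \<mu> \<nu>"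
proof -
  show tc: "total_action \<phi> \<gamma> \<mu> \<nu> = cost {0..1} \<mu> \<nu>" by (simp add: total_action_def cost_def)
  have ce: "(\<mu>, \<nu>) \<in> CE 1" and fin: "cost {0..1} \<mu> \<nu> < \<infinity>" and e: "\<mu> 0 = \<mu>0" "\<mu> 1 = \<mu>1"
    using assms by (auto simp: CE_action_def tc)
  show "\<mu> 0 = \<mu>0" "\<mu> 1 = \<mu>1" by fact+
  have M: "\<mu> t \<in> Mloc" "\<nu> t \<in> Mloc" if "t \<in> {0..1}" for t using ce that by (auto simp: CE_def)
  have wc: "continuous_on {0..1} (\<lambda>t. pairing (\<mu> t) f)" if "continuous_on UNIV f" "bounded {x. f x \<noteq> 0}" for f
  proof -
    have "weak_star_continuous_on {0..1} \<mu>" using ce by (auto simp: CE_def)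
    moreover have "compact (closure {x. f x \<noteq> 0})" using that(2) by (simp add: compact_closure)
    ultimately show ?thesis using that(1) by (simp add: weak_star_continuous_on_def)
  qed
  have bf: "borel_family_on {0..1} \<nu>" using ce by (simp add: CE_def)
  have adm: "admissible {0..1} \<mu> \<nu>" using M bf fin by (simp add: admissible_def)
  have bd: "bdens (\<mu> t)" if t: "t \<in> {0..1}" for t
  proof -
    have "\<exists>s. s \<in> {0..1} \<and> \<bar>s - t\<bar> < 1 / real (Suc n) \<and> action \<phi> \<gamma> (\<mu> s) (\<nu> s) < \<infinity>" for n
    proof -
      define l where "l = max 0 (t - 1 / real (Suc n))" define u where "u = min 1 (t + 1 / real (Suc n))"
      have lu: "l < u" "{l<..<u} \<subseteq> {0..1}"
      proof -
        define e where "e = 1 / real (Suc n)"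
        have "0 < e" by (simp add: e_def)
        then show "l < u" "{l<..<u} \<subseteq> {0..1}" using t unfolding l_def u_def e_def[symmetric] by auto
      qed
      obtain s where "l < s" "s < u" "action \<phi> \<gamma> (\<mu> s) (\<nu> s) < \<infinity>"
        using nn_integral_finite_dense[OF fin[unfolded cost_def] lu] .
      then show ?thesis by (intro exI[of _ s]) (auto simp: l_def u_def abs_if)
    qed
    then obtain s where s: "\<And>n. s n \<in> {0..1}" "\<And>n. \<bar>s n - t\<bar> < 1 / real (Suc n)" "\<And>n. action \<phi> \<gamma> (\<mu> (s n)) (\<nu> (s n)) < \<infinity>"
      by metis
    have st: "s \<longlonglongrightarrow> t"
    proof (rule LIM_zero_cancel, rule Lim_null_comparison[OF _ LIMSEQ_Suc[OF lim_1_over_n]])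
      show "\<forall>\<^sub>F n in sequentially. norm (s n - t) \<le> 1 / real (Suc n)"
        using s(2) unfolding real_norm_def by (intro always_eventually allI less_imp_le)
    qed
    show ?thesis
    proof (rule bdens_closed[of "\<lambda>n. \<mu> (s n)"])
      show "bdens (\<mu> (s n))" for n by (rule action_finite_bdens[OF M[OF s(1)] s(3)])
      show "\<mu> t \<in> Mloc" by (rule M[OF t])
      fix f g assume f: "test (f :: 'a \<Rightarrow> real) g"
      have "continuous_on {0..1} (\<lambda>t. pairing (\<mu> t) f)"
        using f by (intro wc test_continuous) (auto simp: test_def)
      then show "(\<lambda>n. pairing (\<mu> (s n)) f) \<longlonglongrightarrow> pairing (\<mu> t) f"
        by (rule continuous_on_tendsto_compose[OF _ st t]) (use s in auto)
    qed
  qed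
  have "pairing (\<mu> t) f - pairing (\<mu> s) f = (LINT r:{s<..t}|lborel. pairing (\<nu> r) g)"
    if f: "test f g" and st: "0 \<le> s" "s \<le> t" "t \<le> 1" for f g s t
  proof (rule dubois_reymond[OF _ _ _ st])
    show "continuous_on {0..1} (\<lambda>t. pairing (\<mu> t) f)"
      using f by (intro wc test_continuous) (auto simp: test_def)
    show "set_integrable lborel {0..1} (\<lambda>r. pairing (\<nu> r) g)"
      by (rule flux_integrable[OF adm test_bfun(2)[OF f]]) auto
    fix \<eta> \<eta>' :: "real \<Rightarrow> real" and c d :: real
    assume d: "\<And>\<tau>. (\<eta> has_field_derivative \<eta>' \<tau>) (at \<tau>)" and c': "continuous_on UNIV \<eta>'"
      and cd: "0 < c" "d < 1" and z: "\<And>\<tau>. \<tau> \<notin> {c..d} \<Longrightarrow> \<eta> \<tau> = 0"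
    define \<zeta> where "\<zeta> z = \<eta> (snd z) * f (fst z)" for z :: "'a \<times> real"
    define D where "D z = (\<eta> (snd z) *\<^sub>R g (fst z), \<eta>' (snd z) * f (fst z))" for z :: "'a \<times> real"
    have eta: "continuous_on UNIV \<eta>" using d by (intro continuous_at_imp_continuous_on) (auto intro: DERIV_isCont)
    have sub: "{z. \<zeta> z \<noteq> 0} \<subseteq> {x. f x \<noteq> 0} \<times> {c..d}" 
    proof
      fix w assume w: "w \<in> {z. \<zeta> z \<noteq> 0}"
      then have "snd w \<in> {c..d}" using z[of "snd w"] by (cases "snd w \<in> {c..d}") (auto simp: \<zeta>_def)
      then show "w \<in> {x. f x \<noteq> 0} \<times> {c..d}" using w by (auto simp: \<zeta>_def mem_Times_iff)
    qed
    have "bounded {x. f x \<noteq> 0}" using f by (simp add: test_def)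
    then have bd: "bounded {z. \<zeta> z \<noteq> 0}" using bounded_subset[OF bounded_Times sub] by auto
    have "closure {z. \<zeta> z \<noteq> 0} \<subseteq> UNIV \<times> {c..d}"
      using sub by (intro closure_minimal) (auto intro: closed_Times)
    then have cl: "closure {z. \<zeta> z \<noteq> 0} \<subseteq> UNIV \<times> {0<..<1}" using cd by auto
    have gd: "\<forall>z. GDERIV \<zeta> z :> D z"
    proof
      fix z :: "'a \<times> real"
      obtain x t where "z = (x, t)" by force
      then show "GDERIV \<zeta> z :> D z"
        using GDERIV_mult_time[of f x "g x" \<eta> "\<eta>' t" t] f d unfolding \<zeta>_def[abs_def] D_def by (simp add: test_def)
    qed
    have cD: "continuous_on UNIV D" unfolding D_def[abs_def]
      by (intro continuous_intros continuous_on_compose2[OF eta] continuous_on_compose2[OF c']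
          continuous_on_compose2[OF test_continuous(1)[OF f]] continuous_on_compose2[OF test_continuous(2)[OF f]]) auto
    have eqn: "\<forall>(\<zeta> :: 'a \<times> real \<Rightarrow> real) D.
        (\<forall>z. GDERIV \<zeta> z :> D z) \<longrightarrow> continuous_on UNIV D \<longrightarrow>
        compact (closure {z. \<zeta> z \<noteq> 0}) \<longrightarrow> closure {z. \<zeta> z \<noteq> 0} \<subseteq> UNIV \<times> {0<..<1} \<longrightarrow>
        (LINT t:{0..1}|lborel. pairing (\<mu> t) (\<lambda>x. snd (D (x, t))))
        + (LINT t:{0..1}|lborel. pairing (\<nu> t) (\<lambda>x. fst (D (x, t)))) = 0"
      using ce by (simp add: CE_def)
    have "(LINT t:{0..1}|lborel. pairing (\<mu> t) (\<lambda>x. snd (D (x, t)))) + (LINT t:{0..1}|lborel. pairing (\<nu> t) (\<lambda>x. fst (D (x, t)))) = 0"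
      using eqn gd cD cl bd by (simp add: compact_closure)
    then show "(LINT \<tau>:{0..1}|lborel. \<eta>' \<tau> * pairing (\<mu> \<tau>) f) + (LINT \<tau>:{0..1}|lborel. \<eta> \<tau> * pairing (\<nu> \<tau>) g) = 0"
      using pairing_scaleR[where F=f] by (simp add: D_def pairing_scaleR)
  qed
  then show "curve 0 1 \<mu> \<nu>" using adm bd by (simp add: curve_def)
qed

end

section \<open>From curves back to the continuity equation\<close>

lemma GDERIV_partial:
  fixes \<zeta> :: "'a::euclidean_space \<times> real \<Rightarrow> real"
  assumes d: "GDERIV \<zeta> (x, t) :> D"
  shows "GDERIV (\<lambda>x. \<zeta> (x, t)) x :> fst D" "((\<lambda>t. \<zeta> (x, t)) has_field_derivative snd D) (at t)"
proof -
  have z: "(\<zeta> has_derivative (\<lambda>h. h \<bullet> D)) (at (x, t))" using d by (simp add: gderiv_def)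
  have 1: "((\<lambda>x. (x, t)) has_derivative (\<lambda>h. (h, 0))) (at x)" by (auto intro!: derivative_eq_intros)
  have 2: "((\<lambda>t. (x, t)) has_derivative (\<lambda>h. (0, h))) (at t)" by (auto intro!: derivative_eq_intros)
  have "((\<lambda>x. \<zeta> (x, t)) has_derivative (\<lambda>h. (h, 0) \<bullet> D)) (at x)"
    using has_derivative_compose[OF 1, of \<zeta> "\<lambda>h. h \<bullet> D"] z by simp
  then show "GDERIV (\<lambda>x. \<zeta> (x, t)) x :> fst D" unfolding gderiv_def
    by (rule has_derivative_eq_rhs) (simp add: inner_prod_def)
  have "((\<lambda>t. \<zeta> (x, t)) has_derivative (\<lambda>h. (0, h) \<bullet> D)) (at t)"
    using has_derivative_compose[OF 2, of \<zeta> "\<lambda>h. h \<bullet> D"] z by simp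
  then show "((\<lambda>t. \<zeta> (x, t)) has_field_derivative snd D) (at t)" unfolding has_field_derivative_def
    by (rule has_derivative_eq_rhs) (simp add: inner_prod_def mult.commute fun_eq_iff)
qed

lemma LINT_Icc_Ioc:
  fixes f :: "real \<Rightarrow> real" shows "(LINT t:{l..u}|lborel. f t) = (LINT t:{l<..u}|lborel. f t)"
  unfolding set_lebesgue_integral_def
  by (rule integral_discrete_difference[of "{l}"]) (auto simp: indicator_def)

context action_setup
begin

text \<open>Measure and function vary together; the \<open>L\<^sup>1(\<gamma>)\<close> distance
  bounds the error for all densities in \<open>[a, b]\<close> at once.\<close>

lemma bdens_dominated:
  fixes F :: "nat \<Rightarrow> 'a \<Rightarrow> real"
  assumes mu: "\<And>n. bdens (\<mu> n)" and F: "\<And>n. F n \<in> borel_measurable borel"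
    "\<And>n x. norm (F n x) \<le> C * indicator (ball 0 R) x" and lim: "\<And>x. (\<lambda>n. F n x) \<longlonglongrightarrow> l x"
  shows "(\<lambda>n. pairing (\<mu> n) (F n) - pairing (\<mu> n) l) \<longlonglongrightarrow> 0"
proof -
  have lm: "l \<in> borel_measurable borel" by (rule borel_measurable_LIMSEQ_metric[OF F(1)]) (rule lim)
  have lb: "norm (l x) \<le> C * indicator (ball 0 R) x" for x
    by (rule LIMSEQ_le_const2[OF tendsto_norm[OF lim]]) (use F(2) in blast)
  have bF: "bfun (F n)" for n by (rule bfunI[OF F])
  have bl: "bfun l" by (rule bfunI[OF lm lb])
  have "(\<lambda>n. LINT x|\<gamma>. \<bar>F n x - l x\<bar>) \<longlonglongrightarrow> (LINT x|\<gamma>. 0)"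
  proof (rule integral_dominated_convergence[where w="\<lambda>x. 2 * (C * indicator (ball 0 R) x)"])
    show "integrable \<gamma> (\<lambda>x. 2 * (C * indicator (ball 0 R) x))"
      using bborel_integrable[OF G bborel_ball[of 0 R]] by (intro integrable_mult_right) auto
    show "AE x in \<gamma>. (\<lambda>n. \<bar>F n x - l x\<bar>) \<longlonglongrightarrow> 0"
    proof (rule AE_I2)
      fix x
      have "(\<lambda>n. \<bar>F n x - l x\<bar>) \<longlonglongrightarrow> \<bar>l x - l x\<bar>" by (intro tendsto_intros lim)
      then show "(\<lambda>n. \<bar>F n x - l x\<bar>) \<longlonglongrightarrow> 0" by simp
    qed
    show "AE x in \<gamma>. norm \<bar>F n x - l x\<bar> \<le> 2 * (C * indicator (ball 0 R) x)" for n
    proof (rule AE_I2)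
      fix x show "norm \<bar>F n x - l x\<bar> \<le> 2 * (C * indicator (ball 0 R) x)"
        using F(2)[of n x] lb[of x] unfolding real_norm_def by linarith
    qed
    have [measurable]: "F n \<in> borel_measurable \<gamma>" "l \<in> borel_measurable \<gamma>" for n using F(1) lm by (auto simp: borel_iff)
    show "(\<lambda>x. \<bar>F n x - l x\<bar>) \<in> borel_measurable \<gamma>" for n by measurable
  qed simp
  then have "(\<lambda>n. dbound * (LINT x|\<gamma>. \<bar>F n x - l x\<bar>)) \<longlonglongrightarrow> dbound * (LINT x|\<gamma>. 0)" by (rule tendsto_mult_left)
  then have z: "(\<lambda>n. dbound * (LINT x|\<gamma>. \<bar>F n x - l x\<bar>)) \<longlonglongrightarrow> 0" by simp
  show ?thesis
    by (rule Lim_null_comparison[OF always_eventually z]) (use bdens_pairing_diff_le[OF mu bF bl] in auto)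
qed

text \<open>A discrete product rule on a time grid. Over a cell from \<open>s\<close> to
  \<open>t\<close>, the increment of the pairing of \<open>\<mu>\<close> with \<open>\<zeta>\<close>
  is the pairing of \<open>\<mu> t\<close> with the increment of \<open>\<zeta>\<close>, plus the
  increment of \<open>\<mu>\<close> paired with \<open>\<zeta>\<close> at time \<open>s\<close>.
  \<open>A n\<close> and \<open>B n\<close> are the integrands that sum these two contributions. The
  total is 0 because \<open>\<zeta>\<close> vanishes at times 0 and 1; then the cells
  shrink.\<close>

lemma curve_continuity_equation:
  fixes \<zeta> :: "'a \<times> real \<Rightarrow> real"
  assumes cv: "curve 0 1 \<mu> \<nu>" and gd: "\<And>z. GDERIV \<zeta> z :> D z" and cD: "continuous_on UNIV D"
    and bz: "bounded {z. \<zeta> z \<noteq> 0}" and sub: "closure {z. \<zeta> z \<noteq> 0} \<subseteq> UNIV \<times> {0<..<1}"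
  shows "(LINT t:{0..1}|lborel. pairing (\<mu> t) (\<lambda>x. snd (D (x, t))))
        + (LINT t:{0..1}|lborel. pairing (\<nu> t) (\<lambda>x. fst (D (x, t)))) = 0"
proof -
  note adm = curveD(1)[OF cv]
  have M: "\<nu> t \<in> Mloc" if "t \<in> {0..1}" for t using adm that by (auto simp: admissible_def)
  have bD: "bounded {z. D z \<noteq> 0}"
    by (rule bounded_subset[OF bounded_closure[OF bz] GDERIV_support[OF gd]])
  obtain C R where C0: "0 \<le> C" and CR: "\<And>z. norm (D z) \<le> C * indicator (ball 0 R) z"
    using bfun_continuous[OF cD bD] by (rule bfunE) blast
  have Dle: "norm (D (x, t)) \<le> C * indicator (ball 0 R) x" for x t
  proof (cases "x \<in> ball 0 R")
    case True
    have "norm (D (x, t)) \<le> C * indicator (ball 0 R) (x, t)" by (rule CR)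
    also have "\<dots> \<le> C * 1" using C0 by (intro mult_left_mono) (auto simp: indicator_def)
    finally show ?thesis using True by simp
  next
    case False
    have "norm x \<le> norm (x, t)" using norm_fst_le[of x t] .
    then have "(x, t) \<notin> ball 0 R" using False by simp
    then show ?thesis using CR[of "(x, t)"] False by simp
  qed
  have gle: "norm (fst (D (x, t))) \<le> C * indicator (ball 0 R) x" "norm (snd (D (x, t))) \<le> C * indicator (ball 0 R) x" for x t
    using Dle[of x t] norm_fst_le[of "fst (D (x, t))" "snd (D (x, t))"] norm_snd_le[of "snd (D (x, t))" "fst (D (x, t))"] by auto
  have cDx: "continuous_on UNIV (\<lambda>x. D (x, t))" and cDt: "continuous_on UNIV (\<lambda>t. D (x, t))" for x t
    by (intro continuous_on_compose2[OF cD] continuous_intros; simp)+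
  have test: "test (\<lambda>x. \<zeta> (x, t)) (\<lambda>x. fst (D (x, t)))" for t
    unfolding test_def
  proof (intro conjI allI)
    show "GDERIV (\<lambda>x. \<zeta> (x, t)) x :> fst (D (x, t))" for x by (rule GDERIV_partial(1)[OF gd])
    show "continuous_on UNIV (\<lambda>x. fst (D (x, t)))" by (intro continuous_intros cDx)
    have "{x. \<zeta> (x, t) \<noteq> 0} \<subseteq> fst ` {z. \<zeta> z \<noteq> 0}" by force
    then show "bounded {x. \<zeta> (x, t) \<noteq> 0}" using bounded_subset[OF bounded_fst[OF bz]] by blast
  qed
  have z0: "\<zeta> (x, t) = 0" if "t \<le> 0 \<or> 1 \<le> t" for x t
    using that sub closure_subset[of "{z. \<zeta> z \<noteq> 0}"] by force
  \<comment> \<open>\<open>up\<close> and \<open>dn\<close> are the ends of the grid cell containing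
    \<open>r\<close>. The ceiling makes the cells open on the left, like the intervals in
    \<open>curve\<close>.\<close>
  define up where "up n r = real_of_int \<lceil>real n * r\<rceil> / real n" for n r
  define dn where "dn n r = (real_of_int \<lceil>real n * r\<rceil> - 1) / real n" for n r
  have piece: "up n r = real (Suc i) / real n" "dn n r = real i / real n"
    if "n > 0" "r \<in> {real i / real n<..real (Suc i) / real n}" for n i r
  proof -
    have "real i < real n * r" "real n * r \<le> real (Suc i)" using that by (auto simp: field_simps)
    then have "\<lceil>real n * r\<rceil> = int (Suc i)" by (intro ceiling_unique) auto
    then show "up n r = real (Suc i) / real n" "dn n r = real i / real n" by (auto simp: up_def dn_def)
  qed
  define F where "F n r x = real n * (\<zeta> (x, up n r) - \<zeta> (x, dn n r))" for n r x
  define A where "A n r = pairing (\<mu> (up n r)) (F n r)" for n r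
  define B where "B n r = pairing (\<nu> r) (\<lambda>x. fst (D (x, dn n r)))" for n r
  have tb: "bfun (\<lambda>x. \<zeta> (x, t))" "bfun (\<lambda>x. fst (D (x, t)))" for t using test_bfun[OF test] by auto
  have up_dn: "dn n r < r" "r \<le> up n r" "up n r - dn n r = 1 / real n" if "n > 0" for n r
    using that ceiling_correct[of "real n * r"] unfolding up_def dn_def
    by (auto simp: field_simps)
  have up01: "up n r \<in> {0..1}" "dn n r \<in> {0..1}" if "n > 0" "r \<in> {0<..1}" for n r
  proof -
    have 1: "1 \<le> \<lceil>real n * r\<rceil>" using that by (simp add: one_le_ceiling)
    have "\<lceil>real n * r\<rceil> \<le> int n" using that by (intro ceiling_le) (simp add: mult_left_le)
    then have 2: "real_of_int \<lceil>real n * r\<rceil> \<le> real n" by linarith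
    define k where "k = real_of_int \<lceil>real n * r\<rceil>"
    have "1 \<le> k" "k \<le> real n" using 1 2 unfolding k_def by linarith+
    then show "up n r \<in> {0..1}" "dn n r \<in> {0..1}"
      using that unfolding up_def dn_def k_def[symmetric] by auto
  qed
  \<comment> \<open>By the mean value theorem the difference quotient is a value of the time
    derivative, so it inherits the bound of \<open>D\<close> uniformly in \<open>n\<close> and
    \<open>r\<close>.\<close>
  have Fle: "norm (F n r x) \<le> C * indicator (ball 0 R) x" if n: "n > 0" for n r x
  proof -
    obtain \<xi> where "\<zeta> (x, up n r) - \<zeta> (x, dn n r) = (up n r - dn n r) * snd (D (x, \<xi>))"
      using MVT2[of "dn n r" "up n r" "\<lambda>t. \<zeta> (x, t)" "\<lambda>t. snd (D (x, t))"] GDERIV_partial(2)[OF gd] up_dn[OF n, of r] by force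
    then have "F n r x = snd (D (x, \<xi>))" using up_dn(3)[OF n, of r] n by (simp add: F_def)
    then show ?thesis using gle(2) by simp
  qed
  have Fm: "F n r \<in> borel_measurable borel" for n r
    unfolding F_def using tb[THEN bfun_measurable] by measurable
  have Flim: "(\<lambda>n. F (Suc n) r x) \<longlonglongrightarrow> snd (D (x, r))" for r x
  proof -
    have "\<exists>\<xi>. dn (Suc n) r < \<xi> \<and> \<xi> < up (Suc n) r \<and> F (Suc n) r x = snd (D (x, \<xi>))" for n
    proof -
      have n: "Suc n > 0" by simp
      have "dn (Suc n) r < up (Suc n) r" using up_dn[OF n, of r] by linarith
      from MVT2[OF this, of "\<lambda>t. \<zeta> (x, t)" "\<lambda>t. snd (D (x, t))"] GDERIV_partial(2)[OF gd]
      obtain \<xi> where "dn (Suc n) r < \<xi>" "\<xi> < up (Suc n) r"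
        "\<zeta> (x, up (Suc n) r) - \<zeta> (x, dn (Suc n) r) = (up (Suc n) r - dn (Suc n) r) * snd (D (x, \<xi>))" by blast
      moreover from this have "F (Suc n) r x = snd (D (x, \<xi>))"
        using up_dn(3)[OF n, of r] by (simp add: F_def del: of_nat_Suc)
      ultimately show ?thesis by blast
    qed
    then obtain \<xi> where x: "\<And>n. dn (Suc n) r < \<xi> n" "\<And>n. \<xi> n < up (Suc n) r" "\<And>n. F (Suc n) r x = snd (D (x, \<xi> n))" by metis
    have "\<xi> \<longlonglongrightarrow> r"
    proof (rule LIM_zero_cancel, rule Lim_null_comparison[OF _ LIMSEQ_Suc[OF lim_1_over_n]])
      show "\<forall>\<^sub>F n in sequentially. norm (\<xi> n - r) \<le> 1 / real (Suc n)"
      proof (intro always_eventually allI)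
        fix n show "norm (\<xi> n - r) \<le> 1 / real (Suc n)"
          using x(1,2)[of n] up_dn[of "Suc n" r] unfolding real_norm_def by linarith
      qed
    qed
    then have "(\<lambda>n. snd (D (x, \<xi> n))) \<longlonglongrightarrow> snd (D (x, r))"
      by (intro tendsto_snd continuous_on_tendsto_compose[OF cDt]) auto
    then show ?thesis by (simp add: x(3))
  qed
  have lim_ud: "(\<lambda>n. up (Suc n) r) \<longlonglongrightarrow> r" "(\<lambda>n. dn (Suc n) r) \<longlonglongrightarrow> r" for r
  proof -
    show "(\<lambda>n. up (Suc n) r) \<longlonglongrightarrow> r"
    proof (rule LIM_zero_cancel, rule Lim_null_comparison[OF _ LIMSEQ_Suc[OF lim_1_over_n]])
      show "\<forall>\<^sub>F n in sequentially. norm (up (Suc n) r - r) \<le> 1 / real (Suc n)"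
      proof (intro always_eventually allI)
        fix n show "norm (up (Suc n) r - r) \<le> 1 / real (Suc n)"
          using up_dn[of "Suc n" r] unfolding real_norm_def by linarith
      qed
    qed
    show "(\<lambda>n. dn (Suc n) r) \<longlonglongrightarrow> r"
    proof (rule LIM_zero_cancel, rule Lim_null_comparison[OF _ LIMSEQ_Suc[OF lim_1_over_n]])
      show "\<forall>\<^sub>F n in sequentially. norm (dn (Suc n) r - r) \<le> 1 / real (Suc n)"
      proof (intro always_eventually allI)
        fix n show "norm (dn (Suc n) r - r) \<le> 1 / real (Suc n)"
          using up_dn[of "Suc n" r] unfolding real_norm_def by linarith
      qed
    qed
  qed
  have telescope: "set_integrable lborel {0<..real j / real n} (A n) \<and> set_integrable lborel {0<..real j / real n} (B n) \<and>
      pairing (\<mu> (real j / real n)) (\<lambda>x. \<zeta> (x, real j / real n)) - pairing (\<mu> 0) (\<lambda>x. \<zeta> (x, 0))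
      = (LINT r:{0<..real j / real n}|lborel. A n r) + (LINT r:{0<..real j / real n}|lborel. B n r)"
    if n: "n > 0" and j: "j \<le> n" for n j
    using j
  proof (induction j)
    case 0 then show ?case by (simp add: set_integrable_def set_lebesgue_integral_def)
  next
    case (Suc j)
    define s where "s = real j / real n" define t where "t = real (Suc j) / real n"
    have st: "0 \<le> s" "s \<le> t" "t \<le> 1" "t - s = 1 / real n" using Suc(2) n by (auto simp: s_def t_def field_simps)
    have IH: "set_integrable lborel {0<..s} (A n)" "set_integrable lborel {0<..s} (B n)"
      "pairing (\<mu> s) (\<lambda>x. \<zeta> (x, s)) - pairing (\<mu> 0) (\<lambda>x. \<zeta> (x, 0)) = (LINT r:{0<..s}|lborel. A n r) + (LINT r:{0<..s}|lborel. B n r)"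
      using Suc by (auto simp: s_def)
    have pc: "up n r = t" "dn n r = s" if "r \<in> {s<..t}" for r using piece[OF n, of r j] that by (auto simp: s_def t_def)
    define k where "k = pairing (\<mu> t) (\<lambda>x. real n * (\<zeta> (x, t) - \<zeta> (x, s)))"
    have Ak: "A n r = k" if "r \<in> {s<..t}" for r using pc[OF that] by (simp add: A_def F_def[abs_def] k_def)
    have Bk: "B n r = pairing (\<nu> r) (\<lambda>x. fst (D (x, s)))" if "r \<in> {s<..t}" for r using pc[OF that] by (simp add: B_def)
    have iA: "set_integrable lborel {s<..t} (A n)"
    proof -
      have "set_integrable lborel {s<..t} (\<lambda>r. k)" unfolding set_integrable_def
        using st by (intro integrable_scaleR_left integrable_real_indicator) auto
      then show ?thesis using Ak by (subst set_integrable_cong[OF refl refl, of _ "A n" "\<lambda>r. k"]) auto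
    qed
    have iB: "set_integrable lborel {s<..t} (B n)"
      using flux_integrable_Ioc[OF adm tb(2), of s t s] st Bk
      by (subst set_integrable_cong[OF refl refl, of _ "B n" "\<lambda>r. pairing (\<nu> r) (\<lambda>x. fst (D (x, s)))"]) auto
    have LA: "(LINT r:{s<..t}|lborel. A n r) = pairing (\<mu> t) (\<lambda>x. \<zeta> (x, t)) - pairing (\<mu> t) (\<lambda>x. \<zeta> (x, s))"
    proof -
      have "(LINT r:{s<..t}|lborel. A n r) = (LINT r:{s<..t}|lborel. k)" using Ak by (intro set_lebesgue_integral_cong) auto
      also have "\<dots> = k / real n" using st by (simp add: set_lebesgue_integral_def)
      also have "k = real n * (pairing (\<mu> t) (\<lambda>x. \<zeta> (x, t)) - pairing (\<mu> t) (\<lambda>x. \<zeta> (x, s)))"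
        unfolding k_def using pairing_scaleR[of "\<mu> t" "real n" "\<lambda>x. \<zeta> (x, t) - \<zeta> (x, s)"]
          pairing_add(2)[OF bdens_Mloc[OF curveD(2)[OF cv]] tb(1) tb(1), of t t s] st by simp
      finally show ?thesis using n by simp
    qed
    have LB: "(LINT r:{s<..t}|lborel. B n r) = pairing (\<mu> t) (\<lambda>x. \<zeta> (x, s)) - pairing (\<mu> s) (\<lambda>x. \<zeta> (x, s))"
    proof -
      have "(LINT r:{s<..t}|lborel. B n r) = (LINT r:{s<..t}|lborel. pairing (\<nu> r) (\<lambda>x. fst (D (x, s))))"
        using Bk by (intro set_lebesgue_integral_cong) auto
      then show ?thesis using curveD(3)[OF cv test, of s t s] st by simp
    qed
    have un: "{0<..t} = {0<..s} \<union> {s<..t}" using st by auto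
    have "set_integrable lborel {0<..t} (A n)" "set_integrable lborel {0<..t} (B n)"
      unfolding un using IH iA iB by (auto intro: set_integrable_Un)
    moreover have "(LINT r:{0<..t}|lborel. A n r) = (LINT r:{0<..s}|lborel. A n r) + (LINT r:{s<..t}|lborel. A n r)"
      "(LINT r:{0<..t}|lborel. B n r) = (LINT r:{0<..s}|lborel. B n r) + (LINT r:{s<..t}|lborel. B n r)"
      using st IH iA iB by (auto intro!: set_integrable_Ioc_split)
    ultimately show ?case unfolding t_def[symmetric] using IH(3) LA LB by simp
  qed
  have zp: "pairing \<kappa> (\<lambda>x. \<zeta> (x, 0)) = 0" "pairing \<kappa> (\<lambda>x. \<zeta> (x, 1)) = 0" for \<kappa> by (simp_all add: z0 pairing_def)
  have sum0: "(LINT r:{0<..1}|lborel. A (Suc n) r) + (LINT r:{0<..1}|lborel. B (Suc n) r) = 0"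
    and iA: "set_integrable lborel {0<..1} (A (Suc n))" and iB: "set_integrable lborel {0<..1} (B (Suc n))" for n
    using telescope[of "Suc n" "Suc n"] by (auto simp: zp)
  have limA: "(\<lambda>n. LINT r:{0<..1}|lborel. A (Suc n) r) \<longlonglongrightarrow> (LINT r:{0<..1}|lborel. pairing (\<mu> r) (\<lambda>x. snd (D (x, r))))"
    unfolding set_lebesgue_integral_def
  proof (rule dominated_convergence_lower(2))
    show "(\<lambda>r. indicator {0<..1} r *\<^sub>R A (Suc n) r) \<in> borel_measurable lborel" for n
      using iA[of n] unfolding set_integrable_def by (rule borel_measurable_integrable)
    let ?K = "dbound * (LINT x|\<gamma>. C * indicator (ball 0 R) x)"
    show "ennreal (norm (indicator {0<..1} r *\<^sub>R A (Suc n) r)) \<le> ennreal ?K * indicator {0<..1} r" for n r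
    proof (cases "r \<in> {0<..1}")
      case True
      have bF: "bfun (F (Suc n) r)" by (rule bfunI[OF Fm Fle]) simp
      have "\<bar>A (Suc n) r\<bar> \<le> dbound * (LINT x|\<gamma>. \<bar>F (Suc n) r x\<bar>)"
        unfolding A_def by (rule bdens_pairing_le[OF curveD(2)[OF cv up01(1)[OF _ True]] bF]) simp
      also have "\<dots> \<le> ?K"
      proof (intro mult_left_mono dbound integral_mono)
        show "integrable \<gamma> (\<lambda>x. \<bar>F (Suc n) r x\<bar>)" using bfun_integrable[OF G bF] by simp
        show "integrable \<gamma> (\<lambda>x. C * indicator (ball 0 R) x)"
          using bborel_integrable[OF G bborel_ball[of 0 R]] by (intro integrable_mult_right) auto
        show "\<bar>F (Suc n) r x\<bar> \<le> C * indicator (ball 0 R) x" for x using Fle[of "Suc n" r x] by simp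
      qed
      finally show ?thesis using True by (simp add: ennreal_leI)
    qed simp
    show "(\<integral>\<^sup>+r. ennreal ?K * indicator {0<..1::real} r \<partial>lborel) < \<infinity>"
      by (subst nn_integral_cmult_indicator) auto
    fix r :: real
    show "(\<lambda>n. indicator {0<..1} r *\<^sub>R A (Suc n) r) \<longlonglongrightarrow> indicator {0<..1} r *\<^sub>R pairing (\<mu> r) (\<lambda>x. snd (D (x, r)))"
    proof (cases "r \<in> {0<..1}")
      case True
      have bs: "bfun (\<lambda>x. snd (D (x, r)))"
        by (rule bfunI[OF borel_measurable_continuous_onI gle(2)]) (intro continuous_intros cDx)
      \<comment> \<open>The limit is taken in two moves: the difference quotient is replaced by the
        derivative, uniformly over the measures, and then the time is moved to \<open>r\<close> by
        continuity of the curve.\<close>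
      have "(\<lambda>n. pairing (\<mu> (up (Suc n) r)) (F (Suc n) r) - pairing (\<mu> (up (Suc n) r)) (\<lambda>x. snd (D (x, r)))) \<longlonglongrightarrow> 0"
        by (rule bdens_dominated[OF curveD(2)[OF cv up01(1)[OF _ True]] Fm Fle Flim]) auto
      moreover have "(\<lambda>n. pairing (\<mu> (up (Suc n) r)) (\<lambda>x. snd (D (x, r)))) \<longlonglongrightarrow> pairing (\<mu> r) (\<lambda>x. snd (D (x, r)))"
        by (rule continuous_on_tendsto_compose[OF curve_continuous[OF cv bs] lim_ud(1)]) (use True up01[OF _ True] in auto)
      ultimately have "(\<lambda>n. A (Suc n) r) \<longlonglongrightarrow> 0 + pairing (\<mu> r) (\<lambda>x. snd (D (x, r)))"
        unfolding A_def using tendsto_add by fastforce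
      then show ?thesis using True by simp
    qed simp
  qed
  have limB: "(\<lambda>n. LINT r:{0<..1}|lborel. B (Suc n) r) \<longlonglongrightarrow> (LINT r:{0<..1}|lborel. pairing (\<nu> r) (\<lambda>x. fst (D (x, r))))"
    unfolding set_lebesgue_integral_def
  \<comment> \<open>Here the dominating function contains the action, so only its lower integral is
    under control.\<close>
  proof (rule dominated_convergence_lower(2))
    show "(\<lambda>r. indicator {0<..1} r *\<^sub>R B (Suc n) r) \<in> borel_measurable lborel" for n
      using iB[of n] unfolding set_integrable_def by (rule borel_measurable_integrable)
    let ?K = "\<integral>\<^sup>+x. ennreal ((C * indicator (ball 0 R) x) powr q) \<partial>\<gamma>"
    have q0: "0 < q" using p q_def by simp
    have Kfin: "?K < \<infinity>"
    proof -
      have "?K = (\<integral>\<^sup>+x. ennreal (C powr q) * indicator (ball 0 R) x \<partial>\<gamma>)"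
        by (intro nn_integral_cong) (auto simp: indicator_def)
      also have "\<dots> = ennreal (C powr q) * emeasure \<gamma> (ball 0 R)"
        by (intro nn_integral_cmult_indicator) (simp add: Mloc_pos_sets[OF G])
      also have "\<dots> < \<infinity>" using Mloc_pos_finite[OF G bborel_ball[of 0 R]] by (simp add: ennreal_mult_less_top)
      finally show ?thesis .
    qed
    show "ennreal (norm (indicator {0<..1} r *\<^sub>R B (Suc n) r))
      \<le> ?K * indicator {0<..1} r + ennreal (1 / coer) * (action \<phi> \<gamma> (\<mu> r) (\<nu> r) * indicator {0..1} r)" for n r
    proof (cases "r \<in> {0<..1}")
      case True
      then have r01: "r \<in> {0..1}" by auto
      have "ennreal \<bar>B (Suc n) r\<bar> \<le> ennreal (1 powr (- q)) * (\<integral>\<^sup>+x. ennreal (norm (fst (D (x, dn (Suc n) r))) powr q) \<partial>\<gamma>)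
         + ennreal (1 powr p / coer) * action \<phi> \<gamma> (\<mu> r) (\<nu> r)"
        unfolding B_def by (rule pairing_bound[OF bdens_Mloc[OF curveD(2)[OF cv r01]] M[OF r01] tb(2)]) simp
      also have "\<dots> \<le> ennreal (1 powr (- q)) * ?K + ennreal (1 powr p / coer) * action \<phi> \<gamma> (\<mu> r) (\<nu> r)"
        using q0 gle(1) by (intro add_right_mono mult_left_mono nn_integral_mono ennreal_leI powr_mono2) auto
      finally show ?thesis using True r01 by simp
    qed simp
    have "(\<integral>\<^sup>+r. ?K * indicator {0<..1} r + ennreal (1 / coer) * (action \<phi> \<gamma> (\<mu> r) (\<nu> r) * indicator {0..1} r) \<partial>lborel)
      \<le> (\<integral>\<^sup>+r. ?K * indicator {0<..1::real} r \<partial>lborel) + (\<integral>\<^sup>+r. ennreal (1 / coer) * (action \<phi> \<gamma> (\<mu> r) (\<nu> r) * indicator {0..1} r) \<partial>lborel)"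
    proof (rule nn_integral_add_le)
      show "(\<lambda>r. ?K * indicator {0<..1::real} r) \<in> borel_measurable lborel" by measurable
      show "?K * indicator {0<..1} r < \<infinity>" for r :: real using Kfin by (cases "r \<in> {0<..1}") auto
    qed
    also have "(\<integral>\<^sup>+r. ?K * indicator {0<..1::real} r \<partial>lborel) = ?K"
      by (subst nn_integral_cmult_indicator) auto
    also have "(\<integral>\<^sup>+r. ennreal (1 / coer) * (action \<phi> \<gamma> (\<mu> r) (\<nu> r) * indicator {0..1} r) \<partial>lborel) = ennreal (1 / coer) * cost {0..1} \<mu> \<nu>"
      unfolding cost_def using coer_pos by (intro nn_integral_cmult_real) auto
    also have "?K + ennreal (1 / coer) * cost {0..1} \<mu> \<nu> < \<infinity>" using Kfin adm by (simp add: admissible_def ennreal_mult_less_top)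
    finally show "(\<integral>\<^sup>+r. ?K * indicator {0<..1} r + ennreal (1 / coer) * (action \<phi> \<gamma> (\<mu> r) (\<nu> r) * indicator {0..1} r) \<partial>lborel) < \<infinity>" .
    fix r :: real
    show "(\<lambda>n. indicator {0<..1} r *\<^sub>R B (Suc n) r) \<longlonglongrightarrow> indicator {0<..1} r *\<^sub>R pairing (\<nu> r) (\<lambda>x. fst (D (x, r)))"
    proof (cases "r \<in> {0<..1}")
      case True
      then have "\<nu> r \<in> Mloc" by (intro M) auto
      then have "(\<lambda>n. B (Suc n) r) \<longlonglongrightarrow> pairing (\<nu> r) (\<lambda>x. fst (D (x, r)))"
        unfolding B_def
      proof (rule pairing_limit)
        show "(\<lambda>x. fst (D (x, dn (Suc n) r))) \<in> borel_measurable borel" for n using tb(2) by (rule bfun_measurable)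
        show "norm (fst (D (x, dn (Suc n) r))) \<le> C * indicator (ball 0 R) x" for n x by (rule gle)
        show "(\<lambda>n. fst (D (x, dn (Suc n) r))) \<longlonglongrightarrow> fst (D (x, r))" for x
          by (intro tendsto_fst continuous_on_tendsto_compose[OF cDt lim_ud(2)]) auto
      qed
      then show ?thesis using True by simp
    qed simp
  qed
  have "(\<lambda>n. (LINT r:{0<..1}|lborel. A (Suc n) r) + (LINT r:{0<..1}|lborel. B (Suc n) r))
    \<longlonglongrightarrow> (LINT r:{0<..1}|lborel. pairing (\<mu> r) (\<lambda>x. snd (D (x, r)))) + (LINT r:{0<..1}|lborel. pairing (\<nu> r) (\<lambda>x. fst (D (x, r))))"
    by (intro tendsto_add limA limB)
  then show ?thesis unfolding sum0 LINT_Icc_Ioc by (rule LIMSEQ_unique[OF _ tendsto_const])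
qed

text \<open>The infimum in \<open>W\<close> thus runs over curves. The local mass bounds of
  \<open>CE\<close> come from the density bound for \<open>\<mu>\<close> and from
  \<open>variation_bound\<close> for \<open>\<nu>\<close>.\<close>

lemma curve_CE_action:
  assumes cv: "curve 0 1 \<mu> \<nu>" shows "(\<mu>, \<nu>) \<in> CE_action \<phi> \<gamma> (\<mu> 0) (\<mu> 1)"
proof -
  note adm = curveD(1)[OF cv]
  have M: "\<mu> t \<in> Mloc" "\<nu> t \<in> Mloc" if "t \<in> {0..1}" for t using adm that by (auto simp: admissible_def)
  have ws: "weak_star_continuous_on {0..1} \<mu>"
    unfolding weak_star_continuous_on_def
  proof (intro allI impI)
    fix f :: "'a \<Rightarrow> real" assume f: "continuous_on UNIV f" "compact (closure {x. f x \<noteq> 0})"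
    have "bounded {x. f x \<noteq> 0}" using f(2) compact_imp_bounded bounded_subset closure_subset by blast
    then show "continuous_on {0..1} (\<lambda>t. pairing (\<mu> t) f)" by (intro curve_continuous[OF cv] bfun_continuous f)
  qed
  have vm: "(\<integral>\<^sup>+t\<in>{0..1}. emeasure (variation (\<mu> t)) (ball 0 R) \<partial>lborel) < \<infinity>" for R
  proof -
    have "(\<integral>\<^sup>+t\<in>{0..1}. emeasure (variation (\<mu> t)) (ball 0 R) \<partial>lborel) \<le> (\<integral>\<^sup>+t. (ennreal dbound * emeasure \<gamma> (ball 0 R)) * indicator {0..1::real} t \<partial>lborel)"
    proof (rule nn_integral_mono)
      fix t
      show "emeasure (variation (\<mu> t)) (ball 0 R) * indicator {0..1} t \<le> (ennreal dbound * emeasure \<gamma> (ball 0 R)) * indicator {0..1} t"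
      proof (cases "t \<in> {0..1}")
        case True
        obtain \<rho> where r: "\<rho> \<in> borel_measurable borel" "\<And>x. \<rho> x \<in> {a..b}" "loc_integrable \<gamma> \<rho>" "\<mu> t = with_density \<gamma> \<rho>"
          using curveD(2)[OF cv True] by (rule bdensD) blast
        have "emeasure (variation (\<mu> t)) (ball 0 R) \<le> (\<integral>\<^sup>+x\<in>ball 0 R. ennreal (norm (\<rho> x)) \<partial>\<gamma>)"
          unfolding r(4) by (rule variation_with_density_le[OF G r(3)]) simp
        also have "\<dots> \<le> (\<integral>\<^sup>+x. ennreal dbound * indicator (ball 0 R) x \<partial>\<gamma>)"
          using dbound(2)[OF r(2)] by (intro nn_integral_mono mult_right_mono ennreal_leI) auto
        also have "\<dots> = ennreal dbound * emeasure \<gamma> (ball 0 R)"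
          by (intro nn_integral_cmult_indicator) (simp add: Mloc_pos_sets[OF G])
        finally show ?thesis using True by simp
      qed simp
    qed
    also have "\<dots> = ennreal dbound * emeasure \<gamma> (ball 0 R)"
      by (subst nn_integral_cmult_indicator) auto
    also have "\<dots> < \<infinity>" using Mloc_pos_finite[OF G bborel_ball[of 0 R]] by (simp add: ennreal_mult_less_top)
    finally show ?thesis .
  qed
  have vn: "(\<integral>\<^sup>+t\<in>{0..1}. emeasure (variation (\<nu> t)) (ball 0 R) \<partial>lborel) < \<infinity>" for R
  proof -
    let ?K = "emeasure \<gamma> (ball 0 R)"
    have K: "?K < \<infinity>" by (rule Mloc_pos_finite[OF G bborel_ball])
    have "(\<integral>\<^sup>+t\<in>{0..1}. emeasure (variation (\<nu> t)) (ball 0 R) \<partial>lborel)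
      \<le> (\<integral>\<^sup>+t. ?K * indicator {0..1} t + ennreal (1 / coer) * (action \<phi> \<gamma> (\<mu> t) (\<nu> t) * indicator {0..1} t) \<partial>lborel)"
    proof (rule nn_integral_mono)
      fix t
      show "emeasure (variation (\<nu> t)) (ball 0 R) * indicator {0..1} t \<le> ?K * indicator {0..1} t + ennreal (1 / coer) * (action \<phi> \<gamma> (\<mu> t) (\<nu> t) * indicator {0..1} t)"
        using variation_bound[OF M, of t t "ball 0 R"] by (cases "t \<in> {0..1}") auto
    qed
    also have "\<dots> \<le> (\<integral>\<^sup>+t. ?K * indicator {0..1::real} t \<partial>lborel) + (\<integral>\<^sup>+t. ennreal (1 / coer) * (action \<phi> \<gamma> (\<mu> t) (\<nu> t) * indicator {0..1} t) \<partial>lborel)"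
    proof (rule nn_integral_add_le)
      show "(\<lambda>t. ?K * indicator {0..1::real} t) \<in> borel_measurable lborel" by measurable
      show "?K * indicator {0..1} t < \<infinity>" for t :: real using K by (cases "t \<in> {0..1}") auto
    qed
    also have "(\<integral>\<^sup>+t. ?K * indicator {0..1::real} t \<partial>lborel) = ?K" by (subst nn_integral_cmult_indicator) auto
    also have "(\<integral>\<^sup>+t. ennreal (1 / coer) * (action \<phi> \<gamma> (\<mu> t) (\<nu> t) * indicator {0..1} t) \<partial>lborel) = ennreal (1 / coer) * cost {0..1} \<mu> \<nu>"
      unfolding cost_def using coer_pos by (intro nn_integral_cmult_real) auto
    also have "?K + ennreal (1 / coer) * cost {0..1} \<mu> \<nu> < \<infinity>" using K adm by (simp add: admissible_def ennreal_mult_less_top)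
    finally show ?thesis .
  qed
  have ce: "(LINT t:{0..1}|lborel. pairing (\<mu> t) (\<lambda>x. snd (D (x, t)))) + (LINT t:{0..1}|lborel. pairing (\<nu> t) (\<lambda>x. fst (D (x, t)))) = 0"
    if "\<forall>z. GDERIV \<zeta> z :> D z" "continuous_on UNIV D" "compact (closure {z. \<zeta> z \<noteq> 0})" "closure {z. \<zeta> z \<noteq> 0} \<subseteq> UNIV \<times> {0<..<1}"
    for \<zeta> :: "'a \<times> real \<Rightarrow> real" and D
  proof (rule curve_continuity_equation[OF cv _ that(2) _ that(4)])
    show "bounded {z. \<zeta> z \<noteq> 0}" using that(3) compact_imp_bounded bounded_subset closure_subset by blast
  qed (use that(1) in auto)
  have "(\<mu>, \<nu>) \<in> CE 1"
    using M ws vm vn ce adm by (simp add: CE_def admissible_def)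
  moreover have "total_action \<phi> \<gamma> \<mu> \<nu> < \<infinity>" using adm by (simp add: admissible_def total_action_def cost_def)
  ultimately show ?thesis by (simp add: CE_action_def)
qed

end

subsection \<open>The distance\<close>

context action_setup
begin

abbreviation Wd :: "('a set \<Rightarrow> real) \<Rightarrow> ('a set \<Rightarrow> real) \<Rightarrow> ennreal" where "Wd \<equiv> W p \<phi> \<gamma>"

section \<open>From curves to the distance and back\<close>

lemma Wd_curve_le:
  assumes cv: "curve 0 1 \<mu> \<nu>"
  shows "Wd (\<mu> 0) (\<mu> 1) \<le> ennreal (enn2real (cost {0..1} \<mu> \<nu>) powr (1 / p))"
  unfolding W_def using curve_CE_action[OF cv]
  by (intro INF_lower2[of "(\<mu>, \<nu>)"]) (auto simp: total_action_def cost_def)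

lemma Wd_curve_le_scaled:
  assumes lu: "l < u" and cv: "curve l u \<mu> \<nu>" and E: "cost {l..u} \<mu> \<nu> \<le> ennreal E" "0 \<le> E"
  shows "Wd (\<mu> l) (\<mu> u) \<le> ennreal (((u - l) powr (p - 1) * E) powr (1 / p))"
proof -
  have c: "u - l \<noteq> 0" using lu by simp
  have int: "t \<in> {0..1} \<longleftrightarrow> l + (u - l) * t \<in> {l..u}" for t
  proof -
    have "l + (u - l) * t \<le> u \<longleftrightarrow> (u - l) * t \<le> (u - l) * 1" by (simp add: algebra_simps)
    also have "\<dots> \<longleftrightarrow> t \<le> 1" using lu by (intro mult_le_cancel_left_pos) simp
    finally show ?thesis using lu by (simp add: zero_le_mult_iff)
  qed
  note a = curve_affine[OF cv c int]
  have "cost {0..1} (\<lambda>t. \<mu> (l + (u - l) * t)) (\<lambda>t A. (u - l) *\<^sub>R \<nu> (l + (u - l) * t) A) \<le> ennreal ((u - l) powr (p - 1)) * ennreal E"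
    unfolding a(2) using lu E by (simp add: mult_left_mono)
  also have "\<dots> = ennreal ((u - l) powr (p - 1) * E)" using E by (simp add: ennreal_mult)
  finally have "enn2real (cost {0..1} (\<lambda>t. \<mu> (l + (u - l) * t)) (\<lambda>t A. (u - l) *\<^sub>R \<nu> (l + (u - l) * t) A)) \<le> (u - l) powr (p - 1) * E"
    using E by (intro enn2real_leI) auto
  then have "enn2real (cost {0..1} (\<lambda>t. \<mu> (l + (u - l) * t)) (\<lambda>t A. (u - l) *\<^sub>R \<nu> (l + (u - l) * t) A)) powr (1 / p) \<le> ((u - l) powr (p - 1) * E) powr (1 / p)"
    using p by (intro powr_mono2) auto
  then show ?thesis using order_trans[OF Wd_curve_le[OF a(1)] ennreal_leI] by simp
qed

text \<open>The strict inequality provides an almost optimal curve on the unit interval;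
  \<open>curve_affine\<close> moves it to \<open>{l..u}\<close> at the price of the factor
  \<open>(u - l) powr (1 - p)\<close>.\<close>

lemma Wd_lessE:
  assumes lt: "Wd x y < ennreal e" and e: "0 < e" and lu: "l < u"
  obtains \<mu> \<nu> where "curve l u \<mu> \<nu>" "\<mu> l = x" "\<mu> u = y"
    "cost {l..u} \<mu> \<nu> \<le> ennreal ((u - l) powr (1 - p) * e powr p)"
proof -
  obtain \<mu> \<nu> where ce: "(\<mu>, \<nu>) \<in> CE_action \<phi> \<gamma> x y"
    and le: "ennreal (enn2real (total_action \<phi> \<gamma> \<mu> \<nu>) powr (1 / p)) < ennreal e"
    using lt unfolding W_def INF_less_iff by auto
  note cv = CE_action_curve[OF ce]
  let ?c = "enn2real (cost {0..1} \<mu> \<nu>)"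
  have fin: "cost {0..1} \<mu> \<nu> < \<infinity>" using curveD(1)[OF cv(1)] by (simp add: admissible_def)
  have "?c powr (1 / p) < e" using le by (simp add: cv(4) ennreal_less_iff)
  then have "(?c powr (1 / p)) powr p \<le> e powr p" using p by (intro powr_mono2) auto
  then have "?c \<le> e powr p" using p by (simp add: powr_powr)
  then have ce': "cost {0..1} \<mu> \<nu> \<le> ennreal (e powr p)"
    using fin by (metis ennreal_enn2real ennreal_leI infinity_ennreal_def)
  define c where "c = 1 / (u - l)" define k where "k = - l / (u - l)"
  have c: "c \<noteq> 0" using lu by (simp add: c_def)
  have kc: "k + c * t = (t - l) / (u - l)" for t by (simp add: k_def c_def diff_divide_distrib)
  have int: "t \<in> {l..u} \<longleftrightarrow> k + c * t \<in> {0..1}" for t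
    unfolding kc using lu by (auto simp: divide_simps)
  note a = curve_affine[OF cv(1) c int]
  show thesis
  proof (rule that[OF a(1)])
    show "\<mu> (k + c * l) = x" "\<mu> (k + c * u) = y" unfolding kc using lu cv by auto
    have "\<bar>c\<bar> powr (p - 1) = (u - l) powr (1 - p)" using lu by (simp add: c_def powr_divide powr_minus_divide[symmetric])
    then show "cost {l..u} (\<lambda>t. \<mu> (k + c * t)) (\<lambda>t A. c *\<^sub>R \<nu> (k + c * t) A) \<le> ennreal ((u - l) powr (1 - p) * e powr p)"
      unfolding a(2) using ce' by (simp add: ennreal_mult mult_left_mono)
  qed
qed

lemma Wd_finite_bdens:
  assumes "Wd x y < \<infinity>" shows "bdens x" "bdens y"
proof -
  have "CE_action \<phi> \<gamma> x y \<noteq> {}" using assms by (auto simp: W_def)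
  then obtain \<mu> \<nu> where "(\<mu>, \<nu>) \<in> CE_action \<phi> \<gamma> x y" by auto
  from CE_action_curve[OF this] curveD(2)[of 0 1 \<mu> \<nu> 0] curveD(2)[of 0 1 \<mu> \<nu> 1]
  show "bdens x" "bdens y" by auto
qed

lemma pairing_zero_measure: "bfun F \<Longrightarrow> pairing (\<lambda>A. 0) F = 0"
  using pairing_scale_measure[OF zero_Mloc, of F 0] by simp

section \<open>The axioms of a pseudo-distance\<close>

lemma Wd_refl: assumes "bdens x" shows "Wd x x = 0"
proof -
  have c0: "cost T (\<lambda>t. x) (\<lambda>t A. 0) = 0" for T
    unfolding cost_def by (simp add: action_zero[OF assms])
  have "curve 0 1 (\<lambda>t. x) (\<lambda>t A. 0)"
    unfolding curve_def admissible_def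
    using assms c0 bdens_Mloc[OF assms] zero_Mloc
    by (auto simp: borel_family_on_def pairing_zero_measure[OF test_bfun(2)] set_lebesgue_integral_def)
  from Wd_curve_le[OF this] show ?thesis by (simp add: c0)
qed

text \<open>Time reversal turns a curve from \<open>x\<close> to \<open>y\<close> into one from
  \<open>y\<close> to \<open>x\<close> of the same cost.\<close>

lemma Wd_sym_le: "Wd y x \<le> Wd x y"
  unfolding W_def[of _ _ _ x y]
proof (rule INF_greatest, clarify)
  fix \<mu> \<nu> assume ce: "(\<mu>, \<nu>) \<in> CE_action \<phi> \<gamma> x y"
  note cv = CE_action_curve[OF ce]
  have "t \<in> {0..1} \<longleftrightarrow> 1 + (-1) * t \<in> {0..1::real}" for t by auto
  note a = curve_affine[OF cv(1) _ this]
  show "Wd y x \<le> ennreal (enn2real (total_action \<phi> \<gamma> \<mu> \<nu>) powr (1 / p))"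
    using Wd_curve_le[OF a(1)] a(2) cv by simp
qed

lemma Wd_sym: "Wd x y = Wd y x"
  by (intro antisym Wd_sym_le)

text \<open>The time \<open>m\<close> at which the two curves are joined divides the unit interval
  in the ratio of \<open>e1\<close> to \<open>e2\<close>; for this choice the bounds on the two
  costs add up exactly to \<open>(e1 + e2) powr p\<close>. The summands
  \<open>\<epsilon> / 2\<close> make the inequalities strict and keep \<open>e1\<close>,
  \<open>e2\<close> positive even if a distance is 0.\<close>

lemma Wd_triangle: "Wd x z \<le> Wd x y + Wd y z"
proof (rule ennreal_le_epsilon)
  fix \<epsilon> :: real assume fin: "Wd x y + Wd y z < top" and e: "0 < \<epsilon>"
  define e1 where "e1 = enn2real (Wd x y) + \<epsilon> / 2" define e2 where "e2 = enn2real (Wd y z) + \<epsilon> / 2"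
  have e12: "0 < e1" "0 < e2" using e by (auto simp: e1_def e2_def add_nonneg_pos)
  have w1: "Wd x y = ennreal (enn2real (Wd x y))" "Wd y z = ennreal (enn2real (Wd y z))" using fin by (auto simp: less_top)
  have lt1: "Wd x y < ennreal e1" and lt2: "Wd y z < ennreal e2"
    using e by (subst w1, simp add: e1_def e2_def ennreal_less_iff)+
  define m where "m = e1 / (e1 + e2)"
  have m: "0 < m" "m < 1" using e12 by (auto simp: m_def)
  obtain \<mu>1 \<nu>1 where c1: "curve 0 m \<mu>1 \<nu>1" "\<mu>1 0 = x" "\<mu>1 m = y" "cost {0..m} \<mu>1 \<nu>1 \<le> ennreal ((m - 0) powr (1 - p) * e1 powr p)"
    using Wd_lessE[OF lt1 e12(1) m(1)] .
  obtain \<mu>2 \<nu>2 where c2: "curve m 1 \<mu>2 \<nu>2" "\<mu>2 m = y" "\<mu>2 1 = z" "cost {m..1} \<mu>2 \<nu>2 \<le> ennreal ((1 - m) powr (1 - p) * e2 powr p)"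
    using Wd_lessE[OF lt2 e12(2) m(2)] .
  have "\<mu>1 m = \<mu>2 m" using c1 c2 by simp
  note g = curve_glue[OF c1(1) c2(1) less_imp_le[OF m(1)] less_imp_le[OF m(2)] this]
  have eq: "m powr (1 - p) * e1 powr p + (1 - m) powr (1 - p) * e2 powr p = (e1 + e2) powr p"
  proof -
    let ?s = "e1 + e2"
    have s: "0 < ?s" using e12 by simp
    have m2: "1 - m = e2 / ?s" using s by (simp add: m_def field_simps)
    have *: "(f / ?s) powr (1 - p) * f powr p = ?s powr (p - 1) * f" if "0 < f" for f
    proof -
      have "(f / ?s) powr (1 - p) * f powr p = (f powr (1 - p) * f powr p) / ?s powr (1 - p)"
        using that s by (simp add: powr_divide)
      also have "f powr (1 - p) * f powr p = f" using that by (simp add: powr_add[symmetric])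
      also have "f / ?s powr (1 - p) = ?s powr (p - 1) * f" using powr_minus_divide[of ?s "1 - p"] by simp
      finally show ?thesis .
    qed
    have "m powr (1 - p) * e1 powr p + (1 - m) powr (1 - p) * e2 powr p = ?s powr (p - 1) * ?s"
      unfolding m2 unfolding m_def *[OF e12(1)] *[OF e12(2)] by (simp add: distrib_left)
    also have "\<dots> = ?s powr p" using s by (simp add: powr_diff)
    finally show ?thesis .
  qed
  have "cost {0..1} (\<lambda>t. if t \<le> m then \<mu>1 t else \<mu>2 t) (\<lambda>t. if t \<le> m then \<nu>1 t else \<nu>2 t) \<le> ennreal ((e1 + e2) powr p)"
    unfolding eq[symmetric]
    by (rule order_trans[OF g(2)]) (use add_mono[OF c1(4) c2(4)] in \<open>simp add: ennreal_plus\<close>)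
  from Wd_curve_le_scaled[OF _ g(1) this]
  have "Wd x z \<le> ennreal (((e1 + e2) powr p) powr (1 / p))" using m c1 c2 by simp
  also have "\<dots> = ennreal (e1 + e2)" using e12 p by (simp add: powr_powr)
  also have "\<dots> = Wd x y + Wd y z + ennreal \<epsilon>"
    using e by (subst w1(1), subst w1(2)) (simp add: e1_def e2_def ennreal_plus[symmetric] del: ennreal_plus)
  finally show "Wd x z \<le> Wd x y + Wd y z + ennreal \<epsilon>" .
qed

lemma curve_pairing_le:
  assumes cv: "curve 0 1 \<mu> \<nu>" and t: "test f g" and th: "0 < \<theta>"
    and K: "(\<integral>\<^sup>+x. ennreal (norm (g x) powr q) \<partial>\<gamma>) \<le> ennreal K" "0 \<le> K"
    and E: "cost {0..1} \<mu> \<nu> \<le> ennreal E" "0 \<le> E"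
  shows "\<bar>pairing (\<mu> 1) f - pairing (\<mu> 0) f\<bar> \<le> \<theta> powr (- q) * K + \<theta> powr p / coer * E"
proof -
  note adm = admissible_subset[OF curveD(1)[OF cv], of "{0<..1}"]
  have a: "admissible {0<..1} \<mu> \<nu>" by (rule adm) auto
  have i: "integrable lborel (\<lambda>r. indicator {0<..1} r *\<^sub>R pairing (\<nu> r) g)"
    using flux_integrable[OF a test_bfun(2)[OF t]] by (simp add: set_integrable_def)
  have "ennreal \<bar>pairing (\<mu> 1) f - pairing (\<mu> 0) f\<bar> = ennreal (norm (LINT r|lborel. indicator {0<..1} r *\<^sub>R pairing (\<nu> r) g))"
    using curveD(3)[OF cv t, of 0 1] by (simp add: set_lebesgue_integral_def)
  also have "\<dots> \<le> ennreal (LINT r|lborel. norm (indicator {0<..1} r *\<^sub>R pairing (\<nu> r) g))" by (intro ennreal_leI integral_norm_bound)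
  also have "\<dots> = (\<integral>\<^sup>+r. ennreal (norm (indicator {0<..1} r *\<^sub>R pairing (\<nu> r) g)) \<partial>lborel)"
    by (rule nn_integral_eq_integral[symmetric]) (use i in auto)
  also have "\<dots> = (\<integral>\<^sup>+r\<in>{0<..1}. ennreal \<bar>pairing (\<nu> r) g\<bar> \<partial>lborel)"
    by (rule nn_integral_cong) (auto simp: indicator_def)
  also have "\<dots> \<le> ennreal (\<theta> powr (- q)) * (\<integral>\<^sup>+x. ennreal (norm (g x) powr q) \<partial>\<gamma>) * emeasure lborel {0<..1::real}
      + ennreal (\<theta> powr p / coer) * cost {0<..1} \<mu> \<nu>"
    by (rule flux_bound[OF a test_bfun(2)[OF t] _ th]) simp
  also have "\<dots> \<le> ennreal (\<theta> powr (- q)) * ennreal K * 1 + ennreal (\<theta> powr p / coer) * ennreal E"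
  proof -
    have "cost {0<..1} \<mu> \<nu> \<le> ennreal E" by (rule order_trans[OF cost_mono E(1)]) auto
    then show ?thesis using K by (intro add_mono mult_mono) auto
  qed
  also have "\<dots> = ennreal (\<theta> powr (- q) * K + \<theta> powr p / coer * E)"
    using K(2) E(2) coer_pos by (simp add: ennreal_mult[symmetric] ennreal_plus[symmetric] del: ennreal_plus)
  finally show ?thesis using K(2) E(2) coer_pos by (subst (asm) ennreal_le_iff) auto
qed

text \<open>Curves of arbitrarily small cost join \<open>x\<close> and \<open>y\<close>. First
  \<open>\<theta>\<close> is chosen to make the moment term \<open>s * K\<close>, then
  \<open>\<delta>\<close> to make the cost term \<open>s\<close>; together they give
  \<open>s * (K + 1) = \<epsilon>\<close>.\<close>

lemma Wd_eq_0D: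
  assumes z: "Wd x y = 0" shows "x = y"
proof (rule Mloc_eqI)
  have "Wd x y < \<infinity>" using z by simp
  then show "x \<in> Mloc" "y \<in> Mloc" using Wd_finite_bdens bdens_Mloc by blast+
  fix f g assume t: "test (f :: 'a \<Rightarrow> real) g"
  define K where "K = enn2real (\<integral>\<^sup>+x. ennreal (norm (g x) powr q) \<partial>\<gamma>)"
  have K: "(\<integral>\<^sup>+x. ennreal (norm (g x) powr q) \<partial>\<gamma>) \<le> ennreal K" "0 \<le> K"
    using moment_finite[OF test_bfun(2)[OF t]] by (auto simp: K_def less_top)
  have q0: "0 < q" using p q_def by simp
  have "\<bar>pairing y f - pairing x f\<bar> \<le> \<epsilon>" if e: "0 < \<epsilon>" for \<epsilon>
  proof -
    define s where "s = \<epsilon> / (K + 1)"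
    have s: "0 < s" using e K by (simp add: s_def)
    define \<theta> where "\<theta> = s powr (- 1 / q)"
    have th: "0 < \<theta>" "\<theta> powr (- q) = s" using s q0 by (auto simp: \<theta>_def powr_powr)
    define \<delta> where "\<delta> = (s * coer / \<theta> powr p) powr (1 / p)"
    have d: "0 < \<delta>" "\<delta> powr p = s * coer / \<theta> powr p" using s coer_pos th p by (auto simp: \<delta>_def powr_powr)
    obtain \<mu> \<nu> where cv: "curve 0 1 \<mu> \<nu>" "\<mu> 0 = x" "\<mu> 1 = y" "cost {0..1} \<mu> \<nu> \<le> ennreal ((1 - 0) powr (1 - p) * \<delta> powr p)"
      using Wd_lessE[of x y \<delta> 0 1] z d by auto
    have "\<bar>pairing y f - pairing x f\<bar> \<le> s * K + \<theta> powr p / coer * (\<delta> powr p)"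
      using curve_pairing_le[OF cv(1) t th(1) K, of "\<delta> powr p"] cv th by simp
    also have "\<dots> = s * (K + 1)" using d(2) th(1) coer_pos by (simp add: field_simps)
    also have "\<dots> = \<epsilon>" using K(2) by (simp add: s_def)
    finally show ?thesis .
  qed
  then have "\<bar>pairing y f - pairing x f\<bar> \<le> 0" by (rule field_le_epsilon[of _ 0, simplified])
  then show "pairing x f = pairing y f" by simp
qed

lemma pseudo_distance: "pseudo_distance_on Mloc Wd"
  unfolding pseudo_distance_on_def
proof (intro conjI ballI impI)
  fix x show "Wd x x = 0 \<or> Wd x x = \<infinity>"
    using Wd_finite_bdens(1)[of x x] Wd_refl by (cases "Wd x x < \<infinity>") (auto simp: less_top)
next
  fix x y assume "Wd x y = 0" then show "x = y" by (rule Wd_eq_0D)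
next
  fix x y show "Wd x y = Wd y x" by (rule Wd_sym)
next
  fix x y z show "Wd x z \<le> Wd x y + Wd y z" by (rule Wd_triangle)
qed

end

subsection \<open>Completeness\<close>

context action_setup
begin

text \<open>For changes at the ends of an interval, which are null; the same time may be given
  twice.\<close>

lemma cost_AE:
  assumes "\<And>t. t \<notin> {t0, t1} \<Longrightarrow> (t \<in> S \<longleftrightarrow> t \<in> T) \<and> (t \<in> T \<longrightarrow> \<mu> t = \<mu>' t \<and> \<nu> t = \<nu>' t)"
  shows "cost S \<mu> \<nu> = cost T \<mu>' \<nu>'"
  unfolding cost_def
proof (rule nn_integral_cong_AE)
  show "AE t in lborel. action \<phi> \<gamma> (\<mu> t) (\<nu> t) * indicator S t = action \<phi> \<gamma> (\<mu>' t) (\<nu>' t) * indicator T t"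
    using AE_lborel_singleton[of t0] AE_lborel_singleton[of t1]
  proof eventually_elim
    case (elim t)
    then show ?case using assms[of t] by (auto simp: indicator_def)
  qed
qed

text \<open>As the total cost is finite, the flux is integrable up to time 1. So the pairings with
  test functions converge, and \<open>bdens_limit\<close> provides the end point. The flux at the
  single time 1 is set to 0.\<close>

lemma curve_extend:
  assumes cv: "\<And>s. 0 \<le> s \<Longrightarrow> s < 1 \<Longrightarrow> curve 0 s \<mu> \<nu>" and fin: "cost {0..<1} \<mu> \<nu> < \<infinity>"
  obtains x where "curve 0 1 (\<mu>(1 := x)) (\<nu>(1 := \<lambda>A. 0))"
proof -
  define tn where "tn n = 1 - 1 / real (Suc n)" for n
  have tn: "0 \<le> tn n" "tn n < 1" for n by (auto simp: tn_def divide_le_eq)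
  have tlim: "tn \<longlonglongrightarrow> 1"
    unfolding tn_def[abs_def] using tendsto_diff[OF tendsto_const[of "1::real"] LIMSEQ_Suc[OF lim_1_over_n]] by simp
  have tinc: "incseq tn" by (auto simp: incseq_def tn_def frac_le)
  have tUN: "(\<Union>n. {l<..tn n}) = {l<..<1}" for l
  proof
    show "(\<Union>n. {l<..tn n}) \<subseteq> {l<..<1}" using tn order.strict_trans1 by fastforce
    show "{l<..<1} \<subseteq> (\<Union>n. {l<..tn n})"
    proof
      fix t assume t: "t \<in> {l<..<1}"
      then have "t < 1" by simp
      from order_tendstoD(1)[OF tlim this] obtain n where "t < tn n" by (auto simp: eventually_sequentially)
      then show "t \<in> (\<Union>n. {l<..tn n})" using t by (auto intro!: exI[of _ n])
    qed
  qed
  have cvt: "curve 0 (tn n) \<mu> \<nu>" for n by (rule cv[OF tn])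
  have bd: "bdens (\<mu> t)" "\<nu> t \<in> Mloc" if "0 \<le> t" "t < 1" for t
    using curveD(1,2)[OF cv[OF that]] that by (auto simp: admissible_def)
  have bfm: "(\<lambda>t. indicator {0..<1} t *\<^sub>R \<nu> t A) \<in> borel_measurable borel" if A: "A \<in> bborel" for A
  proof (rule borel_measurable_LIMSEQ_metric)
    fix n
    show "(\<lambda>t. indicator {0..tn n} t *\<^sub>R \<nu> t A) \<in> borel_measurable borel"
      using curveD(1)[OF cvt] A by (auto simp: admissible_def borel_family_on_iff)
  next
    fix t :: real
    have "\<forall>\<^sub>F n in sequentially. indicator {0..tn n} t = (indicator {0..<1} t :: real)"
    proof (cases "t < 1")
      case True
      show ?thesis using order_tendstoD(1)[OF tlim True] by eventually_elim (use True in \<open>auto simp: indicator_def\<close>)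
    next
      case False
      then have "indicator {0..tn n} t = (indicator {0..<1} t :: real)" for n using tn(2)[of n] by (auto simp: indicator_def)
      then show ?thesis by simp
    qed
    then have "(\<lambda>n. indicator {0..tn n} t :: real) \<longlonglongrightarrow> indicator {0..<1} t" by (rule tendsto_eventually)
    then show "(\<lambda>n. indicator {0..tn n} t *\<^sub>R \<nu> t A) \<longlonglongrightarrow> indicator {0..<1} t *\<^sub>R \<nu> t A"
      by (intro tendsto_scaleR tendsto_const)
  qed
  have adm: "admissible {0..<1} \<mu> \<nu>"
    using bd bdens_Mloc bfm fin by (auto simp: admissible_def borel_family_on_iff)
  have int: "set_integrable lborel {l<..<1} (\<lambda>r. pairing (\<nu> r) g)" if "test f g" "0 \<le> l" for f g l
    by (rule set_integrable_subset[OF flux_integrable[OF adm test_bfun(2)[OF that(1)]]]) (use that in auto)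
  have lim: "(\<lambda>n. pairing (\<mu> (tn n)) f) \<longlonglongrightarrow> pairing (\<mu> 0) f + (LINT r:{0<..<1}|lborel. pairing (\<nu> r) g)"
    if t: "test f g" for f g
  proof -
    have "(\<lambda>n. LINT r:{0<..tn n}|lborel. pairing (\<nu> r) g) \<longlonglongrightarrow> (LINT r:(\<Union>n. {0<..tn n})|lborel. pairing (\<nu> r) g)"
    proof (rule set_integral_cont_up)
      show "incseq (\<lambda>n. {0<..tn n})" using incseqD[OF tinc] by (fastforce simp: incseq_def)
      show "set_integrable lborel (\<Union>n. {0<..tn n}) (\<lambda>r. pairing (\<nu> r) g)" unfolding tUN by (rule int[OF t]) simp
    qed simp
    then have "(\<lambda>n. pairing (\<mu> 0) f + (LINT r:{0<..tn n}|lborel. pairing (\<nu> r) g)) \<longlonglongrightarrow> pairing (\<mu> 0) f + (LINT r:{0<..<1}|lborel. pairing (\<nu> r) g)"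
      unfolding tUN by (intro tendsto_intros)
    moreover have "pairing (\<mu> (tn n)) f = pairing (\<mu> 0) f + (LINT r:{0<..tn n}|lborel. pairing (\<nu> r) g)" for n
      using curveD(3)[OF cvt[of n] t, of 0 "tn n"] tn(1)[of n] by simp
    ultimately show ?thesis by simp
  qed
  obtain x where x: "bdens x" "\<And>F. bfun F \<Longrightarrow> (\<lambda>n. pairing (\<mu> (tn n)) F) \<longlonglongrightarrow> pairing x F"
  proof (rule bdens_limit[of "\<lambda>n. \<mu> (tn n)"])
    show "bdens (\<mu> (tn n))" for n using bd tn by blast
    show "convergent (\<lambda>n. pairing (\<mu> (tn n)) f)" if "test f g" for f g using lim[OF that] by (auto simp: convergent_def)
  qed blast
  have xf: "pairing x f = pairing (\<mu> 0) f + (LINT r:{0<..<1}|lborel. pairing (\<nu> r) g)" if t: "test f g" for f g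
    by (rule LIMSEQ_unique[OF x(2)[OF test_bfun(1)[OF t]] lim[OF t]])
  let ?m = "\<mu>(1 := x)" let ?n = "\<nu>(1 := \<lambda>A. 0)"
  have c: "cost {0..1} ?m ?n = cost {0..<1} \<mu> \<nu>" by (rule cost_AE[of 1 1]) auto
  have "borel_family_on {0..1} ?n"
    unfolding borel_family_on_iff[OF atLeastAtMost_borel]
  proof
    fix A :: "'a set" assume A: "A \<in> bborel"
    have "(\<lambda>t. indicator {0..1} t *\<^sub>R ?n t A) = (\<lambda>t. indicator {0..<1} t *\<^sub>R \<nu> t A)"
      by (auto simp: indicator_def fun_eq_iff)
    then show "(\<lambda>t. indicator {0..1} t *\<^sub>R ?n t A) \<in> borel_measurable borel" using bfm[OF A] by simp
  qed
  then have adm': "admissible {0..1} ?m ?n"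
    using bd bdens_Mloc x zero_Mloc fin c by (auto simp: admissible_def)
  have "pairing (?m t) f - pairing (?m s) f = (LINT r:{s<..t}|lborel. pairing (?n r) g)"
    if tf: "test f g" and st: "0 \<le> s" "s \<le> t" "t \<le> 1" for f g s t
  proof (cases "t < 1")
    case True
    have "(LINT r:{s<..t}|lborel. pairing (?n r) g) = (LINT r:{s<..t}|lborel. pairing (\<nu> r) g)"
      using True by (intro set_lebesgue_integral_cong) auto
    then show ?thesis using curveD(3)[OF cv tf, of t s t] True st by simp
  next
    case False
    then have t1: "t = 1" using st by simp
    show ?thesis
    proof (cases "s = 1")
      case True then show ?thesis using t1 by (simp add: set_lebesgue_integral_def)
    next
      case False
      then have s1: "s < 1" using st t1 by simp
      have "(LINT r:{s<..1}|lborel. pairing (?n r) g) = (LINT r:{s<..<1}|lborel. pairing (\<nu> r) g)"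
        unfolding set_lebesgue_integral_def using pairing_zero_measure[OF test_bfun(2)[OF tf]]
        by (intro Bochner_Integration.integral_cong) (auto simp: indicator_def)
      moreover have "(LINT r:{0<..<1}|lborel. pairing (\<nu> r) g) = (LINT r:{0<..s}|lborel. pairing (\<nu> r) g) + (LINT r:{s<..<1}|lborel. pairing (\<nu> r) g)"
      proof -
        have "{0<..<1} = {0<..s} \<union> {s<..<1}" using st s1 by auto
        moreover have "set_integrable lborel {0<..s} (\<lambda>r. pairing (\<nu> r) g)"
          by (rule set_integrable_subset[OF int[OF tf, of 0]]) (use s1 in auto)
        moreover have "{0<..s} \<inter> {s<..<1} = {}" by auto
        ultimately show ?thesis using set_integral_Un[OF _ _ int[OF tf st(1)], of "{0<..s}"] by simp
      qed
      moreover have "pairing (\<mu> s) f - pairing (\<mu> 0) f = (LINT r:{0<..s}|lborel. pairing (\<nu> r) g)"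
        using curveD(3)[OF cv tf, of s 0 s] st s1 by simp
      ultimately show ?thesis using t1 s1 xf[OF tf] by simp
    qed
  qed
  moreover have "bdens (?m t)" if "t \<in> {0..1}" for t using that bd x by auto
  ultimately have "curve 0 1 ?m ?n" using adm' by (simp add: curve_def)
  then show thesis by (rule that)
qed

text \<open>Infinitely many pieces, on intervals accumulating at 1. Every time before 1 is reached
  by finitely many gluings, and the bound \<open>C\<close> on the tails supplies the finite cost
  that \<open>curve_extend\<close> asks for.\<close>

lemma curve_chain:
  assumes t0: "t 0 = 0" and tmono: "\<And>k::nat. t k < t (Suc k)" and t1: "t \<longlonglongrightarrow> 1"
    and cv: "\<And>k. curve (t k) (t (Suc k)) (M k) (N k)"
    and match: "\<And>k. M k (t (Suc k)) = M (Suc k) (t (Suc k))"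
    and c: "\<And>k. cost {t k..t (Suc k)} (M k) (N k) \<le> ennreal (c k)" "\<And>k. 0 \<le> c k"
    and C: "\<And>k j. (\<Sum>i\<in>{k..<j}. c i) \<le> C k"
  obtains \<mu> \<nu> where "curve 0 1 \<mu> \<nu>" "\<And>k. \<mu> (t k) = M k (t k)" "\<And>k. cost {t k..1} \<mu> \<nu> \<le> ennreal (C k)"
proof -
  have inc: "incseq t" using tmono by (auto intro: incseq_SucI less_imp_le)
  have str: "t i < t j" if "i < j" for i j using that tmono lift_Suc_mono_less[of t] by blast
  have lt1: "t k < 1" for k using tmono[of k] incseq_le[OF inc t1, of "Suc k"] by simp
  have t0': "0 \<le> t k" for k using incseqD[OF inc, of 0 k] t0 by simp
  \<comment> \<open>The index of the piece \<open>{t k<..t (Suc k)}\<close> that contains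
    \<open>s\<close>; time 0 falls to the first piece.\<close>
  define \<kappa> where "\<kappa> s = (LEAST k. s \<le> t (Suc k))" for s
  define \<mu> where "\<mu> s = M (\<kappa> s) s" for s
  define \<nu> where "\<nu> s = N (\<kappa> s) s" for s
  have kap: "\<kappa> s = k" if "t k < s" "s \<le> t (Suc k)" for s k
    unfolding \<kappa>_def
  proof (rule Least_equality)
    fix y assume "s \<le> t (Suc y)"
    then have "t k < t (Suc y)" using that by simp
    then show "k \<le> y" using incseqD[OF inc, of "Suc y" k] by (metis not_less_eq_eq not_le)
  qed (use that in auto)
  have kap0: "\<kappa> s = 0" if "s \<le> t (Suc 0)" for s
    unfolding \<kappa>_def using that by (intro Least_equality) auto
  have mt: "\<mu> (t k) = M k (t k)" for k
  proof (cases k)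
    case 0
    then show ?thesis using kap0[of "t 0"] tmono[of 0] by (simp add: \<mu>_def)
  next
    case (Suc j)
    then show ?thesis using kap[of j "t (Suc j)"] tmono[of j] match[of j] by (simp add: \<mu>_def)
  qed
  have base: "curve 0 (t (Suc k)) \<mu> \<nu>" for k
  proof (induction k)
    case 0
    show ?case
      by (rule curve_cong[of _ _ "M 0" "N 0"]) (use cv[of 0] kap0 in \<open>auto simp: t0 \<mu>_def \<nu>_def\<close>)
  next
    case (Suc k)
    let ?t = "t (Suc k)"
    have "curve 0 (t (Suc (Suc k))) (\<lambda>s. if s \<le> ?t then \<mu> s else M (Suc k) s) (\<lambda>s. if s \<le> ?t then \<nu> s else N (Suc k) s)"
      by (rule curve_glue(1)[OF Suc cv]) (use t0' tmono[of "Suc k"] mt in auto)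
    then show ?case
      by (rule curve_cong) (use kap[of "Suc k"] in \<open>auto simp: \<mu>_def \<nu>_def\<close>)
  qed
  have cv1: "curve 0 s \<mu> \<nu>" if s: "0 \<le> s" "s < 1" for s
  proof -
    obtain k where "s < t k" using order_tendstoD(1)[OF t1 s(2)] by (auto simp: eventually_sequentially)
    then have "s \<le> t (Suc k)" using tmono[of k] by simp
    then show ?thesis using curve_subset[OF base] by auto
  qed
  have piece: "cost {t k<..t (Suc k)} \<mu> \<nu> \<le> ennreal (c k)" for k
  proof -
    have "cost {t k<..t (Suc k)} \<mu> \<nu> = cost {t k<..t (Suc k)} (M k) (N k)"
      using kap by (intro cost_cong) (auto simp: \<mu>_def \<nu>_def)
    also have "\<dots> \<le> cost {t k..t (Suc k)} (M k) (N k)" by (rule cost_mono) auto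
    finally show ?thesis using c(1)[of k] by (rule order_trans)
  qed
  have partial: "cost {t k<..t (k + j)} \<mu> \<nu> \<le> ennreal (\<Sum>i\<in>{k..<k + j}. c i)" for k j
  proof (induction j)
    case 0 then show ?case by (simp add: cost_def)
  next
    case (Suc j)
    have le: "t k \<le> t (k + j)" "t (k + j) \<le> t (Suc (k + j))" using inc by (auto intro: incseqD)
    have *: "(\<integral>\<^sup>+s\<in>S. (action \<phi> \<gamma> (\<mu> s) (\<nu> s) * indicator {t k<..t (Suc (k + j))} s) \<partial>lborel) = cost S \<mu> \<nu>"
      if "S \<subseteq> {t k<..t (Suc (k + j))}" for S
      unfolding cost_def using that by (intro nn_integral_cong) (auto simp: indicator_def)
    have "cost {t k<..t (Suc (k + j))} \<mu> \<nu>
      \<le> (\<integral>\<^sup>+s\<in>{t k<..t (k + j)}. (action \<phi> \<gamma> (\<mu> s) (\<nu> s) * indicator {t k<..t (Suc (k + j))} s) \<partial>lborel)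
      + (\<integral>\<^sup>+s\<in>{t (k + j)<..t (Suc (k + j))}. (action \<phi> \<gamma> (\<mu> s) (\<nu> s) * indicator {t k<..t (Suc (k + j))} s) \<partial>lborel)"
      unfolding cost_def by (rule nn_integral_split_le) (auto simp: indicator_def)
    also have "\<dots> = cost {t k<..t (k + j)} \<mu> \<nu> + cost {t (k + j)<..t (Suc (k + j))} \<mu> \<nu>"
      using le by (subst (1 2) *) auto
    also have "\<dots> \<le> ennreal (\<Sum>i\<in>{k..<k + j}. c i) + ennreal (c (k + j))" by (intro add_mono Suc piece)
    also have "\<dots> = ennreal (\<Sum>i\<in>{k..<k + Suc j}. c i)" using c(2) by (simp add: ennreal_plus[symmetric] sum_nonneg del: ennreal_plus)
    finally show ?case by simp
  qed
  have tail: "cost {t k<..<1} \<mu> \<nu> \<le> ennreal (C k)" for k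
  proof -
    have "(\<Union>j. {t k<..t (k + j)}) = {t k<..<1}"
    proof
      show "(\<Union>j. {t k<..t (k + j)}) \<subseteq> {t k<..<1}" using lt1 order.strict_trans1 by fastforce
      show "{t k<..<1} \<subseteq> (\<Union>j. {t k<..t (k + j)})"
      proof
        fix s assume s: "s \<in> {t k<..<1}"
        then have "s < 1" by simp
        from order_tendstoD(1)[OF t1 this] obtain j where "s < t j" by (auto simp: eventually_sequentially)
        also have "t j \<le> t (k + j)" by (rule incseqD[OF inc]) simp
        finally show "s \<in> (\<Union>j. {t k<..t (k + j)})" using s by (auto intro!: exI[of _ j])
      qed
    qed
    \<comment> \<open>The bound on every finite stretch passes to the union by exhaustion, again
      without measurability of the action.\<close>
    moreover have "(\<integral>\<^sup>+s\<in>(\<Union>j. {t k<..t (k + j)}). action \<phi> \<gamma> (\<mu> s) (\<nu> s) \<partial>lborel) \<le> ennreal (C k)"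
    proof (rule nn_integral_UN_le)
      show "incseq (\<lambda>j. {t k<..t (k + j)})"
      proof (rule incseq_SucI)
        fix j show "{t k<..t (k + j)} \<subseteq> {t k<..t (k + Suc j)}" using tmono[of "k + j"] by auto
      qed
      show "(\<integral>\<^sup>+s\<in>{t k<..t (k + j)}. action \<phi> \<gamma> (\<mu> s) (\<nu> s) \<partial>lborel) \<le> ennreal (C k)" for j
        using order_trans[OF partial ennreal_leI[OF C]] by (simp add: cost_def)
    qed simp
    ultimately show ?thesis by (simp add: cost_def)
  qed
  have "cost {0..<1} \<mu> \<nu> = cost {t 0<..<1} \<mu> \<nu>" by (rule cost_AE[of 0 0]) (auto simp: t0)
  then have "cost {0..<1} \<mu> \<nu> < \<infinity>" using tail[of 0] by (metis ennreal_less_top infinity_ennreal_def order.strict_trans1)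
  from curve_extend[OF cv1 this] obtain x where x: "curve 0 1 (\<mu>(1 := x)) (\<nu>(1 := \<lambda>A. 0))" by blast
  show thesis
  proof (rule that[OF x])
    show "(\<mu>(1 := x)) (t k) = M k (t k)" for k using mt[of k] lt1[of k] by simp
    show "cost {t k..1} (\<mu>(1 := x)) (\<nu>(1 := \<lambda>A. 0)) \<le> ennreal (C k)" for k
    proof -
      have "cost {t k..1} (\<mu>(1 := x)) (\<nu>(1 := \<lambda>A. 0)) = cost {t k<..<1} \<mu> \<nu>" by (rule cost_AE[of 1 "t k"]) auto
      then show ?thesis using tail[of k] by simp
    qed
  qed
qed

text \<open>With \<open>h\<close> short for \<open>h (Suc k)\<close>, the \<open>k\<close>-th curve
  bridges a distance below \<open>h ^ 2\<close> in time \<open>h\<close>, so it costs at most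
  \<open>h powr (1 - p) * (h ^ 2) powr p = h powr (1 + p)\<close>, which is at most
  \<open>h\<close>. The tail from \<open>t k\<close> then costs at most \<open>h k\<close> on an
  interval of length \<open>h k\<close>, and rescaling it to unit length bounds the distance to the
  end point by \<open>h k\<close>.\<close>

lemma pseudo_complete: "pseudo_complete_on Mloc Wd"
  unfolding pseudo_complete_on_def
proof (intro allI impI)
  fix u :: "nat \<Rightarrow> 'a set \<Rightarrow> real"
  assume cauchy: "\<forall>\<epsilon>>0. \<exists>N. \<forall>n\<ge>N. \<forall>m\<ge>N. Wd (u n) (u m) < \<epsilon>"
  define h where "h k = (1/2 :: real) ^ k" for k :: nat
  have h: "0 < h k" "h k \<le> 1" "h (Suc k) = h k / 2" for k by (auto simp: h_def power_le_one)
  have "\<forall>k. \<exists>N. \<forall>n\<ge>N. \<forall>m\<ge>N. Wd (u n) (u m) < ennreal (h (Suc k) ^ 2)"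
  proof
    fix k
    have "0 < ennreal (h (Suc k) ^ 2)" using h(1)[of "Suc k"] by simp
    then show "\<exists>N. \<forall>n\<ge>N. \<forall>m\<ge>N. Wd (u n) (u m) < ennreal (h (Suc k) ^ 2)" using cauchy by blast
  qed
  then obtain N where N: "\<And>k n m. N k \<le> n \<Longrightarrow> N k \<le> m \<Longrightarrow> Wd (u n) (u m) < ennreal (h (Suc k) ^ 2)" by metis
  \<comment> \<open>The sum makes the indices increasing in \<open>k\<close> and at least both
    \<open>N k\<close> and \<open>k\<close>.\<close>
  define n where "n k = (\<Sum>i\<le>k. Suc (N i))" for k
  have nN: "N k \<le> n k" for k
    using member_le_sum[of k "{..k}" "\<lambda>i. Suc (N i)"] unfolding n_def by simp
  have nk: "k \<le> n k" for k
    using sum_mono[of "{..k}" "\<lambda>i. 1" "\<lambda>i. Suc (N i)"] unfolding n_def by simp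
  have nmono: "n k \<le> n (Suc k)" for k unfolding n_def by simp
  define v where "v k = u (n k)" for k
  have vlt: "Wd (v k) (v (Suc k)) < ennreal (h (Suc k) ^ 2)" for k
    unfolding v_def using nN[of k] nmono[of k] by (intro N) auto
  define t where "t k = 1 - h k" for k
  have t: "t 0 = 0" "t k < t (Suc k)" "t (Suc k) - t k = h (Suc k)" for k using h(1)[of k] h(3)[of k] by (auto simp: t_def h_def)
  have tl: "t \<longlonglongrightarrow> 1"
  proof -
    have "h \<longlonglongrightarrow> 0" unfolding h_def[abs_def] by (rule LIMSEQ_power_zero) simp
    from tendsto_diff[OF tendsto_const[of 1] this] show ?thesis by (simp add: t_def[abs_def])
  qed
  have "\<forall>k. \<exists>\<mu> \<nu>. curve (t k) (t (Suc k)) \<mu> \<nu> \<and> \<mu> (t k) = v k \<and> \<mu> (t (Suc k)) = v (Suc k) \<and> cost {t k..t (Suc k)} \<mu> \<nu> \<le> ennreal (h (Suc k))"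
  proof
    fix k
    have pos: "0 < h (Suc k) ^ 2" using h(1)[of "Suc k"] by simp
    obtain \<mu> \<nu> where c: "curve (t k) (t (Suc k)) \<mu> \<nu>" "\<mu> (t k) = v k" "\<mu> (t (Suc k)) = v (Suc k)"
      "cost {t k..t (Suc k)} \<mu> \<nu> \<le> ennreal ((t (Suc k) - t k) powr (1 - p) * (h (Suc k) ^ 2) powr p)"
      using Wd_lessE[OF vlt pos t(2)] .
    have "h (Suc k) powr (1 - p) * (h (Suc k) ^ 2) powr p = h (Suc k) powr (1 + p)"
    proof -
      have "h (Suc k) ^ 2 = h (Suc k) powr 2" using h(1)[of "Suc k"] by simp
      then have "h (Suc k) powr (1 - p) * (h (Suc k) ^ 2) powr p = h (Suc k) powr (1 - p) * h (Suc k) powr (2 * p)"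
        by (simp add: powr_powr)
      also have "\<dots> = h (Suc k) powr (1 + p)" by (simp add: powr_add[symmetric] add.commute)
      finally show ?thesis .
    qed
    also have "\<dots> \<le> h (Suc k) powr 1" using h(1,2)[of "Suc k"] p by (intro powr_mono') auto
    also have "\<dots> = h (Suc k)" using h(1)[of "Suc k"] by simp
    finally have "cost {t k..t (Suc k)} \<mu> \<nu> \<le> ennreal (h (Suc k))"
      using c(4) unfolding t(3) by (intro order_trans[OF c(4)[unfolded t(3)] ennreal_leI])
    then show "\<exists>\<mu> \<nu>. curve (t k) (t (Suc k)) \<mu> \<nu> \<and> \<mu> (t k) = v k \<and> \<mu> (t (Suc k)) = v (Suc k) \<and> cost {t k..t (Suc k)} \<mu> \<nu> \<le> ennreal (h (Suc k))"
      using c by blast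
  qed
  then obtain M V where MV: "\<And>k. curve (t k) (t (Suc k)) (M k) (V k)" "\<And>k. M k (t k) = v k" "\<And>k. M k (t (Suc k)) = v (Suc k)"
    "\<And>k. cost {t k..t (Suc k)} (M k) (V k) \<le> ennreal (h (Suc k))"
    by metis
  have sum: "(\<Sum>i\<in>{k..<j}. h (Suc i)) \<le> h k" for k j
  proof (cases "k \<le> j")
    case True
    have "(\<Sum>i\<in>{k..<j}. h (Suc i)) = (\<Sum>i\<in>{k..<j}. h i - h (Suc i))" by (rule sum.cong) (auto simp: h(3))
    also have "\<dots> = h k - h j" using sum_Suc_diff'[OF True, of "\<lambda>i. - h i"] by (simp add: sum_subtractf)
    finally show ?thesis using h(1)[of j] by simp
  qed (use h(1)[of k] in auto)
  obtain \<mu> \<nu> where cv: "curve 0 1 \<mu> \<nu>" "\<And>k. \<mu> (t k) = M k (t k)" "\<And>k. cost {t k..1} \<mu> \<nu> \<le> ennreal (h k)"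
    using curve_chain[of t M V "\<lambda>k. h (Suc k)" h, OF t(1,2) tl MV(1) _ MV(4) _ sum] MV(2,3) less_imp_le[OF h(1)] by auto
  define x where "x = \<mu> 1"
  have vx: "Wd (v k) x \<le> ennreal (h k)" for k
  proof -
    have lt: "t k < 1" "0 \<le> t k" using h(1,2)[of k] by (auto simp: t_def)
    have "Wd (\<mu> (t k)) (\<mu> 1) \<le> ennreal (((1 - t k) powr (p - 1) * h k) powr (1 / p))"
      using lt h(1)[of k] by (intro Wd_curve_le_scaled[OF lt(1) curve_subset[OF cv(1)] cv(3)]) auto
    also have "(1 - t k) powr (p - 1) * h k = h k powr p" using h(1)[of k] by (simp add: t_def powr_diff)
    also have "(h k powr p) powr (1 / p) = h k" using h(1)[of k] p by (simp add: powr_powr)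
    finally show ?thesis using cv(2) MV(2) by (simp add: x_def)
  qed
  have "bdens x" unfolding x_def by (rule curveD(2)[OF cv(1)]) simp
  moreover have "(\<lambda>n. Wd (u n) x) \<longlonglongrightarrow> 0"
  proof (rule order_tendstoI)
    fix e :: ennreal assume "0 < e"
    then obtain e' where e': "0 < e'" "ennreal e' < e"
    proof -
      obtain d where d: "0 < d" "d < e" using dense[OF \<open>0 < e\<close>] by blast
      then obtain r where "d = ennreal r" "0 \<le> r" by (cases d) auto
      then show ?thesis using d that[of r] by auto
    qed
    have "h \<longlonglongrightarrow> 0" unfolding h_def[abs_def] by (rule LIMSEQ_power_zero) simp
    from order_tendstoD(2)[OF this, of "e' / 2"] e' obtain k0 where k0: "\<And>k. k0 \<le> k \<Longrightarrow> h k < e' / 2"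
      by (auto simp: eventually_sequentially)
    have "0 < ennreal (e' / 2)" using e' by simp
    with cauchy obtain N0 where N0: "\<And>n m. N0 \<le> n \<Longrightarrow> N0 \<le> m \<Longrightarrow> Wd (u n) (u m) < ennreal (e' / 2)" by blast
    define k where "k = max k0 N0"
    have m: "N0 \<le> n k" "Wd (u (n k)) x \<le> ennreal (e' / 2)"
    proof -
      show "N0 \<le> n k" using nk[of k] by (simp add: k_def)
      have "h k \<le> e' / 2" using k0[of k] by (simp add: k_def)
      then show "Wd (u (n k)) x \<le> ennreal (e' / 2)" using order_trans[OF vx ennreal_leI] by (simp add: v_def)
    qed
    show "\<forall>\<^sub>F n in sequentially. Wd (u n) x < e"
      unfolding eventually_sequentially
    proof (intro exI[of _ N0] allI impI)
      fix i assume "N0 \<le> i"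
      have "Wd (u i) x \<le> Wd (u i) (u (n k)) + Wd (u (n k)) x" by (rule Wd_triangle)
      also have "\<dots> \<le> ennreal (e' / 2) + ennreal (e' / 2)" using N0[OF \<open>N0 \<le> i\<close> m(1)] m(2) by (intro add_mono) auto
      also have "\<dots> = ennreal e'" using e' by (simp add: ennreal_plus[symmetric] del: ennreal_plus)
      finally show "Wd (u i) x < e" using e'(2) by (rule order.strict_trans1)
    qed
  qed simp
  ultimately show "\<exists>x\<in>Mloc. (\<lambda>n. Wd (u n) x) \<longlonglongrightarrow> 0" using bdens_Mloc by blast
qed

end

subsection \<open>Conservation of mass\<close>

text \<open>No bounded set can exceed the integral of the positive part, and the parts
  \<open>A n\<close> of \<open>{f > 0}\<close> in growing balls attain it in the limit.\<close>

lemma pos_mass_with_density: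
  assumes M: "M \<in> Mloc_pos" and f: "loc_integrable M f"
  shows "pos_mass (with_density M f) = (\<integral>\<^sup>+x. ennreal (f x) \<partial>M)"
proof (rule antisym)
  have [measurable]: "f \<in> borel_measurable M" using f by (simp add: loc_integrable_def)
  have i: "integrable M (\<lambda>x. indicator A x * f x)" if "A \<in> bborel" for A
    using loc_integrableD[OF f that] by (simp add: set_integrable_def)
  have wd: "with_density M f A = (LINT x|M. indicator A x * f x)" if "A \<in> bborel" for A
    using that by (simp add: with_density_def set_lebesgue_integral_def)
  show "pos_mass (with_density M f) \<le> (\<integral>\<^sup>+x. ennreal (f x) \<partial>M)"
    unfolding pos_mass_def
  proof (rule SUP_least)
    fix A :: "'a set" assume A: "A \<in> bborel"
    have "with_density M f A \<le> (LINT x|M. max 0 (indicator A x * f x))"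
      unfolding wd[OF A] using i[OF A] by (intro integral_mono) auto
    then have "ennreal (with_density M f A) \<le> ennreal (LINT x|M. max 0 (indicator A x * f x))" by (rule ennreal_leI)
    also have "\<dots> = (\<integral>\<^sup>+x. ennreal (max 0 (indicator A x * f x)) \<partial>M)"
      using i[OF A] by (intro nn_integral_eq_integral[symmetric]) auto
    also have "\<dots> \<le> (\<integral>\<^sup>+x. ennreal (f x) \<partial>M)"
      by (intro nn_integral_mono) (auto simp: indicator_def max_def ennreal_leI)
    finally show "ennreal (with_density M f A) \<le> (\<integral>\<^sup>+x. ennreal (f x) \<partial>M)" .
  qed
  define A where "A n = {x\<in>space M. 0 < f x} \<inter> ball 0 (real n)" for n
  have As[measurable]: "A n \<in> sets M" for n
  proof -
    have "{x\<in>space M. 0 < f x} \<in> sets M" by measurable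
    then show ?thesis unfolding A_def using M by (intro sets.Int) (simp_all add: Mloc_pos_sets)
  qed
  have Ab: "A n \<in> bborel" for n
    using As[of n] M by (intro bborel_subset[OF bborel_ball[of 0 "real n"]]) (auto simp: A_def Mloc_pos_sets)
  have ind: "ennreal (indicator (A n) x * f x) = ennreal (f x) * indicator (ball 0 (real n)) x" for n x
    by (cases "0 < f x") (auto simp: A_def Mloc_pos_space[OF M] indicator_def ennreal_neg)
  have "(\<integral>\<^sup>+x. ennreal (f x) \<partial>M) = (\<integral>\<^sup>+x. (SUP n. ennreal (indicator (A n) x * f x)) \<partial>M)"
  proof (rule nn_integral_cong)
    fix x :: 'a
    obtain n :: nat where "norm x < real n" using reals_Archimedean2 by blast
    then have "ennreal (f x) \<le> (SUP n. ennreal (indicator (A n) x * f x))"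
      unfolding ind by (intro SUP_upper2[of n]) auto
    moreover have "(SUP n. ennreal (indicator (A n) x * f x)) \<le> ennreal (f x)"
      unfolding ind by (intro SUP_least) (auto simp: indicator_def)
    ultimately show "ennreal (f x) = (SUP n. ennreal (indicator (A n) x * f x))" by (rule antisym)
  qed
  also have "\<dots> = (SUP n. \<integral>\<^sup>+x. ennreal (indicator (A n) x * f x) \<partial>M)"
  proof (rule nn_integral_monotone_convergence_SUP)
    show "incseq (\<lambda>n x. ennreal (indicator (A n) x * f x))"
      unfolding ind by (auto simp: incseq_def le_fun_def indicator_def)
  qed measurable
  also have "\<dots> \<le> pos_mass (with_density M f)"
    unfolding pos_mass_def
  proof (intro SUP_least)
    fix n
    have "(\<integral>\<^sup>+x. ennreal (indicator (A n) x * f x) \<partial>M) = ennreal (with_density M f (A n))"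
      unfolding wd[OF Ab] by (rule nn_integral_eq_integral[OF i[OF Ab]]) (auto simp: A_def indicator_def)
    then show "(\<integral>\<^sup>+x. ennreal (indicator (A n) x * f x) \<partial>M) \<le> (SUP A\<in>bborel. ennreal (with_density M f A))"
      using Ab[of n] by (auto intro: SUP_upper)
  qed
  finally show "(\<integral>\<^sup>+x. ennreal (f x) \<partial>M) \<le> pos_mass (with_density M f)" .
qed

lemma neg_mass_eq_pos_mass: "neg_mass \<mu> = pos_mass (\<lambda>A. - \<mu> A)"
  by (simp add: neg_mass_def pos_mass_def)

lemma neg_mass_with_density:
  assumes M: "M \<in> Mloc_pos" and f: "loc_integrable M f"
  shows "neg_mass (with_density M f) = (\<integral>\<^sup>+x. ennreal (- f x) \<partial>M)"
proof -
  have "(\<lambda>A. - with_density M f A) = with_density M (\<lambda>x. - f x)"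
    using with_density_scaleR[of M "-1" f] by (auto simp: fun_eq_iff)
  moreover have "loc_integrable M (\<lambda>x. - f x)" using loc_integrable_scaleR[OF f, of "-1"] by simp
  ultimately show ?thesis using pos_mass_with_density[OF M] by (simp add: neg_mass_eq_pos_mass)
qed

section \<open>Cut-offs and the total mass\<close>

lemma bump_mono: assumes "0 < r" "r \<le> r'" shows "bump 0 r x \<le> bump 0 r' x"
proof -
  have "r\<^sup>2 \<le> r'\<^sup>2" using assms by (intro power_mono) auto
  then have "(norm x)\<^sup>2 / r'\<^sup>2 \<le> (norm x)\<^sup>2 / r\<^sup>2" using assms by (intro divide_left_mono) auto
  then show ?thesis unfolding bump_def by (intro power_mono) auto
qed

lemma bump_tendsto: "(\<lambda>n. bump 0 (real (Suc n)) x) \<longlonglongrightarrow> 1"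
proof -
  have "(\<lambda>n. (1 / real (Suc n))\<^sup>2 * (norm x)\<^sup>2) \<longlonglongrightarrow> 0\<^sup>2 * (norm x)\<^sup>2"
    by (intro tendsto_intros LIMSEQ_Suc[OF lim_1_over_n])
  then have "(\<lambda>n. (max 0 (1 - (1 / real (Suc n))\<^sup>2 * (norm x)\<^sup>2))\<^sup>2) \<longlonglongrightarrow> (max 0 (1 - 0\<^sup>2 * (norm x)\<^sup>2))\<^sup>2"
    by (rule tendsto_power[OF tendsto_max[OF tendsto_const tendsto_diff[OF tendsto_const]]])
  then show ?thesis by (simp add: bump_def power_divide del: of_nat_Suc)
qed

text \<open>The convergence is monotone, so the limit may be infinite. \<open>ennreal\<close>
  discards negative values: applied to \<open>f\<close> and to \<open>- f\<close>, the lemma handles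
  the positive and the negative part.\<close>

lemma bump_nn_integral_tendsto:
  assumes M: "M \<in> Mloc_pos" and f: "f \<in> borel_measurable M"
  shows "(\<lambda>n. \<integral>\<^sup>+x. ennreal (bump 0 (real (Suc n)) x * f x) \<partial>M) \<longlonglongrightarrow> (\<integral>\<^sup>+x. ennreal (f x) \<partial>M)"
proof -
  note f[measurable]
  have eq: "ennreal (bump 0 (real (Suc n)) x * f x) = ennreal (bump 0 (real (Suc n)) x) * ennreal (f x)" for n x
    using bump_range(1) by (rule ennreal_mult')
  have bm[measurable]: "bump 0 (real (Suc n)) \<in> borel_measurable M" for n
    using test_bfun(1)[OF test_bump[of "real (Suc n)" 0], THEN bfun_measurable]
    by (simp add: measurable_cong_sets[OF Mloc_pos_sets[OF M] refl] del: of_nat_Suc)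
  have inc: "incseq (\<lambda>n x. ennreal (bump 0 (real (Suc n)) x * f x))"
    unfolding eq by (intro incseq_SucI le_funI mult_right_mono ennreal_leI bump_mono) auto
  have "(SUP n. ennreal (bump 0 (real (Suc n)) x * f x)) = ennreal (f x)" for x
  proof (rule LIMSEQ_unique[OF LIMSEQ_SUP])
    show "incseq (\<lambda>n. ennreal (bump 0 (real (Suc n)) x * f x))" using inc by (auto simp: incseq_def le_fun_def)
    have "(\<lambda>n. bump 0 (real (Suc n)) x * f x) \<longlonglongrightarrow> 1 * f x" by (intro tendsto_intros bump_tendsto)
    then show "(\<lambda>n. ennreal (bump 0 (real (Suc n)) x * f x)) \<longlonglongrightarrow> ennreal (f x)" by (intro tendsto_ennrealI) simp
  qed
  moreover have "(\<lambda>x. ennreal (bump 0 (real (Suc n)) x * f x)) \<in> borel_measurable M" for n by measurable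
  ultimately have "(\<integral>\<^sup>+x. ennreal (f x) \<partial>M) = (SUP n. \<integral>\<^sup>+x. ennreal (bump 0 (real (Suc n)) x * f x) \<partial>M)"
    using nn_integral_monotone_convergence_SUP[OF inc] by (simp del: of_nat_Suc)
  moreover have "incseq (\<lambda>n. \<integral>\<^sup>+x. ennreal (bump 0 (real (Suc n)) x * f x) \<partial>M)"
    using inc by (auto simp: incseq_def le_fun_def intro!: nn_integral_mono)
  ultimately show ?thesis using LIMSEQ_SUP by simp
qed

text \<open>Each cut-off pairing is a difference of two finite integrals. These tend to the positive
  and the negative mass, and \<open>has_total_mass\<close> excludes the difference of two
  infinities.\<close>

lemma pairing_bump_tendsto_total_mass:
  assumes M: "M \<in> Mloc_pos" and f: "loc_integrable M f" and tm: "has_total_mass (with_density M f)"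
  shows "(\<lambda>n. ereal (pairing (with_density M f) (bump 0 (real (Suc n))))) \<longlonglongrightarrow> total_mass (with_density M f)"
proof -
  let ?P = "\<lambda>n. \<integral>\<^sup>+x. ennreal (bump 0 (real (Suc n)) x * f x) \<partial>M"
  let ?N = "\<lambda>n. \<integral>\<^sup>+x. ennreal (bump 0 (real (Suc n)) x * - f x) \<partial>M"
  have fm: "f \<in> borel_measurable M" using f by (simp add: loc_integrable_def)
  have bb: "bfun (bump 0 (real (Suc n)))" for n by (rule test_bfun(1)[OF test_bump]) simp
  have int: "integrable M (\<lambda>x. bump 0 (real (Suc n)) x * f x)" for n
    using bfun_inner_integrable[OF M f bb] by simp
  have eq: "ereal (pairing (with_density M f) (bump 0 (real (Suc n)))) = enn2ereal (?P n) - enn2ereal (?N n)" for n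
  proof -
    have "pairing (with_density M f) (bump 0 (real (Suc n))) = (LINT x|M. bump 0 (real (Suc n)) x * f x)"
      by (subst pairing_with_density[OF M f bb]) simp
    also have "\<dots> = enn2real (?P n) - enn2real (?N n)"
      by (subst real_lebesgue_integral_def[OF int]) simp
    finally have 1: "pairing (with_density M f) (bump 0 (real (Suc n))) = enn2real (?P n) - enn2real (?N n)" .
    have fin: "?P n < \<infinity>" "?N n < \<infinity>"
      using int[of n] by (auto simp: real_integrable_def less_top)
    then have "enn2ereal (?P n) = ereal (enn2real (?P n))" "enn2ereal (?N n) = ereal (enn2real (?N n))"
      by (cases "?P n"; cases "?N n"; simp add: enn2ereal_ennreal)+
    then show ?thesis unfolding 1 by (simp del: of_nat_Suc)
  qed
  have P: "(\<lambda>n. enn2ereal (?P n)) \<longlonglongrightarrow> enn2ereal (pos_mass (with_density M f))"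
    unfolding pos_mass_with_density[OF M f] by (intro tendsto_enn2erealI bump_nn_integral_tendsto M fm)
  have N: "(\<lambda>n. enn2ereal (?N n)) \<longlonglongrightarrow> enn2ereal (neg_mass (with_density M f))"
    unfolding neg_mass_with_density[OF M f] by (intro tendsto_enn2erealI bump_nn_integral_tendsto M) (use fm in simp)
  have "enn2ereal (pos_mass (with_density M f)) \<noteq> \<infinity> \<or> enn2ereal (neg_mass (with_density M f)) \<noteq> \<infinity>"
    using tm unfolding has_total_mass_def by (auto simp: enn2ereal_eq_top_iff top_ereal_def)
  then show ?thesis unfolding eq total_mass_def
    by (intro tendsto_diff_ereal_general P N) auto
qed

context action_setup
begin

lemma bump_grad_moment_tendsto:
  assumes mom: "gen_moment (- q) \<gamma> < \<infinity>"
  shows "(\<lambda>n. \<integral>\<^sup>+x. ennreal (norm (bump_grad 0 (real (Suc n)) x) powr q) \<partial>\<gamma>) \<longlonglongrightarrow> 0"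
proof -
  have q0: "0 < q" using p q_def by simp
  \<comment> \<open>The integrand of \<open>gen_moment\<close> times \<open>4 powr q\<close>; the 4
    comes from differentiating the two squares in \<open>bump\<close>.\<close>
  let ?w = "\<lambda>x. ennreal (4 powr q) * (indicator (ball 0 1) x + ennreal (norm x powr (- q)) * indicator (- ball 0 1) x)"
  have norm_le: "norm (bump_grad 0 (real (Suc n)) x) \<le> 4 * norm x / (real (Suc n))\<^sup>2" for n and x :: 'a
  proof -
    have "2 * max 0 (1 - (norm (x - 0))\<^sup>2 / (real (Suc n))\<^sup>2) \<le> 2" by simp
    then have "\<bar>2 * max 0 (1 - (norm (x - 0))\<^sup>2 / (real (Suc n))\<^sup>2)\<bar> * (2 / (real (Suc n))\<^sup>2 * norm x) \<le> 2 * (2 / (real (Suc n))\<^sup>2 * norm x)"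
      by (intro mult_right_mono) auto
    then show ?thesis by (simp add: bump_grad_def mult.assoc del: of_nat_Suc)
  qed
  have zero: "bump_grad 0 (real (Suc n)) x = 0" if "real (Suc n) \<le> norm x" for n and x :: 'a
  proof -
    have "(real (Suc n))\<^sup>2 \<le> (norm x)\<^sup>2" using that by (intro power_mono) auto
    then have "1 - (norm (x - 0))\<^sup>2 / (real (Suc n))\<^sup>2 \<le> 0" by (simp add: le_divide_eq del: of_nat_Suc)
    then show ?thesis by (simp add: bump_grad_def max_def del: of_nat_Suc)
  qed
  have le: "ennreal (norm (bump_grad 0 (real (Suc n)) x) powr q) \<le> ?w x" for n and x :: 'a
  proof (cases "x \<in> ball 0 1")
    case True
    have "4 * norm x / (real (Suc n))\<^sup>2 \<le> 4 * 1 / 1"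
      using True one_le_power[of "real (Suc n)" 2] by (intro frac_le mult_left_mono) auto
    then have "norm (bump_grad 0 (real (Suc n)) x) \<le> 4" using norm_le[of n x] by simp
    then have "norm (bump_grad 0 (real (Suc n)) x) powr q \<le> 4 powr q" using q0 by (intro powr_mono2) auto
    then show ?thesis using True by (simp add: ennreal_leI)
  next
    case False
    then have x1: "1 \<le> norm x" by simp
    \<comment> \<open>Beyond the support the gradient is 0; inside, \<open>norm x < Suc n\<close>
      turns the bound \<open>4 * norm x / (Suc n)\<^sup>2\<close> into this one, which no longer
      contains \<open>n\<close>.\<close>
    have "norm (bump_grad 0 (real (Suc n)) x) \<le> 4 / norm x"
    proof (cases "real (Suc n) \<le> norm x")
      case True then show ?thesis using zero[OF True] by simp
    next
      case False
      have "4 * norm x / (real (Suc n))\<^sup>2 \<le> 4 * norm x / (norm x)\<^sup>2"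
        using False x1 by (intro divide_left_mono power_mono mult_pos_pos zero_less_power) auto
      also have "\<dots> = 4 / norm x" using x1 by (simp add: power2_eq_square)
      finally show ?thesis using norm_le[of n x] by linarith
    qed
    then have "norm (bump_grad 0 (real (Suc n)) x) powr q \<le> (4 / norm x) powr q" using q0 by (intro powr_mono2) auto
    also have "\<dots> = 4 powr q * norm x powr (- q)" by (simp add: powr_divide powr_minus field_simps)
    finally show ?thesis using False by (simp add: ennreal_mult[symmetric] ennreal_leI)
  qed
  have gm[measurable]: "bump_grad 0 (real (Suc n)) \<in> borel_measurable \<gamma>" for n
    using test_bfun(2)[OF test_bump[of "real (Suc n)" 0], THEN bfun_measurable] by (simp add: borel_iff del: of_nat_Suc)
  have bs[measurable]: "ball 0 1 \<in> sets \<gamma>" "- ball 0 1 \<in> sets \<gamma>" by (simp_all add: Mloc_pos_sets[OF G])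
  have nm[measurable]: "(\<lambda>x. norm x powr (- q)) \<in> borel_measurable \<gamma>"
  proof -
    have "(\<lambda>x::'a. norm x powr (- q)) \<in> borel_measurable borel" by measurable
    then show ?thesis by (simp only: borel_iff)
  qed
  have "(\<lambda>n. \<integral>\<^sup>+x. ennreal (norm (bump_grad 0 (real (Suc n)) x) powr q) \<partial>\<gamma>) \<longlonglongrightarrow> (\<integral>\<^sup>+x. 0 \<partial>\<gamma>)"
  proof (rule nn_integral_dominated_convergence[where w="?w"])
    show "(\<lambda>x. ennreal (norm (bump_grad 0 (real (Suc n)) x) powr q)) \<in> borel_measurable \<gamma>" for n by measurable
    show "?w \<in> borel_measurable \<gamma>" by measurable
    show "AE x in \<gamma>. ennreal (norm (bump_grad 0 (real (Suc n)) x) powr q) \<le> ?w x" for n by (rule AE_I2) (rule le)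
    have "integral\<^sup>N \<gamma> ?w = ennreal (4 powr q) * (\<integral>\<^sup>+x. indicator (ball 0 1) x + ennreal (norm x powr (- q)) * indicator (- ball 0 1) x \<partial>\<gamma>)"
      by (intro nn_integral_cmult) measurable
    also have "(\<integral>\<^sup>+x. indicator (ball 0 1) x + ennreal (norm x powr (- q)) * indicator (- ball 0 1) x \<partial>\<gamma>) = gen_moment (- q) \<gamma>"
      unfolding gen_moment_def by (subst nn_integral_add) auto
    finally show "integral\<^sup>N \<gamma> ?w < \<infinity>" using mom by (simp add: ennreal_mult_less_top)
    show "AE x in \<gamma>. (\<lambda>n. ennreal (norm (bump_grad 0 (real (Suc n)) x) powr q)) \<longlonglongrightarrow> 0"
    proof (rule AE_I2)
      fix x :: 'a
      have "(\<lambda>n. norm (bump_grad 0 (real (Suc n)) x)) \<longlonglongrightarrow> 0"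
      proof (rule tendsto_sandwich[OF _ _ tendsto_const])
        show "\<forall>\<^sub>F n in sequentially. norm (bump_grad 0 (real (Suc n)) x) \<le> 4 * norm x * (1 / real (Suc n))\<^sup>2"
          using norm_le by (simp add: power_divide del: of_nat_Suc)
        have "(\<lambda>n. 4 * norm x * (1 / real (Suc n))\<^sup>2) \<longlonglongrightarrow> 4 * norm x * 0\<^sup>2"
          by (intro tendsto_intros LIMSEQ_Suc[OF lim_1_over_n])
        then show "(\<lambda>n. 4 * norm x * (1 / real (Suc n))\<^sup>2) \<longlonglongrightarrow> 0" by simp
      qed simp
      then have "(\<lambda>n. norm (bump_grad 0 (real (Suc n)) x) powr q) \<longlonglongrightarrow> 0 powr q"
        using q0 by (intro tendsto_powr2) (auto simp del: of_nat_Suc)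
      then have "(\<lambda>n. ennreal (norm (bump_grad 0 (real (Suc n)) x) powr q)) \<longlonglongrightarrow> ennreal 0"
        by (intro tendsto_ennrealI) simp
      then show "(\<lambda>n. ennreal (norm (bump_grad 0 (real (Suc n)) x) powr q)) \<longlonglongrightarrow> 0" by simp
    qed
  qed measurable
  then show ?thesis by simp
qed

text \<open>A single curve of finite action suffices. Its action fixes \<open>\<theta>\<close>,
  making the cost term at most \<open>\<epsilon> / 2\<close>; only then is the cut-off radius taken
  large enough for the moment term.\<close>

lemma mass_conserved:
  assumes mom: "gen_moment (- q) \<gamma> < \<infinity>" and fin: "Wd \<mu> \<sigma> < \<infinity>"
    and tm: "has_total_mass \<mu>" "has_total_mass \<sigma>"
  shows "total_mass \<mu> = total_mass \<sigma>"
proof -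
  let ?\<eta> = "\<lambda>n. bump 0 (real (Suc n)) :: 'a \<Rightarrow> real" and ?g = "\<lambda>n. bump_grad 0 (real (Suc n)) :: 'a \<Rightarrow> 'a"
  have "CE_action \<phi> \<gamma> \<mu> \<sigma> \<noteq> {}" using fin by (auto simp: W_def)
  then obtain m n where ce: "(m, n) \<in> CE_action \<phi> \<gamma> \<mu> \<sigma>" by auto
  note cv = CE_action_curve[OF ce]
  define E where "E = enn2real (cost {0..1} m n)"
  have E: "cost {0..1} m n \<le> ennreal E" "0 \<le> E"
    using curveD(1)[OF cv(1)] by (auto simp: E_def admissible_def less_top)
  define K where "K i = enn2real (\<integral>\<^sup>+x. ennreal (norm (?g i x) powr q) \<partial>\<gamma>)" for i
  have test: "test (?\<eta> i) (?g i)" for i by (rule test_bump) simp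
  have K: "(\<integral>\<^sup>+x. ennreal (norm (?g i x) powr q) \<partial>\<gamma>) \<le> ennreal (K i)" "0 \<le> K i" for i
    using moment_finite[OF test_bfun(2)[OF test]] by (auto simp: K_def less_top)
  have K0: "K \<longlonglongrightarrow> 0"
    unfolding K_def[abs_def] by (rule tendsto_enn2real) (use bump_grad_moment_tendsto[OF mom] in simp_all)
  have diff: "(\<lambda>i. pairing \<sigma> (?\<eta> i) - pairing \<mu> (?\<eta> i)) \<longlonglongrightarrow> 0"
  proof (rule LIMSEQ_I)
    fix \<epsilon> :: real assume e: "0 < \<epsilon>"
    define \<theta> where "\<theta> = (\<epsilon> * coer / (2 * (E + 1))) powr (1 / p)"
    have th: "0 < \<theta>" "\<theta> powr p = \<epsilon> * coer / (2 * (E + 1))"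
      using e coer_pos E(2) p by (auto simp: \<theta>_def powr_powr)
    have "\<theta> powr p / coer * E = \<epsilon> / 2 * (E / (E + 1))" using coer_pos th(2) by simp
    also have "\<dots> \<le> \<epsilon> / 2 * 1" using e E(2) by (intro mult_left_mono) auto
    finally have 1: "\<theta> powr p / coer * E \<le> \<epsilon> / 2" by simp
    have "(\<lambda>i. \<theta> powr (- q) * K i) \<longlonglongrightarrow> \<theta> powr (- q) * 0" by (intro tendsto_mult_left K0)
    then have "(\<lambda>i. \<theta> powr (- q) * K i) \<longlonglongrightarrow> 0" by simp
    from order_tendstoD(2)[OF this, of "\<epsilon> / 2"] e obtain N where N: "\<And>i. N \<le> i \<Longrightarrow> \<theta> powr (- q) * K i < \<epsilon> / 2"
      by (auto simp: eventually_sequentially simp del: less_divide_eq_numeral1)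
    have "norm (pairing \<sigma> (?\<eta> i) - pairing \<mu> (?\<eta> i) - 0) < \<epsilon>" if "N \<le> i" for i
      using curve_pairing_le[OF cv(1) test th(1) K E, of i] N[OF that] 1 unfolding cv(2,3) real_norm_def by linarith
    then show "\<exists>N. \<forall>i\<ge>N. norm (pairing \<sigma> (?\<eta> i) - pairing \<mu> (?\<eta> i) - 0) < \<epsilon>" by blast
  qed
  note bd = Wd_finite_bdens[OF fin]
  have lim: "(\<lambda>i. ereal (pairing \<xi> (?\<eta> i))) \<longlonglongrightarrow> total_mass \<xi>" if "bdens \<xi>" "has_total_mass \<xi>" for \<xi>
    using that pairing_bump_tendsto_total_mass[OF G] by (elim bdensD) auto
  \<comment> \<open>The added difference has a real limit, so addition in \<open>ereal\<close> is
    continuous here even if the total mass is infinite.\<close>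
  have "(\<lambda>i. ereal (pairing \<mu> (?\<eta> i)) + ereal (pairing \<sigma> (?\<eta> i) - pairing \<mu> (?\<eta> i))) \<longlonglongrightarrow> total_mass \<mu> + ereal 0"
    using diff by (intro tendsto_add_ereal_general lim bd tm) auto
  then have "(\<lambda>i. ereal (pairing \<sigma> (?\<eta> i))) \<longlonglongrightarrow> total_mass \<mu>" by simp
  then show ?thesis using LIMSEQ_unique[OF lim[OF bd(2) tm(2)]] by simp
qed

section \<open>The classes of measures at finite distance\<close>

lemma finite_class_metric:
  assumes s: "\<sigma> \<in> Mloc"
  defines "X \<equiv> finite_dist_class p \<phi> \<gamma> \<sigma>"
  shows "\<And>\<mu> \<mu>'. \<mu> \<in> X \<Longrightarrow> \<mu>' \<in> X \<Longrightarrow> Wd \<mu> \<mu>' < \<infinity>"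
    "Metric_space X (\<lambda>\<mu> \<mu>'. enn2real (Wd \<mu> \<mu>'))"
    "Metric_space.mcomplete X (\<lambda>\<mu> \<mu>'. enn2real (Wd \<mu> \<mu>'))"
proof -
  have X: "\<mu> \<in> X \<longleftrightarrow> \<mu> \<in> Mloc \<and> Wd \<mu> \<sigma> < \<infinity>" for \<mu> by (simp add: X_def finite_dist_class_def)
  show fin: "Wd \<mu> \<mu>' < \<infinity>" if "\<mu> \<in> X" "\<mu>' \<in> X" for \<mu> \<mu>'
    using that Wd_triangle[of \<mu> \<mu>' \<sigma>] Wd_sym[of \<sigma> \<mu>'] by (auto simp: X intro: order.strict_trans1)
  have eq: "Wd \<mu> \<mu>' = ennreal (enn2real (Wd \<mu> \<mu>'))" if "\<mu> \<in> X" "\<mu>' \<in> X" for \<mu> \<mu>'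
    using fin[OF that] by (simp add: less_top)
  show ms: "Metric_space X (\<lambda>\<mu> \<mu>'. enn2real (Wd \<mu> \<mu>'))"
  proof
    show "0 \<le> enn2real (Wd x y)" for x y by simp
    show "enn2real (Wd x y) = enn2real (Wd y x)" for x y by (simp add: Wd_sym[of x y])
    show "enn2real (Wd x y) = 0 \<longleftrightarrow> x = y" if "x \<in> X" "y \<in> X" for x y
    proof
      assume "enn2real (Wd x y) = 0"
      then have "Wd x y = 0" using eq[OF that] by simp
      then show "x = y" by (rule Wd_eq_0D)
    next
      assume "x = y"
      \<comment> \<open>Finite distance to \<open>\<sigma>\<close> gives a density in
        \<open>[a, b]\<close>, which makes the diagonal 0 rather than
        \<open>\<infinity>\<close>.\<close>
      then show "enn2real (Wd x y) = 0" using Wd_refl[OF Wd_finite_bdens(1)] that by (auto simp: X)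
    qed
    show "enn2real (Wd x z) \<le> enn2real (Wd x y) + enn2real (Wd y z)" if "x \<in> X" "y \<in> X" "z \<in> X" for x y z
    proof -
      have "ennreal (enn2real (Wd x z)) \<le> ennreal (enn2real (Wd x y) + enn2real (Wd y z))"
        using Wd_triangle[of x z y] eq[OF that(1,3)] eq[OF that(1,2)] eq[OF that(2,3)] by simp
      then show ?thesis by (subst (asm) ennreal_le_iff) auto
    qed
  qed
  interpret Metric_space X "\<lambda>\<mu> \<mu>'. enn2real (Wd \<mu> \<mu>')" by (rule ms)
  show mcomplete
    unfolding mcomplete_def
  proof (intro allI impI)
    fix u :: "nat \<Rightarrow> 'a set \<Rightarrow> real" assume u: "MCauchy u"
    then have uX: "u n \<in> X" for n by (auto simp: MCauchy_def)
    have "\<forall>\<epsilon>>0. \<exists>N. \<forall>n\<ge>N. \<forall>m\<ge>N. Wd (u n) (u m) < \<epsilon>"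
    proof (intro allI impI)
      fix \<epsilon> :: ennreal assume "0 < \<epsilon>"
      then obtain d where d: "0 < d" "d < \<epsilon>" using dense by blast
      then obtain r where r: "d = ennreal r" "0 \<le> r" by (cases d) auto
      then have "0 < r" using d by simp
      then obtain N where N: "\<And>n n'. N \<le> n \<Longrightarrow> N \<le> n' \<Longrightarrow> enn2real (Wd (u n) (u n')) < r"
        using u unfolding MCauchy_def by blast
      have "Wd (u n) (u m) < \<epsilon>" if "N \<le> n" "N \<le> m" for n m
      proof -
        have "Wd (u n) (u m) < ennreal r" using N[OF that] by (subst eq[OF uX uX]) (simp add: ennreal_less_iff)
        then show ?thesis using d r by simp
      qed
      then show "\<exists>N. \<forall>n\<ge>N. \<forall>m\<ge>N. Wd (u n) (u m) < \<epsilon>" by blast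
    qed
    moreover have "range u \<subseteq> Mloc" using uX X by auto
    ultimately obtain x where x: "x \<in> Mloc" "(\<lambda>n. Wd (u n) x) \<longlonglongrightarrow> 0"
      using pseudo_complete unfolding pseudo_complete_on_def by blast
    have lt: "\<exists>N. \<forall>n\<ge>N. Wd (u n) x < ennreal \<epsilon>" if "0 < \<epsilon>" for \<epsilon>
    proof -
      have "0 < ennreal \<epsilon>" using that by simp
      from order_tendstoD(2)[OF x(2) this] show ?thesis by (simp add: eventually_sequentially)
    qed
    from lt[of 1] obtain N where "Wd (u N) x < 1" by auto
    then have "Wd x (u N) < \<infinity>" by (simp add: Wd_sym[of x] order.strict_trans)
    \<comment> \<open>The limit is found in \<open>Mloc\<close> only; it belongs to the class since
      it has finite distance to some \<open>u N\<close>, hence to \<open>\<sigma>\<close>.\<close>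
    then have xX: "x \<in> X" using Wd_triangle[of x \<sigma> "u N"] uX[of N] x(1)
      by (auto simp: X intro: order.strict_trans1)
    show "\<exists>x. limitin mtopology u x sequentially"
      unfolding limit_metric_sequentially
    proof (intro exI[of _ x] conjI xX allI impI)
      fix \<epsilon> :: real assume "0 < \<epsilon>"
      from lt[OF this] obtain N where N: "\<And>n. N \<le> n \<Longrightarrow> Wd (u n) x < ennreal \<epsilon>" by blast
      have "enn2real (Wd (u n) x) < \<epsilon>" if "N \<le> n" for n
        using N[OF that] by (subst (asm) eq[OF uX xX]) (simp add: ennreal_less_iff)
      then show "\<exists>N. \<forall>n\<ge>N. u n \<in> X \<and> enn2real (Wd (u n) x) < \<epsilon>" using uX by blast
    qed
  qed
qed

end

theorem proposition3p4:
  fixes p q a b :: real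
    and \<gamma> :: "'a::euclidean_space measure"
    and \<phi> :: "real \<times> 'a \<Rightarrow> ennreal"
  assumes "1 < p" and "q = p / (p - 1)" and "a < b"
    and "\<gamma> \<in> Mloc_pos" and "\<phi> \<in> Adm_int p a b"
  shows
    "(pseudo_distance_on Mloc (W p \<phi> \<gamma>) \<and> pseudo_complete_on Mloc (W p \<phi> \<gamma>)) \<and>
     (\<forall>\<sigma>\<in>Mloc.
        (\<forall>\<mu>\<in>finite_dist_class p \<phi> \<gamma> \<sigma>. \<forall>\<mu>'\<in>finite_dist_class p \<phi> \<gamma> \<sigma>. W p \<phi> \<gamma> \<mu> \<mu>' < \<infinity>) \<and>
        Metric_space (finite_dist_class p \<phi> \<gamma> \<sigma>) (\<lambda>\<mu> \<mu>'. enn2real (W p \<phi> \<gamma> \<mu> \<mu>')) \<and>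
        Metric_space.mcomplete (finite_dist_class p \<phi> \<gamma> \<sigma>) (\<lambda>\<mu> \<mu>'. enn2real (W p \<phi> \<gamma> \<mu> \<mu>'))) \<and>
     (gen_moment (- q) \<gamma> < \<infinity> \<longrightarrow>
        (\<forall>\<sigma>\<in>Mloc. \<forall>\<mu>\<in>finite_dist_class p \<phi> \<gamma> \<sigma>.
           has_total_mass \<mu> \<longrightarrow> has_total_mass \<sigma> \<longrightarrow> total_mass \<mu> = total_mass \<sigma>))"
proof -
  interpret action_setup p q a b \<gamma> \<phi> by unfold_locales (use assms in auto)
  show ?thesis
  proof (intro conjI ballI impI)
    fix \<sigma> \<mu>
    assume "gen_moment (- q) \<gamma> < \<infinity>" "\<mu> \<in> finite_dist_class p \<phi> \<gamma> \<sigma>" "has_total_mass \<mu>" "has_total_mass \<sigma>"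
    then show "total_mass \<mu> = total_mass \<sigma>" by (intro mass_conserved) (auto simp: finite_dist_class_def)
  qed (intro pseudo_distance pseudo_complete finite_class_metric; assumption)+
qed

end
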